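(* Let $\mathbf{k}$ be a field, $S=\mathbf{k}[x_1,\dots,x_n]$ and $R=\mathbf{k}[x_1,\dots,x_{n+1}]$. Let $M$ be a finitely generated graded $S$-module with a $2$-linear minimal free resolution and $\beta_{0,0}(M)=m$. Then there exist threshold graphs $T_1,\dots,T_m$ on the vertex set $[n+1]$, not necessarily distinct, such that $\beta^S(M)=\beta^R(\mathbf{k}[T_1]\oplus\cdots\oplus\mathbf{k}[T_m])$, i.e. $\beta^S_{i,j}(M)=\beta^R_{i,j}(\mathbf{k}[T_1]\oplus\cdots\oplus\mathbf{k}[T_m])$ for all $i,j$.
   Context: For a finitely generated graded module $M$ over a standard graded polynomial ring $A$ over $\mathbf{k}$, $\beta_{i,j}(M)=\beta^A_{i,j}(M)=\dim_{\mathbf{k}}\operatorname{Tor}_i^A(M,\mathbf{k})_j$ are the graded Betti numbers and $\beta(M)$ is the array of all of them. A graded $S$-module $M$ has a $2$-linear minimal free resolution if $\beta_{0,j}(M)=0$ for $j\neq 0$ and, for every $i\ge 1$, $\beta_{i,j}(M)=0$ for $j\neq i+1$. For a graph $G$ on vertex set $[n+1]$, $I^c(G)\subseteq R$ is the ideal generated by the monomials $x_ix_j$ with $i\neq j$ and $ij$ not an edge of $G$, and $\mathbf{k}[G]=R/I^c(G)$. For a graph $G$, $G_\ast$ denotes $G$ with one new isolated vertex added and $G^\ast$ denotes $G$ with one new vertex adjacent to all vertices of $G$ added. A graph is threshold if it can be obtained from a single vertex by a finite sequence of the operations $G\mapsto G_\ast$ and $G\mapsto G^\ast$. *)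

theory Defs
  imports Complex_Main "HOL-Library.Poly_Mapping" "HOL-Algebra.QuotRing" "HOL-Algebra.Module"
begin

section \<open>Polynomial rings over a field\<close>

text \<open>A monomial is an exponent vector \<open>nat \<Rightarrow>\<^sub>0 nat\<close>. The ring \<open>mpoly_ring n\<close> is
  \<open>k[x\<^sub>1, \<dots>, x\<^sub>n]\<close>: the polynomials in which only the variables with index in
  \<open>{1..n}\<close> occur.\<close>

type_synonym 'k mpoly = "(nat \<Rightarrow>\<^sub>0 nat) \<Rightarrow>\<^sub>0 'k"

definition mpoly_ring :: "nat \<Rightarrow> ('k::field) mpoly ring" where
  "mpoly_ring n =
    \<lparr>carrier = {p. \<forall>t \<in> Poly_Mapping.keys p. Poly_Mapping.keys t \<subseteq> {1..n}},
     mult = (*), one = 1, zero = 0, add = (+)\<rparr>"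

definition monomial_degree :: "(nat \<Rightarrow>\<^sub>0 nat) \<Rightarrow> nat" where
  "monomial_degree t = (\<Sum>i \<in> Poly_Mapping.keys t. Poly_Mapping.lookup t i)"

text \<open>The graded piece of degree \<open>j\<close>, which is \<open>{0}\<close> for \<open>j < 0\<close>.\<close>

definition homogeneous :: "nat \<Rightarrow> int \<Rightarrow> ('k::field) mpoly set" where
  "homogeneous n j =
    {p \<in> carrier (mpoly_ring n). \<forall>t \<in> Poly_Mapping.keys p. int (monomial_degree t) = j}"

definition var :: "nat \<Rightarrow> ('k::field) mpoly" where
  "var i = Poly_Mapping.single (Poly_Mapping.single i 1) 1"

definition const :: "'k::field \<Rightarrow> 'k mpoly" where
  "const c = Poly_Mapping.single 0 c"


section \<open>Graded modules\<close>

text \<open>\<open>module\<close> inherits the fields \<open>mult\<close> and \<open>one\<close> from \<open>ring\<close>; they play no role for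
  modules.\<close>

record ('a, 'b) graded_module = "('a, 'b) module" +
  grade :: "int \<Rightarrow> 'b set"

locale graded_module = Module.module "mpoly_ring n" M
  for n :: nat and M :: "(('k::field) mpoly, 'm) graded_module" +
  assumes grade_subgroup: "subgroup (grade M j) (add_monoid M)"
    and grade_decomposition: "x \<in> carrier M \<Longrightarrow>
      \<exists>!f. (\<forall>j. f j \<in> grade M j) \<and> finite {j. f j \<noteq> \<zero>\<^bsub>M\<^esub>} \<and>
           x = (\<Oplus>\<^bsub>M\<^esub> j \<in> {j. f j \<noteq> \<zero>\<^bsub>M\<^esub>}. f j)"
    and grade_smult: "p \<in> homogeneous n d \<Longrightarrow> x \<in> grade M j \<Longrightarrow> p \<odot>\<^bsub>M\<^esub> x \<in> grade M (d + j)"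

definition finitely_generated :: "nat \<Rightarrow> (('k::field) mpoly, 'm) graded_module \<Rightarrow> bool" where
  "finitely_generated n M \<longleftrightarrow>
    (\<exists>X. finite X \<and> X \<subseteq> carrier M \<and>
      (\<forall>N. submodule N (mpoly_ring n) M \<longrightarrow> X \<subseteq> N \<longrightarrow> N = carrier M))"

definition graded_hom ::
  "nat \<Rightarrow> (('k::field) mpoly, 'm) graded_module \<Rightarrow> ('k mpoly, 'l) graded_module \<Rightarrow> ('m \<Rightarrow> 'l) set"
where
  "graded_hom n M N =
    {h \<in> carrier M \<rightarrow> carrier N.
      (\<forall>x \<in> carrier M. \<forall>y \<in> carrier M. h (x \<oplus>\<^bsub>M\<^esub> y) = h x \<oplus>\<^bsub>N\<^esub> h y) \<and>
      (\<forall>p \<in> carrier (mpoly_ring n). \<forall>x \<in> carrier M. h (p \<odot>\<^bsub>M\<^esub> x) = p \<odot>\<^bsub>N\<^esub> h x) \<and>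
      (\<forall>j. h ` grade M j \<subseteq> grade N j)}"

definition direct_sum ::
  "'i set \<Rightarrow> ('i \<Rightarrow> (('k::field) mpoly, 'm) graded_module) \<Rightarrow> ('k mpoly, 'i \<Rightarrow> 'm) graded_module"
where \<comment> \<open>for finite \<open>I\<close>\<close>
  "direct_sum I N =
    \<lparr>carrier = (\<Pi>\<^sub>E l \<in> I. carrier (N l)),
     mult = (\<lambda>_ _. undefined), one = undefined,
     zero = (\<lambda>l \<in> I. \<zero>\<^bsub>N l\<^esub>),
     add = (\<lambda>x y. \<lambda>l \<in> I. x l \<oplus>\<^bsub>N l\<^esub> y l),
     smult = (\<lambda>p x. \<lambda>l \<in> I. p \<odot>\<^bsub>N l\<^esub> x l),
     grade = (\<lambda>j. \<Pi>\<^sub>E l \<in> I. grade (N l) j)\<rparr>"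


section \<open>Graded free resolutions\<close>

text \<open>The graded free module with basis \<open>(e\<^sub>b)\<close>, \<open>b \<in> B\<close>, where \<open>e\<^sub>b\<close> has degree
  \<open>d b\<close>. An element is given by its finitely supported family of coordinates.\<close>

definition free_module ::
  "nat \<Rightarrow> nat set \<Rightarrow> (nat \<Rightarrow> int) \<Rightarrow> (('k::field) mpoly, nat \<Rightarrow>\<^sub>0 'k mpoly) graded_module"
where
  "free_module n B d =
    \<lparr>carrier = {f. Poly_Mapping.keys f \<subseteq> B \<and>
                   (\<forall>b. Poly_Mapping.lookup f b \<in> carrier (mpoly_ring n))},
     mult = (\<lambda>_ _. undefined), one = undefined,
     zero = 0, add = (+),
     smult = (\<lambda>p f. Poly_Mapping.map (\<lambda>q. p * q) f),
     grade = (\<lambda>j. {f. Poly_Mapping.keys f \<subseteq> B \<and>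
                       (\<forall>b \<in> B. Poly_Mapping.lookup f b \<in> homogeneous n (j - d b))})\<rparr>"

text \<open>The data of a complex \<open>\<dots> \<rightarrow> F\<^sub>2 \<rightarrow> F\<^sub>1 \<rightarrow> F\<^sub>0 \<rightarrow> M\<close> of graded free modules:
  \<open>differential F i\<close> is the map \<open>F\<^sub>i\<^sub>+\<^sub>1 \<rightarrow> F\<^sub>i\<close> and \<open>augmentation F\<close> is the map
  \<open>F\<^sub>0 \<rightarrow> M\<close>.\<close>

record (overloaded) ('k::zero, 'm) free_complex =
  basis :: "nat \<Rightarrow> nat set"
  basis_degree :: "nat \<Rightarrow> nat \<Rightarrow> int"
  differential :: "nat \<Rightarrow> (nat \<Rightarrow>\<^sub>0 'k mpoly) \<Rightarrow> (nat \<Rightarrow>\<^sub>0 'k mpoly)"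
  augmentation :: "(nat \<Rightarrow>\<^sub>0 'k mpoly) \<Rightarrow> 'm"

definition term_module ::
  "nat \<Rightarrow> ('k::field, 'm) free_complex \<Rightarrow> nat \<Rightarrow> ('k mpoly, nat \<Rightarrow>\<^sub>0 'k mpoly) graded_module"
where
  "term_module n F i = free_module n (basis F i) (basis_degree F i)"

definition basis_in_degree :: "('k::field, 'm) free_complex \<Rightarrow> nat \<Rightarrow> int \<Rightarrow> nat set" where
  "basis_in_degree F i j = {b \<in> basis F i. basis_degree F i b = j}"

text \<open>The terms of a resolution may have infinite rank, but only finitely many basis elements in
  each degree. Minimality is not required.\<close>

definition graded_free_resolution ::
  "nat \<Rightarrow> (('k::field) mpoly, 'm) graded_module \<Rightarrow> ('k, 'm) free_complex \<Rightarrow> bool"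
where
  "graded_free_resolution n M F \<longleftrightarrow>
    (\<forall>i j. finite (basis_in_degree F i j)) \<and>
    augmentation F \<in> graded_hom n (term_module n F 0) M \<and>
    (\<forall>i. differential F i \<in> graded_hom n (term_module n F (Suc i)) (term_module n F i)) \<and>
    augmentation F ` carrier (term_module n F 0) = carrier M \<and>
    {x \<in> carrier (term_module n F 0). augmentation F x = \<zero>\<^bsub>M\<^esub>} =
      differential F 0 ` carrier (term_module n F 1) \<and>
    (\<forall>i. {x \<in> carrier (term_module n F (Suc i)). differential F i x = 0} =
      differential F (Suc i) ` carrier (term_module n F (Suc (Suc i))))"


section \<open>Tor and graded Betti numbers\<close>

text \<open>For a graded free module \<open>F\<close> with basis \<open>(e\<^sub>b)\<close>, \<open>F \<otimes> k\<close> is the \<open>k\<close>-vector space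
  with basis \<open>(e\<^sub>b \<otimes> 1)\<close>, represented by coordinates in \<open>nat \<Rightarrow>\<^sub>0 'k\<close>. As \<open>A\<close> acts on
  \<open>k\<close> through the constant coefficient, the element \<open>f \<otimes> 1\<close> has the constant coefficients of
  the coordinates of \<open>f\<close> as its coordinates. \<open>tensor_map h\<close> is \<open>h \<otimes> id\<^sub>k\<close>.\<close>

definition tensor_one :: "(nat \<Rightarrow>\<^sub>0 ('k::field) mpoly) \<Rightarrow> (nat \<Rightarrow>\<^sub>0 'k)" where
  "tensor_one f = Poly_Mapping.map (\<lambda>p. Poly_Mapping.lookup p 0) f"

definition tensor_map ::
  "((nat \<Rightarrow>\<^sub>0 ('k::field) mpoly) \<Rightarrow> (nat \<Rightarrow>\<^sub>0 'k mpoly)) \<Rightarrow> (nat \<Rightarrow>\<^sub>0 'k) \<Rightarrow> (nat \<Rightarrow>\<^sub>0 'k)"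
where
  "tensor_map h v = tensor_one (h (Poly_Mapping.map const v))"

definition tensor_degree_part ::
  "('k::field, 'm) free_complex \<Rightarrow> nat \<Rightarrow> int \<Rightarrow> (nat \<Rightarrow>\<^sub>0 'k) set"
where
  "tensor_degree_part F i j = {v. Poly_Mapping.keys v \<subseteq> basis_in_degree F i j}"

definition tor_cycles :: "('k::field, 'm) free_complex \<Rightarrow> nat \<Rightarrow> int \<Rightarrow> (nat \<Rightarrow>\<^sub>0 'k) set" where
  "tor_cycles F i j =
    (case i of
      0 \<Rightarrow> tensor_degree_part F 0 j
    | Suc i' \<Rightarrow> {v \<in> tensor_degree_part F i j. tensor_map (differential F i') v = 0})"

definition tor_boundaries :: "('k::field, 'm) free_complex \<Rightarrow> nat \<Rightarrow> int \<Rightarrow> (nat \<Rightarrow>\<^sub>0 'k) set" where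
  "tor_boundaries F i j = tensor_map (differential F i) ` tensor_degree_part F (Suc i) j"

definition kdim :: "(nat \<Rightarrow>\<^sub>0 'k::field) set \<Rightarrow> nat" where
  "kdim V = vector_space.dim (\<lambda>c v. Poly_Mapping.map (\<lambda>a. c * a) v) V"

text \<open>\<open>dim (H\<^sub>i(F \<otimes> k)\<^sub>j)\<close> for a resolution \<open>F\<close>. The boundaries are a subspace of the
  cycles, and both have finite dimension since \<open>basis_in_degree F i j\<close> is finite, so the
  truncated subtraction is the dimension of the quotient.\<close>

definition tor_dim :: "('k::field, 'm) free_complex \<Rightarrow> nat \<Rightarrow> int \<Rightarrow> nat" where
  "tor_dim F i j = kdim (tor_cycles F i j) - kdim (tor_boundaries F i j)"

text \<open>\<open>betti n M i j = dim\<^sub>k Tor\<^sub>i(M, k)\<^sub>j\<close> over \<open>A = k[x\<^sub>1, \<dots>, x\<^sub>n]\<close>. Any graded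
  free resolution of \<open>M\<close> computes \<open>Tor\<close>; a finitely generated graded \<open>M\<close> has one of the form
  required here.\<close>

definition betti :: "nat \<Rightarrow> (('k::field) mpoly, 'm) graded_module \<Rightarrow> nat \<Rightarrow> int \<Rightarrow> nat" where
  "betti n M i j = tor_dim (SOME F. graded_free_resolution n M F) i j"

definition two_linear_resolution :: "nat \<Rightarrow> (('k::field) mpoly, 'm) graded_module \<Rightarrow> bool" where
  "two_linear_resolution n M \<longleftrightarrow>
    (\<forall>j. j \<noteq> 0 \<longrightarrow> betti n M 0 j = 0) \<and>
    (\<forall>i \<ge> 1. \<forall>j. j \<noteq> int i + 1 \<longrightarrow> betti n M i j = 0)"


section \<open>Threshold graphs and their edge rings\<close>

text \<open>A simple graph is a pair \<open>(V, E)\<close> with \<open>E\<close> a set of two-element subsets of \<open>V\<close>.\<close>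

type_synonym 'v graph = "'v set \<times> 'v set set"

fun add_isolated :: "'v \<Rightarrow> 'v graph \<Rightarrow> 'v graph" where
  "add_isolated v (V, E) = (insert v V, E)"

fun add_dominating :: "'v \<Rightarrow> 'v graph \<Rightarrow> 'v graph" where
  "add_dominating v (V, E) = (insert v V, E \<union> {{u, v} | u. u \<in> V})"

inductive threshold_graph :: "'v graph \<Rightarrow> bool" where
  single: "threshold_graph ({v}, {})"
| isolated: "threshold_graph G \<Longrightarrow> v \<notin> fst G \<Longrightarrow> threshold_graph (add_isolated v G)"
| dominating: "threshold_graph G \<Longrightarrow> v \<notin> fst G \<Longrightarrow> threshold_graph (add_dominating v G)"

text \<open>For a graph \<open>G\<close> on the vertex set \<open>{1..N}\<close>: the ideal \<open>I\<^sup>c(G)\<close> of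
  \<open>R = k[x\<^sub>1, \<dots>, x\<^sub>N]\<close> and the graded \<open>R\<close>-module \<open>k[G] = R / I\<^sup>c(G)\<close>.\<close>

definition nonedge_ideal :: "nat \<Rightarrow> nat graph \<Rightarrow> ('k::field) mpoly set" where
  "nonedge_ideal N G =
    Idl\<^bsub>mpoly_ring N\<^esub>
      {var a * var b | a b. a \<in> {1..N} \<and> b \<in> {1..N} \<and> a \<noteq> b \<and> {a, b} \<notin> snd G}"

definition graph_module :: "nat \<Rightarrow> nat graph \<Rightarrow> (('k::field) mpoly, 'k mpoly set) graded_module" where
  "graph_module N G =
    (let R = mpoly_ring N; I = nonedge_ideal N G; Q = R Quot I in
      \<lparr>carrier = carrier Q, mult = mult Q, one = one Q, zero = zero Q, add = add Q,
       smult = (\<lambda>p X. (I +>\<^bsub>R\<^esub> p) \<otimes>\<^bsub>Q\<^esub> X),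
       grade = (\<lambda>j. {I +>\<^bsub>R\<^esub> p | p. p \<in> homogeneous N j})\<rparr>)"

end

(*
  Present M by generators and relations and compute Tor from the Koszul complex on the presentation
  instead of a resolution (a double complex argument). A 2-linear resolution then means that the
  Koszul homology is concentrated in internal degrees 0 and 1, so the Betti numbers are, up to sign,
  the coefficients of the numerator (1 - X)^n H of the Hilbert series. It remains to show that this
  numerator is a sum of m numerators of threshold graphs.

  Write the numerator as m - X^2 (a_1 + a_2 (1 - X) + ... + a_n (1 - X)^(n-1)). Over an uncountable
  field, dividing by a generic linear form removes the last summand, whose coefficient a_n is the
  dimension of the socle in degree 1; a Vandermonde argument for r generic linear forms gives
  r a_(r+1) <= (r + 1) a_r, and a_1 <= m. Cutting a_r into m blocks of size at most r yields
  sequences alpha with alpha_r = r or alpha_(r+1) <= alpha_r <= r, and exactly these come from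
  threshold graphs: adding a dominating vertex keeps the numerator, and adding an isolated vertex
  replaces alpha by (1, 1 + alpha_1, 1 + alpha_2, ...).
*)

theory Submission
  imports Defs "HOL-Library.Function_Algebras" "HOL-Library.Nat_Bijection" "HOL-Library.Countable_Set"
    "HOL-Computational_Algebra.Polynomial" "HOL-Computational_Algebra.Formal_Power_Series"
    "HOL-Computational_Algebra.Formal_Laurent_Series"
begin

section \<open>Linear algebra for quotients Z / B that are never formed as types\<close>

section \<open>Dimensions of subquotients\<close>

text \<open>The generic forms run along the curve l_t = sum of t^k x_k. In one degree only finitely
  many t are bad: otherwise, by generic independence, some polynomial in t with coefficients in the
  module is killed by l_t identically in t, and McCoy's argument forces its coefficients into the
  socle (which is zero above degree 1). All degrees together exclude countably many t. This is why
  the field has to be uncountable, and Laurent series over k are, whatever k is. On this curve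
  distinct parameters, up to the number of variables, give independent forms. If socle elements l_t
  u_t add up to zero, then, as the generators have no linear relations, the Vandermonde system gives
  u_t = 0. So the parts of the socle that die in the sections M / l_t M are independent, and with r
  variables some good t kills at most the fraction 1 / r of the socle. The rest embeds in the socle
  of M / l_t M, whose dimension is the preceding coefficient; this is the origin of (r - 1) a_r <= r
  a_(r-1).\<close>

definition finite_dim :: "('k::field \<Rightarrow> 'b::ab_group_add \<Rightarrow> 'b) \<Rightarrow> 'b set \<Rightarrow> bool" where
  "finite_dim s A \<longleftrightarrow> module.subspace s A \<and> (\<exists>S. finite S \<and> A \<subseteq> module.span s S)"

abbreviation (input) pw :: "('k \<Rightarrow> 'v \<Rightarrow> 'v) \<Rightarrow> 'k \<Rightarrow> ('i \<Rightarrow> 'v) \<Rightarrow> 'i \<Rightarrow> 'v" where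
  "pw s \<equiv> \<lambda>c f i. s c (f i)"

context vector_space
begin

lemma finite_dim_subspace: "finite_dim scale A \<Longrightarrow> subspace A"
  by (simp add: finite_dim_def)

lemma finite_dim_basis:
  assumes "finite_dim scale A"
  obtains E where "finite E" "independent E" "span E = A" "card E = dim A"
proof -
  obtain E where E: "E \<subseteq> A" "independent E" "A \<subseteq> span E" "card E = dim A"
    using basis_exists by blast
  obtain S where "finite S" "A \<subseteq> span S"
    using assms by (auto simp: finite_dim_def)
  then have "finite E"
    using E independent_span_bound[of S E] by auto
  moreover have "span E = A"
    using E assms by (meson finite_dim_def span_minimal subset_antisym)
  ultimately show ?thesis using that E by blast
qed

lemma finite_dim_subset: "finite_dim scale B \<Longrightarrow> subspace A \<Longrightarrow> A \<subseteq> B \<Longrightarrow> finite_dim scale A"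
  by (auto simp: finite_dim_def)

lemma finite_dim_spanI: "finite S \<Longrightarrow> finite_dim scale (span S)"
  by (auto simp: finite_dim_def)

lemma dim_subset_le:
  assumes "finite_dim scale B" "A \<subseteq> B"
  shows "dim A \<le> dim B"
proof -
  obtain E where E: "finite E" "independent E" "span E = B" "card E = dim B"
    using finite_dim_basis[OF assms(1)] .
  then show ?thesis using dim_le_card[of A E] assms(2) by simp
qed

lemma extend_to_basis:
  assumes A: "finite_dim scale A" and B: "subspace B" "B \<subseteq> A"
  obtains E0 E where "finite E0" "finite E" "E0 \<inter> E = {}" "independent (E0 \<union> E)"
    "span E0 = B" "span (E0 \<union> E) = A" "card E0 = dim B" "card E0 + card E = dim A"
proof -
  obtain E0 where E0: "finite E0" "independent E0" "span E0 = B" "card E0 = dim B"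
    using finite_dim_basis[OF finite_dim_subset[OF A B]] .
  have "E0 \<subseteq> A" using E0(3) B(2) span_superset by blast
  then obtain F where F: "E0 \<subseteq> F" "F \<subseteq> A" "independent F" "A \<subseteq> span F"
    using maximal_independent_subset_extend[OF _ E0(2)] by metis
  have spanF: "span F = A"
    using F A by (meson finite_dim_def span_minimal subset_antisym)
  obtain S where "finite S" "A \<subseteq> span S" using A by (auto simp: finite_dim_def)
  then have finF: "finite F" using F independent_span_bound[of S F] by auto
  have "card F = dim A" using dim_span_eq_card_independent[OF F(3)] spanF by simp
  moreover have "E0 \<union> (F - E0) = F" using F(1) by blast
  ultimately show ?thesis
    using that[of E0 "F - E0"] E0 F finF spanF
    by (metis Diff_disjoint card_Un_disjoint finite_Diff)
qed

lemma dim_subset_eq: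
  assumes "finite_dim scale B" "subspace A" "A \<subseteq> B" "dim A = dim B"
  shows "A = B"
proof -
  obtain E0 E where "finite E0" "finite E" "span E0 = A" "span (E0 \<union> E) = B"
      "card E0 + card E = dim B" "card E0 = dim A"
    using extend_to_basis[OF assms(1-3)] by metis
  then show ?thesis using assms(4) by auto
qed

lemma independent_iff_sum:
  "finite S \<Longrightarrow> independent S \<longleftrightarrow> (\<forall>u. (\<Sum>v\<in>S. scale (u v) v) = 0 \<longrightarrow> (\<forall>v\<in>S. u v = 0))"
  by (auto simp: dependent_finite)

lemma independent_card_le_dim':
  assumes "finite_dim scale A" "independent E" "E \<subseteq> A"
  shows "card E \<le> dim A"
proof -
  obtain F where F: "finite F" "independent F" "span F = A" "card F = dim A"
    using finite_dim_basis[OF assms(1)] .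
  then show ?thesis using independent_span_bound[of F E] assms by auto
qed

end

text \<open>Zigzags through a double complex give no map from Tor cycles to Koszul cycles, since
  every lift is a choice. The pairs joined by some choice of lifts are still closed under addition
  and scaling, and that is enough to compare dimensions.\<close>

locale linear_relation = v1: vector_space s1 + v2: vector_space s2
  for s1 :: "'k::field \<Rightarrow> 'a::ab_group_add \<Rightarrow> 'a" and s2 :: "'k \<Rightarrow> 'b::ab_group_add \<Rightarrow> 'b" +
  fixes R :: "'a \<Rightarrow> 'b \<Rightarrow> bool"
  assumes R_zero: "R 0 0"
    and R_add: "R a b \<Longrightarrow> R a' b' \<Longrightarrow> R (a + a') (b + b')"
    and R_scale: "R a b \<Longrightarrow> R (s1 c a) (s2 c b)"
begin

lemma R_sum: "finite I \<Longrightarrow> (\<And>i. i \<in> I \<Longrightarrow> R (f i) (g i)) \<Longrightarrow> R (sum f I) (sum g I)"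
  by (induction I rule: finite_induct) (auto intro: R_zero R_add)

text \<open>A basis of a complement of \<open>B1\<close> in \<open>Z1\<close> has
  \<open>R\<close>-partners in \<open>Z2\<close> that stay independent modulo \<open>B2\<close>;
  hence dim Z1/B1 <= dim Z2/B2. The inequality is arranged as sums because dimensions are natural
  numbers.\<close>

lemma subquotient_dim_le:
  assumes Z1: "finite_dim s1 Z1" and B1: "v1.subspace B1" "B1 \<subseteq> Z1"
    and Z2: "finite_dim s2 Z2" and B2: "v2.subspace B2" "B2 \<subseteq> Z2"
    and total: "\<And>a. a \<in> Z1 \<Longrightarrow> \<exists>b\<in>Z2. R a b"
    and boundary: "\<And>a b. R a b \<Longrightarrow> a \<in> Z1 \<Longrightarrow> b \<in> Z2 \<Longrightarrow> b \<in> B2 \<Longrightarrow> a \<in> B1"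
  shows "v1.dim Z1 + v2.dim B2 \<le> v2.dim Z2 + v1.dim B1"
proof -
  obtain E0 E where E: "finite E0" "finite E" "E0 \<inter> E = {}" "v1.independent (E0 \<union> E)"
    "v1.span E0 = B1" "v1.span (E0 \<union> E) = Z1" "card E0 = v1.dim B1" "card E0 + card E = v1.dim Z1"
    using v1.extend_to_basis[OF Z1 B1] by metis
  obtain C where C: "finite C" "v2.independent C" "v2.span C = B2" "card C = v2.dim B2"
    using v2.finite_dim_basis[OF v2.finite_dim_subset[OF Z2 B2]] .
  have EZ: "E \<subseteq> Z1" using E(6) v1.span_superset by blast
  obtain \<phi> where \<phi>: "\<And>e. e \<in> E \<Longrightarrow> \<phi> e \<in> Z2 \<and> R e (\<phi> e)"
    using total EZ by (metis subsetD)
  have sZ1: "v1.subspace Z1" and sZ2: "v2.subspace Z2"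
    using Z1 Z2 by (auto simp: finite_dim_def)
  \<comment> \<open>Independence modulo \<open>B2\<close>: \<open>R\<close> relates a combination of
    the \<open>\<phi> e\<close> to the same combination of the \<open>e\<close>, the boundary
    condition pulls membership in \<open>B2\<close> back to \<open>B1\<close>, and \<open>B1\<close>
    meets the span of \<open>E\<close> only in zero.\<close>
  have key: "\<forall>e\<in>E. u e = 0" if u: "(\<Sum>e\<in>E. s2 (u e) (\<phi> e)) \<in> B2" for u
  proof -
    have "R (\<Sum>e\<in>E. s1 (u e) e) (\<Sum>e\<in>E. s2 (u e) (\<phi> e))"
      using \<phi> E(2) by (intro R_sum R_scale) auto
    moreover have "(\<Sum>e\<in>E. s1 (u e) e) \<in> Z1"
      using EZ by (intro v1.subspace_sum[OF sZ1] v1.subspace_scale[OF sZ1]) auto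
    moreover have "(\<Sum>e\<in>E. s2 (u e) (\<phi> e)) \<in> Z2"
      using \<phi> by (intro v2.subspace_sum[OF sZ2] v2.subspace_scale[OF sZ2]) auto
    ultimately have "(\<Sum>e\<in>E. s1 (u e) e) \<in> B1" using boundary u by blast
    then obtain w where w: "(\<Sum>e\<in>E. s1 (u e) e) = (\<Sum>e\<in>E0. s1 (w e) e)"
      using v1.span_finite[OF E(1)] E(5) by auto
    define r where "r e = (if e \<in> E then u e else - w e)" for e
    have "(\<Sum>e\<in>E0 \<union> E. s1 (r e) e) = (\<Sum>e\<in>E0. s1 (r e) e) + (\<Sum>e\<in>E. s1 (r e) e)"
      using E by (intro sum.union_disjoint) auto
    also have "(\<Sum>e\<in>E0. s1 (r e) e) = - (\<Sum>e\<in>E0. s1 (w e) e)"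
      unfolding sum_negf[symmetric] using E(3) by (intro sum.cong) (auto simp: r_def)
    also have "(\<Sum>e\<in>E. s1 (r e) e) = (\<Sum>e\<in>E. s1 (u e) e)"
      by (intro sum.cong) (auto simp: r_def)
    finally have "(\<Sum>e\<in>E0 \<union> E. s1 (r e) e) = 0" using w by simp
    then have "\<forall>e\<in>E0 \<union> E. r e = 0"
      using E(1,2,4) v1.independent_iff_sum[of "E0 \<union> E"] by blast
    then have r0: "r e = 0" if "e \<in> E0 \<union> E" for e using that by (rule bspec)
    show ?thesis
    proof
      fix e assume "e \<in> E"
      then show "u e = 0" using r0[of e] unfolding r_def by simp
    qed
  qed
  have inj: "inj_on \<phi> E"
  proof
    fix e f assume ef: "e \<in> E" "f \<in> E" "\<phi> e = \<phi> f"
    show "e = f"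
    proof (rule ccontr)
      assume "e \<noteq> f"
      define u where "u g = (if g = e then 1 else if g = f then -1 else (0::'k))" for g
      have "(\<Sum>g\<in>E. s2 (u g) (\<phi> g)) = (\<Sum>g\<in>{e, f}. s2 (u g) (\<phi> g))"
        using ef E(2) by (intro sum.mono_neutral_right) (auto simp: u_def)
      also have "\<dots> = 0" using \<open>e \<noteq> f\<close> ef(3) by (simp add: u_def)
      finally show False using key[of u] ef B2(1) v2.subspace_0 by (force simp: u_def)
    qed
  qed
  have disj: "C \<inter> \<phi> ` E = {}"
  proof (rule ccontr)
    assume "C \<inter> \<phi> ` E \<noteq> {}"
    then obtain e where e: "e \<in> E" "\<phi> e \<in> C" by auto
    then have "\<phi> e \<in> B2" using C(3) v2.span_superset by blast
    moreover have "(\<Sum>g\<in>E. s2 (if g = e then 1 else 0) (\<phi> g)) = \<phi> e"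
    proof -
      have "(\<Sum>g\<in>E. s2 (if g = e then 1 else 0) (\<phi> g)) = (\<Sum>g\<in>E. if g = e then \<phi> g else 0)"
        by (intro sum.cong) auto
      then show ?thesis using e E(2) by simp
    qed
    ultimately show False using key[of "\<lambda>g. if g = e then 1 else 0"] e by auto
  qed
  have "v2.independent (C \<union> \<phi> ` E)"
    unfolding v2.independent_iff_sum[OF finite_UnI[OF C(1) finite_imageI[OF E(2)]]]
  proof (intro allI impI)
    fix u assume "(\<Sum>v\<in>C \<union> \<phi> ` E. s2 (u v) v) = 0"
    then have *: "(\<Sum>v\<in>C. s2 (u v) v) + (\<Sum>e\<in>E. s2 (u (\<phi> e)) (\<phi> e)) = 0"
      using C(1) E(2) disj inj by (simp add: sum.union_disjoint sum.reindex)
    have inB: "(\<Sum>v\<in>C. s2 (u v) v) \<in> B2"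
      unfolding C(3)[symmetric] by (intro v2.span_sum v2.span_scale v2.span_base)
    have "(\<Sum>e\<in>E. s2 (u (\<phi> e)) (\<phi> e)) = - (\<Sum>v\<in>C. s2 (u v) v)"
      using * by (simp add: add_eq_0_iff)
    then have "\<forall>e\<in>E. u (\<phi> e) = 0"
      using key[of "u \<circ> \<phi>"] v2.subspace_neg[OF B2(1) inB] by simp
    moreover from this have "(\<Sum>v\<in>C. s2 (u v) v) = 0" using * by simp
    then have "\<forall>v\<in>C. u v = 0" using C(2) v2.independent_iff_sum[OF C(1)] by simp
    ultimately show "\<forall>v\<in>C \<union> \<phi> ` E. u v = 0" by auto
  qed
  moreover have "C \<union> \<phi> ` E \<subseteq> Z2" using \<phi> C(3) B2(2) v2.span_superset by blast
  ultimately have "card (C \<union> \<phi> ` E) \<le> v2.dim Z2"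
    using v2.independent_card_le_dim' Z2 by blast
  moreover have "card (C \<union> \<phi> ` E) = v2.dim B2 + card E"
    using C E(2) disj inj by (simp add: card_Un_disjoint card_image)
  ultimately show ?thesis using E(7,8) by linarith
qed

end

text \<open>Both inequalities come from the same lemma, applied to \<open>R\<close> and to its
  converse.\<close>

lemma subquotient_dim_eq:
  assumes "linear_relation s1 s2 R"
    and Z1: "finite_dim s1 Z1" and B1: "module.subspace s1 B1" "B1 \<subseteq> Z1"
    and Z2: "finite_dim s2 Z2" and B2: "module.subspace s2 B2" "B2 \<subseteq> Z2"
    and total1: "\<And>a. a \<in> Z1 \<Longrightarrow> \<exists>b\<in>Z2. R a b"
    and total2: "\<And>b. b \<in> Z2 \<Longrightarrow> \<exists>a\<in>Z1. R a b"
    and boundary: "\<And>a b. R a b \<Longrightarrow> a \<in> Z1 \<Longrightarrow> b \<in> Z2 \<Longrightarrow> a \<in> B1 \<longleftrightarrow> b \<in> B2"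
  shows "vector_space.dim s1 Z1 + vector_space.dim s2 B2
    = vector_space.dim s2 Z2 + vector_space.dim s1 B1"
proof -
  interpret l: linear_relation s1 s2 R by fact
  interpret l': linear_relation s2 s1 "\<lambda>b a. R a b"
    by unfold_locales (auto intro: l.R_zero l.R_add l.R_scale)
  show ?thesis
    using l.subquotient_dim_le[OF Z1 B1 Z2 B2] l'.subquotient_dim_le[OF Z2 B2 Z1 B1]
      total1 total2 boundary by fastforce
qed

context vector_space_pair
begin

lemma linear_relation_linear:
  assumes "Vector_Spaces.linear s1 s2 f" and that: "vs2.subspace C"
  shows "linear_relation s1 s2 (\<lambda>a y. y - f a \<in> C)"
proof -
  interpret f: Vector_Spaces.linear s1 s2 f by fact
  show ?thesis
  proof unfold_locales
    fix a b a' b' c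
    assume "b - f a \<in> C"
    then show "s2 c b - f (s1 c a) \<in> C"
      using vs2.subspace_scale[OF that, of "b - f a" c] by (simp add: f.scale vs2.scale_right_diff_distrib)
  next
    fix a b a' b'
    assume "b - f a \<in> C" "b' - f a' \<in> C"
    then show "b + b' - f (a + a') \<in> C"
      using vs2.subspace_add[OF that, of "b - f a" "b' - f a'"] by (simp add: f.add algebra_simps)
  qed (use that vs2.subspace_0 in \<open>simp_all add: f.zero\<close>)
qed

lemma finite_dim_image:
  assumes "Vector_Spaces.linear s1 s2 f" "finite_dim s1 A"
  shows "finite_dim s2 (f ` A)"
proof -
  interpret f: Vector_Spaces.linear s1 s2 f by fact
  obtain E where E: "finite E" "vs1.span E = A"
    using vs1.finite_dim_basis[OF assms(2)] by metis
  then have "f ` A = vs2.span (f ` E)" by (metis f.span_image)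
  then show ?thesis using E(1) by (simp add: vs2.finite_dim_spanI)
qed

end

context vector_space
begin

lemma finite_dim_sums:
  assumes "finite_dim scale A" "finite_dim scale B"
  shows "finite_dim scale {x + y |x y. x \<in> A \<and> y \<in> B}"
proof -
  obtain E F where "finite E" "span E = A" "finite F" "span F = B"
    using finite_dim_basis assms by metis
  then have "{x + y |x y. x \<in> A \<and> y \<in> B} = span (E \<union> F)" by (auto simp: span_Un)
  then show ?thesis using \<open>finite E\<close> \<open>finite F\<close> finite_dim_spanI by simp
qed

end

context vector_space_pair
begin

text \<open>\<open>f\<close> identifies \<open>A\<close> modulo the preimage of \<open>C\<close>
  with the sum of image and \<open>C\<close>, modulo \<open>C\<close>. For a Koszul differential the
  two sets on the left are cycles and boundaries of a quotient complex; for multiplication by a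
  linear form they give the Hilbert function of a hyperplane section; for the identity they give the
  dimension formula for sums.\<close>

lemma rank_nullity_mod:
  assumes f: "Vector_Spaces.linear s1 s2 f" and A: "finite_dim s1 A" and C: "finite_dim s2 C"
  shows "vs1.dim {a \<in> A. f a \<in> C} + vs2.dim {f a + c |a c. a \<in> A \<and> c \<in> C} = vs1.dim A + vs2.dim C"
proof -
  interpret f: Vector_Spaces.linear s1 s2 f by fact
  have sA: "vs1.subspace A" and sC: "vs2.subspace C"
    using A C by (auto simp: finite_dim_def)
  let ?Z2 = "{f a + c |a c. a \<in> A \<and> c \<in> C}"
  have eq: "?Z2 = {x + y |x y. x \<in> f ` A \<and> y \<in> C}" by auto
  have "vs1.dim A + vs2.dim C = vs2.dim ?Z2 + vs1.dim {a \<in> A. f a \<in> C}"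
  proof (rule subquotient_dim_eq[OF linear_relation_linear[OF f sC] A _ _ _ sC])
    show "vs1.subspace {a \<in> A. f a \<in> C}"
      using sA sC by (auto simp: vs1.subspace_def vs2.subspace_def f.add f.scale f.zero)
    show "finite_dim s2 ?Z2"
      unfolding eq by (intro vs2.finite_dim_sums finite_dim_image[OF f A] C)
    show "C \<subseteq> ?Z2"
    proof
      fix c assume "c \<in> C"
      then have "c = f 0 + c \<and> 0 \<in> A \<and> c \<in> C" using vs1.subspace_0[OF sA] by (simp add: f.zero)
      then show "c \<in> ?Z2" by blast
    qed
    show "\<exists>b\<in>?Z2. b - f a \<in> C" if "a \<in> A" for a
      proof
      show "f a + 0 \<in> ?Z2" using that vs2.subspace_0[OF sC] by blast
      show "f a + 0 - f a \<in> C" using vs2.subspace_0[OF sC] by simp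
    qed
    show "\<exists>a\<in>A. b - f a \<in> C" if "b \<in> ?Z2" for b
      using that by (auto intro!: bexI)
    show "a \<in> {a \<in> A. f a \<in> C} \<longleftrightarrow> b \<in> C"
      if "b - f a \<in> C" "a \<in> A" for a b
      using that vs2.subspace_diff[OF sC, of b "b - f a"] vs2.subspace_add[OF sC, of "b - f a" "f a"]
      by auto
  qed auto
  then show ?thesis by simp
qed

lemma rank_nullity:
  assumes f: "Vector_Spaces.linear s1 s2 f" and A: "finite_dim s1 A"
  shows "vs1.dim {a \<in> A. f a = 0} + vs2.dim (f ` A) = vs1.dim A"
proof -
  have "finite_dim s2 {0}" by (auto simp: finite_dim_def vs2.subspace_single_0 intro!: exI[of _ "{}"])
  moreover have "{f a + c |a c. a \<in> A \<and> c \<in> {0}} = f ` A" by auto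
  moreover have "vs2.dim {0} = 0"
    using vs2.dim_span[of "{}"] vs2.dim_eq_card_independent[OF vs2.independent_empty] by simp
  ultimately show ?thesis using rank_nullity_mod[OF f A, of "{0}"] by simp
qed

end

context vector_space
begin

lemma dim_sums_Int:
  assumes "finite_dim scale A" "finite_dim scale B"
  shows "dim {x + y |x y. x \<in> A \<and> y \<in> B} + dim (A \<inter> B) = dim A + dim B"
proof -
  interpret vector_space_pair scale scale by unfold_locales
  have "Vector_Spaces.linear scale scale (\<lambda>x. x)" by unfold_locales auto
  from rank_nullity_mod[OF this assms] show ?thesis
    by (simp add: Int_def)
qed

lemma dim_zero: "dim {0} = 0"
  using dim_span[of "{}"] dim_eq_card_independent[OF independent_empty] by simp

end

lemma vector_space_pointwise:
  assumes "vector_space s"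
  shows "vector_space (pw s)"
proof -
  interpret vector_space s by fact
  show ?thesis
    by unfold_locales (auto simp: fun_eq_iff scale_right_distrib scale_left_distrib)
qed

text \<open>One coordinate \<open>j\<close> is split off at a time: evaluation at \<open>j\<close>
  has image \<open>S j\<close>, and its kernel is the family over the remaining indices.\<close>

lemma dim_pointwise:
  fixes s :: "'k::field \<Rightarrow> 'v::ab_group_add \<Rightarrow> 'v"
  assumes vs: "vector_space s" and "finite I"
    and S: "\<And>i. i \<in> I \<Longrightarrow> finite_dim s (S i)"
  defines "F \<equiv> {f. \<forall>i. if i \<in> I then f i \<in> S i else f i = 0}"
  shows "finite_dim (pw s) F
    \<and> vector_space.dim (pw s) F = (\<Sum>i\<in>I. vector_space.dim s (S i))"
  using assms(2) S unfolding F_def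
proof (induction I rule: finite_induct)
  case empty
  interpret v: vector_space s by fact
  interpret p: vector_space "pw s" using vector_space_pointwise[OF vs] .
  have "{f. \<forall>i. if i \<in> {} then f i \<in> S i else f i = 0} = {0}" by (auto simp: fun_eq_iff)
  then show ?case using p.dim_zero
    by (auto simp: finite_dim_def p.subspace_single_0 intro!: exI[of _ "{}"])
next
  case (insert j I)
  interpret v: vector_space s by fact
  interpret p: vector_space "pw s" using vector_space_pointwise[OF vs] .
  interpret pv: vector_space_pair "pw s" s by unfold_locales
  interpret vp: vector_space_pair s "pw s" by unfold_locales
  let ?G = "{f. \<forall>i. if i \<in> I then f i \<in> S i else f i = 0}"
  let ?F = "{f. \<forall>i. if i \<in> insert j I then f i \<in> S i else f i = 0}"
  have G: "finite_dim (pw s) ?G" "p.dim ?G = (\<Sum>i\<in>I. v.dim (S i))"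
    using insert by auto
  have subS: "v.subspace (S i)" if "i \<in> insert j I" for i
    using insert.prems[OF that] by (simp add: finite_dim_def)
  let ?d = "\<lambda>x i. if i = j then x else 0"
  have lin_d: "Vector_Spaces.linear s (pw s) ?d"
    by unfold_locales (auto simp: fun_eq_iff)
  have lin_j: "Vector_Spaces.linear (pw s) s (\<lambda>f. f j)"
    by unfold_locales auto
  have subF: "p.subspace ?F"
    using subS by (auto simp: p.subspace_def v.subspace_def)
  have F_sum: "?F \<subseteq> {x + y |x y. x \<in> ?d ` S j \<and> y \<in> ?G}"
  proof
    fix f assume f: "f \<in> ?F"
    have "f = ?d (f j) + f(j := 0)" by (auto simp: fun_eq_iff)
    moreover have "f(j := 0) \<in> ?G" using f insert.hyps by auto
    moreover have "f j \<in> S j" using f by auto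
    ultimately show "f \<in> {x + y |x y. x \<in> ?d ` S j \<and> y \<in> ?G}" by blast
  qed
  have F: "finite_dim (pw s) ?F"
    using p.finite_dim_subset[OF p.finite_dim_sums[OF vp.finite_dim_image[OF lin_d] G(1)] subF F_sum]
      insert.prems by blast
  have ker: "{f \<in> ?F. f j = 0} = ?G"
    using insert.hyps(2) subS[THEN v.subspace_0] by (auto split: if_splits)
  have im: "(\<lambda>f. f j) ` ?F = S j"
  proof
    show "S j \<subseteq> (\<lambda>f. f j) ` ?F"
    proof
      fix x assume "x \<in> S j"
      then have "?d x \<in> ?F" using subS[THEN v.subspace_0] by auto
      then have "(\<lambda>f. f j) (?d x) \<in> (\<lambda>f. f j) ` ?F" by (rule imageI)
      then show "x \<in> (\<lambda>f. f j) ` ?F" by simp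
    qed
  qed auto
  show ?case using pv.rank_nullity[OF lin_j F] ker im F G insert.hyps by simp
qed

section \<open>Koszul differential, wedge product and the homotopy between them\<close>

section \<open>Koszul complexes\<close>

text \<open>The Koszul complex of commuting operators \<open>xs\<close> is built as an iterated mapping cone.
  A chain is a function on bit lists of length \<open>length xs\<close>; the bit list selects the factors
  \<open>e\<^sub>x\<close> of a basis element of the exterior algebra, and a chain \<open>f\<close> for \<open>x # xs\<close>
  stands for \<open>f(False # _) + e\<^sub>x \<and> f(True # _)\<close>.\<close>

fun koszul :: "('v::ab_group_add \<Rightarrow> 'v) list \<Rightarrow> (bool list \<Rightarrow> 'v) \<Rightarrow> bool list \<Rightarrow> 'v" where
  "koszul (x # xs) f (True # bs) = - koszul xs (\<lambda>bs. f (True # bs)) bs"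
| "koszul (x # xs) f (False # bs) = koszul xs (\<lambda>bs. f (False # bs)) bs + x (f (True # bs))"
| "koszul _ f _ = 0"

text \<open>\<open>r\<close> is the number of operators and \<open>p\<close> the exterior degree.
  Values outside the index range are forced to be zero, so that equality of chains is equality of
  functions.\<close>

definition chains :: "nat \<Rightarrow> nat \<Rightarrow> 'v::zero set \<Rightarrow> (bool list \<Rightarrow> 'v) set" where
  "chains r p S = {f. \<forall>bs. if length bs = r \<and> count_list bs True = p then f bs \<in> S else f bs = 0}"

lemma chains_iff:
  "f \<in> chains r p S \<longleftrightarrow> (\<forall>bs. (length bs = r \<and> count_list bs True = p \<longrightarrow> f bs \<in> S) \<and>
     (\<not> (length bs = r \<and> count_list bs True = p) \<longrightarrow> f bs = 0))"
  unfolding chains_def mem_Collect_eq if_bool_eq_conj ..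

lemma chainsD: "f \<in> chains r p S \<Longrightarrow> length bs = r \<Longrightarrow> count_list bs True = p \<Longrightarrow> f bs \<in> S"
  unfolding chains_iff by blast

lemma chainsD0: "f \<in> chains r p S \<Longrightarrow> \<not> (length bs = r \<and> count_list bs True = p) \<Longrightarrow> f bs = 0"
  unfolding chains_iff by blast

lemma chainsD': "f \<in> chains r p S \<Longrightarrow> 0 \<in> S \<Longrightarrow> f bs \<in> S"
  using chainsD[of f r p S bs] chainsD0[of f r p S bs] by metis

lemma chainsI:
  "(\<And>bs. length bs = r \<Longrightarrow> count_list bs True = p \<Longrightarrow> f bs \<in> S) \<Longrightarrow>
   (\<And>bs. \<not> (length bs = r \<and> count_list bs True = p) \<Longrightarrow> f bs = 0) \<Longrightarrow> f \<in> chains r p S"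
  unfolding chains_iff by blast

lemma chains_mono: "S \<subseteq> T \<Longrightarrow> chains r p S \<subseteq> chains r p T"
  unfolding subset_eq Ball_def chains_iff by blast

lemma chains_map: "f \<in> chains r p S \<Longrightarrow> (\<And>u. u \<in> S \<Longrightarrow> h u \<in> T) \<Longrightarrow> h 0 = 0 \<Longrightarrow> (\<lambda>bs. h (f bs)) \<in> chains r p T"
  unfolding chains_iff by simp

lemma chains_zero: "0 \<in> S \<Longrightarrow> (\<lambda>_. 0) \<in> chains r p S"
  unfolding chains_iff by simp

lemma chains_change: "f \<in> chains r p S \<Longrightarrow> (\<And>bs. f bs \<in> T) \<Longrightarrow> f \<in> chains r p T"
  unfolding chains_iff by blast

lemma chains_add:
  fixes f :: "bool list \<Rightarrow> 'v::ab_group_add"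
  shows "(\<And>x y. x \<in> S \<Longrightarrow> y \<in> S \<Longrightarrow> x + y \<in> S) \<Longrightarrow> f \<in> chains r p S \<Longrightarrow> g \<in> chains r p S \<Longrightarrow> f + g \<in> chains r p S"
  unfolding chains_iff by simp

lemma chains_diff:
  fixes f :: "bool list \<Rightarrow> 'v::ab_group_add"
  shows "(\<And>x y. x \<in> S \<Longrightarrow> y \<in> S \<Longrightarrow> x - y \<in> S) \<Longrightarrow> f \<in> chains r p S \<Longrightarrow> g \<in> chains r p S \<Longrightarrow> f - g \<in> chains r p S"
  unfolding chains_iff by simp

lemma chains_False: "f \<in> chains (Suc r) p S \<Longrightarrow> (\<lambda>bs. f (False # bs)) \<in> chains r p S"
  unfolding chains_iff by simp

lemma chains_True: "f \<in> chains (Suc r) (Suc p) S \<Longrightarrow> (\<lambda>bs. f (True # bs)) \<in> chains r p S"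
  unfolding chains_iff by simp

lemma chains_True_0: "f \<in> chains (Suc r) 0 S \<Longrightarrow> f (True # bs) = 0"
  unfolding chains_iff by simp

text \<open>Inverse to splitting a chain for \<open>x # xs\<close> at its first bit:
  \<open>z\<close> is the part without the new factor, \<open>y\<close> the part with it.\<close>

definition cone :: "(bool list \<Rightarrow> 'v::zero) \<Rightarrow> (bool list \<Rightarrow> 'v) \<Rightarrow> bool list \<Rightarrow> 'v" where
  "cone z y bs = (case bs of [] \<Rightarrow> 0 | b # bs \<Rightarrow> if b then y bs else z bs)"

lemma cone_simps [simp]: "cone z y [] = 0" "cone z y (True # bs) = y bs" "cone z y (False # bs) = z bs"
  by (simp_all add: cone_def)

lemma cone_chains_0: "z \<in> chains r 0 S \<Longrightarrow> cone z (\<lambda>_. 0) \<in> chains (Suc r) 0 S"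
  unfolding chains_iff by (auto simp: cone_def split: list.splits)

lemma cone_chains: "z \<in> chains r (Suc p) S \<Longrightarrow> y \<in> chains r p S \<Longrightarrow> cone z y \<in> chains (Suc r) (Suc p) S"
  unfolding chains_iff by (auto simp: cone_def split: list.splits)

lemma koszul_Cons_eqI:
  assumes "\<And>bs. koszul xs (\<lambda>bs. f (False # bs)) bs + x (f (True # bs)) = g (False # bs)"
    and "\<And>bs. - koszul xs (\<lambda>bs. f (True # bs)) bs = g (True # bs)" and "g [] = 0"
  shows "koszul (x # xs) f = g"
proof
  fix bs show "koszul (x # xs) f bs = g bs"
  proof (cases bs)
    case (Cons b bs)
    then show ?thesis using assms by (cases b) auto
  qed (use assms in simp)
qed

text \<open>One induction for naturality with respect to relations, from which closure properties
  and compatibility with homomorphisms both follow. \<open>Q\<close> concerns the values of the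
  chain and \<open>R\<close> those of its differential; they differ because the operators raise the
  degree.\<close>

lemma koszul_rel:
  assumes ops: "list_all2 (\<lambda>x y. \<forall>u v. Q u v \<longrightarrow> R (x u) (y v)) xs ys"
    and R: "R 0 0" "\<And>a b a' b'. R a b \<Longrightarrow> R a' b' \<Longrightarrow> R (a + a') (b + b')" "\<And>a b. R a b \<Longrightarrow> R (- a) (- b)"
    and Q: "\<And>bs. Q (f bs) (g bs)"
  shows "R (koszul xs f bs) (koszul ys g bs)"
  using ops Q
proof (induction arbitrary: f g bs rule: list_all2_induct)
  case Nil
  then show ?case using R by (cases bs) auto
next
  case (Cons x xs y ys)
  show ?case
  proof (cases bs)
    case Nil
    then show ?thesis using R by simp
  next
    case (Cons b bs')
    have "R (koszul xs (\<lambda>bs. f (c # bs)) bs') (koszul ys (\<lambda>bs. g (c # bs)) bs')" for c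
      using Cons.IH[of "\<lambda>bs. f (c # bs)" "\<lambda>bs. g (c # bs)"] Cons.prems by blast
    moreover have "R (x (f (True # bs'))) (y (g (True # bs')))"
      using Cons.hyps Cons.prems by blast
    ultimately show ?thesis using Cons R by (cases b) auto
  qed
qed

lemma koszul_mem:
  assumes "\<And>x u. x \<in> set xs \<Longrightarrow> u \<in> S \<Longrightarrow> x u \<in> T"
    and "0 \<in> T" "\<And>a b. a \<in> T \<Longrightarrow> b \<in> T \<Longrightarrow> a + b \<in> T" "\<And>a. a \<in> T \<Longrightarrow> - a \<in> T"
    and "\<And>bs. f bs \<in> S"
  shows "koszul xs f bs \<in> T"
  using koszul_rel[where Q = "\<lambda>u _. u \<in> S" and R = "\<lambda>u _. u \<in> T" and xs = xs and ys = xs and f = f and g = f]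
    assms by (simp add: list_all2_same)

lemma koszul_hom:
  assumes "list_all2 (\<lambda>x y. \<forall>u. u \<in> S \<longrightarrow> x u \<in> S \<and> h (x u) = y (h u)) xs ys"
    and "0 \<in> S" "\<And>a b. a \<in> S \<Longrightarrow> b \<in> S \<Longrightarrow> a + b \<in> S" "\<And>a. a \<in> S \<Longrightarrow> - a \<in> S"
    and "\<And>a b. a \<in> S \<Longrightarrow> b \<in> S \<Longrightarrow> h (a + b) = h a + h b"
    and "\<And>bs. f bs \<in> S"
  shows "h (koszul xs f bs) = koszul ys (\<lambda>bs. h (f bs)) bs"
proof -
  have h0: "h 0 = 0" using assms(2) assms(5)[of 0 0] by simp
  have hneg: "h (- a) = - h a" if "a \<in> S" for a
    using assms(5)[of a "- a"] assms(4)[OF that] that h0 by (simp add: eq_neg_iff_add_eq_0 add.commute)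
  have "koszul xs f bs \<in> S \<and> koszul ys (\<lambda>bs. h (f bs)) bs = h (koszul xs f bs)"
    by (rule koszul_rel[where Q = "\<lambda>u v. u \<in> S \<and> v = h u" and R = "\<lambda>u v. u \<in> S \<and> v = h u"])
      (use assms h0 hneg in \<open>auto elim!: list_all2_mono\<close>)
  then show ?thesis by simp
qed

definition commuting :: "('v::ab_group_add \<Rightarrow> 'v) list \<Rightarrow> bool" where
  "commuting xs \<longleftrightarrow> (\<forall>x\<in>set xs. additive x) \<and> (\<forall>x\<in>set xs. \<forall>y\<in>set xs. \<forall>v. x (y v) = y (x v))"

lemma commuting_Cons:
  "commuting (x # xs) \<longleftrightarrow> additive x \<and> commuting xs \<and> (\<forall>y\<in>set xs. \<forall>v. x (y v) = y (x v))"
  by (auto simp: commuting_def)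

lemma koszul_add: "commuting xs \<Longrightarrow> koszul xs (f + g) bs = koszul xs f bs + koszul xs g bs"
proof (induction xs f bs arbitrary: g rule: koszul.induct)
  case (1 x xs f bs)
  then show ?case using "1.IH"[of "\<lambda>bs. g (True # bs)"]
    by (simp add: commuting_Cons plus_fun_def)
next
  case (2 x xs f bs)
  then show ?case using "2.IH"[of "\<lambda>bs. g (False # bs)"]
    by (simp add: commuting_Cons plus_fun_def additive.add)
qed auto

lemma koszul_zero: "commuting xs \<Longrightarrow> koszul xs (\<lambda>_. 0) bs = 0"
  using koszul_add[of xs "\<lambda>_. 0" "\<lambda>_. 0" bs] by (simp add: plus_fun_def)

lemma koszul_neg: "commuting xs \<Longrightarrow> koszul xs (- f) bs = - koszul xs f bs"
  using koszul_add[of xs f "- f" bs] koszul_zero[of xs bs]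
  by (simp add: plus_fun_def eq_neg_iff_add_eq_0 add.commute)

lemma koszul_diff: "commuting xs \<Longrightarrow> koszul xs (f - g) bs = koszul xs f bs - koszul xs g bs"
  using koszul_add[of xs f "- g" bs] koszul_neg[of xs g bs] by simp

lemma koszul_commute:
  assumes "commuting (x # xs)"
  shows "x (koszul xs f bs) = koszul xs (\<lambda>bs. x (f bs)) bs"
  using assms
proof (intro koszul_hom[where S = UNIV])
  show "list_all2 (\<lambda>xa y. \<forall>u. u \<in> UNIV \<longrightarrow> xa u \<in> UNIV \<and> x (xa u) = y (x u)) xs xs"
    using assms by (auto simp: list_all2_same commuting_Cons)
qed (auto simp: commuting_Cons additive.add)

lemma koszul_koszul: "commuting xs \<Longrightarrow> koszul xs (koszul xs f) bs = 0"
proof (induction xs arbitrary: f bs)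
  case Nil
  then show ?case by (cases bs) auto
next
  case (Cons x xs)
  have c: "commuting xs" using Cons.prems by (simp add: commuting_Cons)
  show ?case
  proof (cases bs)
    case (Cons b bs')
    let ?z = "\<lambda>bs. f (False # bs)" let ?y = "\<lambda>bs. f (True # bs)"
    have y: "(\<lambda>bs. koszul (x # xs) f (True # bs)) = - koszul xs ?y" by (auto simp: fun_eq_iff)
    have z: "(\<lambda>bs. koszul (x # xs) f (False # bs)) = koszul xs ?z + (\<lambda>bs. x (?y bs))"
      by (auto simp: fun_eq_iff)
    show ?thesis
    proof (cases b)
      case True
      then show ?thesis using Cons y Cons.IH[OF c] by (simp add: koszul_neg[OF c])
    next
      case False
      \<comment> \<open>The minus sign in the \<open>True\<close> part of the differential makes
        this mixed term cancel the one from the \<open>False\<close> part.\<close>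
      have "x (- koszul xs ?y bs') = - koszul xs (\<lambda>bs. x (?y bs)) bs'"
        using koszul_commute[OF Cons.prems, of ?y bs'] Cons.prems
        by (simp add: commuting_Cons additive.minus)
      then show ?thesis using Cons y z False Cons.IH[OF c] by (simp add: koszul_add[OF c])
    qed
  qed simp
qed

lemma koszul_chains_0:
  assumes "commuting xs" "g \<in> chains (length xs) 0 S"
  shows "koszul xs g = (\<lambda>_. 0)"
proof
  fix bs show "koszul xs g bs = 0"
    using assms
  proof (induction xs g bs rule: koszul.induct)
    case (1 x xs f bs)
    have "(\<lambda>bs. f (True # bs)) = (\<lambda>_. 0)" using "1.prems" chains_True_0 by (auto simp: fun_eq_iff)
    then show ?case using "1.prems" koszul_zero[of xs] by (simp add: commuting_Cons)
  next
    case (2 x xs f bs)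
    then show ?case using chains_False[of f _ 0 S] chains_True_0[of f _ S]
      by (simp add: commuting_Cons additive.zero)
  qed auto
qed

lemma koszul_chains:
  assumes "f \<in> chains (length xs) (Suc p) S"
    and "\<And>x u. x \<in> set xs \<Longrightarrow> u \<in> S \<Longrightarrow> x u \<in> T"
    and "0 \<in> T" "\<And>a b. a \<in> T \<Longrightarrow> b \<in> T \<Longrightarrow> a + b \<in> T" "\<And>a. a \<in> T \<Longrightarrow> - a \<in> T"
    and "commuting xs"
  shows "koszul xs f \<in> chains (length xs) p T"
  using assms(1,2,6)
proof (induction xs arbitrary: f p)
  case Nil
  have "koszul [] f = 0" by (auto simp: fun_eq_iff)
  then show ?case using assms(3) by (simp add: chains_iff)
next
  case (Cons x xs)
  have c: "commuting xs" "x 0 = 0" using Cons.prems by (auto simp: commuting_Cons additive.zero)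
  let ?z = "\<lambda>bs. f (False # bs)" let ?y = "\<lambda>bs. f (True # bs)"
  have z: "koszul xs ?z \<in> chains (length xs) p T"
    using Cons.IH[OF chains_False] Cons.prems c by simp
  have y0: "?y \<in> chains (length xs) p S" using chains_True Cons.prems by simp
  then have "(\<lambda>bs. x (?y bs)) \<in> chains (length xs) p T"
    using Cons.prems(2)[of x] c by (intro chains_map[where h = x]) auto
  then have z': "koszul xs ?z + (\<lambda>bs. x (?y bs)) \<in> chains (length xs) p T"
    using z assms(4) by (intro chains_add)
  have eq: "koszul (x # xs) f = cone (koszul xs ?z + (\<lambda>bs. x (?y bs))) (- koszul xs ?y)"
    by (rule koszul_Cons_eqI) auto
  show ?case
  proof (cases p)
    case 0
    have "koszul xs ?y bs = 0" for bs
      using koszul_chains_0[of xs ?y S] y0 c 0 by simp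
    then have "koszul (x # xs) f = cone (koszul xs ?z + (\<lambda>bs. x (?y bs))) (\<lambda>_. 0)"
      using eq by (auto simp: fun_eq_iff cone_def split: list.splits)
    then show ?thesis using cone_chains_0[of _ "length xs" T] z' 0 by simp
  next
    case (Suc q)
    have "koszul xs ?y \<in> chains (length xs) q T"
      using Cons.IH[of ?y q] y0 Cons.prems(2) c Suc by simp
    then have "- koszul xs ?y \<in> chains (length xs) q T" using chains_map[of _ _ _ T uminus T] assms(5) by (simp add: fun_Compl_def)
    then show ?thesis unfolding eq using cone_chains[of _ "length xs" q T] z' Suc by simp
  qed
qed

text \<open>\<open>wedge as\<close> is left multiplication by the element \<open>v\<close> of the exterior algebra with
  coordinates \<open>as\<close>, where the scalars are given by their action.\<close>

fun wedge :: "('v::ab_group_add \<Rightarrow> 'v) list \<Rightarrow> (bool list \<Rightarrow> 'v) \<Rightarrow> bool list \<Rightarrow> 'v" where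
  "wedge (a # as) f (True # bs) = a (f (False # bs)) - wedge as (\<lambda>bs. f (True # bs)) bs"
| "wedge (a # as) f (False # bs) = wedge as (\<lambda>bs. f (False # bs)) bs"
| "wedge _ f _ = 0"

fun lincomb :: "('v::ab_group_add \<Rightarrow> 'v) list \<Rightarrow> ('v \<Rightarrow> 'v) list \<Rightarrow> 'v \<Rightarrow> 'v" where
  "lincomb (a # as) (x # xs) v = a (x v) + lincomb as xs v"
| "lincomb _ _ v = 0"

lemma wedge_add: "\<forall>a\<in>set as. additive a \<Longrightarrow> wedge as (f + g) bs = wedge as f bs + wedge as g bs"
proof (induction as f bs arbitrary: g rule: wedge.induct)
  case (1 x xs f bs)
  then show ?case using "1.IH"[of "\<lambda>bs. g (True # bs)"]
    by (simp add: plus_fun_def additive.add algebra_simps)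
next
  case (2 x xs f bs)
  then show ?case using "2.IH"[of "\<lambda>bs. g (False # bs)"]
    by (simp add: plus_fun_def)
qed auto

lemma wedge_zero: "\<forall>a\<in>set as. additive a \<Longrightarrow> wedge as (\<lambda>_. 0) bs = 0"
  using wedge_add[of as "\<lambda>_. 0" "\<lambda>_. 0" bs] by (simp add: plus_fun_def)

lemma wedge_neg: "\<forall>a\<in>set as. additive a \<Longrightarrow> wedge as (- f) bs = - wedge as f bs"
  using wedge_add[of as f "- f" bs] wedge_zero[of as bs]
  by (simp add: plus_fun_def eq_neg_iff_add_eq_0 add.commute)

lemma wedge_commute:
  assumes "additive x" "\<forall>a\<in>set as. \<forall>v. a (x v) = x (a v)"
  shows "wedge as (\<lambda>bs. x (f bs)) bs = x (wedge as f bs)"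
  using assms
proof (induction as f bs rule: wedge.induct)
  case (1 a as f bs)
  then show ?case by (simp add: additive.diff)
qed (auto simp: additive.zero)

text \<open>Cartan's formula: the Koszul differential is contraction with the operators, so its
  anticommutator with multiplication by a vector is multiplication by the pairing of the two. Later
  it provides the change of basis of the exterior algebra that replaces one variable by a linear
  form.\<close>

lemma koszul_wedge:
  assumes "commuting xs" "length as = length xs" "length bs = length xs"
    and "\<forall>a\<in>set as. additive a" "\<forall>a\<in>set as. \<forall>x\<in>set xs. \<forall>v. a (x v) = x (a v)"
  shows "koszul xs (wedge as f) bs + wedge as (koszul xs f) bs = lincomb as xs (f bs)"
  using assms
proof (induction xs arbitrary: as f bs)
  case Nil
  then show ?case by simp
next
  case (Cons x xs)
  obtain a as' where as: "as = a # as'" "length as' = length xs" using Cons.prems by (cases as) auto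
  obtain b bs' where bs: "bs = b # bs'" "length bs' = length xs" using Cons.prems by (cases bs) auto
  have c: "commuting xs" "additive x" using Cons.prems by (auto simp: commuting_Cons)
  have a: "additive a" "\<forall>a\<in>set as'. additive a" "\<forall>v. a (x v) = x (a v)" "\<forall>y\<in>set xs. \<forall>v. a (y v) = y (a v)"
    "\<forall>a\<in>set as'. \<forall>v. a (x v) = x (a v)"
    using Cons.prems as by auto
  let ?z = "\<lambda>bs. f (False # bs)" let ?y = "\<lambda>bs. f (True # bs)"
  have IH: "koszul xs (wedge as' g) bs' + wedge as' (koszul xs g) bs' = lincomb as' xs (g bs')" for g
    using Cons.IH[OF c(1) as(2) bs(2) a(2), of g] Cons.prems(5) unfolding as by (meson list.set_intros(2))
  have ak: "koszul xs (\<lambda>bs. a (g bs)) bs' = a (koszul xs g bs')" for g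
    using koszul_commute[of a xs g] c a by (simp add: commuting_Cons)
  have w1: "(\<lambda>bs. wedge as f (True # bs)) = (\<lambda>bs. a (?z bs)) - wedge as' ?y"
    and w2: "(\<lambda>bs. wedge as f (False # bs)) = wedge as' ?z" by (auto simp: as fun_eq_iff)
  have k1: "(\<lambda>bs. koszul (x # xs) f (True # bs)) = - koszul xs ?y"
    and k2: "(\<lambda>bs. koszul (x # xs) f (False # bs)) = koszul xs ?z + (\<lambda>bs. x (?y bs))"
    by (auto simp: fun_eq_iff)
  show ?case
  proof (cases b)
    case True
    have A: "koszul (x # xs) (wedge as f) bs = - (a (koszul xs ?z bs') - koszul xs (wedge as' ?y) bs')"
      using w1 bs True by (simp add: koszul_diff[OF c(1)] ak)
    have B: "wedge as (koszul (x # xs) f) bs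
        = a (koszul xs ?z bs' + x (?y bs')) + wedge as' (koszul xs ?y) bs'"
      using k1 bs True as by (simp add: wedge_neg[OF a(2)])
    show ?thesis
      unfolding A B using IH[of ?y] bs True as a(1) by (simp add: additive.add algebra_simps)
  next
    case False
    have A: "koszul (x # xs) (wedge as f) bs
        = koszul xs (wedge as' ?z) bs' + x (a (?z bs') - wedge as' ?y bs')"
      using w2 bs False as by simp
    have B: "wedge as (koszul (x # xs) f) bs
        = wedge as' (koszul xs ?z) bs' + x (wedge as' ?y bs')"
      using k2 bs False as wedge_commute[OF c(2) a(5), of ?y bs'] by (simp add: wedge_add[OF a(2)])
    show ?thesis
      unfolding A B using IH[of ?z] bs False as a c(2) by (simp add: additive.diff algebra_simps)
  qed
qed

lemma wedge_chains:
  assumes "f \<in> chains (length as) p S" "\<forall>a\<in>set as. \<forall>u\<in>S. a u \<in> S" "\<forall>a\<in>set as. a 0 = 0"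
    and "0 \<in> S" "\<And>a b. a \<in> S \<Longrightarrow> b \<in> S \<Longrightarrow> a - b \<in> S"
  shows "wedge as f \<in> chains (length as) (Suc p) S"
  using assms(1-3)
proof (induction as arbitrary: f p)
  case Nil
  have "wedge [] f = (\<lambda>_. 0)" by (auto simp: fun_eq_iff)
  then show ?case using assms(4) by (simp add: chains_iff)
next
  case (Cons a as)
  let ?z = "\<lambda>bs. f (False # bs)" let ?y = "\<lambda>bs. f (True # bs)"
  have z: "?z \<in> chains (length as) p S" using chains_False Cons.prems by simp
  have az: "(\<lambda>bs. a (?z bs)) \<in> chains (length as) p S"
    using z Cons.prems by (intro chains_map[where h = a]) auto
  have wy: "wedge as ?y \<in> chains (length as) p S"
  proof (cases p)
    case 0
    have "?y = (\<lambda>_. 0)" using Cons.prems 0 chains_True_0 by (auto simp: fun_eq_iff)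
    moreover have "wedge as (\<lambda>_. 0) bs = 0" for bs
    proof -
      have "wedge as g bs = 0" if "g = (\<lambda>_. 0)" "\<forall>a\<in>set as. a 0 = 0" for g and as :: "('a \<Rightarrow> 'a) list"
        using that by (induction as g bs rule: wedge.induct) auto
      then show ?thesis using Cons.prems(3) by simp
    qed
    ultimately show ?thesis using assms(4) by (simp add: chains_iff)
  next
    case (Suc q)
    then show ?thesis using Cons.IH[of ?y q] chains_True[of f _ q S] Cons.prems by simp
  qed
  have "wedge (a # as) f = cone (wedge as ?z) ((\<lambda>bs. a (?z bs)) - wedge as ?y)"
  proof
    fix bs show "wedge (a # as) f bs = cone (wedge as ?z) ((\<lambda>bs. a (?z bs)) - wedge as ?y) bs"
      by (cases bs; cases "hd bs") auto
  qed
  moreover have "wedge as ?z \<in> chains (length as) (Suc p) S" using Cons.IH[OF z] Cons.prems by simp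
  ultimately show ?case using chains_diff[OF assms(5) az wy] cone_chains by auto
qed

section \<open>Polynomial coordinates, homogeneous components and acyclicity for free
  modules\<close>

section \<open>Graded free modules in coordinates\<close>

type_synonym idx = "nat \<times> (nat \<Rightarrow>\<^sub>0 nat)"

abbreviation (input) unit_exp :: "nat \<Rightarrow> nat \<Rightarrow>\<^sub>0 nat" where
  "unit_exp i \<equiv> Poly_Mapping.single i (Suc 0)"

definition coeff :: "(nat \<Rightarrow>\<^sub>0 ('k::field) mpoly) \<Rightarrow> idx \<Rightarrow> 'k" where
  "coeff f = (\<lambda>(b, t). Poly_Mapping.lookup (Poly_Mapping.lookup f b) t)"

definition of_coeff :: "(idx \<Rightarrow> 'k) \<Rightarrow> nat \<Rightarrow>\<^sub>0 ('k::field) mpoly" where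
  "of_coeff g = Abs_poly_mapping (\<lambda>b. Abs_poly_mapping (\<lambda>t. g (b, t)))"

text \<open>Multiplication by the i-th variable in coordinates; monomials not divisible by it
  receive the coefficient 0.\<close>

definition shift :: "nat \<Rightarrow> (idx \<Rightarrow> 'k::zero) \<Rightarrow> idx \<Rightarrow> 'k" where
  "shift i g = (\<lambda>(b, t). if Poly_Mapping.lookup t i > 0 then g (b, t - unit_exp i) else 0)"

definition scale_poly :: "'k::field mpoly \<Rightarrow> (nat \<Rightarrow>\<^sub>0 'k mpoly) \<Rightarrow> nat \<Rightarrow>\<^sub>0 'k mpoly" where
  "scale_poly p f = Poly_Mapping.map (\<lambda>q. p * q) f"

lemma nonzero_lookup: "p \<noteq> 0 \<Longrightarrow> \<exists>t. Poly_Mapping.lookup p t \<noteq> 0"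
  by (metis poly_mapping_eqI lookup_zero)

lemma coeff_eqI: "(\<And>b t. coeff f (b, t) = coeff g (b, t)) \<Longrightarrow> f = g"
  by (auto simp: coeff_def intro!: poly_mapping_eqI)

lemma coeff_add: "coeff (f + g) i = coeff f i + coeff g i"
  and coeff_diff: "coeff (f - g) i = coeff f i - coeff g i"
  and coeff_uminus: "coeff (- f) i = - coeff f i"
  and coeff_zero: "coeff 0 i = 0"
  by (auto simp: coeff_def lookup_add lookup_minus split: prod.splits)

lemma coeff_sum: "coeff (sum f I) i = (\<Sum>j\<in>I. coeff (f j) i)"
  by (induction I rule: infinite_finite_induct) (auto simp: coeff_add coeff_zero)

lemmas coeff_simps = coeff_add coeff_diff coeff_uminus coeff_zero coeff_sum

lemma finite_coeff: "finite {i. coeff f i \<noteq> 0}"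
proof (rule finite_subset)
  show "{i. coeff f i \<noteq> 0} \<subseteq> Sigma (Poly_Mapping.keys f) (\<lambda>b. Poly_Mapping.keys (Poly_Mapping.lookup f b))"
    by (auto simp: coeff_def in_keys_iff)
qed auto

lemma coeff_of_coeff:
  assumes "finite {i. g i \<noteq> 0}"
  shows "coeff (of_coeff g) = g"
proof -
  have fin: "finite {t. g (b, t) \<noteq> 0}" for b
  proof (rule finite_subset)
    show "{t. g (b, t) \<noteq> 0} \<subseteq> snd ` {i. g i \<noteq> 0}" by force
  qed (use assms in simp)
  have l: "Poly_Mapping.lookup (Abs_poly_mapping (\<lambda>t. g (b, t))) t = g (b, t)" for b t
    using fin[of b] by simp
  have "{b. Abs_poly_mapping (\<lambda>t. g (b, t)) \<noteq> 0} \<subseteq> fst ` {i. g i \<noteq> 0}"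
  proof
    fix b assume "b \<in> {b. Abs_poly_mapping (\<lambda>t. g (b, t)) \<noteq> 0}"
    then obtain t where "g (b, t) \<noteq> 0" using l[of b] by (auto simp: poly_mapping_eq_iff fun_eq_iff)
    then show "b \<in> fst ` {i. g i \<noteq> 0}" by force
  qed
  then have "finite {b. Abs_poly_mapping (\<lambda>t. g (b, t)) \<noteq> 0}" using assms finite_subset by blast
  then show ?thesis by (auto simp: coeff_def of_coeff_def l fun_eq_iff)
qed

lemma of_coeff_coeff: "of_coeff (coeff f) = f"
  by (rule coeff_eqI) (simp add: coeff_of_coeff finite_coeff)

lemma lookup_scale_poly: "Poly_Mapping.lookup (scale_poly p f) b = p * Poly_Mapping.lookup f b"
  by (auto simp: scale_poly_def Poly_Mapping.map.rep_eq when_def)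

lemma scale_poly_add: "scale_poly p (f + g) = scale_poly p f + scale_poly p g"
  by (rule poly_mapping_eqI) (simp add: lookup_scale_poly lookup_add distrib_left)

lemma lookup_single_times:
  fixes p :: "(nat \<Rightarrow>\<^sub>0 nat) \<Rightarrow>\<^sub>0 'k::field"
  shows "Poly_Mapping.lookup (Poly_Mapping.single s c * p) (s + t) = c * Poly_Mapping.lookup p t"
    and "(\<nexists>t. u = s + t) \<Longrightarrow> Poly_Mapping.lookup (Poly_Mapping.single s c * p) u = 0"
proof -
  have eq: "Poly_Mapping.lookup (Poly_Mapping.single s c * p) u
      = (\<Sum>t\<in>Poly_Mapping.keys p. if u = s + t then c * Poly_Mapping.lookup p t else 0)" for u
  proof -
    have "p = (\<Sum>t\<in>Poly_Mapping.keys p. Poly_Mapping.single t (Poly_Mapping.lookup p t))"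
      by (rule poly_mapping_eqI) (auto simp: lookup_sum lookup_single when_def in_keys_iff)
    then have "Poly_Mapping.single s c * p
      = (\<Sum>t\<in>Poly_Mapping.keys p. Poly_Mapping.single s c * Poly_Mapping.single t (Poly_Mapping.lookup p t))"
      by (metis sum_distrib_left)
    then have "Poly_Mapping.lookup (Poly_Mapping.single s c * p) u = (\<Sum>t\<in>Poly_Mapping.keys p.
        Poly_Mapping.lookup (Poly_Mapping.single (s + t) (c * Poly_Mapping.lookup p t)) u)"
      by (simp add: lookup_sum mult_single)
    also have "\<dots> = (\<Sum>t\<in>Poly_Mapping.keys p. if u = s + t then c * Poly_Mapping.lookup p t else 0)"
      by (intro sum.cong) (auto simp: lookup_single when_def)
    finally show ?thesis .
  qed
  show "Poly_Mapping.lookup (Poly_Mapping.single s c * p) (s + t) = c * Poly_Mapping.lookup p t"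
    unfolding eq by (auto simp: in_keys_iff)
  show "Poly_Mapping.lookup (Poly_Mapping.single s c * p) u = 0" if "\<nexists>t. u = s + t"
    unfolding eq using that by (intro sum.neutral) auto
qed

lemma minus_unit_exp: "Poly_Mapping.lookup t i > 0 \<Longrightarrow> unit_exp i + (t - unit_exp i) = t"
  by (rule poly_mapping_eqI) (auto simp: lookup_add lookup_minus lookup_single when_def)

lemma lookup_var_times:
  "Poly_Mapping.lookup (var i * p) t
    = (if Poly_Mapping.lookup t i > 0 then Poly_Mapping.lookup p (t - unit_exp i) else (0::'k::field))"
proof (cases "Poly_Mapping.lookup t i > 0")
  case True
  then show ?thesis using lookup_single_times(1)[of "unit_exp i" 1 p "t - unit_exp i"] minus_unit_exp[OF True]
    by (simp add: var_def)
next
  case False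
  then have "\<nexists>u. t = unit_exp i + u" by (auto simp: lookup_add)
  then show ?thesis using lookup_single_times(2)[of t "unit_exp i" 1 p] False by (simp add: var_def)
qed

lemma lookup_const_times: "Poly_Mapping.lookup (const c * p) t = c * Poly_Mapping.lookup p t"
  using lookup_single_times(1)[of 0 c p t] by (simp add: const_def)

definition mulvar :: "nat \<Rightarrow> (nat \<Rightarrow>\<^sub>0 ('k::field) mpoly) \<Rightarrow> nat \<Rightarrow>\<^sub>0 'k mpoly" where
  "mulvar i = scale_poly (var i)"

lemma coeff_mulvar: "coeff (mulvar i f) = shift i (coeff f)"
  by (auto simp: mulvar_def coeff_def shift_def lookup_scale_poly lookup_var_times fun_eq_iff)

lemma coeff_scale_const: "coeff (scale_poly (const c) f) i = c * coeff f i"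
  by (cases i) (simp add: coeff_def lookup_scale_poly lookup_const_times)

lemma additive_mulvar: "additive (mulvar i)"
  by unfold_locales (simp add: mulvar_def scale_poly_add)

lemma mulvar_commute: "mulvar i (mulvar j f) = mulvar j (mulvar i f)"
  by (rule poly_mapping_eqI) (simp add: mulvar_def lookup_scale_poly mult.left_commute)

text \<open>The variables are listed in decreasing order, so that one more variable is a
  \<open>Cons\<close> and the recursion of \<open>koszul\<close> matches induction on the number of
  variables.\<close>

definition var_ops :: "nat \<Rightarrow> ((nat \<Rightarrow>\<^sub>0 ('k::field) mpoly) \<Rightarrow> nat \<Rightarrow>\<^sub>0 'k mpoly) list" where
  "var_ops n = rev (map mulvar [1..<Suc n])"

lemma var_ops_simps [simp]: "var_ops 0 = []" "var_ops (Suc n) = mulvar (Suc n) # var_ops n"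
  by (simp_all add: var_ops_def)

lemma length_var_ops [simp]: "length (var_ops n) = n"
  by (induction n) auto

lemma set_var_ops: "set (var_ops n) = mulvar ` {1..n}"
  by (auto simp: var_ops_def)

lemma commuting_var_ops: "commuting (var_ops n)"
  by (auto simp: commuting_def set_var_ops additive_mulvar mulvar_commute)

lemma monomial_degree_add: "monomial_degree (s + t) = monomial_degree s + monomial_degree t"
proof -
  have *: "monomial_degree u = (\<Sum>i\<in>Poly_Mapping.keys s \<union> Poly_Mapping.keys t. Poly_Mapping.lookup u i)"
    if "Poly_Mapping.keys u \<subseteq> Poly_Mapping.keys s \<union> Poly_Mapping.keys t" for u :: "nat \<Rightarrow>\<^sub>0 nat"
    unfolding monomial_degree_def using that by (intro sum.mono_neutral_left) (auto simp: in_keys_iff)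
  show ?thesis
    using *[of "s + t"] *[of s] *[of t] Poly_Mapping.keys_add[of s t] by (simp add: lookup_add sum.distrib)
qed

lemma monomial_degree_unit_exp [simp]: "monomial_degree (unit_exp i) = 1"
  by (simp add: monomial_degree_def)

lemma monomial_degree_zero [simp]: "monomial_degree 0 = 0"
  by (simp add: monomial_degree_def)

lemma monomial_degree_minus:
  "Poly_Mapping.lookup t i > 0 \<Longrightarrow> monomial_degree t = Suc (monomial_degree (t - unit_exp i))"
  using monomial_degree_add[of "unit_exp i" "t - unit_exp i"] minus_unit_exp[of t i] by simp

lemma monomial_degree_eq_0_iff: "monomial_degree t = 0 \<longleftrightarrow> t = 0"
  by (auto simp: monomial_degree_def in_keys_iff poly_mapping_eq_iff fun_eq_iff)

lemma keys_minus_unit_exp: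
  "Poly_Mapping.lookup t i > 0 \<Longrightarrow> Poly_Mapping.keys t = insert i (Poly_Mapping.keys (t - unit_exp i))"
  by (auto simp: in_keys_iff lookup_minus lookup_single when_def split: if_splits)

lemma keys_plus_unit_exp: "Poly_Mapping.keys (t + unit_exp i) = insert i (Poly_Mapping.keys t)"
  by (auto simp: in_keys_iff lookup_add lookup_single when_def split: if_splits)

definition index_set :: "nat \<Rightarrow> nat set \<Rightarrow> (nat \<Rightarrow> int) \<Rightarrow> int \<Rightarrow> idx set" where
  "index_set n B d j = {(b, t). b \<in> B \<and> Poly_Mapping.keys t \<subseteq> {1..n} \<and> int (monomial_degree t) + d b = j}"

abbreviation (input) free_grade :: "nat \<Rightarrow> nat set \<Rightarrow> (nat \<Rightarrow> int) \<Rightarrow> int \<Rightarrow> (nat \<Rightarrow>\<^sub>0 ('k::field) mpoly) set" where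
  "free_grade n B d \<equiv> grade (free_module n B d)"

lemma coeff_not_0_keys: "coeff f (b, t) \<noteq> 0 \<Longrightarrow> b \<in> Poly_Mapping.keys f"
  by (auto simp: coeff_def in_keys_iff)

lemma keys_coeff_not_0: "b \<in> Poly_Mapping.keys f \<Longrightarrow> \<exists>t. coeff f (b, t) \<noteq> 0"
  using nonzero_lookup[of "Poly_Mapping.lookup f b"] by (auto simp: in_keys_iff coeff_def)

lemma keys_lookup_iff: "t \<in> Poly_Mapping.keys (Poly_Mapping.lookup f b) \<longleftrightarrow> coeff f (b, t) \<noteq> 0"
  by (simp add: in_keys_iff coeff_def)

lemma mem_free_carrier:
  "f \<in> carrier (free_module n B d) \<longleftrightarrow>
    (\<forall>b t. coeff f (b, t) \<noteq> 0 \<longrightarrow> b \<in> B \<and> Poly_Mapping.keys t \<subseteq> {1..n})"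
  using coeff_not_0_keys[of f] keys_coeff_not_0[of _ f]
  unfolding free_module_def mpoly_ring_def partial_object.simps mem_Collect_eq Ball_def keys_lookup_iff subset_eq
  by meson

lemma mem_free_grade:
  "f \<in> free_grade n B d j \<longleftrightarrow> (\<forall>b t. coeff f (b, t) \<noteq> 0 \<longrightarrow> (b, t) \<in> index_set n B d j)"
proof -
  have "f \<in> free_grade n B d j \<longleftrightarrow> Poly_Mapping.keys f \<subseteq> B \<and> (\<forall>b\<in>B. \<forall>t. coeff f (b, t) \<noteq> 0 \<longrightarrow>
      Poly_Mapping.keys t \<subseteq> {1..n} \<and> int (monomial_degree t) = j - d b)"
    unfolding free_module_def homogeneous_def mpoly_ring_def partial_object.simps
      graded_module.select_convs mem_Collect_eq Ball_def keys_lookup_iff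
    by blast
  also have "\<dots> \<longleftrightarrow> (\<forall>b t. coeff f (b, t) \<noteq> 0 \<longrightarrow> (b, t) \<in> index_set n B d j)"
    using coeff_not_0_keys[of f] keys_coeff_not_0[of _ f]
    unfolding index_set_def subset_eq eq_diff_eq mem_Collect_eq prod.case by blast
  finally show ?thesis .
qed

lemma free_grade_carrier: "f \<in> free_grade n B d j \<Longrightarrow> f \<in> carrier (free_module n B d)"
  unfolding mem_free_grade mem_free_carrier by (auto simp: index_set_def)

lemma free_grade_zero: "0 \<in> free_grade n B d j"
  by (simp add: mem_free_grade coeff_zero)

lemma free_grade_add: "f \<in> free_grade n B d j \<Longrightarrow> g \<in> free_grade n B d j \<Longrightarrow> f + g \<in> free_grade n B d j"
  unfolding mem_free_grade coeff_add by (metis add.right_neutral)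

lemma free_grade_neg: "f \<in> free_grade n B d j \<Longrightarrow> - f \<in> free_grade n B d j"
  by (simp add: mem_free_grade coeff_uminus)

lemma free_grade_diff: "f \<in> free_grade n B d j \<Longrightarrow> g \<in> free_grade n B d j \<Longrightarrow> f - g \<in> free_grade n B d j"
  using free_grade_add[of f n B d j "- g"] free_grade_neg[of g n B d j] by simp

lemma free_grade_mulvar:
  assumes "i \<in> {1..n}" "f \<in> free_grade n B d j"
  shows "mulvar i f \<in> free_grade n B d (j + 1)"
  unfolding mem_free_grade
proof (intro allI impI)
  fix b t assume "coeff (mulvar i f) (b, t) \<noteq> 0"
  then have t: "Poly_Mapping.lookup t i > 0" "coeff f (b, t - unit_exp i) \<noteq> 0"
    by (auto simp: coeff_mulvar shift_def split: if_splits)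
  then have "(b, t - unit_exp i) \<in> index_set n B d j" using assms by (simp add: mem_free_grade)
  then show "(b, t) \<in> index_set n B d (j + 1)"
    using assms(1) keys_minus_unit_exp[OF t(1)] monomial_degree_minus[OF t(1)]
    by (simp add: index_set_def)
qed

lemma free_carrier_add:
  "f \<in> carrier (free_module n B d) \<Longrightarrow> g \<in> carrier (free_module n B d) \<Longrightarrow> f + g \<in> carrier (free_module n B d)"
  unfolding mem_free_carrier coeff_add by (metis add.right_neutral)

lemma free_carrier_zero: "0 \<in> carrier (free_module n B d)"
  by (simp add: mem_free_carrier coeff_zero)

lemma free_carrier_neg: "f \<in> carrier (free_module n B d) \<Longrightarrow> - f \<in> carrier (free_module n B d)"
  by (simp add: mem_free_carrier coeff_uminus)

lemma free_carrier_diff: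
  "f \<in> carrier (free_module n B d) \<Longrightarrow> g \<in> carrier (free_module n B d) \<Longrightarrow> f - g \<in> carrier (free_module n B d)"
  using free_carrier_add[of f n B d "- g"] free_carrier_neg[of g n B d] by simp

lemma free_module_simps [simp]:
  "zero (free_module n B d) = 0" "add (free_module n B d) = (+)" "(\<odot>\<^bsub>free_module n B d\<^esub>) = scale_poly"
  by (auto simp: free_module_def scale_poly_def fun_eq_iff)

subsection \<open>Homogeneous components\<close>

definition component :: "(nat \<Rightarrow> int) \<Rightarrow> int \<Rightarrow> (nat \<Rightarrow>\<^sub>0 ('k::field) mpoly) \<Rightarrow> nat \<Rightarrow>\<^sub>0 'k mpoly" where
  "component d j f = of_coeff (\<lambda>(b, t). if int (monomial_degree t) + d b = j then coeff f (b, t) else 0)"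

lemma coeff_component:
  "coeff (component d j f) (b, t) = (if int (monomial_degree t) + d b = j then coeff f (b, t) else 0)"
proof -
  have "finite {i. (\<lambda>(b, t). if int (monomial_degree t) + d b = j then coeff f (b, t) else 0) i \<noteq> 0}"
    by (rule finite_subset[OF _ finite_coeff[of f]]) (auto split: if_splits)
  from coeff_of_coeff[OF this] show ?thesis by (simp add: component_def)
qed

lemma component_grade: "f \<in> carrier (free_module n B d) \<Longrightarrow> component d j f \<in> free_grade n B d j"
  unfolding mem_free_grade mem_free_carrier coeff_component by (auto simp: index_set_def)

lemma component_self: "f \<in> free_grade n B d j \<Longrightarrow> component d j f = f"
  unfolding mem_free_grade by (rule coeff_eqI) (auto simp: coeff_component index_set_def)

lemma component_other: "f \<in> free_grade n B d j \<Longrightarrow> i \<noteq> j \<Longrightarrow> component d i f = 0"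
  unfolding mem_free_grade by (rule coeff_eqI) (auto simp: coeff_component coeff_zero index_set_def)

lemma component_sum: "component d j (sum f I) = (\<Sum>i\<in>I. component d j (f i))"
  by (rule coeff_eqI) (simp add: coeff_component coeff_sum)

lemma sum_components:
  obtains J where "finite J" "f = (\<Sum>j\<in>J. component d j f)" "\<And>j. j \<notin> J \<Longrightarrow> component d j f = 0"
proof
  let ?J = "(\<lambda>(b, t). int (monomial_degree t) + d b) ` {i. coeff f i \<noteq> 0}"
  show "finite ?J" using finite_coeff by blast
  show "component d j f = 0" if "j \<notin> ?J" for j
    using that by (intro coeff_eqI) (force simp: coeff_component coeff_zero)
  show "f = (\<Sum>j\<in>?J. component d j f)"
  proof (rule coeff_eqI)
    fix b t
    have "(\<Sum>j\<in>?J. coeff (component d j f) (b, t)) = coeff f (b, t)"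
    proof (cases "coeff f (b, t) = 0")
      case False
      then have "int (monomial_degree t) + d b \<in> ?J" by force
      then show ?thesis using \<open>finite ?J\<close> by (simp add: coeff_component)
    qed (auto simp: coeff_component intro!: sum.neutral)
    then show "coeff f (b, t) = coeff (\<Sum>j\<in>?J. component d j f) (b, t)" by (simp add: coeff_sum)
  qed
qed

lemma graded_hom_free:
  fixes h :: "(nat \<Rightarrow>\<^sub>0 ('a::field) mpoly) \<Rightarrow> nat \<Rightarrow>\<^sub>0 'a mpoly"
  assumes "h \<in> graded_hom n (free_module n B d) (free_module n B' d')"
  shows "x \<in> carrier (free_module n B d) \<Longrightarrow> h x \<in> carrier (free_module n B' d')"
    and "x \<in> carrier (free_module n B d) \<Longrightarrow> y \<in> carrier (free_module n B d) \<Longrightarrow> h (x + y) = h x + h y"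
    and "x \<in> free_grade n B d j \<Longrightarrow> h x \<in> free_grade n B' d' j"
    and "i \<in> {1..n} \<Longrightarrow> x \<in> carrier (free_module n B d) \<Longrightarrow> h (mulvar i x) = mulvar i (h x)"
    and "h 0 = 0"
    and "x \<in> carrier (free_module n B d) \<Longrightarrow> h (- x) = - h x"
    and "x \<in> carrier (free_module n B d) \<Longrightarrow> y \<in> carrier (free_module n B d) \<Longrightarrow> h (x - y) = h x - h y"
proof -
  show add: "h (x + y) = h x + h y"
    if "x \<in> carrier (free_module n B d)" "y \<in> carrier (free_module n B d)" for x y
    using assms that by (simp add: graded_hom_def)
  show zero: "h 0 = 0" using add[OF free_carrier_zero free_carrier_zero] by (metis add.right_neutral add_left_cancel)
  show neg: "h (- x) = - h x" if "x \<in> carrier (free_module n B d)" for x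
    using add[OF that free_carrier_neg[OF that]] zero by (simp add: eq_neg_iff_add_eq_0 add.commute)
  show "h (x - y) = h x - h y"
    if "x \<in> carrier (free_module n B d)" "y \<in> carrier (free_module n B d)" for x y
    using add[OF that(1) free_carrier_neg[OF that(2)]] neg[OF that(2)] by simp
  show "h (mulvar i x) = mulvar i (h x)" if "i \<in> {1..n}" "x \<in> carrier (free_module n B d)"
  proof -
    have "(var i :: 'a mpoly) \<in> carrier (mpoly_ring n)" using that(1) by (auto simp: var_def mpoly_ring_def)
    then show ?thesis using assms that(2) by (simp add: graded_hom_def mulvar_def)
  qed
qed (use assms in \<open>auto simp: graded_hom_def image_subset_iff\<close>)

lemma free_carrier_sum:
  "(\<And>i. i \<in> I \<Longrightarrow> f i \<in> carrier (free_module n B d)) \<Longrightarrow> sum f I \<in> carrier (free_module n B d)"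
  by (induction I rule: infinite_finite_induct) (auto intro: free_carrier_add free_carrier_zero)

text \<open>Each component of \<open>x\<close> is mapped into a single degree, so the sum of the
  images is already the decomposition of \<open>h x\<close>.\<close>

lemma graded_hom_free_component:
  assumes h: "h \<in> graded_hom n (free_module n B d) (free_module n B' d')"
    and x: "x \<in> carrier (free_module n B d)"
  shows "h (component d j x) = component d' j (h x)"
proof -
  obtain J where J: "finite J" "x = (\<Sum>j\<in>J. component d j x)" "\<And>j. j \<notin> J \<Longrightarrow> component d j x = 0"
    using sum_components[of x d] by blast
  have hsum: "h (\<Sum>i\<in>I. component d i x) = (\<Sum>i\<in>I. h (component d i x))" if "finite I" for I
    using that
  proof (induction I rule: finite_induct)
    case (insert i I)
    then show ?case
      using graded_hom_free(2)[OF h, of "component d i x" "\<Sum>i\<in>I. component d i x"]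
        component_grade[OF x, THEN free_grade_carrier] free_carrier_sum[of I "\<lambda>i. component d i x" n B d] by simp
  qed (simp add: graded_hom_free(5)[OF h])
  have "component d' j (h x) = (\<Sum>i\<in>J. component d' j (h (component d i x)))"
    using hsum[OF J(1)] J(2) component_sum by metis
  also have "\<dots> = (\<Sum>i\<in>J. if i = j then h (component d i x) else 0)"
  proof (rule sum.cong)
    fix i assume "i \<in> J"
    have g: "h (component d i x) \<in> free_grade n B' d' i"
      using graded_hom_free(3)[OF h component_grade[OF x]] .
    show "component d' j (h (component d i x)) = (if i = j then h (component d i x) else 0)"
      using component_self[OF g] component_other[OF g, of j] by auto
  qed simp
  also have "\<dots> = h (component d j x)"
    using J(1,3) graded_hom_free(5)[OF h] by auto
  finally show ?thesis by simp
qed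

text \<open>Exactness of a resolution is given for whole modules; this makes it usable one degree at
  a time.\<close>

lemma graded_hom_free_lift:
  assumes h: "h \<in> graded_hom n (free_module n B d) (free_module n B' d')"
    and y: "y \<in> free_grade n B' d' j" "y \<in> h ` carrier (free_module n B d)"
  shows "\<exists>x \<in> free_grade n B d j. h x = y"
proof -
  obtain x where x: "x \<in> carrier (free_module n B d)" "y = h x" using y by blast
  have "h (component d j x) = y"
    using graded_hom_free_component[OF h x(1)] component_self y(1) x(2) by metis
  then show ?thesis using component_grade[OF x(1)] by blast
qed

subsection \<open>Exactness of the Koszul complex of a free module\<close>

text \<open>A left inverse of \<open>mulvar i\<close>: division by the variable, discarding the
  monomials that it does not divide.\<close>

definition shift_down :: "nat \<Rightarrow> (nat \<Rightarrow>\<^sub>0 ('k::field) mpoly) \<Rightarrow> nat \<Rightarrow>\<^sub>0 'k mpoly" where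
  "shift_down i f = of_coeff (\<lambda>(b, t). coeff f (b, t + unit_exp i))"

lemma coeff_shift_down: "coeff (shift_down i f) (b, t) = coeff f (b, t + unit_exp i)"
proof -
  have "finite {i'. (\<lambda>(b, t). coeff f (b, t + unit_exp i)) i' \<noteq> 0}"
  proof (rule finite_imageD)
    show "finite ((\<lambda>(b, t). (b, t + unit_exp i)) ` {i'. (\<lambda>(b, t). coeff f (b, t + unit_exp i)) i' \<noteq> 0})"
      by (rule finite_subset[OF _ finite_coeff[of f]]) auto
  qed (auto simp: inj_on_def)
  from coeff_of_coeff[OF this] show ?thesis by (simp add: shift_down_def)
qed

lemma free_grade_shift_down:
  assumes "f \<in> free_grade n B d j"
  shows "shift_down i f \<in> free_grade n B d (j - 1)"
  using assms unfolding mem_free_grade coeff_shift_down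
  by (force simp: index_set_def keys_plus_unit_exp monomial_degree_add)

abbreviation (input) low :: "nat \<Rightarrow> bool list" where "low r \<equiv> replicate r False"

lemma count_list_True_eq_0: "length bs = r \<Longrightarrow> count_list bs True = 0 \<longleftrightarrow> bs = low r"
proof (induction bs arbitrary: r)
  case (Cons b bs)
  then show ?case by (cases r) auto
qed auto

lemma chains_0_eqI:
  assumes "f \<in> chains r 0 S" "g \<in> chains r 0 T" "f (low r) = g (low r)"
  shows "f = g"
proof
  fix bs show "f bs = g bs"
    using chainsD0[OF assms(1), of bs] chainsD0[OF assms(2), of bs] count_list_True_eq_0[of bs r] assms(3)
    by (cases "length bs = r \<and> count_list bs True = 0") auto
qed

definition at_low :: "nat \<Rightarrow> 'v::zero \<Rightarrow> bool list \<Rightarrow> 'v" where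
  "at_low r v = (\<lambda>bs. if bs = low r then v else 0)"

lemma at_low_chains: "v \<in> S \<Longrightarrow> at_low r v \<in> chains r 0 S"
  by (rule chainsI) (use count_list_True_eq_0 in \<open>auto simp: at_low_def\<close>)

lemma at_low_low [simp]: "at_low r v (low r) = v"
  by (simp add: at_low_def)

lemma koszul_low_coeff:
  assumes "Poly_Mapping.keys t \<inter> {1..r} = {}"
  shows "coeff (koszul (var_ops r) c (low r)) (b, t) = 0"
  using assms
proof (induction r arbitrary: c)
  case (Suc r)
  then have "coeff (koszul (var_ops r) (\<lambda>bs. c (False # bs)) (low r)) (b, t) = 0" by force
  moreover have "Poly_Mapping.lookup t (Suc r) = 0" using Suc.prems by (force simp: in_keys_iff)
  ultimately show ?case by (simp add: coeff_add coeff_mulvar shift_def)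
qed (simp add: coeff_zero)

text \<open>Every monomial of \<open>e\<close> is divisible by one of the first \<open>r\<close>
  variables. Dividing by the last of them wherever possible leaves a remainder whose monomials are
  divisible by one of the others.\<close>

lemma koszul_low_surj:
  assumes "e \<in> free_grade n B d j" "r \<le> n"
    and "\<And>b t. Poly_Mapping.keys t \<inter> {1..r} = {} \<Longrightarrow> coeff e (b, t) = 0"
  shows "\<exists>c \<in> chains r 1 (free_grade n B d (j - 1)). koszul (var_ops r) c (low r) = e"
  using assms
proof (induction r arbitrary: e)
  case 0
  then have "e = 0" by (intro coeff_eqI) (simp add: coeff_zero)
  then show ?case using chains_zero[OF free_grade_zero] by (intro bexI[of _ "\<lambda>_. 0"]) auto
next
  case (Suc r)
  let ?e2 = "shift_down (Suc r) e" let ?e1 = "e - mulvar (Suc r) ?e2"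
  have e2: "?e2 \<in> free_grade n B d (j - 1)" using free_grade_shift_down Suc.prems(1) .
  have ce1: "coeff ?e1 (b, t) = (if Poly_Mapping.lookup t (Suc r) > 0 then 0 else coeff e (b, t))" for b t
    using minus_unit_exp[of t "Suc r"]
    by (auto simp: coeff_diff coeff_mulvar shift_def coeff_shift_down add.commute)
  have "?e1 \<in> free_grade n B d j"
    using free_grade_diff[OF Suc.prems(1)] free_grade_mulvar[OF _ e2, of "Suc r"] Suc.prems(2) by simp
  moreover have "coeff ?e1 (b, t) = 0" if t: "Poly_Mapping.keys t \<inter> {1..r} = {}" for b t
  proof (cases "Poly_Mapping.lookup t (Suc r) > 0")
    case False
    then have "Poly_Mapping.keys t \<inter> {1..Suc r} = {}" using t by (auto simp: in_keys_iff le_Suc_eq disjoint_iff)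
    then show ?thesis using Suc.prems(3) ce1 by auto
  qed (use ce1 in simp)
  ultimately obtain c where c: "c \<in> chains r 1 (free_grade n B d (j - 1))" "koszul (var_ops r) c (low r) = ?e1"
    using Suc.IH[of ?e1] Suc.prems(2) by auto
  have "cone c (at_low r ?e2) \<in> chains (Suc r) 1 (free_grade n B d (j - 1))"
    using cone_chains[of c r 0 _ "at_low r ?e2"] c at_low_chains[OF e2] by simp
  moreover have "koszul (var_ops (Suc r)) (cone c (at_low r ?e2)) (low (Suc r)) = e"
    using c(2) by simp
  ultimately show ?case by blast
qed

text \<open>The variables form a regular sequence. In the cone the part \<open>?y\<close> over the
  last variable is a cycle; once it is the boundary of some \<open>w'\<close>, the corrected part
  \<open>?z'\<close> is a cycle for fewer variables, and the induction hypothesis applies. In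
  exterior degree 0 the homology is the reduction modulo the variables, which is why the statement
  begins with degree 1.\<close>

lemma koszul_free_exact:
  fixes c :: "bool list \<Rightarrow> nat \<Rightarrow>\<^sub>0 ('a::field) mpoly"
  assumes "c \<in> chains r (Suc p) (free_grade n B d j)" "r \<le> n" "koszul (var_ops r) c = (\<lambda>_. 0)"
  shows "\<exists>c' \<in> chains r (Suc (Suc p)) (free_grade n B d (j - 1)). koszul (var_ops r) c' = c"
  using assms
proof (induction r arbitrary: c p)
  case 0
  have "c = (\<lambda>_. 0)"
  proof
    fix bs show "c bs = 0" using chainsD0[OF 0(1), of bs] by (cases bs) auto
  qed
  then show ?case using chains_zero[OF free_grade_zero] by (intro bexI[of _ "\<lambda>_. 0"]) auto
next
  case (Suc r)
  let ?G = "free_grade n B d :: int \<Rightarrow> (nat \<Rightarrow>\<^sub>0 'a mpoly) set"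
    and ?xs = "var_ops r :: ((nat \<Rightarrow>\<^sub>0 'a mpoly) \<Rightarrow> nat \<Rightarrow>\<^sub>0 'a mpoly) list"
    and ?x = "mulvar (Suc r) :: (nat \<Rightarrow>\<^sub>0 'a mpoly) \<Rightarrow> nat \<Rightarrow>\<^sub>0 'a mpoly"
  let ?z = "\<lambda>bs. c (False # bs)" and ?y = "\<lambda>bs. c (True # bs)"
  note cm = commuting_var_ops
  have z: "?z \<in> chains r (Suc p) (?G j)" and y: "?y \<in> chains r p (?G j)"
    using chains_False[OF Suc.prems(1)] chains_True[OF Suc.prems(1)] by auto
  have kz: "koszul ?xs ?z bs + ?x (?y bs) = 0" for bs
    using fun_cong[OF Suc.prems(3), of "False # bs"] by simp
  have ky: "koszul ?xs ?y bs = 0" for bs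
    using fun_cong[OF Suc.prems(3), of "True # bs"] by simp
  have mv: "x u \<in> ?G j" if "x \<in> set ?xs" "u \<in> ?G (j - 1)" for x u
    using that Suc.prems(2) free_grade_mulvar[of _ n u B d "j - 1"] by (auto simp: set_var_ops)
  have kc: "koszul ?xs w \<in> chains r q (?G j)" if "w \<in> chains r (Suc q) (?G (j - 1))" for w q
  proof -
    have "koszul ?xs w \<in> chains (length ?xs) q (?G j)"
      by (rule koszul_chains[where S = "?G (j - 1)"])
        (use that mv cm in \<open>auto intro: free_grade_zero free_grade_add free_grade_neg\<close>)
    then show ?thesis by simp
  qed
  obtain w' where w': "w' \<in> chains r (Suc p) (?G (j - 1))" "koszul ?xs w' = ?y"
  proof (cases p)
    case 0
    let ?e = "?y (low r)"
    \<comment> \<open>Regularity read on monomials: the last variable times \<open>?e\<close> lies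
      in the submodule generated by the first \<open>r\<close> variables, and if \<open>t\<close>
      avoids these, so does its product with the last variable.\<close>
    have "coeff ?e (b, t) = 0" if t: "Poly_Mapping.keys t \<inter> {1..r} = {}" for b t
    proof -
      have "Poly_Mapping.keys (t + unit_exp (Suc r)) \<inter> {1..r} = {}"
        using t by (auto simp: keys_plus_unit_exp)
      from koszul_low_coeff[OF this, of ?z b] have "coeff (?x ?e) (b, t + unit_exp (Suc r)) = 0"
        using kz[of "low r"] by (metis add_0 coeff_add coeff_zero)
      then show ?thesis by (simp add: coeff_mulvar shift_def lookup_add)
    qed
    moreover have "?e \<in> ?G j" using chainsD'[OF y free_grade_zero] .
    ultimately obtain w' where w': "w' \<in> chains r 1 (?G (j - 1))" "koszul ?xs w' (low r) = ?e"
      using koszul_low_surj[of ?e n B d j r] Suc.prems(2) by auto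
    have "koszul ?xs w' = ?y"
      using chains_0_eqI[OF kc[of w' 0]] w' y 0 by auto
    then show ?thesis using that w' 0 by simp
  next
    case (Suc q)
    then show ?thesis using Suc.IH[of ?y q] y ky Suc.prems(2) that by auto
  qed
  let ?z' = "?z + (\<lambda>bs. ?x (w' bs))"
  have xw: "(\<lambda>bs. ?x (w' bs)) \<in> chains r (Suc p) (?G j)"
    using w'(1) free_grade_mulvar[of "Suc r" n _ B d "j - 1"] Suc.prems(2) additive.zero[OF additive_mulvar]
    by (intro chains_map[where h = ?x]) auto
  then have "?z' \<in> chains r (Suc p) (?G j)" using z by (intro chains_add free_grade_add)
  moreover have "koszul ?xs ?z' = (\<lambda>_. 0)"
  proof
    fix bs
    have "?x (koszul ?xs w' bs) = koszul ?xs (\<lambda>bs. ?x (w' bs)) bs"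
      using koszul_commute[of ?x ?xs w' bs] cm[of "Suc r"] by simp
    then show "koszul ?xs ?z' bs = 0" using kz[of bs] w'(2) by (simp add: koszul_add[OF cm])
  qed
  ultimately obtain w where w: "w \<in> chains r (Suc (Suc p)) (?G (j - 1))" "koszul ?xs w = ?z'"
    using Suc.IH[of ?z' p, OF _ Suc_leD[OF Suc.prems(2)]] by blast
  have "- w' \<in> chains r (Suc p) (?G (j - 1))"
    unfolding fun_Compl_def by (rule chains_map[OF w'(1)]) (auto intro: free_grade_neg)
  then have "cone w (- w') \<in> chains (Suc r) (Suc (Suc p)) (?G (j - 1))" using cone_chains w by blast
  moreover have "koszul (var_ops (Suc r)) (cone w (- w')) = c"
    unfolding var_ops_simps
  proof (rule koszul_Cons_eqI)
    show "koszul ?xs (\<lambda>bs. cone w (- w') (False # bs)) bs + ?x (cone w (- w') (True # bs)) = c (False # bs)" for bs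
      using w(2) by (simp add: fun_Compl_def additive.minus[OF additive_mulvar])
    show "- koszul ?xs (\<lambda>bs. cone w (- w') (True # bs)) bs = c (True # bs)" for bs
      using koszul_neg[OF cm, of r w'] w'(2) by (simp add: fun_Compl_def)
    show "c [] = 0" using chainsD0[OF Suc.prems(1)] by simp
  qed
  ultimately show ?case by blast
qed

section \<open>Diagram chase along a diagonal of a double complex\<close>

section \<open>Double complexes with exact rows and columns\<close>

text \<open>Exactness is assumed in the direction \<open>v\<close> alone; \<open>E p\<close> plays
  the part of the kernel of an augmentation at the edge q = 0. The double complex that computes Tor
  satisfies this in both directions, so the locale is interpreted twice and both halves of the
  comparison use the same lemmas. The two differentials commute without a sign.\<close>

locale half_double_complex =
  fixes D :: "nat \<Rightarrow> nat \<Rightarrow> 'c::ab_group_add set"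
    and h v :: "nat \<Rightarrow> nat \<Rightarrow> 'c \<Rightarrow> 'c" and E :: "nat \<Rightarrow> 'c set"
  assumes D_diff: "x \<in> D p q \<Longrightarrow> y \<in> D p q \<Longrightarrow> x - y \<in> D p q"
    and h_in: "x \<in> D (Suc p) q \<Longrightarrow> h p q x \<in> D p q"
    and v_in: "x \<in> D p (Suc q) \<Longrightarrow> v p q x \<in> D p q"
    and h_diff: "x \<in> D (Suc p) q \<Longrightarrow> y \<in> D (Suc p) q \<Longrightarrow> h p q (x - y) = h p q x - h p q y"
    and v_diff: "x \<in> D p (Suc q) \<Longrightarrow> y \<in> D p (Suc q) \<Longrightarrow> v p q (x - y) = v p q x - v p q y"
    and h_v: "x \<in> D (Suc p) (Suc q) \<Longrightarrow> h p q (v (Suc p) q x) = v p q (h p (Suc q) x)"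
    and h_h: "x \<in> D (Suc (Suc p)) q \<Longrightarrow> h p q (h (Suc p) q x) = 0"
    and exact: "x \<in> D p (Suc q) \<Longrightarrow> v p q x = 0 \<Longrightarrow> \<exists>y \<in> D p (Suc (Suc q)). v p (Suc q) y = x"
    and edge: "x \<in> D p 0 \<Longrightarrow> x \<in> E p \<Longrightarrow> \<exists>y \<in> D p 1. v p 0 y = x"
begin

text \<open>Up to signs, a cycle of the total complex with one entry at each place of the diagonal p
  + q = i.\<close>

definition zigzag :: "nat \<Rightarrow> (nat \<Rightarrow> 'c) \<Rightarrow> bool" where
  "zigzag i c \<longleftrightarrow> (\<forall>q\<le>i. c q \<in> D (i - q) q) \<and>
    (\<forall>q<i. h (i - Suc q) q (c q) = v (i - Suc q) q (c (Suc q)))"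

lemma zigzag_exists:
  assumes c0: "c0 \<in> D i 0" and cyc: "\<And>i'. i = Suc i' \<Longrightarrow> h i' 0 c0 \<in> E i'"
  shows "\<exists>c. zigzag i c \<and> c 0 = c0"
proof -
  have "\<exists>c. (\<forall>q\<le>k. c q \<in> D (i - q) q) \<and>
      (\<forall>q<k. h (i - Suc q) q (c q) = v (i - Suc q) q (c (Suc q))) \<and> c 0 = c0" if "k \<le> i" for k
    using that
  proof (induction k)
    case 0
    show ?case using c0 by (intro exI[of _ "\<lambda>_. c0"]) auto
  next
    case (Suc k)
    then obtain c where c: "\<forall>q\<le>k. c q \<in> D (i - q) q"
      "\<forall>q<k. h (i - Suc q) q (c q) = v (i - Suc q) q (c (Suc q))" "c 0 = c0" by auto
    define p where "p = i - Suc k"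
    have ik: "i - k = Suc p" using Suc.prems p_def by simp
    have ck: "c k \<in> D (Suc p) k" using c(1) ik by (metis order_refl)
    have hk: "h p k (c k) \<in> D p k" using h_in[OF ck] .
    have "\<exists>y \<in> D p (Suc k). v p k y = h p k (c k)"
    proof (cases k)
      case 0
      then have "h p 0 (c 0) \<in> E p" using cyc[of p] ik c(3) by simp
      then show ?thesis using edge[of "h p 0 (c 0)" p] hk 0 by simp
    next
      case (Suc k')
      have ik': "i - Suc k' = Suc p" "i - k' = Suc (Suc p)" using ik Suc \<open>Suc k \<le> i\<close> by auto
      have eq: "h (Suc p) k' (c k') = v (Suc p) k' (c k)" using c(2)[rule_format, of k'] Suc ik' by simp
      \<comment> \<open>Since the previous equation writes \<open>v (c k)\<close> as
        \<open>h (c k')\<close>, the square of \<open>h\<close> appears and vanishes, and exactness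
        supplies the next entry.\<close>
      have "v p k' (h p k (c k)) = h p k' (v (Suc p) k' (c k))" using h_v[of "c k" p k'] ck Suc by simp
      also have "\<dots> = 0" unfolding eq[symmetric] using h_h[of "c k'" p k'] c(1)[rule_format, of k'] ik' Suc by simp
      finally show ?thesis using exact[of "h p k (c k)" p k'] hk Suc by auto
    qed
    then obtain y where y: "y \<in> D p (Suc k)" "v p k y = h p k (c k)" by blast
    have "(\<forall>q\<le>Suc k. (c(Suc k := y)) q \<in> D (i - q) q)"
      using c(1) y(1) p_def by (auto simp: le_Suc_eq)
    moreover have "\<forall>q<Suc k. h (i - Suc q) q ((c(Suc k := y)) q) = v (i - Suc q) q ((c(Suc k := y)) (Suc q))"
      using c(2) y(2) p_def by (auto simp: less_Suc_eq)
    ultimately show ?case using c(3) by (intro exI[of _ "c(Suc k := y)"]) auto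
  qed
  from this[of i] show ?thesis by (auto simp: zigzag_def)
qed

text \<open>Carries a boundary from one end of the diagonal to the other: if
  \<open>c k = h u + v w\<close>, then \<open>c (Suc k) - h w\<close> is killed by \<open>v\<close>.
  So the old \<open>w\<close> becomes the next \<open>u\<close>, and a lift of the difference
  becomes the next \<open>w\<close>.\<close>

lemma zigzag_boundary:
  assumes z: "zigzag i c" and c': "c' \<in> D (Suc i) 0" "c 0 - h i 0 c' \<in> E i"
  shows "\<exists>u \<in> D 1 i. \<exists>w \<in> D 0 (Suc i). c i = h 0 i u + v 0 i w"
proof -
  have zc: "c q \<in> D (i - q) q" if "q \<le> i" for q using z that by (simp add: zigzag_def)
  have "\<exists>u \<in> D (Suc (i - k)) k. \<exists>w \<in> D (i - k) (Suc k). c k = h (i - k) k u + v (i - k) k w"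
    if "k \<le> i" for k
    using that
  proof (induction k)
    case 0
    have "c 0 - h i 0 c' \<in> D i 0" using zc[of 0] h_in[OF c'(1)] D_diff by auto
    then obtain y where "y \<in> D i 1" "v i 0 y = c 0 - h i 0 c'" using edge c'(2) by blast
    then show ?case using c'(1) by (intro bexI[of _ c'] bexI[of _ y]) auto
  next
    case (Suc k)
    define p where "p = i - Suc k"
    have ik: "i - k = Suc p" using Suc.prems p_def by simp
    obtain u w where uw: "u \<in> D (Suc (Suc p)) k" "w \<in> D (Suc p) (Suc k)"
      "c k = h (Suc p) k u + v (Suc p) k w" using Suc ik by auto
    have ck: "c k \<in> D (Suc p) k" using zc[of k] ik Suc.prems by simp
    have ck': "c (Suc k) \<in> D p (Suc k)" using zc[of "Suc k"] p_def Suc.prems by simp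
    have "v p k (c (Suc k) - h p (Suc k) w) = v p k (c (Suc k)) - v p k (h p (Suc k) w)"
      using v_diff ck' h_in[OF uw(2)] by blast
    also have "v p k (c (Suc k)) = h p k (c k)" using z Suc.prems p_def by (simp add: zigzag_def)
    also have "v p k (h p (Suc k) w) = h p k (v (Suc p) k w)" using h_v[OF uw(2)] by simp
    also have "h p k (c k) - \<dots> = h p k (c k - v (Suc p) k w)"
      using h_diff[OF ck v_in[OF uw(2)]] by simp
    also have "\<dots> = 0" using uw h_h by simp
    finally obtain w' where "w' \<in> D p (Suc (Suc k))" "v p (Suc k) w' = c (Suc k) - h p (Suc k) w"
      using exact[of "c (Suc k) - h p (Suc k) w" p k] D_diff[OF ck' h_in[OF uw(2)]] by blast
    then show ?case using uw(2) p_def[symmetric] by (intro bexI[of _ w] bexI[of _ w']) auto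
  qed
  from this[of i] show ?thesis by simp
qed

end

section \<open>Modules as finite-dimensional graded pieces with relations\<close>

section \<open>Presentations of graded modules by coordinates\<close>

definition shifts :: "nat \<Rightarrow> ((idx \<Rightarrow> 'k::zero) \<Rightarrow> idx \<Rightarrow> 'k) list" where
  "shifts n = rev (map shift [1..<Suc n])"

lemma shifts_simps [simp]: "shifts 0 = []" "shifts (Suc n) = shift (Suc n) # shifts n"
  by (simp_all add: shifts_def)

lemma length_shifts [simp]: "length (shifts n) = n"
  by (induction n) auto

lemma set_shifts: "set (shifts n) = shift ` {1..n}"
  by (auto simp: shifts_def)

lemma shift_add: "shift i (u + v) = shift i u + shift i (v :: idx \<Rightarrow> 'k::monoid_add)"
  by (auto simp: shift_def fun_eq_iff)

lemma additive_shift: "additive (shift i :: (idx \<Rightarrow> 'k::ab_group_add) \<Rightarrow> idx \<Rightarrow> 'k)"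
  by unfold_locales (rule shift_add)

lemma shift_scale: "shift i (\<lambda>j. c * u j) = (\<lambda>j. c * shift i u j)" for c :: "'k::mult_zero"
  by (auto simp: shift_def fun_eq_iff)

lemma shift_commute: "shift i (shift j u) = shift j (shift i u)"
proof -
  have "t - unit_exp i - unit_exp j = t - unit_exp j - unit_exp i" for t :: "nat \<Rightarrow>\<^sub>0 nat"
    by (rule poly_mapping_eqI) (simp add: lookup_minus)
  then show ?thesis by (auto simp: shift_def fun_eq_iff lookup_minus lookup_single when_def)
qed

lemma commuting_shifts: "commuting (shifts n :: ((idx \<Rightarrow> 'k::ab_group_add) \<Rightarrow> _) list)"
  by (auto simp: commuting_def set_shifts additive_shift shift_commute)

text \<open>A graded piece of a free module as plain functions instead of polynomials. The index set
  is finite for finitely many generators, and the same definition serves again over the extension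
  field.\<close>

definition coords :: "nat \<Rightarrow> nat set \<Rightarrow> (nat \<Rightarrow> int) \<Rightarrow> int \<Rightarrow> (idx \<Rightarrow> 'k::zero) set" where
  "coords n G dg j = {u. \<forall>i. u i \<noteq> 0 \<longrightarrow> i \<in> index_set n G dg j}"

lemma coords_zero: "0 \<in> coords n G dg j" "(\<lambda>_. 0) \<in> coords n G dg j"
  by (auto simp: coords_def)

lemma coords_add: "u \<in> coords n G dg j \<Longrightarrow> v \<in> coords n G dg j \<Longrightarrow> u + v \<in> coords n G dg j"
  for u :: "idx \<Rightarrow> 'k::monoid_add"
  unfolding coords_def by force

lemma coords_scale: "u \<in> coords n G dg j \<Longrightarrow> (\<lambda>i. c * u i) \<in> coords n G dg j" for c :: "'k::mult_zero"
  unfolding coords_def by force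

lemma coords_neg: "u \<in> coords n G dg j \<Longrightarrow> - u \<in> coords n G dg j" for u :: "idx \<Rightarrow> 'k::group_add"
  unfolding coords_def by force

lemma coords_diff: "u \<in> coords n G dg j \<Longrightarrow> v \<in> coords n G dg j \<Longrightarrow> u - v \<in> coords n G dg j"
  for u :: "idx \<Rightarrow> 'k::ab_group_add"
  using coords_add[of u n G dg j "- v"] coords_neg[of v n G dg j] by simp

lemma coords_shift:
  assumes "i \<in> {1..n}" "u \<in> coords n G dg j"
  shows "shift i u \<in> coords n G dg (j + 1)"
  unfolding coords_def
proof (intro CollectI allI impI)
  fix k assume "shift i u k \<noteq> 0"
  then obtain b t where k: "k = (b, t)" "Poly_Mapping.lookup t i > 0" "u (b, t - unit_exp i) \<noteq> 0"
    by (cases k) (auto simp: shift_def split: if_splits)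
  then have "(b, t - unit_exp i) \<in> index_set n G dg j" using assms by (auto simp: coords_def)
  then show "k \<in> index_set n G dg (j + 1)"
    using assms(1) keys_minus_unit_exp[OF k(2)] monomial_degree_minus[OF k(2)] k(1)
    by (simp add: index_set_def)
qed

lemma finite_monomials: "finite {t. Poly_Mapping.keys t \<subseteq> {1..n} \<and> monomial_degree t = e}"
proof (rule finite_imageD)
  let ?S = "{t. Poly_Mapping.keys t \<subseteq> {1..n} \<and> monomial_degree t = e}"
  have "Poly_Mapping.lookup ` ?S \<subseteq> {f. \<forall>i. (i \<in> {1..n} \<longrightarrow> f i \<in> {..e}) \<and> (i \<notin> {1..n} \<longrightarrow> f i = 0)}"
  proof clarsimp
    fix t :: "nat \<Rightarrow>\<^sub>0 nat" and i
    assume t: "Poly_Mapping.keys t \<subseteq> {Suc 0..n}"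
    have "Poly_Mapping.lookup t i \<le> monomial_degree t"
    proof (cases "i \<in> Poly_Mapping.keys t")
      case True
      then show ?thesis unfolding monomial_degree_def by (intro member_le_sum) auto
    qed (simp add: in_keys_iff)
    then show "(Suc 0 \<le> i \<and> i \<le> n \<longrightarrow> Poly_Mapping.lookup t i \<le> monomial_degree t) \<and>
      ((Suc 0 \<le> i \<longrightarrow> \<not> i \<le> n) \<longrightarrow> Poly_Mapping.lookup t i = 0)"
      using t not_in_keys_iff_lookup_eq_zero[of i t] by (meson atLeastAtMost_iff subsetD)
  qed
  moreover have "finite {f. \<forall>i. (i \<in> {1..n} \<longrightarrow> f i \<in> {..e}) \<and> (i \<notin> {1..n} \<longrightarrow> f i = (0::nat))}"
    by (rule finite_set_of_finite_funs) auto
  ultimately show "finite (Poly_Mapping.lookup ` ?S)" by (rule finite_subset)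
  show "inj_on Poly_Mapping.lookup ?S" by (simp add: inj_on_def Poly_Mapping.lookup_inject)
qed

text \<open>A lower bound for the degrees of the basis leaves finitely many basis degrees up to
  \<open>j\<close>, and each of them admits finitely many monomials.\<close>

lemma finite_index_set:
  assumes "\<And>j'. j' \<le> j \<Longrightarrow> finite {b \<in> G. dg b = j'}" "\<And>b. b \<in> G \<Longrightarrow> dg b \<ge> j0"
  shows "finite (index_set n G dg j)"
proof (rule finite_subset)
  show "index_set n G dg j \<subseteq> (\<Union>j'\<in>{j0..j}. {b \<in> G. dg b = j'} \<times>
      {t. Poly_Mapping.keys t \<subseteq> {1..n} \<and> monomial_degree t = nat (j - j')})"
    using assms(2) by (force simp: index_set_def)
  show "finite (\<Union>j'\<in>{j0..j}. {b \<in> G. dg b = j'} \<times>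
      {t. Poly_Mapping.keys t \<subseteq> {1..n} \<and> monomial_degree t = nat (j - j')})"
    using assms(1) finite_monomials by (intro finite_UN_I finite_cartesian_product) auto
qed

lemma finite_index_set': "finite G \<Longrightarrow> finite (index_set n G dg j)"
proof (rule finite_index_set)
  assume "finite G"
  then show "b \<in> G \<Longrightarrow> dg b \<ge> Min (dg ` G)" for b by simp
qed auto

abbreviation (input) vscale :: "'k::field \<Rightarrow> (idx \<Rightarrow> 'k) \<Rightarrow> idx \<Rightarrow> 'k" where
  "vscale \<equiv> \<lambda>c f i. c * f i"

lemma vector_space_vscale: "vector_space (\<lambda>(c::'k::field) f (i::'i). c * f i)"
  by unfold_locales (auto simp: fun_eq_iff algebra_simps)

lemma finite_dim_supported:
  assumes "finite A"
  shows "finite_dim vscale {f :: idx \<Rightarrow> 'k::field. \<forall>i. f i \<noteq> 0 \<longrightarrow> i \<in> A}"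
    and "vector_space.dim vscale {f :: idx \<Rightarrow> 'k::field. \<forall>i. f i \<noteq> 0 \<longrightarrow> i \<in> A} = card A"
proof -
  interpret m: vector_space "(*) :: 'k \<Rightarrow> 'k \<Rightarrow> 'k" by unfold_locales (auto simp: algebra_simps)
  have sp: "m.span {1} = UNIV"
  proof -
    have "x \<in> m.span {1}" for x using m.span_scale[OF m.span_base[of 1 "{1}"], of x] by simp
    then show ?thesis by blast
  qed
  have d: "m.dim UNIV = 1"
    using m.dim_eq_card[of "{1}" UNIV] sp by (simp add: m.dependent_single)
  have f: "finite_dim (*) (UNIV :: 'k set)"
    unfolding finite_dim_def using sp by (metis finite.emptyI finite.insertI m.subspace_UNIV subset_refl)
  have eq: "{f :: idx \<Rightarrow> 'k. \<forall>i. f i \<noteq> 0 \<longrightarrow> i \<in> A}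
      = {f. \<forall>i. if i \<in> A then f i \<in> UNIV else f i = 0}"
    by auto
  from dim_pointwise[OF m.vector_space_axioms assms, of "\<lambda>_. UNIV"] f d
  show "finite_dim vscale {f :: idx \<Rightarrow> 'k. \<forall>i. f i \<noteq> 0 \<longrightarrow> i \<in> A}"
    and "vector_space.dim vscale {f :: idx \<Rightarrow> 'k. \<forall>i. f i \<noteq> 0 \<longrightarrow> i \<in> A} = card A"
    unfolding eq by auto
qed

lemma finite_dim_coords:
  assumes "finite (index_set n G dg j)"
  shows "finite_dim vscale (coords n G dg j :: (idx \<Rightarrow> 'k::field) set)"
    and "vector_space.dim vscale (coords n G dg j :: (idx \<Rightarrow> 'k::field) set) = card (index_set n G dg j)"
  unfolding coords_def by (rule finite_dim_supported[OF assms])+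

lemma finite_bit_lists: "finite {bs :: bool list. length bs = r \<and> count_list bs True = p}"
  by (rule finite_subset[OF _ finite_lists_length_eq[of UNIV r]]) auto

lemma card_bit_lists: "card {bs :: bool list. length bs = r \<and> count_list bs True = p} = r choose p"
proof (induction r arbitrary: p)
  case 0
  have "{bs :: bool list. length bs = 0 \<and> count_list bs True = p} = (if p = 0 then {[]} else {})" by auto
  then show ?case by (cases p) simp_all
next
  case (Suc r)
  let ?S = "\<lambda>r p. {bs :: bool list. length bs = r \<and> count_list bs True = p}"
  show ?case
  proof (cases p)
    case 0
    have "?S (Suc r) 0 = (#) False ` ?S r 0"
    proof (rule Set.set_eqI)
      fix bs show "bs \<in> ?S (Suc r) 0 \<longleftrightarrow> bs \<in> (#) False ` ?S r 0"
        by (cases bs; cases "hd bs") auto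
    qed
    then show ?thesis using Suc.IH[of 0] 0 by (simp add: card_image)
  next
    case (Suc q)
    have "?S (Suc r) (Suc q) = (#) False ` ?S r (Suc q) \<union> (#) True ` ?S r q"
    proof (rule Set.set_eqI)
      fix bs show "bs \<in> ?S (Suc r) (Suc q) \<longleftrightarrow> bs \<in> (#) False ` ?S r (Suc q) \<union> (#) True ` ?S r q"
        by (cases bs; cases "hd bs") auto
    qed
    moreover have "card ((#) False ` ?S r (Suc q) \<union> (#) True ` ?S r q) = card (?S r (Suc q)) + card (?S r q)"
    proof -
      have "card ((#) b ` ?S r p) = card (?S r p)" for b p by (simp add: card_image)
      moreover have "(#) False ` ?S r (Suc q) \<inter> (#) True ` ?S r q = {}" by blast
      ultimately show ?thesis using finite_bit_lists by (simp add: card_Un_disjoint)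
    qed
    ultimately show ?thesis using Suc.IH Suc by simp
  qed
qed

lemma finite_dim_chains:
  assumes "vector_space s" "finite_dim s S"
  shows "finite_dim (pw s) (chains r p S)"
    and "vector_space.dim (pw s) (chains r p S) = (r choose p) * vector_space.dim s S"
proof -
  have eq: "chains r p S = {f. \<forall>bs. if bs \<in> {bs. length bs = r \<and> count_list bs True = p} then f bs \<in> S else f bs = 0}"
    by (simp add: chains_def)
  from dim_pointwise[OF assms(1) finite_bit_lists[of r p], of "\<lambda>_. S"] assms(2)
  show "finite_dim (pw s) (chains r p S)"
    and "vector_space.dim (pw s) (chains r p S) = (r choose p) * vector_space.dim s S"
    unfolding eq by (auto simp: card_bit_lists)
qed

text \<open>A system of relations: subspaces \<open>B j\<close> of the coordinate spaces that are stable under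
  multiplication by the variables. It describes the graded module with homogeneous pieces
  \<open>coords n G dg j / B j\<close>.\<close>

locale relations =
  fixes n :: nat and G :: "nat set" and dg :: "nat \<Rightarrow> int" and B :: "int \<Rightarrow> (idx \<Rightarrow> 'k::field) set"
  assumes finite_G: "finite G"
    and B_coords: "B j \<subseteq> coords n G dg j"
    and B_subspace: "module.subspace vscale (B j)"
    and B_shift: "i \<in> {1..n} \<Longrightarrow> u \<in> B j \<Longrightarrow> shift i u \<in> B (j + 1)"
begin

abbreviation U :: "int \<Rightarrow> (idx \<Rightarrow> 'k) set" where "U \<equiv> coords n G dg"

text \<open>Koszul homology of the quotient of \<open>U\<close> by \<open>B\<close>, with all chains
  kept in the free module: cycles close up modulo \<open>B\<close>, and chains with values in
  \<open>B\<close> count as boundaries. \<open>d\<close> is the degree of the coefficients, so a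
  class in exterior degree \<open>i\<close> has total degree \<open>d + i\<close>.\<close>

definition cycles :: "nat \<Rightarrow> int \<Rightarrow> (bool list \<Rightarrow> idx \<Rightarrow> 'k) set" where
  "cycles i d = {p \<in> chains n i (U d). \<forall>bs. koszul (shifts n) p bs \<in> B (d + 1)}"

definition boundaries :: "nat \<Rightarrow> int \<Rightarrow> (bool list \<Rightarrow> idx \<Rightarrow> 'k) set" where
  "boundaries i d = {koszul (shifts n) q + b |q b. q \<in> chains n (Suc i) (U (d - 1)) \<and> b \<in> chains n i (B d)}"

definition koszul_betti :: "nat \<Rightarrow> int \<Rightarrow> nat" where
  "koszul_betti i d = vector_space.dim (pw vscale) (cycles i d) - vector_space.dim (pw vscale) (boundaries i d)"

sublocale v: vector_space vscale by (rule vector_space_vscale)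
sublocale c: vector_space "pw vscale" by (rule vector_space_pointwise[OF vector_space_vscale])
sublocale cc: vector_space_pair "pw vscale" "pw vscale" by unfold_locales

lemma finite_dim_U: "finite_dim vscale (U j)"
  by (rule finite_dim_coords[OF finite_index_set'[OF finite_G]])

lemma finite_dim_B: "finite_dim vscale (B j)"
  using v.finite_dim_subset[OF finite_dim_U B_subspace B_coords] .

lemmas B_zero = v.subspace_0[OF B_subspace]
lemmas B_add = v.subspace_add[OF B_subspace]
lemmas B_neg = v.subspace_neg[OF B_subspace]
lemmas B_diff = v.subspace_diff[OF B_subspace]

lemma koszul_scale:
  fixes a :: 'k
  shows "koszul (shifts n) (\<lambda>bs i. a * p bs i) bs = (\<lambda>i. a * koszul (shifts n) p bs i)"
proof -
  have "(\<lambda>u i. a * u i) (koszul (shifts n) p bs) = koszul (shifts n) (\<lambda>bs. (\<lambda>u i. a * u i) (p bs)) bs"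
    for p :: "bool list \<Rightarrow> idx \<Rightarrow> 'k"
    by (rule koszul_hom[where S = UNIV and h = "\<lambda>u i. a * u i"])
      (auto simp: list_all2_same set_shifts shift_scale algebra_simps plus_fun_def)
  then show ?thesis by simp
qed

lemma linear_koszul:
  "Vector_Spaces.linear (pw vscale) (pw vscale) (koszul (shifts n) :: (bool list \<Rightarrow> idx \<Rightarrow> 'k) \<Rightarrow> _)"
  by unfold_locales (auto simp: fun_eq_iff koszul_scale koszul_add[OF commuting_shifts])

lemma koszul_U: "q \<in> chains n (Suc i) (U (d - 1)) \<Longrightarrow> koszul (shifts n) q \<in> chains n i (U d)"
proof -
  assume q: "q \<in> chains n (Suc i) (U (d - 1))"
  have sh: "shift i u \<in> U d" if "i \<in> {1..n}" "u \<in> U (d - 1)" for i u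
    using coords_shift[OF that] by simp
  have "koszul (shifts n) q \<in> chains (length (shifts n :: ((idx \<Rightarrow> 'k) \<Rightarrow> _) list)) i (U d)"
    by (rule koszul_chains[where S = "U (d - 1)"])
      (use q sh in
        \<open>auto simp: set_shifts commuting_shifts intro: coords_zero coords_add coords_neg\<close>)
  then show ?thesis by simp
qed

lemma koszul_B: "(\<And>bs. p bs \<in> B d) \<Longrightarrow> koszul (shifts n) p bs \<in> B (d + 1)"
  by (rule koszul_mem[where S = "B d"]) (auto simp: set_shifts B_shift B_zero B_add B_neg)

lemma boundaries_subset: "boundaries i d \<subseteq> cycles i d"
proof
  fix p assume "p \<in> boundaries i d"
  then obtain q b where p: "p = koszul (shifts n) q + b"
    "q \<in> chains n (Suc i) (U (d - 1))" "b \<in> chains n i (B d)" by (auto simp: boundaries_def)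
  have "p \<in> chains n i (U d)"
    unfolding p(1)
    by (rule chains_add[OF _ koszul_U[OF p(2)] subsetD[OF chains_mono[OF B_coords] p(3)]]) (rule coords_add)
  moreover have "koszul (shifts n) p bs \<in> B (d + 1)" for bs
    using koszul_B[OF chainsD'[OF p(3) B_zero]] p(1)
    by (simp add: koszul_add[OF commuting_shifts] koszul_koszul[OF commuting_shifts])
  ultimately show "p \<in> cycles i d" by (simp add: cycles_def)
qed

lemma finite_dim_chains_U: "finite_dim (pw vscale) (chains n i (U d))"
  and dim_chains_U: "c.dim (chains n i (U d)) = (n choose i) * v.dim (U d)"
  using finite_dim_chains[OF vector_space_vscale finite_dim_U] by auto

lemma finite_dim_chains_B: "finite_dim (pw vscale) (chains n i (B d))"
  and dim_chains_B: "c.dim (chains n i (B d)) = (n choose i) * v.dim (B d)"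
  using finite_dim_chains[OF vector_space_vscale finite_dim_B] by auto

lemma subspace_cycles: "c.subspace (cycles i d)"
proof (rule c.subspaceI)
  note cU = c.finite_dim_subspace[OF finite_dim_chains_U[of i d]]
  show "0 \<in> cycles i d"
  proof -
    have "koszul (shifts n) (0 :: bool list \<Rightarrow> idx \<Rightarrow> 'k) bs = 0" for bs
      using koszul_zero[OF commuting_shifts, of n bs] by (simp add: zero_fun_def)
    then show ?thesis using c.subspace_0[OF cU] B_zero by (simp add: cycles_def)
  qed
  show "x + y \<in> cycles i d" if "x \<in> cycles i d" "y \<in> cycles i d" for x y
    using that c.subspace_add[OF cU] B_add by (simp add: cycles_def koszul_add[OF commuting_shifts])
  show "(\<lambda>bs i. a * x bs i) \<in> cycles i d" if "x \<in> cycles i d" for x a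
    using that c.subspace_scale[OF cU] v.subspace_scale[OF B_subspace] by (simp add: cycles_def koszul_scale)
qed

lemma finite_dim_cycles: "finite_dim (pw vscale) (cycles i d)"
  by (rule c.finite_dim_subset[OF finite_dim_chains_U subspace_cycles]) (auto simp: cycles_def)

lemma boundaries_eq: "boundaries i d = {x + y |x y. x \<in> koszul (shifts n) ` chains n (Suc i) (U (d - 1)) \<and> y \<in> chains n i (B d)}"
  by (auto simp: boundaries_def)

lemma finite_dim_boundaries: "finite_dim (pw vscale) (boundaries i d)"
  unfolding boundaries_eq
  by (intro c.finite_dim_sums cc.finite_dim_image[OF linear_koszul] finite_dim_chains_U finite_dim_chains_B)

end

text \<open>Lifts are chosen value by value; off the support the lift is 0, where
  \<open>R 0 0\<close> applies.\<close>

lemma chains_lift: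
  assumes f: "f \<in> chains r p S" and R: "\<And>u. u \<in> S \<Longrightarrow> u \<in> range f \<Longrightarrow> \<exists>w\<in>T. R w u" and R0: "R 0 0"
  shows "\<exists>g\<in>chains r p T. \<forall>bs. R (g bs) (f bs)"
proof -
  define g where "g bs = (if length bs = r \<and> count_list bs True = p then SOME w. w \<in> T \<and> R w (f bs) else 0)" for bs
  have g: "g bs \<in> T \<and> R (g bs) (f bs)" if "length bs = r" "count_list bs True = p" for bs
  proof -
    have "\<exists>w. w \<in> T \<and> R w (f bs)" using R[OF chainsD[OF f that]] by auto
    from someI_ex[OF this] show ?thesis using that by (simp add: g_def)
  qed
  have "g \<in> chains r p T" by (rule chainsI) (use g in \<open>auto simp: g_def\<close>)
  moreover have "R (g bs) (f bs)" for bs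
    using g[of bs] chainsD0[OF f, of bs] R0 by (cases "length bs = r \<and> count_list bs True = p") (auto simp: g_def)
  ultimately show ?thesis by blast
qed

lemma var_ops_shifts_rel:
  assumes "\<And>i x y. i \<in> {1..n} \<Longrightarrow> Q x y \<Longrightarrow> R (mulvar i x) (shift i y)"
  shows "list_all2 (\<lambda>x y. \<forall>u v. Q u v \<longrightarrow> R (x u) (y v)) (var_ops n) (shifts n)"
  using assms by (auto simp: var_ops_def shifts_def list_all2_map1 list_all2_map2 list_all2_same)

lemma (in abelian_group) additive_eq_iff:
  fixes f :: "'v::ab_group_add \<Rightarrow> 'a"
  assumes "f (x - y + y) = f (x - y) \<oplus> f y" "f (x - y) \<in> carrier G" "f y \<in> carrier G"
  shows "f (x - y) = \<zero> \<longleftrightarrow> f x = f y"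
  using assms by (simp add: add.l_cancel_one')

lemma lookup_map_scale: "Poly_Mapping.lookup (Poly_Mapping.map (\<lambda>a. c * a) v) i = c * Poly_Mapping.lookup v i"
  for c :: "'k::field" and v :: "nat \<Rightarrow>\<^sub>0 'k"
  by (auto simp: Poly_Mapping.map.rep_eq when_def)

lemma vector_space_poly_mapping: "vector_space (\<lambda>(c::'k::field) (v::nat \<Rightarrow>\<^sub>0 'k). Poly_Mapping.map (\<lambda>a. c * a) v)"
  by unfold_locales
    (rule poly_mapping_eqI, simp only: lookup_map_scale lookup_add, simp add: algebra_simps)+

subsection \<open>Reduction modulo the variables\<close>

definition lift_const :: "(nat \<Rightarrow>\<^sub>0 'k::field) \<Rightarrow> nat \<Rightarrow>\<^sub>0 'k mpoly" where
  "lift_const v = Poly_Mapping.map const v"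

lemma lookup_tensor_one: "Poly_Mapping.lookup (tensor_one f) b = coeff f (b, 0)"
  by (auto simp: tensor_one_def coeff_def Poly_Mapping.map.rep_eq when_def)

lemma coeff_lift_const: "coeff (lift_const v) (b, t) = (if t = 0 then Poly_Mapping.lookup v b else 0)"
proof -
  have "const (0::'a) = 0" by (simp add: const_def)
  then have "Poly_Mapping.lookup (lift_const v) b = const (Poly_Mapping.lookup v b)"
    by (auto simp: lift_const_def Poly_Mapping.map.rep_eq when_def)
  then show ?thesis by (auto simp: coeff_def const_def lookup_single when_def)
qed

lemma tensor_one_add: "tensor_one (f + g) = tensor_one f + tensor_one g"
  and tensor_one_diff: "tensor_one (f - g) = tensor_one f - tensor_one g"
  and tensor_one_zero: "tensor_one 0 = 0"
  by (auto intro!: poly_mapping_eqI simp: lookup_tensor_one lookup_add lookup_minus coeff_simps)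

lemma tensor_one_lift_const: "tensor_one (lift_const v) = v"
  by (rule poly_mapping_eqI) (simp add: lookup_tensor_one coeff_lift_const)

lemma tensor_map_eq: "tensor_map h v = tensor_one (h (lift_const v))"
  by (simp add: tensor_map_def lift_const_def)

lemma lift_const_grade: "v \<in> tensor_degree_part F i j \<Longrightarrow> lift_const v \<in> free_grade n (basis F i) (basis_degree F i) j"
  unfolding mem_free_grade tensor_degree_part_def basis_in_degree_def
  by (auto simp: coeff_lift_const index_set_def in_keys_iff split: if_splits)

lemma tensor_one_degree_part:
  assumes "f \<in> free_grade n (basis F i) (basis_degree F i) j"
  shows "tensor_one f \<in> tensor_degree_part F i j"
proof -
  have "b \<in> basis_in_degree F i j" if "coeff f (b, 0) \<noteq> 0" for b
  proof -
    have "(b, 0) \<in> index_set n (basis F i) (basis_degree F i) j"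
      using assms that unfolding mem_free_grade by blast
    then show ?thesis by (simp add: basis_in_degree_def index_set_def)
  qed
  then show ?thesis by (auto simp: tensor_degree_part_def in_keys_iff lookup_tensor_one)
qed

lemma lift_const_add: "lift_const (v + w) = lift_const v + lift_const w"
  by (rule coeff_eqI) (simp add: coeff_lift_const coeff_add lookup_add)

lemma lift_const_scale: "lift_const (Poly_Mapping.map (\<lambda>a. c * a) v) = scale_poly (const c) (lift_const v)"
  by (rule coeff_eqI) (simp add: coeff_lift_const coeff_scale_const lookup_map_scale)

lemma tensor_one_scale: "tensor_one (scale_poly (const c) f) = Poly_Mapping.map (\<lambda>a. c * a) (tensor_one f)"
  by (rule poly_mapping_eqI) (simp add: lookup_tensor_one coeff_scale_const lookup_map_scale)

lemma tensor_one_koszul_low: "tensor_one (koszul (var_ops n) c (low n)) = 0"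
  by (rule poly_mapping_eqI) (simp add: lookup_tensor_one koszul_low_coeff)

text \<open>The edge condition of the double complex in the Koszul direction: reduction modulo the
  variables is the augmentation there.\<close>

lemma tensor_one_eq_0_koszul:
  assumes "f \<in> free_grade n B d j" "tensor_one f = 0"
  shows "\<exists>c \<in> chains n 1 (free_grade n B d (j - 1)). koszul (var_ops n) c (low n) = f"
proof (rule koszul_low_surj[OF assms(1) order_refl])
  fix b and t :: "nat \<Rightarrow>\<^sub>0 nat" assume t: "Poly_Mapping.keys t \<inter> {1..n} = {}"
  show "coeff f (b, t) = 0"
  proof (rule ccontr)
    assume nz: "coeff f (b, t) \<noteq> 0"
    then have "Poly_Mapping.keys t = {}" using assms(1) t unfolding mem_free_grade index_set_def by blast
    then have "t = 0" by (simp add: keys_eq_empty)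
    then show False using nz assms(2) lookup_tensor_one[of f b] by simp
  qed
qed

lemma koszul_var_chains:
  assumes "c \<in> chains n (Suc p) (free_grade n B d j)"
  shows "koszul (var_ops n) c \<in> chains n p (free_grade n B d (j + 1))"
proof -
  have "koszul (var_ops n) c \<in> chains (length (var_ops n :: ((nat \<Rightarrow>\<^sub>0 'a mpoly) \<Rightarrow> _) list)) p (free_grade n B d (j + 1))"
    by (rule koszul_chains[where S = "free_grade n B d j"])
      (use assms in \<open>auto simp: set_var_ops commuting_var_ops
        intro: free_grade_zero free_grade_add free_grade_neg free_grade_mulvar\<close>)
  then show ?thesis by simp
qed

text \<open>The constant part of a homogeneous element is all that matters after applying a module
  homomorphism and reducing, since the rest lies in the submodule generated by the variables.\<close>

lemma tensor_one_hom:
  fixes h :: "(nat \<Rightarrow>\<^sub>0 ('a::field) mpoly) \<Rightarrow> nat \<Rightarrow>\<^sub>0 'a mpoly"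
  assumes h: "h \<in> graded_hom n (free_module n B d) (free_module n B' d')"
    and f: "f \<in> free_grade n B d j" and g: "g \<in> free_grade n B d j" and eq: "tensor_one f = tensor_one g"
  shows "tensor_one (h f) = tensor_one (h g)"
proof -
  have "f - g \<in> free_grade n B d j" "tensor_one (f - g) = 0"
    using free_grade_diff[OF f g] eq by (auto simp: tensor_one_diff)
  then obtain c where c: "c \<in> chains n 1 (free_grade n B d (j - 1))" "koszul (var_ops n) c (low n) = f - g"
    using tensor_one_eq_0_koszul by blast
  have cc: "c bs \<in> carrier (free_module n B d)" for bs
    using chainsD'[OF c(1) free_grade_zero] by (rule free_grade_carrier)
  have "h (koszul (var_ops n) c (low n)) = koszul (var_ops n) (\<lambda>bs. h (c bs)) (low n)"
  proof (rule koszul_hom[where S = "carrier (free_module n B d)"])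
    have "mulvar i u \<in> carrier (free_module n B d)" if "i \<in> {1..n}" "u \<in> carrier (free_module n B d)"
      for i and u :: "nat \<Rightarrow>\<^sub>0 'a mpoly"
      unfolding mem_free_carrier
    proof (intro allI impI)
      fix b t assume "coeff (mulvar i u) (b, t) \<noteq> 0"
      then have t: "Poly_Mapping.lookup t i > 0" "coeff u (b, t - unit_exp i) \<noteq> 0"
        by (auto simp: coeff_mulvar shift_def split: if_splits)
      then show "b \<in> B \<and> Poly_Mapping.keys t \<subseteq> {1..n}"
        using that keys_minus_unit_exp[OF t(1)] unfolding mem_free_carrier by auto
    qed
    then show "list_all2 (\<lambda>x y. \<forall>u. u \<in> carrier (free_module n B d) \<longrightarrow>
        x u \<in> carrier (free_module n B d) \<and> h (x u) = y (h u)) (var_ops n) (var_ops n)"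
      using graded_hom_free(4)[OF h] by (auto simp: list_all2_same set_var_ops)
  qed (use cc graded_hom_free(2)[OF h] in \<open>auto intro: free_carrier_zero free_carrier_add free_carrier_neg\<close>)
  then have "tensor_one (h (f - g)) = 0" using c(2) tensor_one_koszul_low by metis
  moreover have "h (f - g) = h f - h g"
    using graded_hom_free(7)[OF h] free_grade_carrier f g by blast
  ultimately show ?thesis by (simp add: tensor_one_diff)
qed

section \<open>Balancing Tor: a resolution against the Koszul complex\<close>

section \<open>Tor and Koszul homology\<close>

text \<open>Coordinates for the graded pieces of \<open>M\<close>, together with the facts that the
  comparison of Tor with Koszul homology uses. The assumption \<open>hom_component\<close> stands
  for uniqueness of homogeneous decompositions in \<open>M\<close>: an element of degree
  \<open>j\<close> in the image of a free module is already the image of a component of degree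
  \<open>j\<close>.\<close>

locale presentation =
  fixes n :: nat and M :: "('k::field mpoly, 'm) graded_module" and G :: "nat set" and dg :: "nat \<Rightarrow> int"
    and \<pi> :: "(idx \<Rightarrow> 'k) \<Rightarrow> 'm"
  assumes fin_G: "finite G"
    and abelian: "abelian_group M"
    and grade_carrier: "grade M j \<subseteq> carrier M"
    and pi_add: "u \<in> coords n G dg j \<Longrightarrow> v \<in> coords n G dg j \<Longrightarrow> \<pi> (u + v) = \<pi> u \<oplus>\<^bsub>M\<^esub> \<pi> v"
    and pi_scale: "u \<in> coords n G dg j \<Longrightarrow> \<pi> (\<lambda>i. c * u i) = const c \<odot>\<^bsub>M\<^esub> \<pi> u"
    and pi_shift: "i \<in> {1..n} \<Longrightarrow> u \<in> coords n G dg j \<Longrightarrow> \<pi> (shift i u) = var i \<odot>\<^bsub>M\<^esub> \<pi> u"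
    and pi_image: "\<pi> ` coords n G dg j = grade M j"
    and hom_component: "h \<in> graded_hom n (free_module n B d) M \<Longrightarrow> x \<in> carrier (free_module n B d) \<Longrightarrow>
      h x \<in> grade M j \<Longrightarrow> h (component d j x) = h x"
begin

sublocale M: abelian_group M by (rule abelian)

definition ker :: "int \<Rightarrow> (idx \<Rightarrow> 'k) set" where
  "ker j = {u \<in> coords n G dg j. \<pi> u = \<zero>\<^bsub>M\<^esub>}"

lemma pi_carrier: "u \<in> coords n G dg j \<Longrightarrow> \<pi> u \<in> carrier M"
  using pi_image grade_carrier by blast

lemma pi_zero: "\<pi> 0 = \<zero>\<^bsub>M\<^esub>"
  using pi_add[OF coords_zero(1) coords_zero(1)] pi_carrier[OF coords_zero(1)]
  by (simp add: M.add.l_cancel_one)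

lemma pi_diff: "u \<in> coords n G dg j \<Longrightarrow> v \<in> coords n G dg j \<Longrightarrow> \<pi> (u - v) = \<zero>\<^bsub>M\<^esub> \<longleftrightarrow> \<pi> u = \<pi> v"
proof -
  assume uv: "u \<in> coords n G dg j" "v \<in> coords n G dg j"
  show ?thesis
    by (rule M.additive_eq_iff[where f = \<pi> and x = u and y = v])
      (intro pi_add[OF coords_diff[OF uv] uv(2)] pi_carrier[OF coords_diff[OF uv]] pi_carrier[OF uv(2)])+
qed

lemma smult_zero: "const c \<odot>\<^bsub>M\<^esub> \<zero>\<^bsub>M\<^esub> = \<zero>\<^bsub>M\<^esub>" "i \<in> {1..n} \<Longrightarrow> var i \<odot>\<^bsub>M\<^esub> \<zero>\<^bsub>M\<^esub> = \<zero>\<^bsub>M\<^esub>"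
proof -
  show "const c \<odot>\<^bsub>M\<^esub> \<zero>\<^bsub>M\<^esub> = \<zero>\<^bsub>M\<^esub>"
    using pi_scale[OF coords_zero(1), of c] pi_zero by (simp add: zero_fun_def)
  have "shift i (0 :: idx \<Rightarrow> 'k) = 0" by (rule additive.zero[OF additive_shift])
  then show "var i \<odot>\<^bsub>M\<^esub> \<zero>\<^bsub>M\<^esub> = \<zero>\<^bsub>M\<^esub>" if "i \<in> {1..n}"
    using pi_shift[OF that coords_zero(1)] pi_zero by simp
qed

sublocale relations n G dg ker
proof unfold_locales
  show "finite G" by (rule fin_G)
  show "ker j \<subseteq> coords n G dg j" for j by (auto simp: ker_def)
  interpret v: vector_space vscale by (rule vector_space_vscale)
  show "v.subspace (ker j)" for j
  proof (rule v.subspaceI)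
    show "0 \<in> ker j" using pi_zero coords_zero(1) by (simp add: ker_def)
    show "x + y \<in> ker j" if "x \<in> ker j" "y \<in> ker j" for x y
      using that pi_add[of x j y] coords_add[of x n G dg j y] by (simp add: ker_def)
    show "(\<lambda>i. c * x i) \<in> ker j" if "x \<in> ker j" for c x
      using that pi_scale[of x j c] coords_scale[of x n G dg j c] smult_zero by (simp add: ker_def)
  qed
  show "shift i u \<in> ker (j + 1)" if "i \<in> {1..n}" "u \<in> ker j" for i u j
    using that pi_shift[of i u j] coords_shift[of i n u G dg j] smult_zero by (simp add: ker_def)
qed

lemma aug_hom:
  assumes "h \<in> graded_hom n (free_module n B d) M"
  shows "x \<in> carrier (free_module n B d) \<Longrightarrow> h x \<in> carrier M"
    and "x \<in> carrier (free_module n B d) \<Longrightarrow> y \<in> carrier (free_module n B d) \<Longrightarrow> h (x + y) = h x \<oplus>\<^bsub>M\<^esub> h y"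
    and "x \<in> free_grade n B d j \<Longrightarrow> h x \<in> grade M j"
    and "i \<in> {1..n} \<Longrightarrow> x \<in> carrier (free_module n B d) \<Longrightarrow> h (mulvar i x) = var i \<odot>\<^bsub>M\<^esub> h x"
    and "x \<in> carrier (free_module n B d) \<Longrightarrow> h (scale_poly (const c) x) = const c \<odot>\<^bsub>M\<^esub> h x"
    and "h 0 = \<zero>\<^bsub>M\<^esub>"
    and "x \<in> carrier (free_module n B d) \<Longrightarrow> y \<in> carrier (free_module n B d) \<Longrightarrow> h (x - y) = \<zero>\<^bsub>M\<^esub> \<longleftrightarrow> h x = h y"
proof -
  show carrier: "h x \<in> carrier M" if "x \<in> carrier (free_module n B d)" for x
    using assms that by (auto simp: graded_hom_def)
  show add: "h (x + y) = h x \<oplus>\<^bsub>M\<^esub> h y"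
    if "x \<in> carrier (free_module n B d)" "y \<in> carrier (free_module n B d)" for x y
    using assms that by (simp add: graded_hom_def)
  show "h 0 = \<zero>\<^bsub>M\<^esub>"
    using add[OF free_carrier_zero free_carrier_zero] carrier[OF free_carrier_zero] by (simp add: M.add.l_cancel_one)
  show "h (x - y) = \<zero>\<^bsub>M\<^esub> \<longleftrightarrow> h x = h y"
    if "x \<in> carrier (free_module n B d)" "y \<in> carrier (free_module n B d)"
    using add[OF free_carrier_diff[OF that] that(2)] carrier that free_carrier_diff by (intro M.additive_eq_iff) blast+
  show "h (mulvar i x) = var i \<odot>\<^bsub>M\<^esub> h x" if "i \<in> {1..n}" "x \<in> carrier (free_module n B d)"
  proof -
    have "(var i :: 'k mpoly) \<in> carrier (mpoly_ring n)" using that(1) by (auto simp: var_def mpoly_ring_def)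
    then show ?thesis using assms that(2) by (simp add: graded_hom_def mulvar_def)
  qed
  show "h (scale_poly (const c) x) = const c \<odot>\<^bsub>M\<^esub> h x" if "x \<in> carrier (free_module n B d)"
  proof -
    have "(const c :: 'k mpoly) \<in> carrier (mpoly_ring n)" by (auto simp: const_def mpoly_ring_def)
    then show ?thesis using assms that by (simp add: graded_hom_def)
  qed
  show "x \<in> free_grade n B d j \<Longrightarrow> h x \<in> grade M j"
    using assms by (auto simp: graded_hom_def image_subset_iff)
qed

end

text \<open>The double complex of a resolution and the Koszul complex in the fixed total degree
  \<open>j\<close>: exterior degree \<open>p\<close> lowers the degree of the coefficients to
  \<open>j - p\<close>. Both differentials then preserve the total degree.\<close>

locale resolved_presentation = presentation n M G dg \<pi>
  for n :: nat and M :: "('k::field mpoly, 'm) graded_module" and G dg \<pi> +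
  fixes F :: "('k, 'm) free_complex" and j :: int
  assumes res: "graded_free_resolution n M F"
begin

abbreviation Fg :: "nat \<Rightarrow> int \<Rightarrow> (nat \<Rightarrow>\<^sub>0 'k mpoly) set" where
  "Fg q \<equiv> free_grade n (basis F q) (basis_degree F q)"
abbreviation Fc :: "nat \<Rightarrow> (nat \<Rightarrow>\<^sub>0 'k mpoly) set" where
  "Fc q \<equiv> carrier (free_module n (basis F q) (basis_degree F q))"
abbreviation D :: "nat \<Rightarrow> nat \<Rightarrow> (bool list \<Rightarrow> nat \<Rightarrow>\<^sub>0 'k mpoly) set" where
  "D p q \<equiv> chains n p (Fg q (j - int p))"
abbreviation horiz :: "nat \<Rightarrow> nat \<Rightarrow> (bool list \<Rightarrow> nat \<Rightarrow>\<^sub>0 'k mpoly) \<Rightarrow> bool list \<Rightarrow> nat \<Rightarrow>\<^sub>0 'k mpoly" where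
  "horiz p q \<equiv> koszul (var_ops n)"
abbreviation vert :: "nat \<Rightarrow> nat \<Rightarrow> (bool list \<Rightarrow> nat \<Rightarrow>\<^sub>0 'k mpoly) \<Rightarrow> bool list \<Rightarrow> nat \<Rightarrow>\<^sub>0 'k mpoly" where
  "vert p q \<equiv> (\<lambda>c bs. differential F q (c bs))"
abbreviation \<epsilon> where "\<epsilon> \<equiv> augmentation F"

lemma dhom: "differential F q \<in> graded_hom n (free_module n (basis F (Suc q)) (basis_degree F (Suc q)))
    (free_module n (basis F q) (basis_degree F q))"
  using res by (simp add: graded_free_resolution_def term_module_def)

lemma ehom: "\<epsilon> \<in> graded_hom n (free_module n (basis F 0) (basis_degree F 0)) M"
  using res by (simp add: graded_free_resolution_def term_module_def)

lemmas d_carrier = graded_hom_free(1)[OF dhom]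
lemmas d_grade = graded_hom_free(3)[OF dhom]
lemmas d_zero = graded_hom_free(5)[OF dhom]
lemmas d_diff = graded_hom_free(7)[OF dhom]

lemma exact_0: "x \<in> Fc 0 \<Longrightarrow> \<epsilon> x = \<zero>\<^bsub>M\<^esub> \<longleftrightarrow> x \<in> differential F 0 ` Fc 1"
  using res unfolding graded_free_resolution_def term_module_def by blast

lemma exact_Suc: "x \<in> Fc (Suc q) \<Longrightarrow> differential F q x = 0 \<longleftrightarrow> x \<in> differential F (Suc q) ` Fc (Suc (Suc q))"
  using res unfolding graded_free_resolution_def term_module_def by blast

lemma eps_surj: "m \<in> grade M e \<Longrightarrow> \<exists>x\<in>Fg 0 e. \<epsilon> x = m"
proof -
  assume m: "m \<in> grade M e"
  have "\<epsilon> ` Fc 0 = carrier M" using res by (simp add: graded_free_resolution_def term_module_def)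
  then have "m \<in> \<epsilon> ` Fc 0" using m grade_carrier[of e] by auto
  then obtain x where x: "x \<in> Fc 0" "\<epsilon> x = m" by auto
  then have "\<epsilon> (component (basis_degree F 0) e x) = m" using hom_component[OF ehom x(1)] m by simp
  then show ?thesis using component_grade[OF x(1)] by blast
qed

lemma d_exact_grade: "x \<in> Fg (Suc q) e \<Longrightarrow> differential F q x = 0 \<Longrightarrow> \<exists>y\<in>Fg (Suc (Suc q)) e. differential F (Suc q) y = x"
  using graded_hom_free_lift[OF dhom] exact_Suc free_grade_carrier by metis

lemma eps_exact_grade: "x \<in> Fg 0 e \<Longrightarrow> \<epsilon> x = \<zero>\<^bsub>M\<^esub> \<Longrightarrow> \<exists>y\<in>Fg 1 e. differential F 0 y = x"
  using graded_hom_free_lift[OF dhom[of 0]] exact_0 free_grade_carrier by (metis One_nat_def)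

lemma d_koszul:
  assumes "c \<in> chains n p (Fg (Suc q) e)"
  shows "differential F q (koszul (var_ops n) c bs) = koszul (var_ops n) (\<lambda>bs. differential F q (c bs)) bs"
proof -
  have "koszul (var_ops n) (\<lambda>bs. differential F q (c bs)) bs = differential F q (koszul (var_ops n) c bs)
      \<and> koszul (var_ops n) c bs \<in> Fc (Suc q)"
  proof (rule koszul_rel[where Q = "\<lambda>x y. x \<in> Fg (Suc q) e \<and> y = differential F q x"
        and R = "\<lambda>x y. y = differential F q x \<and> x \<in> Fc (Suc q)"])
    show "list_all2 (\<lambda>x y. \<forall>u v. u \<in> Fg (Suc q) e \<and> v = differential F q u \<longrightarrow>
        y v = differential F q (x u) \<and> x u \<in> Fc (Suc q)) (var_ops n) (var_ops n)"
      using graded_hom_free(4)[OF dhom] free_grade_carrier free_grade_mulvar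
      by (fastforce simp: list_all2_same set_var_ops)
    show "c bs \<in> Fg (Suc q) e \<and> differential F q (c bs) = differential F q (c bs)" for bs
      using chainsD'[OF assms free_grade_zero] by simp
  qed (use graded_hom_free(2,6)[OF dhom] d_zero in \<open>auto intro: free_carrier_zero free_carrier_add free_carrier_neg\<close>)
  then show ?thesis by simp
qed

lemma D_koszul: "c \<in> D (Suc p) q \<Longrightarrow> koszul (var_ops n) c \<in> D p q"
  using koszul_var_chains[of c n p "basis F q" "basis_degree F q" "j - int (Suc p)"] by simp

lemma D_diff: "x \<in> D p q \<Longrightarrow> y \<in> D p q \<Longrightarrow> x - y \<in> D p q"
  by (rule chains_diff) (auto intro: free_grade_diff)

lemma D_vert: "c \<in> D p (Suc q) \<Longrightarrow> vert p q c \<in> D p q"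
  by (rule chains_map) (auto intro: d_grade d_zero)

lemma vert_diff: "x \<in> D p (Suc q) \<Longrightarrow> y \<in> D p (Suc q) \<Longrightarrow> vert p q (x - y) = vert p q x - vert p q y"
proof
  fix bs assume xy: "x \<in> D p (Suc q)" "y \<in> D p (Suc q)"
  have "x bs \<in> Fc (Suc q)" "y bs \<in> Fc (Suc q)"
    using chainsD'[OF xy(1) free_grade_zero] chainsD'[OF xy(2) free_grade_zero] free_grade_carrier by blast+
  then show "vert p q (x - y) bs = (vert p q x - vert p q y) bs" using d_diff by simp
qed

lemma koszul_vert: "c \<in> D p (Suc q) \<Longrightarrow> koszul (var_ops n) (vert p q c) = vert p' q (koszul (var_ops n) c)"
  using d_koszul by (auto simp: fun_eq_iff)

lemma d_d: "x \<in> Fc (Suc (Suc q)) \<Longrightarrow> differential F q (differential F (Suc q) x) = 0"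
  using exact_Suc[of "differential F (Suc q) x" q] d_carrier by blast

lemma eps_d: "x \<in> Fc 1 \<Longrightarrow> \<epsilon> (differential F 0 x) = \<zero>\<^bsub>M\<^esub>"
  using exact_0[of "differential F 0 x"] d_carrier[of x 0] by simp

text \<open>Exact because \<open>F\<close> is a resolution; the edge is the kernel of the
  augmentation.\<close>

sublocale rows: half_double_complex D horiz vert "\<lambda>p. {c. \<forall>bs. \<epsilon> (c bs) = \<zero>\<^bsub>M\<^esub>}"
proof unfold_locales
  show "koszul (var_ops n) (x - y) = koszul (var_ops n) x - koszul (var_ops n) y" for x y :: "bool list \<Rightarrow> nat \<Rightarrow>\<^sub>0 'k mpoly"
    using koszul_diff[OF commuting_var_ops] by (auto simp: fun_eq_iff)
  show "koszul (var_ops n) (koszul (var_ops n) x) = 0" for x :: "bool list \<Rightarrow> nat \<Rightarrow>\<^sub>0 'k mpoly"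
    using koszul_koszul[OF commuting_var_ops] by (auto simp: fun_eq_iff)
  show "\<exists>y\<in>D p (Suc (Suc q)). vert p (Suc q) y = x" if x: "x \<in> D p (Suc q)" "vert p q x = 0" for x p q
  proof -
    have "\<exists>g\<in>D p (Suc (Suc q)). \<forall>bs. differential F (Suc q) (g bs) = x bs"
      by (rule chains_lift[OF x(1)])
        (use d_exact_grade fun_cong[OF x(2)] d_zero in \<open>auto simp: zero_fun_def\<close>)
    then show ?thesis by (auto simp: fun_eq_iff)
  qed
  show "\<exists>y\<in>D p 1. vert p 0 y = x" if x: "x \<in> D p 0" "x \<in> {c. \<forall>bs. \<epsilon> (c bs) = \<zero>\<^bsub>M\<^esub>}" for x p
  proof -
    have "\<exists>g\<in>D p 1. \<forall>bs. differential F 0 (g bs) = x bs"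
      by (rule chains_lift[OF x(1)]) (use eps_exact_grade x(2) d_zero in auto)
    then show ?thesis by (auto simp: fun_eq_iff)
  qed
qed (rule D_koszul D_diff D_vert vert_diff koszul_vert koszul_vert[symmetric]; assumption)+

text \<open>The transposed complex, exact because the variables form a regular sequence on every
  free term. Its edge is exterior degree 0, where a chain is its value at \<open>low n\<close>, and
  the augmentation there is reduction modulo the variables.\<close>

sublocale cols: half_double_complex "\<lambda>p q. D q p" "\<lambda>p q. vert q p" "\<lambda>p q. horiz q p"
  "\<lambda>q. {c. tensor_one (c (low n)) = 0}"
proof unfold_locales
  show "koszul (var_ops n) (x - y) = koszul (var_ops n) x - koszul (var_ops n) y" for x y :: "bool list \<Rightarrow> nat \<Rightarrow>\<^sub>0 'k mpoly"
    using koszul_diff[OF commuting_var_ops] by (auto simp: fun_eq_iff)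
  show "vert q p (vert q (Suc p) x) = 0" if "x \<in> D q (Suc (Suc p))" for x p q
    using d_d free_grade_carrier[OF chainsD'[OF that free_grade_zero]] by (auto simp: fun_eq_iff)
  show "\<exists>y\<in>D (Suc (Suc q)) p. horiz (Suc q) p y = x" if x: "x \<in> D (Suc q) p" "horiz q p x = 0" for x p q
    using koszul_free_exact[OF x(1) order_refl] x(2) by (simp add: zero_fun_def algebra_simps)
  show "\<exists>y\<in>D 1 p. horiz 0 p y = x" if x: "x \<in> D 0 p" "x \<in> {c. tensor_one (c (low n)) = 0}" for x p
  proof -
    have "x (low n) \<in> Fg p j" using chainsD'[OF x(1) free_grade_zero] by simp
    then obtain c where c: "c \<in> chains n 1 (Fg p (j - 1))" "koszul (var_ops n) c (low n) = x (low n)"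
      using tensor_one_eq_0_koszul x(2) by blast
    then have "koszul (var_ops n) c \<in> chains n 0 (Fg p j)" using koszul_var_chains[of c n 0 "basis F p" "basis_degree F p" "j - 1"] by simp
    then have "koszul (var_ops n) c = x" using chains_0_eqI x(1) c(2) by blast
    then show ?thesis using c(1) by auto
  qed
qed (rule D_koszul D_diff D_vert vert_diff koszul_vert koszul_vert[symmetric]; assumption)+

end

lemma scale_poly_mulvar: "scale_poly p (mulvar i x) = mulvar i (scale_poly p x)"
  by (rule poly_mapping_eqI) (simp add: mulvar_def lookup_scale_poly mult.left_commute)

lemma koszul_var_scale: "koszul (var_ops n) (\<lambda>bs. scale_poly p (c bs)) bs = scale_poly p (koszul (var_ops n) c bs)"
  by (rule koszul_hom[where S = UNIV and h = "scale_poly p", symmetric])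
    (auto simp: list_all2_same set_var_ops scale_poly_mulvar scale_poly_add)

lemma free_grade_scale_const: "x \<in> free_grade n B d e \<Longrightarrow> scale_poly (const a) x \<in> free_grade n B d e"
  by (simp add: mem_free_grade coeff_scale_const)

lemma scale_poly_zero: "scale_poly p 0 = 0"
  by (rule poly_mapping_eqI) (simp add: lookup_scale_poly)

context resolved_presentation
begin

text \<open>\<open>koszul\<close> needs a group given by a type class, which the carrier of
  \<open>M\<close> is not. Hence no Koszul complex is formed on \<open>M\<close>: chains over the
  resolution and chains of coordinates are compared through the images of their values in
  \<open>M\<close>.\<close>

lemma eps_koszul:
  assumes c: "c \<in> chains n p (Fg 0 e)" and u: "u \<in> chains n p (U e)" and eq: "\<And>bs. \<epsilon> (c bs) = \<pi> (u bs)"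
  shows "\<epsilon> (koszul (var_ops n) c bs) = \<pi> (koszul (shifts n) u bs)"
proof -
  let ?Q = "\<lambda>e x y. x \<in> Fg 0 e \<and> y \<in> U e \<and> \<epsilon> x = \<pi> y"
  note e = aug_hom[OF ehom]
  have add: "?Q e (x + x') (y + y')" if "?Q e x y" "?Q e x' y'" for e x y x' y'
    using that e(2)[of x x'] pi_add[of y e y'] free_grade_carrier free_grade_add coords_add[of y n G dg e y'] by metis
  have zero: "?Q e 0 0" for e by (simp add: e(6) pi_zero free_grade_zero coords_zero(1))
  have neg: "?Q e (- x) (- y)" if "?Q e x y" for e x y
  proof -
    have "\<epsilon> (0 - x) = \<pi> (0 - y)"
    proof -
      have x: "x \<in> Fc 0" "0 - x \<in> Fc 0" and y: "y \<in> U e" "0 - y \<in> U e"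
        using that coords_neg[of y n G dg e] by (auto intro: free_grade_carrier free_carrier_neg)
      have "\<epsilon> (0 - x) \<oplus>\<^bsub>M\<^esub> \<epsilon> x = \<zero>\<^bsub>M\<^esub>" using e(2)[OF x(2,1)] e(6) by simp
      moreover have "\<pi> (0 - y) \<oplus>\<^bsub>M\<^esub> \<epsilon> x = \<zero>\<^bsub>M\<^esub>" using pi_add[OF y(2,1)] pi_zero that by simp
      ultimately show ?thesis using e(1)[OF x(1)] e(1)[OF x(2)] pi_carrier[OF y(2)]
        by (metis M.minus_equality)
    qed
    then show ?thesis using that free_grade_neg[of x] coords_neg[of y n G dg e] by simp
  qed
  have "?Q (e + 1) (koszul (var_ops n) c bs) (koszul (shifts n) u bs)"
  proof (rule koszul_rel[where Q = "?Q e" and R = "?Q (e + 1)"])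
    show "list_all2 (\<lambda>x y. \<forall>u v. ?Q e u v \<longrightarrow> ?Q (e + 1) (x u) (y v)) (var_ops n) (shifts n)"
    proof (rule var_ops_shifts_rel)
      fix i x y assume i: "i \<in> {1..n}" and q: "?Q e x y"
      then have x: "x \<in> Fg 0 e" and y: "y \<in> U e" by auto
      show "?Q (e + 1) (mulvar i x) (shift i y)"
        using e(4)[OF i free_grade_carrier[OF x]] pi_shift[OF i y] free_grade_mulvar[OF i x] coords_shift[OF i y] q
        by simp
    qed
    show "?Q e (c bs) (u bs)" for bs
      using chainsD'[OF c free_grade_zero] chainsD'[OF u coords_zero(1)] eq by simp
  qed (use add zero neg in blast)+
  then show ?thesis by simp
qed

text \<open>Reading the diagonal from its other end exchanges the roles of the two
  directions.\<close>

lemma zigzag_transpose: "cols.zigzag i (\<lambda>q. c (i - q)) \<longleftrightarrow> rows.zigzag i c"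
proof
  assume r: "rows.zigzag i c"
  then have r: "\<And>q. q \<le> i \<Longrightarrow> c q \<in> D (i - q) q" "\<And>q. q < i \<Longrightarrow> koszul (var_ops n) (c q) = vert 0 q (c (Suc q))"
    by (auto simp: rows.zigzag_def)
  show "cols.zigzag i (\<lambda>q. c (i - q))"
    unfolding cols.zigzag_def
  proof (intro conjI allI impI)
    fix q assume "q \<le> i"
    then show "c (i - q) \<in> D q (i - q)" using r(1)[of "i - q"] by simp
  next
    fix q assume "q < i"
    then have "Suc (i - Suc q) = i - q" by simp
    then show "vert q (i - Suc q) (c (i - q)) = horiz q (i - Suc q) (c (i - Suc q))"
      using r(2)[of "i - Suc q"] \<open>q < i\<close> by simp
  qed
next
  assume "cols.zigzag i (\<lambda>q. c (i - q))"
  then have r: "\<And>q. q \<le> i \<Longrightarrow> c (i - q) \<in> D q (i - q)"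
    "\<And>q. q < i \<Longrightarrow> vert 0 (i - Suc q) (c (i - q)) = koszul (var_ops n) (c (i - Suc q))"
    unfolding cols.zigzag_def by blast+
  show "rows.zigzag i c"
    unfolding rows.zigzag_def
  proof (intro conjI allI impI)
    fix q assume "q \<le> i"
    then show "c q \<in> D (i - q) q" using r(1)[of "i - q"] by simp
  next
    fix q assume "q < i"
    then have "i - Suc (i - Suc q) = q" "i - (i - Suc q) = Suc q" by simp_all
    then show "horiz (i - Suc q) q (c q) = vert (i - Suc q) q (c (Suc q))"
      using r(2)[of "i - Suc q"] \<open>q < i\<close> by simp
  qed
qed

lemma D_carrier: "c \<in> D p q \<Longrightarrow> c bs \<in> Fc q"
  using chainsD'[OF _ free_grade_zero] free_grade_carrier by blast

lemma zigzag_D: "rows.zigzag i c \<Longrightarrow> q \<le> i \<Longrightarrow> c q \<in> D (i - q) q"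
  unfolding rows.zigzag_def by blast

lemma zigzag_carrier: "rows.zigzag i c \<Longrightarrow> q \<le> i \<Longrightarrow> c q bs \<in> Fc q"
  by (rule D_carrier[OF zigzag_D])

lemma zigzag_koszul: "rows.zigzag i c \<Longrightarrow> q < i \<Longrightarrow> koszul (var_ops n) (c q) bs = differential F q (c (Suc q) bs)"
  unfolding rows.zigzag_def by metis

lemma zigzag_start: "rows.zigzag i c \<Longrightarrow> c 0 \<in> D i 0"
  using zigzag_D[of i c 0] by simp

lemma zigzag_end: "rows.zigzag i c \<Longrightarrow> c i \<in> D 0 i"
  using zigzag_D[of i c i] by simp

lemma zigzagI:
  assumes "\<And>q. q \<le> i \<Longrightarrow> c q \<in> D (i - q) q"
    and "\<And>q bs. q < i \<Longrightarrow> koszul (var_ops n) (c q) bs = differential F q (c (Suc q) bs)"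
  shows "rows.zigzag i c"
  unfolding rows.zigzag_def using assms by blast

lemma zigzag_zero: "rows.zigzag i (\<lambda>_ _. 0)"
  by (rule zigzagI) (rule chains_zero[OF free_grade_zero], simp add: d_zero koszul_zero[OF commuting_var_ops])

lemma zigzag_add:
  assumes "rows.zigzag i c" "rows.zigzag i c'"
  shows "rows.zigzag i (\<lambda>q. c q + c' q)"
proof (rule zigzagI)
  fix q assume "q \<le> i"
  then show "c q + c' q \<in> D (i - q) q"
    by (intro chains_add free_grade_add zigzag_D assms)
next
  fix q bs assume q: "q < i"
  have "c (Suc q) bs \<in> Fc (Suc q)" "c' (Suc q) bs \<in> Fc (Suc q)"
    using assms q by (auto intro: zigzag_carrier)
  then show "koszul (var_ops n) (c q + c' q) bs = differential F q ((c (Suc q) + c' (Suc q)) bs)"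
    using graded_hom_free(2)[OF dhom] zigzag_koszul[OF assms(1) q] zigzag_koszul[OF assms(2) q]
    by (simp add: koszul_add[OF commuting_var_ops])
qed

lemma zigzag_scale:
  assumes "rows.zigzag i c"
  shows "rows.zigzag i (\<lambda>q bs. scale_poly (const a) (c q bs))"
proof (rule zigzagI)
  fix q assume "q \<le> i"
  then show "(\<lambda>bs. scale_poly (const a) (c q bs)) \<in> D (i - q) q"
    by (rule chains_map[OF zigzag_D[OF assms]]) (auto intro: free_grade_scale_const scale_poly_zero)
next
  fix q bs assume q: "q < i"
  have "c (Suc q) bs \<in> Fc (Suc q)" using assms q by (auto intro: zigzag_carrier)
  moreover have "(const a :: 'k mpoly) \<in> carrier (mpoly_ring n)" by (auto simp: const_def mpoly_ring_def)
  ultimately have "differential F q (scale_poly (const a) (c (Suc q) bs)) = scale_poly (const a) (differential F q (c (Suc q) bs))"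
    using dhom[of q] by (simp add: graded_hom_def)
  then show "koszul (var_ops n) (\<lambda>bs. scale_poly (const a) (c q bs)) bs = differential F q (scale_poly (const a) (c (Suc q) bs))"
    by (simp add: koszul_var_scale zigzag_koszul[OF assms q])
qed

text \<open>A zigzag through the double complex leads from the Koszul cycle \<open>p\<close> to the Tor cycle \<open>v\<close>.\<close>

definition tor_koszul :: "nat \<Rightarrow> (nat \<Rightarrow>\<^sub>0 'k) \<Rightarrow> (bool list \<Rightarrow> idx \<Rightarrow> 'k) \<Rightarrow> bool" where
  "tor_koszul i v p \<longleftrightarrow> (\<exists>c. rows.zigzag i c \<and> p \<in> chains n i (U (j - int i)) \<and>
     (\<forall>bs. \<epsilon> (c 0 bs) = \<pi> (p bs)) \<and> v = tensor_one (c i (low n)))"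

lemma linear_relation_tor_koszul:
  "linear_relation (\<lambda>c v. Poly_Mapping.map (\<lambda>a. c * a) v) (pw vscale) (tor_koszul i)"
proof (intro linear_relation.intro vector_space_poly_mapping linear_relation_axioms.intro)
  show "vector_space (pw vscale :: 'k \<Rightarrow> (bool list \<Rightarrow> idx \<Rightarrow> 'k) \<Rightarrow> _)" by (rule c.vector_space_axioms)
  show "tor_koszul i 0 0"
    unfolding tor_koszul_def
    by (intro exI[of _ "\<lambda>_ _. 0"])
      (simp add: zigzag_zero aug_hom(6)[OF ehom] pi_zero chains_zero[OF coords_zero(1), folded zero_fun_def] tensor_one_zero)
next
  fix v p v' p' assume "tor_koszul i v p" "tor_koszul i v' p'"
  then obtain c c' where c: "rows.zigzag i c" "p \<in> chains n i (U (j - int i))"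
      "\<And>bs. \<epsilon> (c 0 bs) = \<pi> (p bs)" "v = tensor_one (c i (low n))"
    and c': "rows.zigzag i c'" "p' \<in> chains n i (U (j - int i))"
      "\<And>bs. \<epsilon> (c' 0 bs) = \<pi> (p' bs)" "v' = tensor_one (c' i (low n))"
    unfolding tor_koszul_def by blast
  have "c 0 bs \<in> Fc 0" "c' 0 bs \<in> Fc 0" for bs
    using c(1) c'(1) by (auto intro: zigzag_carrier)
  then have "\<epsilon> (c 0 bs + c' 0 bs) = \<pi> (p bs + p' bs)" for bs
    using aug_hom(2)[OF ehom] c(3) c'(3) pi_add[of "p bs" "j - int i" "p' bs"]
      chainsD'[OF c(2) coords_zero(1)] chainsD'[OF c'(2) coords_zero(1)] by simp
  then show "tor_koszul i (v + v') (p + p')"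
    unfolding tor_koszul_def using zigzag_add[OF c(1) c'(1)] c c' chains_add[OF coords_add c(2) c'(2)]
    by (intro exI[of _ "\<lambda>q. c q + c' q"]) (simp add: tensor_one_add)
next
  fix v p a assume "tor_koszul i v p"
  then obtain c where c: "rows.zigzag i c" "p \<in> chains n i (U (j - int i))"
      "\<And>bs. \<epsilon> (c 0 bs) = \<pi> (p bs)" "v = tensor_one (c i (low n))"
    unfolding tor_koszul_def by blast
  have "c 0 bs \<in> Fc 0" for bs using c(1) by (auto intro: zigzag_carrier)
  then have "\<epsilon> (scale_poly (const a) (c 0 bs)) = \<pi> (\<lambda>k. a * p bs k)" for bs
    using aug_hom(5)[OF ehom] c(3) pi_scale[of "p bs" "j - int i" a] chainsD'[OF c(2) coords_zero(1)] by simp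
  moreover have "(\<lambda>bs k. a * p bs k) \<in> chains n i (U (j - int i))"
    by (rule chains_map[OF c(2)]) (auto intro: coords_scale)
  ultimately show "tor_koszul i (Poly_Mapping.map (\<lambda>b. a * b) v) (\<lambda>bs k. a * p bs k)"
    unfolding tor_koszul_def using zigzag_scale[OF c(1), of a] c
    by (intro exI[of _ "\<lambda>q bs. scale_poly (const a) (c q bs)"]) (simp add: tensor_one_scale)
qed

lemma lift_pi: "c \<in> chains n p (Fg 0 e) \<Longrightarrow> \<exists>u\<in>chains n p (U e). \<forall>bs. \<epsilon> (c bs) = \<pi> (u bs)"
proof -
  assume c: "c \<in> chains n p (Fg 0 e)"
  have "\<exists>u\<in>chains n p (U e). \<forall>bs. (\<lambda>w x. \<epsilon> x = \<pi> w) (u bs) (c bs)"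
  proof (rule chains_lift[OF c])
    fix x assume "x \<in> Fg 0 e"
    then have "\<epsilon> x \<in> \<pi> ` U e" using aug_hom(3)[OF ehom] pi_image by blast
    then show "\<exists>w\<in>U e. \<epsilon> x = \<pi> w" by auto
  qed (simp add: pi_zero[unfolded zero_fun_def] aug_hom(6)[OF ehom])
  then show ?thesis by blast
qed

lemma lift_eps: "u \<in> chains n p (U e) \<Longrightarrow> \<exists>c\<in>chains n p (Fg 0 e). \<forall>bs. \<epsilon> (c bs) = \<pi> (u bs)"
proof -
  assume u: "u \<in> chains n p (U e)"
  have "\<exists>c\<in>chains n p (Fg 0 e). \<forall>bs. (\<lambda>x w. \<epsilon> x = \<pi> w) (c bs) (u bs)"
  proof (rule chains_lift[OF u])
    fix w assume "w \<in> U e"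
    then have "\<pi> w \<in> grade M e" using pi_image by blast
    then show "\<exists>c\<in>Fg 0 e. \<epsilon> c = \<pi> w" using eps_surj by blast
  qed (simp add: pi_zero[unfolded zero_fun_def] aug_hom(6)[OF ehom])
  then show ?thesis by blast
qed

text \<open>The zigzag starts at the Tor end, with constants in exterior degree 0, and is built in
  the transposed complex. Its other end passes to coordinates through the augmentation; the Koszul
  differential of that end comes from the next term of the resolution, so it vanishes in
  \<open>M\<close>.\<close>

lemma tor_cycles_total:
  assumes v: "v \<in> tor_cycles F i j"
  shows "\<exists>p\<in>cycles i (j - int i). tor_koszul i v p"
proof -
  have v': "v \<in> tensor_degree_part F i j" using v by (auto simp: tor_cycles_def split: nat.splits)
  let ?c = "at_low n (lift_const v)"
  have c0: "?c \<in> D 0 i" using at_low_chains[OF lift_const_grade[OF v', of n]] by simp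
  have "\<exists>c. cols.zigzag i c \<and> c 0 = ?c"
  proof (rule cols.zigzag_exists[OF c0])
    fix i' assume "i = Suc i'"
    then show "vert 0 i' ?c \<in> {c. tensor_one (c (low n)) = 0}"
      using v by (simp add: tor_cycles_def tensor_map_eq)
  qed
  then obtain c' where c': "cols.zigzag i c'" "c' 0 = ?c" by blast
  define c where "c q = c' (i - q)" for q
  have "cols.zigzag i (\<lambda>q. c (i - q))"
    using c'(1) unfolding cols.zigzag_def c_def by simp
  then have z: "rows.zigzag i c" by (simp add: zigzag_transpose)
  have ci: "c i = ?c" by (simp add: c_def c'(2))
  have cD: "c 0 \<in> chains n i (Fg 0 (j - int i))" using zigzag_start[OF z] .
  obtain p where p: "p \<in> chains n i (U (j - int i))" "\<And>bs. \<epsilon> (c 0 bs) = \<pi> (p bs)"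
    using lift_pi[OF cD] by blast
  have "\<epsilon> (koszul (var_ops n) (c 0) bs) = \<zero>\<^bsub>M\<^esub>" for bs
  proof (cases i)
    case 0
    then show ?thesis
      using koszul_chains_0[OF commuting_var_ops, of "c 0" n] cD aug_hom(6)[OF ehom] by simp
  next
    case (Suc i')
    then have "koszul (var_ops n) (c 0) bs = differential F 0 (c 1 bs)" "c 1 bs \<in> Fc 1"
      using zigzag_koszul[OF z, of 0] zigzag_carrier[OF z, of 1] by auto
    then show ?thesis using eps_d by simp
  qed
  then have "\<pi> (koszul (shifts n) p bs) = \<zero>\<^bsub>M\<^esub>" for bs
    using eps_koszul[OF cD p] by simp
  moreover have "koszul (shifts n) p bs \<in> U (j - int i + 1)" for bs
    by (rule koszul_mem[where S = "U (j - int i)"])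
      (use chainsD'[OF p(1) coords_zero(1)] in \<open>auto simp: set_shifts coords_shift intro: coords_zero coords_add coords_neg\<close>)
  ultimately have "p \<in> cycles i (j - int i)" using p(1) by (simp add: cycles_def ker_def)
  moreover have "tor_koszul i v p"
    unfolding tor_koszul_def using z p ci by (intro exI[of _ c]) (simp add: tensor_one_lift_const)
  ultimately show ?thesis by blast
qed

text \<open>The same path in the opposite direction. The end of the zigzag reduces to a Tor cycle
  because its differential is a Koszul boundary and therefore has no constant terms.\<close>

lemma cycles_total:
  assumes p: "p \<in> cycles i (j - int i)"
  shows "\<exists>v\<in>tor_cycles F i j. tor_koszul i v p"
proof -
  have pU: "p \<in> chains n i (U (j - int i))" and k: "\<And>bs. \<pi> (koszul (shifts n) p bs) = \<zero>\<^bsub>M\<^esub>"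
    using p by (auto simp: cycles_def ker_def)
  obtain c0 where c0: "c0 \<in> D i 0" "\<And>bs. \<epsilon> (c0 bs) = \<pi> (p bs)" using lift_eps[OF pU] by blast
  have "\<exists>c. rows.zigzag i c \<and> c 0 = c0"
    by (rule rows.zigzag_exists[OF c0(1)]) (use eps_koszul[OF c0(1) pU c0(2)] k in simp)
  then obtain c where c: "rows.zigzag i c" "c 0 = c0" by blast
  have ci: "c i (low n) \<in> Fg i j"
    using chainsD'[OF zigzag_end[OF c(1)] free_grade_zero] by simp
  let ?v = "tensor_one (c i (low n))"
  have vd: "?v \<in> tensor_degree_part F i j" using tensor_one_degree_part[OF ci] .
  have "?v \<in> tor_cycles F i j"
  proof (cases i)
    case 0
    then show ?thesis using vd by (simp add: tor_cycles_def)
  next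
    case (Suc i')
    have "tensor_map (differential F i') ?v = tensor_one (differential F i' (c i (low n)))"
      unfolding tensor_map_eq
      by (rule tensor_one_hom[OF dhom]) (use ci lift_const_grade[OF vd, of n] Suc in \<open>simp_all add: tensor_one_lift_const\<close>)
    also have "differential F i' (c i (low n)) = koszul (var_ops n) (c i') (low n)"
      using zigzag_koszul[OF c(1), of i'] Suc by simp
    finally show ?thesis using vd Suc by (simp add: tor_cycles_def tensor_one_koszul_low)
  qed
  moreover have "tor_koszul i ?v p"
    unfolding tor_koszul_def using c c0(2) pU by blast
  ultimately show ?thesis by blast
qed

text \<open>Each implication is \<open>zigzag_boundary\<close> in one of the two directions. It
  leaves two terms; one shows the claim, and the other disappears: a Koszul boundary on reduction
  modulo the variables, a differential of the resolution on mapping to \<open>M\<close>.\<close>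

lemma tor_koszul_boundary:
  assumes r: "tor_koszul i v p"
  shows "v \<in> tor_boundaries F i j \<longleftrightarrow> p \<in> boundaries i (j - int i)"
proof -
  obtain c where c: "rows.zigzag i c" "p \<in> chains n i (U (j - int i))"
      "\<And>bs. \<epsilon> (c 0 bs) = \<pi> (p bs)" "v = tensor_one (c i (low n))"
    using r unfolding tor_koszul_def by blast
  note c0 = zigzag_start[OF c(1)] and ci = zigzag_end[OF c(1)]
  have ciF: "c i (low n) \<in> Fg i j" using chainsD'[OF ci free_grade_zero] by simp
  have e: "\<And>c :: bool list \<Rightarrow> _. c \<in> D (Suc i) 0 \<Longrightarrow> koszul (var_ops n) c \<in> D i 0" using D_koszul by blast
  show ?thesis
  proof
    assume "p \<in> boundaries i (j - int i)"
    then obtain q b where q: "p = koszul (shifts n) q + b" "q \<in> chains n (Suc i) (U (j - int i - 1))"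
      "b \<in> chains n i (ker (j - int i))" by (auto simp: boundaries_def)
    have "j - int i - 1 = j - int (Suc i)" by simp
    then obtain c' where c': "c' \<in> D (Suc i) 0" "\<And>bs. \<epsilon> (c' bs) = \<pi> (q bs)"
      using lift_eps[OF q(2)] by metis
    have q2: "q \<in> chains n (Suc i) (U (j - int (Suc i)))" using q(2) by (simp add: algebra_simps)
    have "\<epsilon> ((c 0 - koszul (var_ops n) c') bs) = \<zero>\<^bsub>M\<^esub>" for bs
    proof -
      have kU: "koszul (shifts n) q bs \<in> U (j - int i)"
        using chainsD'[OF koszul_U[OF q(2)] coords_zero(1)] .
      have bU: "b bs \<in> U (j - int i)" "\<pi> (b bs) = \<zero>\<^bsub>M\<^esub>" using chainsD'[OF q(3) B_zero] by (auto simp: ker_def)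
      have "\<pi> (p bs) = \<pi> (koszul (shifts n) q bs)" using q(1) pi_add[OF kU bU(1)] bU(2) pi_carrier[OF kU] by simp
      then have "\<epsilon> (c 0 bs) = \<epsilon> (koszul (var_ops n) c' bs)"
        using c(3) eps_koszul[OF c'(1) q2 c'(2)] by simp
      then show ?thesis
        using aug_hom(7)[OF ehom D_carrier[OF c0] D_carrier[OF e[OF c'(1)]], of bs bs] by simp
    qed
    then obtain u w where uw: "u \<in> D 1 i" "w \<in> D 0 (Suc i)" "c i = koszul (var_ops n) u + vert 0 i w"
      using rows.zigzag_boundary[OF c(1) c'(1)] by auto
    have wF: "w (low n) \<in> Fg (Suc i) j" using chainsD'[OF uw(2) free_grade_zero] by simp
    have "v = tensor_one (differential F i (w (low n)))"
      using c(4) uw(3) by (simp add: tensor_one_add tensor_one_koszul_low)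
    also have "\<dots> = tensor_map (differential F i) (tensor_one (w (low n)))"
      unfolding tensor_map_eq
      by (rule tensor_one_hom[OF dhom wF])
        (simp_all add: lift_const_grade[OF tensor_one_degree_part[OF wF]] tensor_one_lift_const)
    finally show "v \<in> tor_boundaries F i j"
      unfolding tor_boundaries_def using tensor_one_degree_part[OF wF] by blast
  next
    assume "v \<in> tor_boundaries F i j"
    then obtain v' where v': "v' \<in> tensor_degree_part F (Suc i) j" "v = tensor_map (differential F i) v'"
      by (auto simp: tor_boundaries_def)
    let ?w = "at_low n (lift_const v')"
    have w: "?w \<in> D 0 (Suc i)" using at_low_chains[OF lift_const_grade[OF v'(1), of n]] by simp
    have z: "cols.zigzag i (\<lambda>q. c (i - q))" using c(1) zigzag_transpose by blast
    have "tensor_one ((c i - vert 0 i ?w) (low n)) = 0"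
      using c(4) v'(2) by (simp add: tensor_one_diff tensor_map_eq)
    then have "\<exists>u\<in>D i 1. \<exists>w\<in>D (Suc i) 0. c (i - i) = vert i 0 u + horiz i 0 w"
      using cols.zigzag_boundary[OF z w] by simp
    then obtain u w' where u: "u \<in> D i 1" "w' \<in> D (Suc i) 0" "c 0 = vert i 0 u + koszul (var_ops n) w'"
      by auto
    obtain q where q: "q \<in> chains n (Suc i) (U (j - int (Suc i)))" "\<And>bs. \<epsilon> (w' bs) = \<pi> (q bs)"
      using lift_pi[OF u(2)] by blast
    have q2: "q \<in> chains n (Suc i) (U (j - int i - 1))" using q(1) by (simp add: algebra_simps)
    define b where "b = p - koszul (shifts n) q"
    have bU: "b \<in> chains n i (U (j - int i))"
      unfolding b_def using chains_diff[OF _ c(2) koszul_U[OF q2]] coords_diff[of _ n G dg] by blast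
    have "b bs \<in> ker (j - int i)" for bs
    proof -
      have kU: "koszul (shifts n) q bs \<in> U (j - int i)"
        using chainsD'[OF koszul_U[OF q2] coords_zero(1)] .
      have uC: "u bs \<in> Fc 1" using D_carrier[OF u(1)] .
      then have du: "differential F 0 (u bs) \<in> Fc 0" using d_carrier[of "u bs" 0] by simp
      have kw: "koszul (var_ops n) w' bs \<in> Fc 0" using D_carrier[OF e[OF u(2)]] .
      have "\<epsilon> (c 0 bs) = \<epsilon> (koszul (var_ops n) w' bs)"
        using u(3) aug_hom(2)[OF ehom du kw] eps_d[OF uC] aug_hom(1)[OF ehom kw] by simp
      then have "\<pi> (p bs) = \<pi> (koszul (shifts n) q bs)"
        using c(3) eps_koszul[OF u(2) q] by simp
      then have "\<pi> (b bs) = \<zero>\<^bsub>M\<^esub>"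
        unfolding b_def using pi_diff[OF chainsD'[OF c(2) coords_zero(1)] kU] by simp
      then show ?thesis using chainsD'[OF bU coords_zero(1)] by (simp add: ker_def)
    qed
    then have "b \<in> chains n i (ker (j - int i))" by (rule chains_change[OF bU])
    moreover have "p = koszul (shifts n) q + b" by (simp add: b_def)
    ultimately show "p \<in> boundaries i (j - int i)" unfolding boundaries_def using q2 by blast
  qed
qed

lemma tensor_map_add:
  assumes "v \<in> tensor_degree_part F (Suc i) j" "w \<in> tensor_degree_part F (Suc i) j"
  shows "tensor_map (differential F i) (v + w) = tensor_map (differential F i) v + tensor_map (differential F i) w"
  using graded_hom_free(2)[OF dhom free_grade_carrier[OF lift_const_grade[OF assms(1)]]
      free_grade_carrier[OF lift_const_grade[OF assms(2)]]]
  by (simp add: tensor_map_eq lift_const_add tensor_one_add)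

lemma tensor_map_scale:
  assumes "v \<in> tensor_degree_part F (Suc i) j"
  shows "tensor_map (differential F i) (Poly_Mapping.map (\<lambda>b. a * b) v)
    = Poly_Mapping.map (\<lambda>b. a * b) (tensor_map (differential F i) v)"
proof -
  have "(const a :: 'k mpoly) \<in> carrier (mpoly_ring n)" by (auto simp: const_def mpoly_ring_def)
  then have "differential F i (scale_poly (const a) (lift_const v)) = scale_poly (const a) (differential F i (lift_const v))"
    using dhom[of i] free_grade_carrier[OF lift_const_grade[OF assms]] by (simp add: graded_hom_def)
  then show ?thesis by (simp add: tensor_map_eq lift_const_scale tensor_one_scale)
qed

interpretation t: vector_space "\<lambda>(c::'k) (v::nat \<Rightarrow>\<^sub>0 'k). Poly_Mapping.map (\<lambda>a. c * a) v"
  by (rule vector_space_poly_mapping)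

lemma finite_dim_tensor_part: "finite_dim (\<lambda>c v. Poly_Mapping.map (\<lambda>a. c * a) v) (tensor_degree_part F i j)"
  unfolding finite_dim_def
proof
  have fin: "finite (basis_in_degree F i j)" using res by (simp add: graded_free_resolution_def)
  show "t.subspace (tensor_degree_part F i j)"
  proof (rule t.subspaceI)
    show "x + y \<in> tensor_degree_part F i j" if "x \<in> tensor_degree_part F i j" "y \<in> tensor_degree_part F i j" for x y
      using that Poly_Mapping.keys_add[of x y] by (auto simp: tensor_degree_part_def)
  qed (auto simp: tensor_degree_part_def in_keys_iff lookup_map_scale)
  let ?S = "(\<lambda>b. Poly_Mapping.single b 1) ` basis_in_degree F i j"
  have "v \<in> t.span ?S" if "v \<in> tensor_degree_part F i j" for v :: "nat \<Rightarrow>\<^sub>0 'k"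
  proof -
    have "v = (\<Sum>b\<in>basis_in_degree F i j. Poly_Mapping.map (\<lambda>a. Poly_Mapping.lookup v b * a) (Poly_Mapping.single b 1))"
    proof (rule poly_mapping_eqI)
      fix b
      have "(\<Sum>b'\<in>basis_in_degree F i j. Poly_Mapping.lookup v b' * Poly_Mapping.lookup (Poly_Mapping.single b' 1) b)
          = (\<Sum>b'\<in>basis_in_degree F i j. if b' = b then Poly_Mapping.lookup v b else 0)"
        by (intro sum.cong) (auto simp: lookup_single when_def)
      also have "\<dots> = Poly_Mapping.lookup v b"
        using fin that by (auto simp: tensor_degree_part_def in_keys_iff)
      finally show "Poly_Mapping.lookup v b = Poly_Mapping.lookup
          (\<Sum>b\<in>basis_in_degree F i j. Poly_Mapping.map (\<lambda>a. Poly_Mapping.lookup v b * a) (Poly_Mapping.single b 1)) b"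
        by (simp only: lookup_sum lookup_map_scale)
    qed
    also have "\<dots> \<in> t.span ?S" by (intro t.span_sum t.span_scale t.span_base) auto
    finally show ?thesis .
  qed
  then show "\<exists>S. finite S \<and> tensor_degree_part F i j \<subseteq> t.span S" using fin by (intro exI[of _ ?S]) auto
qed

lemma subspace_tor_cycles: "t.subspace (tor_cycles F i j)"
proof (cases i)
  case 0
  then show ?thesis using t.finite_dim_subspace[OF finite_dim_tensor_part[of 0]] by (simp add: tor_cycles_def)
next
  case (Suc i')
  note sp = t.finite_dim_subspace[OF finite_dim_tensor_part[of "Suc i'"]]
  have "tensor_map (differential F i') 0 = 0"
    using tensor_map_add[OF t.subspace_0[OF sp] t.subspace_0[OF sp]] by (metis add.right_neutral add_left_cancel)
  then show ?thesis
    using Suc t.subspace_0[OF sp] t.subspace_add[OF sp] t.subspace_scale[OF sp]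
    by (intro t.subspaceI) (auto simp: tor_cycles_def tensor_map_add tensor_map_scale t.scale_zero_right)
qed

lemma subspace_tor_boundaries: "t.subspace (tor_boundaries F i j)"
proof (rule t.subspaceI)
  note sp = t.finite_dim_subspace[OF finite_dim_tensor_part[of "Suc i"]]
  have "tensor_map (differential F i) 0 = 0"
    using tensor_map_add[OF t.subspace_0[OF sp] t.subspace_0[OF sp]] by (metis add.right_neutral add_left_cancel)
  then show "0 \<in> tor_boundaries F i j" unfolding tor_boundaries_def using t.subspace_0[OF sp] by force
  show "x + y \<in> tor_boundaries F i j" if xy: "x \<in> tor_boundaries F i j" "y \<in> tor_boundaries F i j" for x y
  proof -
    obtain v w where v: "v \<in> tensor_degree_part F (Suc i) j" "x = tensor_map (differential F i) v"
      and w: "w \<in> tensor_degree_part F (Suc i) j" "y = tensor_map (differential F i) w"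
      using xy unfolding tor_boundaries_def by blast
    then show ?thesis
      using t.subspace_add[OF sp v(1) w(1)] tensor_map_add[OF v(1) w(1)] unfolding tor_boundaries_def by force
  qed
  show "Poly_Mapping.map (\<lambda>b. a * b) x \<in> tor_boundaries F i j" if x: "x \<in> tor_boundaries F i j" for a x
  proof -
    obtain v where v: "v \<in> tensor_degree_part F (Suc i) j" "x = tensor_map (differential F i) v"
      using x unfolding tor_boundaries_def by blast
    then show ?thesis
      using t.subspace_scale[OF sp v(1), of a] tensor_map_scale[OF v(1), of a] unfolding tor_boundaries_def by force
  qed
qed

lemma tor_boundaries_subset: "tor_boundaries F i j \<subseteq> tor_cycles F i j"
proof
  fix v assume "v \<in> tor_boundaries F i j"
  then obtain v' where v': "v' \<in> tensor_degree_part F (Suc i) j" "v = tensor_map (differential F i) v'"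
    by (auto simp: tor_boundaries_def)
  have l: "lift_const v' \<in> Fg (Suc i) j" using lift_const_grade[OF v'(1)] .
  have dl: "differential F i (lift_const v') \<in> Fg i j" using d_grade[OF l] .
  have vp: "v \<in> tensor_degree_part F i j" unfolding v'(2) tensor_map_eq using tensor_one_degree_part[OF dl] .
  show "v \<in> tor_cycles F i j"
  proof (cases i)
    case 0
    then show ?thesis using vp by (simp add: tor_cycles_def)
  next
    case (Suc i')
    have "tensor_map (differential F i') v = tensor_one (differential F i' (differential F i (lift_const v')))"
      unfolding tensor_map_eq
      by (rule tensor_one_hom[OF dhom])
        (use lift_const_grade[OF vp, of n] dl v'(2) Suc in \<open>simp_all add: tensor_map_eq tensor_one_lift_const\<close>)
    also have "\<dots> = 0" using d_d[OF free_grade_carrier, of "lift_const v'" i'] l Suc tensor_one_zero by simp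
    finally show ?thesis using vp Suc by (simp add: tor_cycles_def)
  qed
qed

text \<open>The right side does not mention \<open>F\<close>, so all resolutions of \<open>M\<close>
  give the same numbers; this justifies the arbitrary choice made in \<open>betti\<close>.\<close>

theorem tor_dim_eq_koszul: "tor_dim F i j = koszul_betti i (j - int i)"
proof -
  have sub: "tor_cycles F i j \<subseteq> tensor_degree_part F i j" by (auto simp: tor_cycles_def split: nat.splits)
  have fdc: "finite_dim (\<lambda>c v. Poly_Mapping.map (\<lambda>a. c * a) v) (tor_cycles F i j)"
    using t.finite_dim_subset[OF finite_dim_tensor_part subspace_tor_cycles sub] .
  have "t.dim (tor_cycles F i j) + c.dim (boundaries i (j - int i))
      = c.dim (cycles i (j - int i)) + t.dim (tor_boundaries F i j)"
    by (rule subquotient_dim_eq[OF linear_relation_tor_koszul fdc subspace_tor_boundaries tor_boundaries_subset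
          finite_dim_cycles c.finite_dim_subspace[OF finite_dim_boundaries] boundaries_subset])
      (use tor_cycles_total cycles_total tor_koszul_boundary in blast)+
  moreover have "t.dim (tor_boundaries F i j) \<le> t.dim (tor_cycles F i j)"
    by (rule t.dim_subset_le[OF fdc tor_boundaries_subset])
  ultimately show ?thesis unfolding tor_dim_def kdim_def koszul_betti_def by linarith
qed

end

section \<open>Graded free resolutions by successive covers\<close>

section \<open>Existence of resolutions\<close>

lemma scale_poly_grade:
  assumes p: "p \<in> homogeneous n e" and x: "x \<in> free_grade n B d j"
  shows "scale_poly p x \<in> free_grade n B d (e + j)"
  unfolding mem_free_grade
proof (intro allI impI)
  fix b t assume "coeff (scale_poly p x) (b, t) \<noteq> 0"
  then have "t \<in> Poly_Mapping.keys (p * Poly_Mapping.lookup x b)"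
    by (simp add: coeff_def lookup_scale_poly in_keys_iff)
  then obtain t1 t2 where t: "t = t1 + t2" "t1 \<in> Poly_Mapping.keys p" "t2 \<in> Poly_Mapping.keys (Poly_Mapping.lookup x b)"
    using keys_mult[of p "Poly_Mapping.lookup x b"] by blast
  have "(b, t2) \<in> index_set n B d j" using x t(3) unfolding mem_free_grade keys_lookup_iff by blast
  moreover have "Poly_Mapping.keys t1 \<subseteq> {1..n}" "int (monomial_degree t1) = e"
    using p t(2) by (auto simp: homogeneous_def mpoly_ring_def)
  moreover have "Poly_Mapping.keys t \<subseteq> Poly_Mapping.keys t1 \<union> Poly_Mapping.keys t2"
    using t(1) Poly_Mapping.keys_add[of t1 t2] by simp
  ultimately show "(b, t) \<in> index_set n B d (e + j)"
    using t(1) unfolding index_set_def by (auto simp: monomial_degree_add)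
qed

lemma scale_poly_carrier:
  assumes p: "p \<in> carrier (mpoly_ring n)" and x: "x \<in> carrier (free_module n B d)"
  shows "scale_poly p x \<in> carrier (free_module n B d)"
  unfolding mem_free_carrier
proof (intro allI impI)
  fix b t assume "coeff (scale_poly p x) (b, t) \<noteq> 0"
  then have "t \<in> Poly_Mapping.keys (p * Poly_Mapping.lookup x b)"
    by (simp add: coeff_def lookup_scale_poly in_keys_iff)
  then obtain t1 t2 where t: "t = t1 + t2" "t1 \<in> Poly_Mapping.keys p" "t2 \<in> Poly_Mapping.keys (Poly_Mapping.lookup x b)"
    using keys_mult[of p "Poly_Mapping.lookup x b"] by blast
  have "b \<in> B \<and> Poly_Mapping.keys t2 \<subseteq> {1..n}" using x t(3) unfolding mem_free_carrier keys_lookup_iff by blast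
  moreover have "Poly_Mapping.keys t1 \<subseteq> {1..n}"
    using p t(2) by (auto simp: mpoly_ring_def)
  moreover have "Poly_Mapping.keys t \<subseteq> Poly_Mapping.keys t1 \<union> Poly_Mapping.keys t2"
    using t(1) Poly_Mapping.keys_add[of t1 t2] by simp
  ultimately show "b \<in> B \<and> Poly_Mapping.keys t \<subseteq> {1..n}" by blast
qed

lemma const_carrier: "const c \<in> carrier (mpoly_ring n)"
  by (auto simp: const_def mpoly_ring_def)

abbreviation (input) kscale :: "'k::field \<Rightarrow> (nat \<Rightarrow>\<^sub>0 'k mpoly) \<Rightarrow> nat \<Rightarrow>\<^sub>0 'k mpoly" where
  "kscale \<equiv> \<lambda>c. scale_poly (const c)"

lemma vector_space_kscale: "vector_space kscale"
  by unfold_locales (rule coeff_eqI, simp add: coeff_scale_const coeff_add algebra_simps)+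

lemma free_grade_finite_span:
  assumes fin: "finite (index_set n B d j)"
  shows "\<exists>S :: (nat \<Rightarrow>\<^sub>0 ('k::field) mpoly) set. finite S \<and> free_grade n B d j \<subseteq> module.span kscale S"
proof -
  interpret v: vector_space "kscale :: 'k \<Rightarrow> _" by (rule vector_space_kscale)
  define e :: "idx \<Rightarrow> nat \<Rightarrow>\<^sub>0 'k mpoly" where "e i = of_coeff (\<lambda>i'. if i' = i then 1 else 0)" for i
  have e: "coeff (e i) i' = (if i' = i then 1 else 0)" for i i'
  proof -
    have "finite {i'. (if i' = i then 1 else (0::'k)) \<noteq> 0}"
      by (rule finite_subset[of _ "{i}"]) auto
    from coeff_of_coeff[OF this] show ?thesis by (simp add: e_def)
  qed
  have "f \<in> v.span (e ` index_set n B d j)" if "f \<in> free_grade n B d j" for f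
  proof -
    have "f = (\<Sum>i\<in>index_set n B d j. kscale (coeff f i) (e i))"
    proof (rule coeff_eqI)
      fix b t
      have "(\<Sum>i\<in>index_set n B d j. coeff f i * coeff (e i) (b, t))
          = (\<Sum>i\<in>index_set n B d j. if i = (b, t) then coeff f i else 0)"
        by (intro sum.cong) (auto simp: e)
      also have "\<dots> = coeff f (b, t)" using fin that[unfolded mem_free_grade] by auto
      finally show "coeff f (b, t) = coeff (\<Sum>i\<in>index_set n B d j. kscale (coeff f i) (e i)) (b, t)"
        by (simp add: coeff_sum coeff_scale_const)
    qed
    also have "\<dots> \<in> v.span (e ` index_set n B d j)"
      by (intro v.span_sum v.span_scale v.span_base) auto
    finally show ?thesis .
  qed
  then show ?thesis using fin by (intro exI[of _ "e ` index_set n B d j"]) auto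
qed

text \<open>The lower bound is what keeps each graded piece finite-dimensional when the basis is
  infinite: without it infinitely many basis elements could contribute to one degree.\<close>

definition tame_basis :: "nat set \<Rightarrow> (nat \<Rightarrow> int) \<Rightarrow> bool" where
  "tame_basis B d \<longleftrightarrow> (\<forall>j. finite {b \<in> B. d b = j}) \<and> (\<exists>j0. \<forall>b\<in>B. j0 \<le> d b)"

definition graded_submodule :: "nat \<Rightarrow> nat set \<Rightarrow> (nat \<Rightarrow> int) \<Rightarrow> (nat \<Rightarrow>\<^sub>0 ('k::field) mpoly) set \<Rightarrow> bool" where
  "graded_submodule n B d Z \<longleftrightarrow> Z \<subseteq> carrier (free_module n B d) \<and> 0 \<in> Z \<and>
    (\<forall>x\<in>Z. \<forall>y\<in>Z. x + y \<in> Z) \<and> (\<forall>p\<in>carrier (mpoly_ring n). \<forall>x\<in>Z. scale_poly p x \<in> Z) \<and>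
    (\<forall>x\<in>Z. \<forall>j. component d j x \<in> Z)"

lemma scale_poly_add_left: "scale_poly (p + q) x = scale_poly p x + scale_poly q x"
  by (rule poly_mapping_eqI) (simp add: lookup_scale_poly lookup_add distrib_right)

lemma scale_poly_mult: "scale_poly (p * q) x = scale_poly p (scale_poly q x)"
  by (rule poly_mapping_eqI) (simp add: lookup_scale_poly mult.assoc)

lemma scale_poly_0_left: "scale_poly 0 x = 0" and scale_poly_1: "scale_poly 1 x = x"
  by (rule poly_mapping_eqI, simp add: lookup_scale_poly)+

lemma scale_poly_sum: "scale_poly p (sum f I) = (\<Sum>i\<in>I. scale_poly p (f i))"
  by (induction I rule: infinite_finite_induct) (auto simp: scale_poly_add scale_poly_zero)

lemma free_grade_sum:
  "(\<And>i. i \<in> I \<Longrightarrow> f i \<in> free_grade n B d j) \<Longrightarrow> sum f I \<in> free_grade n B d j"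
  by (induction I rule: infinite_finite_induct) (auto intro: free_grade_add free_grade_zero)

text \<open>The generators of \<open>Z\<close> are a k-basis of each of its graded pieces. Every
  degree receives finitely many of them, and none lies below the lowest degree of the given basis,
  so the new basis is tame again.\<close>

lemma graded_cover:
  fixes Z :: "(nat \<Rightarrow>\<^sub>0 ('k::field) mpoly) set"
  assumes B: "tame_basis B d" and Z: "graded_submodule n B d Z"
  shows "\<exists>B' d' h. tame_basis B' d' \<and> h \<in> graded_hom n (free_module n B' d') (free_module n B d) \<and>
    h ` carrier (free_module n B' d') = Z"
proof -
  interpret v: vector_space "kscale :: 'k \<Rightarrow> _" by (rule vector_space_kscale)
  obtain j0 where j0: "\<And>b. b \<in> B \<Longrightarrow> j0 \<le> d b" and finB: "\<And>j. finite {b \<in> B. d b = j}"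
    using B by (auto simp: tame_basis_def)
  have Zc: "Z \<subseteq> carrier (free_module n B d)" and Z0: "0 \<in> Z" and Zadd: "\<And>x y. x \<in> Z \<Longrightarrow> y \<in> Z \<Longrightarrow> x + y \<in> Z"
    and Zsc: "\<And>p x. p \<in> carrier (mpoly_ring n) \<Longrightarrow> x \<in> Z \<Longrightarrow> scale_poly p x \<in> Z"
    and Zcomp: "\<And>x j. x \<in> Z \<Longrightarrow> component d j x \<in> Z"
    using Z by (auto simp: graded_submodule_def)
  have Zsum: "sum f I \<in> Z" if "\<And>i. i \<in> I \<Longrightarrow> f i \<in> Z" for f :: "nat \<Rightarrow> _" and I
    using that by (induction I rule: infinite_finite_induct) (auto intro: Z0 Zadd)
  have "\<exists>zs. set zs \<subseteq> Z \<inter> free_grade n B d j \<and> Z \<inter> free_grade n B d j \<subseteq> v.span (set zs) \<and> (j < j0 \<longrightarrow> zs = [])" for j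
  proof (cases "j < j0")
    case True
    have "x = 0" if "x \<in> free_grade n B d j" for x
      using that j0 True unfolding mem_free_grade index_set_def
      by (intro coeff_eqI) (fastforce simp: coeff_zero)
    then have "Z \<inter> free_grade n B d j \<subseteq> {0}" by auto
    then show ?thesis by (intro exI[of _ "[]"]) auto
  next
    case False
    obtain S where S: "finite S" "free_grade n B d j \<subseteq> v.span S"
      using free_grade_finite_span[OF finite_index_set[OF finB j0]] by blast
    obtain E where E: "E \<subseteq> Z \<inter> free_grade n B d j" "v.independent E" "Z \<inter> free_grade n B d j \<subseteq> v.span E"
      using v.maximal_independent_subset[of "Z \<inter> free_grade n B d j"] by metis
    then have "finite E" using v.independent_span_bound[OF S(1) E(2)] S(2) by blast
    then obtain zs where "set zs = E" using finite_list by blast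
    then show ?thesis using E False by (intro exI[of _ zs]) auto
  qed
  then obtain zs where zs: "\<And>j. set (zs j) \<subseteq> Z \<inter> free_grade n B d j"
    "\<And>j. Z \<inter> free_grade n B d j \<subseteq> v.span (set (zs j))" "\<And>j. j < j0 \<Longrightarrow> zs j = []"
    by metis
  \<comment> \<open>Bases are sets of natural numbers, so an index encodes the pair of a degree and
    a position in the list \<open>zs\<close> of that degree.\<close>
  define d' where "d' b = int_decode (fst (prod_decode b))" for b
  define B' where "B' = {b. snd (prod_decode b) < length (zs (d' b))}"
  define z where "z b = zs (d' b) ! snd (prod_decode b)" for b
  have z: "z b \<in> Z" "z b \<in> free_grade n B d (d' b)" if "b \<in> B'" for b
    using that zs(1)[of "d' b"] by (auto simp: B'_def z_def)
  have z_surj: "\<exists>b\<in>B'. d' b = j \<and> z b = x" if x: "x \<in> set (zs j)" for j x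
  proof -
    obtain r where "r < length (zs j)" "zs j ! r = x" using x by (auto simp: in_set_conv_nth)
    then show ?thesis
      by (intro bexI[of _ "prod_encode (int_encode j, r)"]) (auto simp: B'_def d'_def z_def)
  qed
  have tame: "tame_basis B' d'"
    unfolding tame_basis_def
  proof (intro conjI allI exI ballI)
    fix j
    have "{b \<in> B'. d' b = j} \<subseteq> (\<lambda>r. prod_encode (int_encode j, r)) ` {..<length (zs j)}"
    proof
      fix b assume b: "b \<in> {b \<in> B'. d' b = j}"
      have "b = prod_encode (int_encode (d' b), snd (prod_decode b))" by (simp add: d'_def)
      then show "b \<in> (\<lambda>r. prod_encode (int_encode j, r)) ` {..<length (zs j)}"
        using b by (auto simp: B'_def)
    qed
    then show "finite {b \<in> B'. d' b = j}" using finite_subset by blast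
  next
    fix b assume "b \<in> B'"
    then have "zs (d' b) \<noteq> []" by (auto simp: B'_def)
    then show "j0 \<le> d' b" using zs(3)[of "d' b"] by linarith
  qed
  define h where "h f = (\<Sum>b\<in>Poly_Mapping.keys f. scale_poly (Poly_Mapping.lookup f b) (z b))" for f
  have h: "h f = (\<Sum>b\<in>S. scale_poly (Poly_Mapping.lookup f b) (z b))" if "finite S" "Poly_Mapping.keys f \<subseteq> S" for f S
    unfolding h_def using that by (intro sum.mono_neutral_left) (auto simp: in_keys_iff scale_poly_0_left)
  have h_add: "h (f + g) = h f + h g" for f g
  proof -
    let ?S = "Poly_Mapping.keys f \<union> Poly_Mapping.keys g"
    show ?thesis using h[of ?S f] h[of ?S g] h[of ?S "f + g"] Poly_Mapping.keys_add[of f g]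
      by (simp add: lookup_add scale_poly_add_left sum.distrib)
  qed
  have h_scale: "h (scale_poly p f) = scale_poly p (h f)" for p f
  proof -
    have "Poly_Mapping.keys (scale_poly p f) \<subseteq> Poly_Mapping.keys f" by (auto simp: in_keys_iff lookup_scale_poly)
    then show ?thesis using h[of "Poly_Mapping.keys f" "scale_poly p f"]
      by (simp add: h_def lookup_scale_poly scale_poly_mult scale_poly_sum)
  qed
  have keysB: "Poly_Mapping.keys f \<subseteq> B'" "Poly_Mapping.lookup f b \<in> carrier (mpoly_ring n)"
    if "f \<in> carrier (free_module n B' d')" for f :: "nat \<Rightarrow>\<^sub>0 'k mpoly" and b
    using that by (auto simp: free_module_def)
  have h_Z: "h f \<in> Z" if "f \<in> carrier (free_module n B' d')" for f
    unfolding h_def using keysB[OF that] z(1) by (intro Zsum Zsc) blast+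
  have h_grade: "h f \<in> free_grade n B d j" if "f \<in> free_grade n B' d' j" for f j
    unfolding h_def
  proof (rule free_grade_sum)
    fix b assume "b \<in> Poly_Mapping.keys f"
    then have b: "b \<in> B'" using that by (auto simp: free_module_def)
    have "Poly_Mapping.lookup f b \<in> homogeneous n (j - d' b)" using that b by (auto simp: free_module_def)
    from scale_poly_grade[OF this z(2)[OF b]] show "scale_poly (Poly_Mapping.lookup f b) (z b) \<in> free_grade n B d j"
      by simp
  qed
  have hom: "h \<in> graded_hom n (free_module n B' d') (free_module n B d)"
    unfolding graded_hom_def using h_add h_scale h_Z Zc h_grade by auto
  have "Z \<subseteq> h ` carrier (free_module n B' d')"
  proof
    fix x assume x: "x \<in> Z"
    have sub: "v.subspace (h ` carrier (free_module n B' d'))"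
    proof (rule v.subspaceI)
      have "h 0 = 0" using h_add[of 0 0] by (metis add.right_neutral add_left_cancel)
      then show "0 \<in> h ` carrier (free_module n B' d')" using free_carrier_zero by (metis image_eqI)
      show "x + y \<in> h ` carrier (free_module n B' d')"
        if "x \<in> h ` carrier (free_module n B' d')" "y \<in> h ` carrier (free_module n B' d')" for x y
        using that h_add[symmetric] free_carrier_add by (auto intro!: imageI)
      show "kscale c x \<in> h ` carrier (free_module n B' d')"
        if "x \<in> h ` carrier (free_module n B' d')" for c x
        using that h_scale[symmetric] scale_poly_carrier[OF const_carrier] by (auto intro!: imageI)
    qed
    have comp: "component d j x \<in> h ` carrier (free_module n B' d')" for j
    proof -
      have "component d j x \<in> Z \<inter> free_grade n B d j" using Zcomp[OF x] component_grade x Zc by blast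
      then have "component d j x \<in> v.span (set (zs j))" using zs(2) by blast
      moreover have "set (zs j) \<subseteq> h ` carrier (free_module n B' d')"
      proof
        fix y assume "y \<in> set (zs j)"
        then obtain b where b: "b \<in> B'" "z b = y" using z_surj by blast
        let ?f = "Poly_Mapping.single b (1 :: 'k mpoly)"
        have "?f \<in> carrier (free_module n B' d')"
          using b(1) by (auto simp: free_module_def mpoly_ring_def lookup_single when_def)
        moreover have "h ?f = y" using b(2) by (simp add: h_def scale_poly_1)
        ultimately show "y \<in> h ` carrier (free_module n B' d')" by blast
      qed
      ultimately show ?thesis using v.span_minimal[OF _ sub] by blast
    qed
    obtain J where "x = (\<Sum>j\<in>J. component d j x)" using sum_components[of x d] by metis
    then show "x \<in> h ` carrier (free_module n B' d')" using v.subspace_sum[OF sub] comp by metis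
  qed
  then show ?thesis using tame hom h_Z by blast
qed

lemma graded_submodule_kernel:
  assumes h: "h \<in> graded_hom n (free_module n B d) (free_module n B' d')"
  shows "graded_submodule n B d {x \<in> carrier (free_module n B d). h x = 0}"
proof -
  have "h (scale_poly p x) = scale_poly p (h x)" if "p \<in> carrier (mpoly_ring n)" "x \<in> carrier (free_module n B d)" for p x
    using h that by (simp add: graded_hom_def)
  moreover have "component d' j 0 = 0" for j
    using component_self[OF free_grade_zero] .
  ultimately show ?thesis
    unfolding graded_submodule_def
    using graded_hom_free(2,5)[OF h] graded_hom_free_component[OF h] free_grade_carrier[OF component_grade]
      scale_poly_carrier[of _ n] free_carrier_zero free_carrier_add scale_poly_zero
    by (auto simp: subset_iff)
qed

text \<open>\<open>graded_cover\<close> is iterated on kernels by dependent choice. The state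
  consists of a tame basis, its degrees, and the graded submodule that the next free module has to
  cover.\<close>

theorem resolution_exists:
  fixes M :: "('k::field mpoly, 'm) graded_module"
  assumes "finite G" and h: "h \<in> graded_hom n (free_module n G dg) M"
    and surj: "h ` carrier (free_module n G dg) = carrier M"
    and Z: "graded_submodule n G dg {x \<in> carrier (free_module n G dg). h x = \<zero>\<^bsub>M\<^esub>}"
  shows "\<exists>F. graded_free_resolution n M F"
proof -
  let ?Z0 = "{x \<in> carrier (free_module n G dg). h x = \<zero>\<^bsub>M\<^esub>}"
  have tame0: "tame_basis G dg"
    unfolding tame_basis_def
  proof (intro conjI allI exI ballI)
    show "Min (dg ` G) \<le> dg b" if "b \<in> G" for b using that assms(1) by simp
  qed (use assms(1) in auto)
  define P :: "nat \<Rightarrow> nat set \<times> (nat \<Rightarrow> int) \<times> (nat \<Rightarrow>\<^sub>0 'k mpoly) set \<Rightarrow> bool" where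
    "P i s \<longleftrightarrow> (case s of (B, d, Z) \<Rightarrow> tame_basis B d \<and> graded_submodule n B d Z \<and> (i = 0 \<longrightarrow> s = (G, dg, ?Z0)))" for i s
  define Q :: "nat \<Rightarrow> nat set \<times> (nat \<Rightarrow> int) \<times> (nat \<Rightarrow>\<^sub>0 'k mpoly) set \<Rightarrow> nat set \<times> (nat \<Rightarrow> int) \<times> (nat \<Rightarrow>\<^sub>0 'k mpoly) set \<Rightarrow> bool" where
    "Q i s s' \<longleftrightarrow> (case s of (B, d, Z) \<Rightarrow> case s' of (B', d', Z') \<Rightarrow>
      \<exists>h\<in>graded_hom n (free_module n B' d') (free_module n B d).
        h ` carrier (free_module n B' d') = Z \<and> Z' = {x \<in> carrier (free_module n B' d'). h x = 0})" for i s s'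
  have "\<exists>f. \<forall>i. P i (f i) \<and> Q i (f i) (f (Suc i))"
  proof (rule dependent_nat_choice)
    show "\<exists>s. P 0 s" using tame0 Z by (intro exI[of _ "(G, dg, ?Z0)"]) (simp add: P_def)
    show "\<exists>s'. P (Suc i) s' \<and> Q i s s'" if "P i s" for s i
    proof -
      obtain B d Z where s: "s = (B, d, Z)" by (cases s)
      then obtain B' d' h' where h': "tame_basis B' d'" "h' \<in> graded_hom n (free_module n B' d') (free_module n B d)"
        "h' ` carrier (free_module n B' d') = Z"
        using graded_cover[of B d n Z] \<open>P i s\<close> by (auto simp: P_def)
      then show ?thesis using s graded_submodule_kernel[OF h'(2)]
        by (intro exI[of _ "(B', d', {x \<in> carrier (free_module n B' d'). h' x = 0})"]) (auto simp: P_def Q_def)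
    qed
  qed
  then obtain f where f: "\<And>i. P i (f i)" "\<And>i. Q i (f i) (f (Suc i))" by blast
  define B where "B i = fst (f i)" for i
  define d where "d i = fst (snd (f i))" for i
  define Z where "Z i = snd (snd (f i))" for i
  have f_eq: "f i = (B i, d i, Z i)" for i by (simp add: B_def d_def Z_def)
  have tame: "tame_basis (B i) (d i)" for i using f(1)[of i] by (simp add: P_def f_eq)
  have init: "B 0 = G" "d 0 = dg" "Z 0 = ?Z0" using f(1)[of 0] by (auto simp: P_def f_eq)
  have "\<forall>i. \<exists>h. h \<in> graded_hom n (free_module n (B (Suc i)) (d (Suc i))) (free_module n (B i) (d i)) \<and>
        h ` carrier (free_module n (B (Suc i)) (d (Suc i))) = Z i \<and>
        Z (Suc i) = {x \<in> carrier (free_module n (B (Suc i)) (d (Suc i))). h x = 0}"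
  proof
    fix i show "\<exists>h. h \<in> graded_hom n (free_module n (B (Suc i)) (d (Suc i))) (free_module n (B i) (d i)) \<and>
        h ` carrier (free_module n (B (Suc i)) (d (Suc i))) = Z i \<and>
        Z (Suc i) = {x \<in> carrier (free_module n (B (Suc i)) (d (Suc i))). h x = 0}"
      using f(2)[of i] unfolding Q_def f_eq prod.case by blast
  qed
  from choice[OF this] obtain \<delta> where \<delta>': "\<forall>i. \<delta> i \<in> graded_hom n (free_module n (B (Suc i)) (d (Suc i))) (free_module n (B i) (d i)) \<and>
        \<delta> i ` carrier (free_module n (B (Suc i)) (d (Suc i))) = Z i \<and>
        Z (Suc i) = {x \<in> carrier (free_module n (B (Suc i)) (d (Suc i))). \<delta> i x = 0}" ..
  note \<delta> = \<delta>'[rule_format, THEN conjunct1] \<delta>'[rule_format, THEN conjunct2, THEN conjunct1]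
    \<delta>'[rule_format, THEN conjunct2, THEN conjunct2]
  let ?F = "\<lparr>basis = B, basis_degree = d, differential = \<delta>, augmentation = h\<rparr> :: ('k, 'm) free_complex"
  have "graded_free_resolution n M ?F"
    unfolding graded_free_resolution_def term_module_def basis_in_degree_def free_complex.select_convs
  proof (intro conjI allI)
    show "finite {b \<in> B i. d i b = j}" for i j using tame[of i] by (simp add: tame_basis_def)
    show "h \<in> graded_hom n (free_module n (B 0) (d 0)) M" using h init by simp
    show "h ` carrier (free_module n (B 0) (d 0)) = carrier M" using surj init by simp
    show "{x \<in> carrier (free_module n (B 0) (d 0)). h x = \<zero>\<^bsub>M\<^esub>} = \<delta> 0 ` carrier (free_module n (B 1) (d 1))"
      using \<delta>(2)[of 0] init by simp
    show "{x \<in> carrier (free_module n (B (Suc i)) (d (Suc i))). \<delta> i x = 0}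
        = \<delta> (Suc i) ` carrier (free_module n (B (Suc (Suc i))) (d (Suc (Suc i))))" for i
      using \<delta>(2)[of "Suc i"] \<delta>(3)[of i] by simp
  qed (rule \<delta>(1))
  then show ?thesis ..
qed

section \<open>From a finitely generated graded module to a presentation\<close>

section \<open>Finitely generated modules\<close>

text \<open>Unlike \<open>presentation\<close>, this has a module map \<open>h\<close> defined on
  polynomials; it yields the coordinate map as well as a resolution. Both the given module and the
  direct sum of edge rings are brought into this form.\<close>

locale presented_by =
  fixes n :: nat and M :: "('k::field mpoly, 'm) graded_module" and G :: "nat set" and dg :: "nat \<Rightarrow> int"
    and h :: "(nat \<Rightarrow>\<^sub>0 'k mpoly) \<Rightarrow> 'm"
  assumes fin_G: "finite G"
    and abelian: "abelian_group M"
    and grade_carrier: "grade M j \<subseteq> carrier M"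
    and zero_grade: "\<zero>\<^bsub>M\<^esub> \<in> grade M j"
    and hom: "h \<in> graded_hom n (free_module n G dg) M"
    and surj: "h ` carrier (free_module n G dg) = carrier M"
    and hom_component: "h' \<in> graded_hom n (free_module n B d) M \<Longrightarrow> x \<in> carrier (free_module n B d) \<Longrightarrow>
      h' x \<in> grade M j \<Longrightarrow> h' (component d j x) = h' x"
begin

lemma coeff_of_coeff_coords: "u \<in> coords n G dg j \<Longrightarrow> coeff (of_coeff u) = u"
proof (rule coeff_of_coeff)
  assume "u \<in> coords n G dg j"
  then have "{i. u i \<noteq> 0} \<subseteq> index_set n G dg j" unfolding coords_def by blast
  then show "finite {i. u i \<noteq> 0}" by (rule finite_subset[OF _ finite_index_set'[OF fin_G]])
qed

lemma of_coeff_grade: "u \<in> coords n G dg j \<Longrightarrow> of_coeff u \<in> free_grade n G dg j"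
  unfolding mem_free_grade by (simp add: coeff_of_coeff_coords) (simp add: coords_def)

lemma h_carrier: "f \<in> carrier (free_module n G dg) \<Longrightarrow> h f \<in> carrier M"
  using hom by (auto simp: graded_hom_def)

sublocale presentation n M G dg "\<lambda>u. h (of_coeff u)"
proof (rule presentation.intro, goal_cases)
  case (3 j)
  then show ?case by (rule grade_carrier)
next
  case (4 u j v)
  have "of_coeff (u + v) = of_coeff u + of_coeff v"
    by (rule coeff_eqI) (simp add: coeff_add coeff_of_coeff_coords[OF 4(1)] coeff_of_coeff_coords[OF 4(2)]
      coeff_of_coeff_coords[OF coords_add[OF 4]])
  then show ?case
    using hom free_grade_carrier[OF of_coeff_grade[OF 4(1)]] free_grade_carrier[OF of_coeff_grade[OF 4(2)]]
    by (simp add: graded_hom_def)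
next
  case (5 u j c)
  have "of_coeff (\<lambda>i. c * u i) = scale_poly (const c) (of_coeff u)"
    by (rule coeff_eqI) (simp add: coeff_scale_const coeff_of_coeff_coords[OF 5]
      coeff_of_coeff_coords[OF coords_scale[OF 5]])
  then show ?case
    using hom free_grade_carrier[OF of_coeff_grade[OF 5]] const_carrier[of c n] by (simp add: graded_hom_def)
next
  case (6 i u j)
  have "of_coeff (shift i u) = mulvar i (of_coeff u)"
    by (rule coeff_eqI) (simp add: coeff_mulvar coeff_of_coeff_coords[OF 6(2)]
      coeff_of_coeff_coords[OF coords_shift[OF 6]])
  moreover have "(var i :: 'k mpoly) \<in> carrier (mpoly_ring n)" using 6(1) by (auto simp: var_def mpoly_ring_def)
  ultimately show ?case
    using hom free_grade_carrier[OF of_coeff_grade[OF 6(2)]] by (simp add: graded_hom_def mulvar_def)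
next
  case (7 j)
  show ?case
  proof
    show "(\<lambda>u. h (of_coeff u)) ` coords n G dg j \<subseteq> grade M j"
    proof
      fix m assume "m \<in> (\<lambda>u. h (of_coeff u)) ` coords n G dg j"
      then obtain u where "u \<in> coords n G dg j" "m = h (of_coeff u)" by blast
      then show "m \<in> grade M j"
        using hom of_coeff_grade[of u j] unfolding graded_hom_def by blast
    qed
    show "grade M j \<subseteq> (\<lambda>u. h (of_coeff u)) ` coords n G dg j"
    proof
      fix m assume m: "m \<in> grade M j"
      then have "m \<in> h ` carrier (free_module n G dg)" using grade_carrier surj by blast
      then obtain f where f: "f \<in> carrier (free_module n G dg)" "h f = m" by auto
      let ?f = "component dg j f"
      have "coeff ?f \<in> coords n G dg j"
        using component_grade[OF f(1), of j] unfolding mem_free_grade coords_def by auto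
      moreover have "h (of_coeff (coeff ?f)) = m"
        using hom_component[OF hom f(1)] f(2) m by (simp add: of_coeff_coeff)
      ultimately show "m \<in> (\<lambda>u. h (of_coeff u)) ` coords n G dg j" by blast
    qed
  qed
next
  case (8 h' B d x j)
  then show ?case by (rule hom_component)
qed (use fin_G abelian in simp_all)

lemma has_resolution: "\<exists>F. graded_free_resolution n M F"
proof (rule resolution_exists[OF fin_G hom surj])
  interpret M: abelian_group M by (rule abelian)
  have sm: "h (scale_poly p x) = p \<odot>\<^bsub>M\<^esub> h x" if "p \<in> carrier (mpoly_ring n)" "x \<in> carrier (free_module n G dg)" for p x
    using hom that by (simp add: graded_hom_def)
  have sm0: "p \<odot>\<^bsub>M\<^esub> \<zero>\<^bsub>M\<^esub> = \<zero>\<^bsub>M\<^esub>" if "p \<in> carrier (mpoly_ring n)" for p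
    using sm[OF that free_carrier_zero] aug_hom(6)[OF hom] by (simp add: scale_poly_zero)
  show "graded_submodule n G dg {x \<in> carrier (free_module n G dg). h x = \<zero>\<^bsub>M\<^esub>}"
    unfolding graded_submodule_def
  proof (intro conjI ballI allI)
    show "0 \<in> {x \<in> carrier (free_module n G dg). h x = \<zero>\<^bsub>M\<^esub>}"
      using free_carrier_zero aug_hom(6)[OF hom] by blast
    show "x + y \<in> {x \<in> carrier (free_module n G dg). h x = \<zero>\<^bsub>M\<^esub>}"
      if "x \<in> {x \<in> carrier (free_module n G dg). h x = \<zero>\<^bsub>M\<^esub>}" "y \<in> {x \<in> carrier (free_module n G dg). h x = \<zero>\<^bsub>M\<^esub>}" for x y
      using that aug_hom(2)[OF hom, of x y] free_carrier_add[of x n G dg y] by simp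
    show "scale_poly p x \<in> {x \<in> carrier (free_module n G dg). h x = \<zero>\<^bsub>M\<^esub>}"
      if "p \<in> carrier (mpoly_ring n)" "x \<in> {x \<in> carrier (free_module n G dg). h x = \<zero>\<^bsub>M\<^esub>}" for p x
      using that sm[of p x] sm0 scale_poly_carrier[of p n x G dg] by simp
    show "component dg j x \<in> {x \<in> carrier (free_module n G dg). h x = \<zero>\<^bsub>M\<^esub>}"
      if "x \<in> {x \<in> carrier (free_module n G dg). h x = \<zero>\<^bsub>M\<^esub>}" for x j
      using that hom_component[OF hom, of x j] zero_grade free_grade_carrier[OF component_grade, of x n G dg j] by simp
  qed blast
qed

text \<open>\<open>SOME\<close> picks a genuine resolution because one exists, and the comparison
  holds for whichever is picked.\<close>

theorem betti_eq_koszul: "betti n M i j = koszul_betti i (j - int i)"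
proof -
  have "graded_free_resolution n M (SOME F. graded_free_resolution n M F)"
    using someI_ex[OF has_resolution] .
  then interpret resolved_presentation n M G dg "\<lambda>u. h (of_coeff u)" "SOME F. graded_free_resolution n M F" j
    by unfold_locales
  show ?thesis unfolding betti_def by (rule tor_dim_eq_koszul)
qed

end

lemma mpoly_ring_simps [simp]:
  "add (mpoly_ring n) = (+)" "(\<otimes>\<^bsub>mpoly_ring n\<^esub>) = (*)" "zero (mpoly_ring n) = 0" "one (mpoly_ring n) = 1"
  by (simp_all add: mpoly_ring_def)

context graded_module
begin

lemma grade_in_carrier: "x \<in> grade M j \<Longrightarrow> x \<in> carrier M"
  using subgroup.subset[OF grade_subgroup] by auto

lemma zero_in_grade: "\<zero>\<^bsub>M\<^esub> \<in> grade M j"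
  using subgroup.one_closed[OF grade_subgroup] by simp

lemma hom_finsum:
  assumes h: "h \<in> graded_hom n (free_module n B d) M" and "finite J"
    and f: "\<And>j. j \<in> J \<Longrightarrow> f j \<in> carrier (free_module n B d)"
  shows "h (sum f J) = (\<Oplus>\<^bsub>M\<^esub>j\<in>J. h (f j))"
  using assms(2) f
proof (induction J rule: finite_induct)
  case empty
  have "(0 :: nat \<Rightarrow>\<^sub>0 'k mpoly) \<in> carrier (free_module n B d)" by (rule free_carrier_zero)
  then have "h (0 + 0) = h 0 \<oplus>\<^bsub>M\<^esub> h 0" "h 0 \<in> carrier M"
    using h unfolding graded_hom_def free_module_simps by blast+
  then have "h 0 = \<zero>\<^bsub>M\<^esub>" by (simp add: M.add.l_cancel_one)
  then show ?case by simp
next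
  case (insert i J)
  have hc: "h x \<in> carrier M" if "x \<in> carrier (free_module n B d)" for x
    using h that by (auto simp: graded_hom_def)
  have "h (f i + sum f J) = h (f i) \<oplus>\<^bsub>M\<^esub> h (sum f J)"
    using h insert.prems free_carrier_sum[of J f n B d] by (simp add: graded_hom_def)
  then show ?case using insert hc by (simp add: M.finsum_insert Pi_def)
qed

text \<open>The images of the components of \<open>x\<close> and the family concentrated in degree
  \<open>j\<close> are two homogeneous decompositions of \<open>h x\<close>, so uniqueness
  identifies them.\<close>

lemma graded_hom_component:
  assumes h: "h \<in> graded_hom n (free_module n B d) M" and x: "x \<in> carrier (free_module n B d)"
    and hx: "h x \<in> grade M j"
  shows "h (component d j x) = h x"
proof -
  obtain J where J: "finite J" "x = (\<Sum>e\<in>J. component d e x)" "\<And>e. e \<notin> J \<Longrightarrow> component d e x = 0"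
    using sum_components[of x d] by blast
  have cg: "component d e x \<in> carrier (free_module n B d)" for e
    using free_grade_carrier[OF component_grade[OF x]] .
  have hg: "h (component d e x) \<in> grade M e" for e
    using h component_grade[OF x] by (auto simp: graded_hom_def image_subset_iff)
  have h0: "h 0 = \<zero>\<^bsub>M\<^esub>" using hom_finsum[OF h, of "{}"] by simp
  let ?f = "\<lambda>e. h (component d e x)" and ?g = "\<lambda>e. if e = j then h x else \<zero>\<^bsub>M\<^esub>"
  let ?P = "\<lambda>f. (\<forall>j. f j \<in> grade M j) \<and> finite {j. f j \<noteq> \<zero>\<^bsub>M\<^esub>} \<and>
           h x = (\<Oplus>\<^bsub>M\<^esub> j \<in> {j. f j \<noteq> \<zero>\<^bsub>M\<^esub>}. f j)"
  have sub: "{e. ?f e \<noteq> \<zero>\<^bsub>M\<^esub>} \<subseteq> J" using J(3) h0 by fastforce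
  have "h x = (\<Oplus>\<^bsub>M\<^esub>e\<in>J. ?f e)" using hom_finsum[OF h J(1), of "\<lambda>e. component d e x"] J(2) cg by simp
  also have "\<dots> = (\<Oplus>\<^bsub>M\<^esub> e \<in> {e. ?f e \<noteq> \<zero>\<^bsub>M\<^esub>}. ?f e)"
    by (rule M.add.finprod_mono_neutral_cong_right[OF J(1) sub]) (use hg grade_in_carrier in auto)
  finally have Pf: "?P ?f" using hg finite_subset[OF sub J(1)] by blast
  have Pg: "?P ?g"
  proof -
    have s: "{e. ?g e \<noteq> \<zero>\<^bsub>M\<^esub>} = (if h x = \<zero>\<^bsub>M\<^esub> then {} else {j})" by auto
    show ?thesis
    proof (intro conjI allI)
      show "?g e \<in> grade M e" for e using hx zero_in_grade by simp
      show "finite {e. ?g e \<noteq> \<zero>\<^bsub>M\<^esub>}" unfolding s by simp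
      show "h x = (\<Oplus>\<^bsub>M\<^esub>e\<in>{e. ?g e \<noteq> \<zero>\<^bsub>M\<^esub>}. ?g e)"
        unfolding s using grade_in_carrier[OF hx] by (simp add: M.finsum_insert)
    qed
  qed
  from grade_decomposition[OF grade_in_carrier[OF hx]]
  obtain f0 where f0: "\<forall>f. ?P f \<longrightarrow> f = f0" by (rule ex1E)
  have "?f = ?g" using f0[THEN spec, THEN mp, OF Pf] f0[THEN spec, THEN mp, OF Pg] by (rule trans[OF _ sym])
  from fun_cong[OF this, of j] show ?thesis by simp
qed

text \<open>Each generator is replaced by its finitely many homogeneous components, listed together
  with their degrees.\<close>

lemma homogeneous_generators:
  assumes "finitely_generated n M"
  shows "\<exists>G dg g. finite (G :: nat set) \<and> (\<forall>b\<in>G. g b \<in> grade M (dg b)) \<and>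
    (\<forall>N. submodule N (mpoly_ring n) M \<longrightarrow> g ` G \<subseteq> N \<longrightarrow> N = carrier M)"
proof -
  obtain X where X: "finite X" "X \<subseteq> carrier M"
    "\<And>N. submodule N (mpoly_ring n) M \<Longrightarrow> X \<subseteq> N \<Longrightarrow> N = carrier M"
    using assms by (auto simp: finitely_generated_def)
  have "\<exists>f. (\<forall>j. f j \<in> grade M j) \<and> finite {j. f j \<noteq> \<zero>\<^bsub>M\<^esub>} \<and> x = (\<Oplus>\<^bsub>M\<^esub> j \<in> {j. f j \<noteq> \<zero>\<^bsub>M\<^esub>}. f j)" if "x \<in> X" for x
    using grade_decomposition[of x] that X(2) by blast
  then obtain f where f: "\<And>x j. x \<in> X \<Longrightarrow> f x j \<in> grade M j" "\<And>x. x \<in> X \<Longrightarrow> finite {j. f x j \<noteq> \<zero>\<^bsub>M\<^esub>}"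
    "\<And>x. x \<in> X \<Longrightarrow> x = (\<Oplus>\<^bsub>M\<^esub> j \<in> {j. f x j \<noteq> \<zero>\<^bsub>M\<^esub>}. f x j)" by metis
  define Y where "Y = (\<Union>x\<in>X. (\<lambda>j. (j, f x j)) ` {j. f x j \<noteq> \<zero>\<^bsub>M\<^esub>})"
  have "finite Y" using X(1) f(2) by (simp add: Y_def)
  then obtain ys where ys: "set ys = Y" using finite_list by blast
  let ?G = "{..<length ys}" and ?dg = "\<lambda>b. fst (ys ! b)" and ?g = "\<lambda>b. snd (ys ! b)"
  have "?g b \<in> grade M (?dg b)" if "b \<in> ?G" for b
  proof -
    have "ys ! b \<in> Y" using that ys by auto
    then show ?thesis using f(1) by (auto simp: Y_def)
  qed
  moreover have "N = carrier M" if N: "submodule N (mpoly_ring n) M" "?g ` ?G \<subseteq> N" for N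
  proof (rule X(3)[OF N(1)])
    show "X \<subseteq> N"
    proof
      fix x assume x: "x \<in> X"
      have inN: "f x j \<in> N" if j: "j \<in> {j. f x j \<noteq> \<zero>\<^bsub>M\<^esub>}" for j
      proof -
        have "(j, f x j) \<in> Y" using x j by (auto simp: Y_def)
        then obtain b where "b < length ys" "ys ! b = (j, f x j)" using ys by (metis in_set_conv_nth)
        then show ?thesis using N(2) by (force simp: image_subset_iff)
      qed
      note sg = submodule.axioms(1)[OF N(1)]
      have "finite S \<Longrightarrow> (\<And>j. j \<in> S \<Longrightarrow> f x j \<in> N) \<Longrightarrow> (\<Oplus>\<^bsub>M\<^esub>j\<in>S. f x j) \<in> N" for S
      proof (induction S rule: finite_induct)
        case empty
        then show ?case using subgroup.one_closed[OF sg] by simp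
      next
        case (insert j S)
        have "f x \<in> S \<rightarrow> carrier M" "f x j \<in> carrier M" using f(1)[OF x] by (auto intro: grade_in_carrier)
        then show ?case
          using insert subgroup.m_closed[OF sg, of "f x j" "\<Oplus>\<^bsub>M\<^esub>j\<in>S. f x j"]
          by (simp add: M.finsum_insert)
      qed
      from this[OF f(2)[OF x] inN] show "x \<in> N" using f(3)[OF x] by simp
    qed
  qed
  ultimately show ?thesis by (intro exI[of _ ?G] exI[of _ ?dg] exI[of _ ?g]) auto
qed

theorem presented_by_exists:
  assumes "finitely_generated n M"
  shows "\<exists>G dg h. presented_by n M G dg h"
proof -
  obtain G :: "nat set" and dg g where G: "finite G" and g: "\<And>b. b \<in> G \<Longrightarrow> g b \<in> grade M (dg b)"
    and gen: "\<And>N. submodule N (mpoly_ring n) M \<Longrightarrow> g ` G \<subseteq> N \<Longrightarrow> N = carrier M"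
    using homogeneous_generators[OF assms] by auto
  let ?F = "free_module n G dg :: ('k mpoly, nat \<Rightarrow>\<^sub>0 'k mpoly) graded_module"
  define h where "h f = (\<Oplus>\<^bsub>M\<^esub>b\<in>G. Poly_Mapping.lookup f b \<odot>\<^bsub>M\<^esub> g b)" for f
  have gc: "g b \<in> carrier M" if "b \<in> G" for b using grade_in_carrier[OF g[OF that]] .
  have lc: "Poly_Mapping.lookup f b \<in> carrier (mpoly_ring n)" if "f \<in> carrier ?F" for f b
    using that by (simp add: free_module_def)
  have tc: "(\<lambda>b. Poly_Mapping.lookup f b \<odot>\<^bsub>M\<^esub> g b) \<in> G \<rightarrow> carrier M" if "f \<in> carrier ?F" for f
    using lc[OF that] gc by auto
  have h_carrier: "h f \<in> carrier M" if "f \<in> carrier ?F" for f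
    unfolding h_def using M.finsum_closed[OF tc[OF that]] .
  have h_add: "h (f + f') = h f \<oplus>\<^bsub>M\<^esub> h f'" if "f \<in> carrier ?F" "f' \<in> carrier ?F" for f f'
  proof -
    have "h (f + f') = (\<Oplus>\<^bsub>M\<^esub>b\<in>G. Poly_Mapping.lookup f b \<odot>\<^bsub>M\<^esub> g b \<oplus>\<^bsub>M\<^esub> Poly_Mapping.lookup f' b \<odot>\<^bsub>M\<^esub> g b)"
      unfolding h_def
      by (rule M.finsum_cong') (use smult_l_distr[OF lc[OF that(1)] lc[OF that(2)] gc] lc that gc in \<open>auto simp: lookup_add\<close>)
    then show ?thesis unfolding h_def using M.finsum_addf[OF tc[OF that(1)] tc[OF that(2)]] by simp
  qed
  have h_smult: "h (scale_poly p f) = p \<odot>\<^bsub>M\<^esub> h f" if "p \<in> carrier (mpoly_ring n)" "f \<in> carrier ?F" for p f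
  proof -
    have "p \<odot>\<^bsub>M\<^esub> h f = (\<Oplus>\<^bsub>M\<^esub>b\<in>G. p \<odot>\<^bsub>M\<^esub> (Poly_Mapping.lookup f b \<odot>\<^bsub>M\<^esub> g b))"
      unfolding h_def using finsum_smult_ldistr[OF G that(1)] tc[OF that(2)] by simp
    also have "\<dots> = h (scale_poly p f)"
      unfolding h_def
      by (rule M.finsum_cong')
        (use smult_assoc1[OF that(1) lc[OF that(2)] gc] that(1) lc[OF that(2)] gc lc[OF scale_poly_carrier[OF that]]
          in \<open>auto simp: lookup_scale_poly\<close>)
    finally show ?thesis by simp
  qed
  have h_grade: "h f \<in> grade M j" if f: "f \<in> grade ?F j" for f j
  proof -
    have t: "Poly_Mapping.lookup f b \<odot>\<^bsub>M\<^esub> g b \<in> grade M j" if "b \<in> G" for b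
    proof -
      have "Poly_Mapping.lookup f b \<in> homogeneous n (j - dg b)" using f that by (simp add: free_module_def)
      from grade_smult[OF this g[OF that]] show ?thesis by simp
    qed
    have "S \<subseteq> G \<Longrightarrow> (\<Oplus>\<^bsub>M\<^esub>b\<in>S. Poly_Mapping.lookup f b \<odot>\<^bsub>M\<^esub> g b) \<in> grade M j" if "finite S" for S
      using that
    proof (induction S rule: finite_induct)
      case empty
      then show ?case using zero_in_grade by simp
    next
      case (insert b S)
      have "(\<lambda>b. Poly_Mapping.lookup f b \<odot>\<^bsub>M\<^esub> g b) \<in> S \<rightarrow> carrier M"
        "Poly_Mapping.lookup f b \<odot>\<^bsub>M\<^esub> g b \<in> carrier M"
        using tc[OF free_grade_carrier[OF f]] insert.prems by auto
      then show ?case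
        using insert subgroup.m_closed[OF grade_subgroup, of _ j] t by (simp add: M.finsum_insert)
    qed
    then show ?thesis unfolding h_def using G by blast
  qed
  have hom: "h \<in> graded_hom n ?F M"
    unfolding graded_hom_def using h_carrier h_add h_smult h_grade by auto
  have "submodule (h ` carrier ?F) (mpoly_ring n) M"
  proof (rule submoduleI)
    show "h ` carrier ?F \<subseteq> carrier M" using h_carrier by auto
    have h0: "h 0 = \<zero>\<^bsub>M\<^esub>" using hom_finsum[OF hom, of "{}"] by simp
    then show "\<zero>\<^bsub>M\<^esub> \<in> h ` carrier ?F" using free_carrier_zero by (metis image_eqI)
    show "\<ominus>\<^bsub>M\<^esub> a \<in> h ` carrier ?F" if "a \<in> h ` carrier ?F" for a
    proof -
      obtain f where f: "f \<in> carrier ?F" "a = h f" using \<open>a \<in> h ` carrier ?F\<close> by auto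
      have "h (- f) \<oplus>\<^bsub>M\<^esub> h f = \<zero>\<^bsub>M\<^esub>" using h_add[OF free_carrier_neg[OF f(1)] f(1)] h0 by simp
      then have "\<ominus>\<^bsub>M\<^esub> a = h (- f)"
        using M.minus_equality[of "h (- f)" "h f"] h_carrier f free_carrier_neg[OF f(1)] by simp
      then show ?thesis using free_carrier_neg[OF f(1)] by blast
    qed
    show "a \<oplus>\<^bsub>M\<^esub> b \<in> h ` carrier ?F" if "a \<in> h ` carrier ?F" "b \<in> h ` carrier ?F" for a b
      using that h_add[symmetric] free_carrier_add by (auto intro!: imageI)
    show "p \<odot>\<^bsub>M\<^esub> x \<in> h ` carrier ?F" if "p \<in> carrier (mpoly_ring n)" "x \<in> h ` carrier ?F" for p x
      using that h_smult[symmetric] scale_poly_carrier by (auto intro!: imageI)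
  qed
  moreover have "g ` G \<subseteq> h ` carrier ?F"
  proof
    fix y assume "y \<in> g ` G"
    then obtain b where b: "b \<in> G" "y = g b" by auto
    let ?f = "Poly_Mapping.single b (1 :: 'k mpoly)"
    have fc: "?f \<in> carrier ?F"
      using b(1) by (auto simp: free_module_def mpoly_ring_def lookup_single when_def)
    have sub: "{b} \<subseteq> G" using b(1) by simp
    have "h ?f = (\<Oplus>\<^bsub>M\<^esub>b'\<in>{b}. Poly_Mapping.lookup ?f b' \<odot>\<^bsub>M\<^esub> g b')"
      unfolding h_def
    proof (rule M.add.finprod_mono_neutral_cong_right[OF G sub _ _ tc[OF fc]])
      show "Poly_Mapping.lookup ?f i \<odot>\<^bsub>M\<^esub> g i = \<zero>\<^bsub>M\<^esub>" if "i \<in> G - {b}" for i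
        using that smult_l_null[OF gc, of i] by (simp add: lookup_single when_def)
    qed simp
    also have "\<dots> = y" using smult_one[OF gc[OF b(1)]] gc b by (simp add: M.finsum_insert)
    finally show "y \<in> h ` carrier ?F" using fc by blast
  qed
  ultimately have "h ` carrier ?F = carrier M" using gen by blast
  then have "presented_by n M G dg h"
    using G M.abelian_group_axioms grade_in_carrier zero_in_grade hom graded_hom_component
    by (intro presented_by.intro) auto
  then show ?thesis by blast
qed

end

section \<open>Euler characteristic and the numerator of the Hilbert series\<close>

section \<open>Betti numbers and Hilbert functions\<close>

context relations
begin

definition hilbert :: "int \<Rightarrow> int" where
  "hilbert d = int (v.dim (U d)) - int (v.dim (B d))"

lemma int_koszul_betti:
  "int (koszul_betti i d) = int (c.dim (cycles i d)) - int (c.dim (boundaries i d))"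
  using c.dim_subset_le[OF finite_dim_cycles boundaries_subset] by (simp add: koszul_betti_def)

lemma koszul_betti_0_exact: "koszul_betti i d = 0 \<longleftrightarrow> cycles i d \<subseteq> boundaries i d"
proof
  assume "koszul_betti i d = 0"
  then have "c.dim (boundaries i d) = c.dim (cycles i d)" using int_koszul_betti[of i d] by simp
  then have "boundaries i d = cycles i d"
    by (rule c.dim_subset_eq[OF finite_dim_cycles c.finite_dim_subspace[OF finite_dim_boundaries] boundaries_subset])
  then show "cycles i d \<subseteq> boundaries i d" by simp
next
  assume "cycles i d \<subseteq> boundaries i d"
  then show "koszul_betti i d = 0" using boundaries_subset[of i d] by (simp add: koszul_betti_def)
qed

text \<open>Rank and nullity of the differential on the quotient: it lowers the exterior degree and
  raises the coefficient degree by one, so the total degree is fixed.\<close>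

lemma dim_cycles_Suc:
  "int (c.dim (cycles (Suc i) d)) + int (c.dim (boundaries i (d + 1)))
    = int (n choose Suc i) * int (v.dim (U d)) + int (n choose i) * int (v.dim (B (d + 1)))"
proof -
  have "{a \<in> chains n (Suc i) (U d). koszul (shifts n) a \<in> chains n i (B (d + 1))} = cycles (Suc i) d"
  proof -
    have "koszul (shifts n) a \<in> chains n i (B (d + 1)) \<longleftrightarrow> (\<forall>bs. koszul (shifts n) a bs \<in> B (d + 1))"
      if a: "a \<in> chains n (Suc i) (U d)" for a
    proof -
      have "koszul (shifts n) a \<in> chains n i (U (d + 1))" using koszul_U[of a i "d + 1"] a by simp
      then show ?thesis using chains_change[of _ n i "U (d + 1)"] chainsD'[OF _ B_zero] by blast
    qed
    then show ?thesis unfolding cycles_def by blast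
  qed
  moreover have "{koszul (shifts n) a + b |a b. a \<in> chains n (Suc i) (U d) \<and> b \<in> chains n i (B (d + 1))} = boundaries i (d + 1)"
    by (simp add: boundaries_def)
  ultimately have "c.dim (cycles (Suc i) d) + c.dim (boundaries i (d + 1))
      = (n choose Suc i) * v.dim (U d) + (n choose i) * v.dim (B (d + 1))"
    using cc.rank_nullity_mod[OF linear_koszul finite_dim_chains_U[of "Suc i" d] finite_dim_chains_B[of i "d + 1"]]
    by (simp only: dim_chains_U dim_chains_B)
  then have "int (c.dim (cycles (Suc i) d) + c.dim (boundaries i (d + 1)))
      = int ((n choose Suc i) * v.dim (U d) + (n choose i) * v.dim (B (d + 1)))" by (rule arg_cong)
  then show ?thesis unfolding of_nat_add of_nat_mult .
qed

lemma cycles_0: "cycles 0 d = chains n 0 (U d)"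
proof -
  have "koszul (shifts n) p bs \<in> B (d + 1)" if "p \<in> chains n 0 (U d)" for p bs
    using koszul_chains_0[OF commuting_shifts, of p n "U d"] that B_zero by simp
  then show ?thesis unfolding cycles_def by blast
qed

lemma boundaries_top: "boundaries n d = chains n n (B d)"
proof -
  have z: "q = 0" if "q \<in> chains n (Suc n) (U (d - 1))" for q :: "bool list \<Rightarrow> idx \<Rightarrow> 'k"
  proof
    fix bs :: "bool list"
    have "count_list bs True \<noteq> Suc n" if "length bs = n" using count_le_length[of bs True] that by simp
    then show "q bs = 0 bs" using chainsD0[OF that, of bs] by auto
  qed
  have k0: "koszul (shifts n) (0 :: bool list \<Rightarrow> idx \<Rightarrow> 'k) = 0"
    using koszul_zero[OF commuting_shifts, of n] by (auto simp: fun_eq_iff zero_fun_def)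
  show ?thesis
  proof
    show "boundaries n d \<subseteq> chains n n (B d)" using z k0 unfolding boundaries_def by force
    show "chains n n (B d) \<subseteq> boundaries n d"
    proof
      fix b assume "b \<in> chains n n (B d)"
      moreover have "(0 :: bool list \<Rightarrow> idx \<Rightarrow> 'k) \<in> chains n (Suc n) (U (d - 1))"
        using chains_zero[OF coords_zero(1)] by (simp add: zero_fun_def)
      moreover have "b = koszul (shifts n) 0 + b" using k0 by simp
      ultimately show "b \<in> boundaries n d" unfolding boundaries_def by blast
    qed
  qed
qed

text \<open>The Euler characteristic in total degree \<open>j\<close>. In the proof
  \<open>r i d\<close> is the rank, on the quotient, of the differential into exterior degree
  \<open>i\<close>; the ranks telescope, and the last one vanishes because nothing lies above
  exterior degree \<open>n\<close>.\<close>

theorem koszul_euler: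
  "(\<Sum>i\<le>n. (-1) ^ i * int (koszul_betti i (j - int i))) = (\<Sum>i\<le>n. (-1) ^ i * int (n choose i) * hilbert (j - int i))"
proof -
  define r where "r i d = int (c.dim (boundaries i d)) - int (n choose i) * int (v.dim (B d))" for i d
  have step: "(\<Sum>i\<le>N. (-1) ^ i * int (koszul_betti i (j - int i)))
      = (\<Sum>i\<le>N. (-1) ^ i * int (n choose i) * hilbert (j - int i)) - (-1) ^ N * r N (j - int N)" for N
  proof (induction N)
    case 0
    show ?case
      using dim_chains_U[of 0 j] by (simp add: int_koszul_betti cycles_0 hilbert_def r_def)
  next
    case (Suc N)
    have e: "j - int N = j - int (Suc N) + 1" by simp
    have k: "int (koszul_betti (Suc N) (j - int (Suc N)))
        = int (n choose Suc N) * hilbert (j - int (Suc N)) - r N (j - int N) - r (Suc N) (j - int (Suc N))"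
      using dim_cycles_Suc[of N "j - int (Suc N)"] unfolding int_koszul_betti hilbert_def r_def e
      by (simp add: algebra_simps)
    show ?case unfolding sum.atMost_Suc Suc.IH k by (simp add: algebra_simps)
  qed
  have "r n d = 0" for d by (simp add: r_def boundaries_top dim_chains_B)
  then show ?thesis using step[of n] by simp
qed

end

definition hilbert_numerator :: "nat \<Rightarrow> (int \<Rightarrow> int) \<Rightarrow> int fps" where
  "hilbert_numerator n h = (1 - fps_X) ^ n * Abs_fps (\<lambda>d. h (int d))"

lemma fps_nth_one_minus_X_power: "fps_nth ((1 - fps_X :: int fps) ^ n) i = (-1) ^ i * int (n choose i)"
proof (induction n arbitrary: i)
  case 0
  then show ?case by (cases i) auto
next
  case (Suc n)
  then show ?case by (cases i) (simp_all add: algebra_simps)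
qed

lemma hilbert_numerator_nth:
  assumes "\<And>d. d < 0 \<Longrightarrow> h d = 0"
  shows "fps_nth (hilbert_numerator n h) j = (\<Sum>i\<le>n. (-1) ^ i * int (n choose i) * h (int j - int i))"
proof -
  let ?t = "\<lambda>i. (-1) ^ i * int (n choose i) * h (int j - int i)"
  have "fps_nth (hilbert_numerator n h) j = (\<Sum>i=0..j. ?t i)"
    unfolding hilbert_numerator_def fps_mult_nth
    by (intro sum.cong) (auto simp: fps_nth_one_minus_X_power of_nat_diff)
  also have "\<dots> = (\<Sum>i\<le>max n j. ?t i)"
    by (intro sum.mono_neutral_left) (auto intro: assms)
  also have "\<dots> = (\<Sum>i\<le>n. ?t i)"
    by (intro sum.mono_neutral_right) (auto simp: binomial_eq_0)
  finally show ?thesis .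
qed

context relations
begin

text \<open>\<open>d\<close> is the coefficient degree, the total degree minus the exterior degree;
  so the generators sit at 0 and all syzygies at 1.\<close>

definition two_linear :: bool where
  "two_linear \<longleftrightarrow> (\<forall>d. d \<noteq> 0 \<longrightarrow> koszul_betti 0 d = 0) \<and> (\<forall>i d. d \<noteq> 1 \<longrightarrow> koszul_betti (Suc i) d = 0)"

text \<open>Nothing cancels in the Euler characteristic: in total degree \<open>i + 2\<close>
  coefficient degree 1 occurs in exterior degree \<open>i + 1\<close> alone, and exterior degree 0
  contributes in total degree 0 alone. Hence the numerator determines all Betti numbers.\<close>

lemma two_linear_betti:
  assumes "two_linear" "\<And>d. d < 0 \<Longrightarrow> hilbert d = 0"
  shows "int (koszul_betti (Suc i) 1) = (-1) ^ Suc i * fps_nth (hilbert_numerator n hilbert) (Suc (Suc i))"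
    and "int (koszul_betti 0 0) = fps_nth (hilbert_numerator n hilbert) 0"
proof -
  have e: "fps_nth (hilbert_numerator n hilbert) j = (\<Sum>i\<le>n. (-1) ^ i * int (koszul_betti i (int j - int i)))" for j
    using hilbert_numerator_nth[where h = hilbert and n = n and j = j, OF assms(2)] koszul_euler[of "int j"] by simp
  have big: "koszul_betti k d = 0" if "k > n" for k d
  proof -
    have "cycles k d \<subseteq> boundaries k d"
    proof
      fix p assume p: "p \<in> cycles k d"
      have "p = 0"
      proof
        fix bs :: "bool list"
        have "count_list bs True \<noteq> k" if "length bs = n" using count_le_length[of bs True] that \<open>k > n\<close> by simp
        then show "p bs = 0 bs" using p chainsD0[of p n k "U d" bs] by (auto simp: cycles_def)
      qed
      then show "p \<in> boundaries k d" using c.subspace_0[OF c.finite_dim_subspace[OF finite_dim_boundaries]] by simp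
    qed
    then show ?thesis by (simp add: koszul_betti_0_exact)
  qed
  have "fps_nth (hilbert_numerator n hilbert) (Suc (Suc i))
      = (\<Sum>k\<le>n. if k = Suc i then (-1) ^ Suc i * int (koszul_betti (Suc i) 1) else 0)"
    unfolding e
  proof (intro sum.cong refl)
    fix k
    have "koszul_betti k (int (Suc (Suc i)) - int k) = 0" if "k \<noteq> Suc i"
      using assms(1) that unfolding two_linear_def by (cases k) (auto split: if_splits)
    then show "(-1) ^ k * int (koszul_betti k (int (Suc (Suc i)) - int k))
        = (if k = Suc i then (-1) ^ Suc i * int (koszul_betti (Suc i) 1) else 0)" by auto
  qed
  also have "\<dots> = (-1) ^ Suc i * int (koszul_betti (Suc i) 1)"
    using big[of "Suc i" 1] by (simp add: sum.delta)
  finally show "int (koszul_betti (Suc i) 1) = (-1) ^ Suc i * fps_nth (hilbert_numerator n hilbert) (Suc (Suc i))"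
    by (simp add: power_mult_distrib[symmetric] mult.assoc[symmetric] power_add[symmetric])
  have "fps_nth (hilbert_numerator n hilbert) 0 = (\<Sum>k\<le>n. if k = 0 then int (koszul_betti 0 0) else 0)"
    unfolding e
  proof (intro sum.cong refl)
    fix k
    have "koszul_betti k (- int k) = 0" if "k \<noteq> 0"
      using assms(1) that unfolding two_linear_def by (cases k) auto
    then show "(-1) ^ k * int (koszul_betti k (int 0 - int k)) = (if k = 0 then int (koszul_betti 0 0) else 0)"
      by auto
  qed
  then show "int (koszul_betti 0 0) = fps_nth (hilbert_numerator n hilbert) 0" by (simp add: sum.delta)
qed

end

section \<open>Generic linear independence along a one-parameter family\<close>

section \<open>Pencils of linear maps over an infinite field\<close>

definition polyfun :: "('k::field \<Rightarrow> 'b::ab_group_add \<Rightarrow> 'b) \<Rightarrow> ('k \<Rightarrow> 'b) \<Rightarrow> bool" where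
  "polyfun s f \<longleftrightarrow> (\<exists>N c. \<forall>t. f t = (\<Sum>e<N. s (t ^ e) (c e)))"

context vector_space
begin

lemma polyfun_const: "polyfun scale (\<lambda>_. v)"
  unfolding polyfun_def by (intro exI[of _ "Suc 0"] exI[of _ "\<lambda>_. v"]) simp

lemma polyfun_extend:
  assumes "\<forall>t. f t = (\<Sum>e<N. scale (t ^ e) (c e))" "N \<le> N'"
  shows "\<forall>t. f t = (\<Sum>e<N'. scale (t ^ e) (if e < N then c e else 0))"
proof
  fix t
  have "(\<Sum>e<N'. scale (t ^ e) (if e < N then c e else 0)) = (\<Sum>e<N. scale (t ^ e) (if e < N then c e else 0))"
    using assms(2) by (intro sum.mono_neutral_right) auto
  then show "f t = (\<Sum>e<N'. scale (t ^ e) (if e < N then c e else 0))" using assms(1) by simp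
qed

lemma polyfun_add: "polyfun scale f \<Longrightarrow> polyfun scale g \<Longrightarrow> polyfun scale (\<lambda>t. f t + g t)"
proof -
  assume "polyfun scale f" "polyfun scale g"
  then obtain N c N' c' where f: "\<forall>t. f t = (\<Sum>e<N. scale (t ^ e) (c e))" and g: "\<forall>t. g t = (\<Sum>e<N'. scale (t ^ e) (c' e))"
    unfolding polyfun_def by blast
  let ?a = "\<lambda>e. if e < N then c e else 0" and ?b = "\<lambda>e. if e < N' then c' e else 0"
  have "\<forall>t. f t + g t = (\<Sum>e<max N N'. scale (t ^ e) (?a e + ?b e))"
    using polyfun_extend[OF f, of "max N N'"] polyfun_extend[OF g, of "max N N'"]
    by (simp add: scale_right_distrib sum.distrib)
  then show ?thesis unfolding polyfun_def by (intro exI[of _ "max N N'"] exI[of _ "\<lambda>e. ?a e + ?b e"])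
qed

lemma polyfun_scale: "polyfun scale f \<Longrightarrow> polyfun scale (\<lambda>t. scale a (f t))"
  unfolding polyfun_def
proof (elim exE)
  fix N c assume "\<forall>t. f t = (\<Sum>e<N. scale (t ^ e) (c e))"
  then have "\<forall>t. scale a (f t) = (\<Sum>e<N. scale (t ^ e) (scale a (c e)))"
    by (simp add: scale_sum_right mult.commute)
  then show "\<exists>N c. \<forall>t. scale a (f t) = (\<Sum>e<N. scale (t ^ e) (c e))"
    by (intro exI[of _ N] exI[of _ "\<lambda>e. scale a (c e)"])
qed

lemma polyfun_times: "polyfun scale f \<Longrightarrow> polyfun scale (\<lambda>t. scale t (f t))"
  unfolding polyfun_def
proof (elim exE)
  fix N c assume f: "\<forall>t. f t = (\<Sum>e<N. scale (t ^ e) (c e))"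
  have "scale t (f t) = (\<Sum>e<Suc N. scale (t ^ e) (case e of 0 \<Rightarrow> 0 | Suc e \<Rightarrow> c e))" for t
    using f by (simp add: sum.lessThan_Suc_shift scale_sum_right del: sum.lessThan_Suc)
  then show "\<exists>N c. \<forall>t. scale t (f t) = (\<Sum>e<N. scale (t ^ e) (c e))" by blast
qed

lemma polyfun_poly: "polyfun scale f \<Longrightarrow> polyfun scale (\<lambda>t. scale (poly p t) (f t))"
proof (induction p)
  case (pCons a p)
  have "polyfun scale (\<lambda>t. scale a (f t) + scale t (scale (poly p t) (f t)))"
    by (intro polyfun_add polyfun_scale polyfun_times pCons)
  then show ?case by (simp add: scale_left_distrib)
qed (use polyfun_const[of 0] in simp)

lemma separating_functional:
  assumes "subspace C" "y \<notin> C"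
  shows "\<exists>\<phi>. Vector_Spaces.linear scale (*) \<phi> \<and> (\<forall>x\<in>C. \<phi> x = 0) \<and> \<phi> y = 1"
proof -
  interpret m: vector_space "(*) :: 'a \<Rightarrow> 'a \<Rightarrow> 'a" by unfold_locales (auto simp: algebra_simps)
  interpret p: vector_space_pair scale "(*) :: 'a \<Rightarrow> 'a \<Rightarrow> 'a" by unfold_locales
  obtain E where E: "E \<subseteq> C" "independent E" "C \<subseteq> span E" using basis_exists by metis
  have sE: "span E = C" using E assms(1) by (meson span_minimal subset_antisym)
  then have "independent (insert y E)" using independent_insertI[of y E] E(2) assms(2) by simp
  from p.linear_independent_extend[OF this, of "\<lambda>x. if x = y then 1 else 0"]
  obtain \<phi> where \<phi>: "Vector_Spaces.linear scale (*) \<phi>" "\<And>x. x \<in> insert y E \<Longrightarrow> \<phi> x = (if x = y then 1 else 0)"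
    by blast
  have "\<phi> x = 0" if "x \<in> C" for x
  proof -
    have "\<phi> e = 0" if "e \<in> E" for e using \<phi>(2)[of e] that E(1) assms(2) by auto
    then show ?thesis using p.linear_eq_0_on_span[OF \<phi>(1), of E x] that sE by blast
  qed
  then show ?thesis using \<phi> by (intro exI[of _ \<phi>]) auto
qed

lemma polyfun_functional:
  assumes "Vector_Spaces.linear scale (*) \<phi>" "polyfun scale f"
  shows "\<exists>q. \<forall>t. \<phi> (f t) = poly q t"
proof -
  interpret \<phi>: Vector_Spaces.linear scale "(*)" \<phi> by fact
  obtain N c where "\<forall>t. f t = (\<Sum>e<N. scale (t ^ e) (c e))" using assms(2) by (auto simp: polyfun_def)
  then have "\<forall>t. \<phi> (f t) = poly (\<Sum>e<N. monom (\<phi> (c e)) e) t"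
    by (simp add: \<phi>.sum \<phi>.scale poly_sum poly_monom mult.commute)
  then show ?thesis by blast
qed

text \<open>Gaussian elimination over the field of rational functions, in a denominator-free form.\<close>

lemma generic_independence:
  assumes C: "subspace C" and "finite I" and "\<And>i. i \<in> I \<Longrightarrow> polyfun scale (v i)"
  shows "finite {t. \<exists>c. (\<exists>i\<in>I. c i \<noteq> 0) \<and> (\<Sum>i\<in>I. scale (c i) (v i t)) \<in> C} \<or>
    (\<exists>p. (\<exists>i\<in>I. p i \<noteq> 0) \<and> (\<forall>t. (\<Sum>i\<in>I. scale (poly (p i) t) (v i t)) \<in> C))"
  using assms(2,3)
proof (induction I arbitrary: v rule: finite_induct)
  case (insert k I)
  show ?case
  proof (cases "\<forall>t. v k t \<in> C")
    case True
    let ?p = "\<lambda>i. if i = k then 1 else (0 :: 'a poly)"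
    have "(\<Sum>i\<in>insert k I. scale (poly (?p i) t) (v i t)) = v k t" for t
    proof -
      have "(\<Sum>i\<in>I. scale (poly (?p i) t) (v i t)) = 0" using insert.hyps by (intro sum.neutral) auto
      then show ?thesis using insert.hyps by simp
    qed
    then show ?thesis using True by (intro disjI2 exI[of _ ?p]) auto
  next
    case False
    then obtain t0 where "v k t0 \<notin> C" by blast
    then obtain \<phi> where \<phi>: "Vector_Spaces.linear scale (*) \<phi>" "\<And>x. x \<in> C \<Longrightarrow> \<phi> x = 0" "\<phi> (v k t0) = 1"
      using separating_functional[OF C] by blast
    interpret \<phi>: Vector_Spaces.linear scale "(*)" \<phi> by fact
    have "\<exists>q. \<forall>t. \<phi> (v i t) = poly q t" if "i \<in> insert k I" for i
      using polyfun_functional[OF \<phi>(1) insert.prems[OF that]] .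
    then obtain q where q: "\<And>i t. i \<in> insert k I \<Longrightarrow> \<phi> (v i t) = poly (q i) t" by metis
    have qk: "q k \<noteq> 0" using \<phi>(3) q[of k t0] by auto
    \<comment> \<open>The denominator-free combination of \<open>v i\<close> and \<open>v k\<close>
      on which \<open>\<phi>\<close> vanishes for every parameter.\<close>
    define w where "w i t = scale (poly (q k) t) (v i t) + scale (poly (- q i) t) (v k t)" for i t
    have "polyfun scale (w i)" if "i \<in> I" for i
      unfolding w_def using insert.prems that by (intro polyfun_add polyfun_poly) auto
    from insert.IH[OF this] show ?thesis
    proof
      let ?bad = "\<lambda>I v. {t. \<exists>c. (\<exists>i\<in>I. c i \<noteq> 0) \<and> (\<Sum>i\<in>I. scale (c i) (v i t)) \<in> C}"
      assume fin: "finite (?bad I w)"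
      \<comment> \<open>Away from the roots of \<open>q k\<close>, a dependency of the
        \<open>v i\<close> modulo \<open>C\<close> yields one of the \<open>w i\<close>: applying
        \<open>\<phi>\<close> determines the coefficient at \<open>k\<close> from the
        others.\<close>
      have sub: "?bad (insert k I) v \<subseteq> ?bad I w \<union> {t. poly (q k) t = 0}"
      proof (rule subsetI, rule ccontr)
        fix t assume t: "t \<in> ?bad (insert k I) v" "t \<notin> ?bad I w \<union> {t. poly (q k) t = 0}"
        obtain c i where i: "i \<in> insert k I" "c i \<noteq> 0" and s: "(\<Sum>i\<in>insert k I. scale (c i) (v i t)) \<in> C"
          using t(1) by blast
        have qt: "poly (q k) t \<noteq> 0" and nb: "\<nexists>c. (\<exists>i\<in>I. c i \<noteq> 0) \<and> (\<Sum>i\<in>I. scale (c i) (w i t)) \<in> C"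
          using t(2) by blast+
        have "0 = \<phi> (\<Sum>i\<in>insert k I. scale (c i) (v i t))" using \<phi>(2)[OF s] by simp
        also have "\<dots> = c k * poly (q k) t + (\<Sum>i\<in>I. c i * poly (q i) t)"
          using insert.hyps q by (simp add: \<phi>.add \<phi>.scale \<phi>.sum)
        finally have ck: "c k * poly (q k) t = - (\<Sum>i\<in>I. c i * poly (q i) t)" by (simp add: eq_neg_iff_add_eq_0)
        have "(\<Sum>i\<in>I. scale (c i) (w i t)) = scale (poly (q k) t) (\<Sum>i\<in>I. scale (c i) (v i t))
            + scale (- (\<Sum>i\<in>I. c i * poly (q i) t)) (v k t)"
          unfolding w_def by (simp add: scale_right_distrib sum.distrib scale_sum_right scale_sum_left
            scale_right_diff_distrib sum_subtractf sum_negf mult.commute)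
        also have "\<dots> = scale (poly (q k) t) (\<Sum>i\<in>insert k I. scale (c i) (v i t))"
          using insert.hyps ck by (simp add: scale_right_distrib mult.commute flip: ck)
        finally have "(\<Sum>i\<in>I. scale (c i) (w i t)) \<in> C" using subspace_scale[OF C s] by simp
        then have z: "\<forall>i\<in>I. c i = 0" using nb by blast
        then have "c k = 0" using ck qt by simp
        then show False using z i by auto
      qed
      show ?thesis
        by (rule disjI1, rule finite_subset[OF sub]) (intro finite_UnI fin poly_roots_finite[OF qk])
    next
      assume "\<exists>p. (\<exists>i\<in>I. p i \<noteq> 0) \<and> (\<forall>t. (\<Sum>i\<in>I. scale (poly (p i) t) (w i t)) \<in> C)"
      then obtain p where p: "\<exists>i\<in>I. p i \<noteq> 0" "\<And>t. (\<Sum>i\<in>I. scale (poly (p i) t) (w i t)) \<in> C" by blast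
      define p' where "p' i = (if i = k then - (\<Sum>i\<in>I. p i * q i) else p i * q k)" for i
      have "(\<Sum>i\<in>insert k I. scale (poly (p' i) t) (v i t)) = (\<Sum>i\<in>I. scale (poly (p i) t) (w i t))" for t
      proof -
        have "(\<Sum>i\<in>I. scale (poly (p' i) t) (v i t)) = (\<Sum>i\<in>I. scale (poly (p i) t * poly (q k) t) (v i t))"
          using insert.hyps by (intro sum.cong) (auto simp: p'_def)
        then show ?thesis
          using insert.hyps unfolding w_def
          by (simp add: p'_def scale_right_distrib scale_right_diff_distrib sum_subtractf sum.distrib scale_sum_left poly_sum sum_negf)
      qed
      moreover have "\<exists>i\<in>insert k I. p' i \<noteq> 0"
        using p(1) qk insert.hyps by (auto simp: p'_def)
      ultimately show ?thesis using p(2) by (intro disjI2 exI[of _ p']) auto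
    qed
  qed
qed auto

text \<open>A functional that separates a coefficient from \<open>C\<close> would turn the family
  into a nonzero scalar polynomial vanishing on an infinite field.\<close>

lemma polynomial_coefficients_mem:
  assumes C: "subspace C" and inf: "infinite (UNIV :: 'a set)"
    and f: "\<And>t. (\<Sum>m<N. scale (t ^ m) (c m)) \<in> C" and "m < N"
  shows "c m \<in> C"
proof (rule ccontr)
  assume "c m \<notin> C"
  then obtain \<phi> where \<phi>: "Vector_Spaces.linear scale (*) \<phi>" "\<And>x. x \<in> C \<Longrightarrow> \<phi> x = 0" "\<phi> (c m) = 1"
    using separating_functional[OF C] by blast
  interpret \<phi>: Vector_Spaces.linear scale "(*)" \<phi> by fact
  let ?q = "\<Sum>m<N. monom (\<phi> (c m)) m"
  have "poly ?q t = 0" for t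
    using \<phi>(2)[OF f[of t]] by (simp add: \<phi>.sum \<phi>.scale poly_sum poly_monom mult.commute)
  then have "?q = 0" using poly_roots_finite[of ?q] inf by auto
  moreover have "poly.coeff ?q m = 1"
  proof -
    have "poly.coeff ?q m = (\<Sum>k<N. if k = m then \<phi> (c m) else 0)"
      unfolding Polynomial.coeff_sum by (intro sum.cong) auto
    then show ?thesis using \<open>m < N\<close> \<phi>(3) by simp
  qed
  ultimately show False by simp
qed

text \<open>Elimination in the Vandermonde system: the equation for \<open>e + 1\<close> minus
  \<open>t k\<close> times the one for \<open>e\<close> no longer involves \<open>k\<close> and
  multiplies each other unknown by the nonzero scalar \<open>t j - t k\<close>.\<close>

lemma vandermonde_mem:
  assumes C: "subspace C" and "finite J" "inj_on t J"
    and "\<And>e. e < card J \<Longrightarrow> (\<Sum>j\<in>J. scale (t j ^ e) (u j)) \<in> C"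
  shows "\<forall>j\<in>J. u j \<in> C"
  using assms(2-4)
proof (induction J arbitrary: u rule: finite_induct)
  case (insert k J)
  have "scale (t j - t k) (u j) \<in> C" if "j \<in> J" for j
  proof -
    have "(\<Sum>j\<in>J. scale (t j ^ e) (scale (t j - t k) (u j))) \<in> C" if "e < card J" for e
    proof -
      have e: "(\<Sum>j\<in>insert k J. scale (t j ^ Suc e) (u j)) - scale (t k) (\<Sum>j\<in>insert k J. scale (t j ^ e) (u j)) \<in> C"
        by (intro subspace_diff[OF C] subspace_scale[OF C] insert.prems(2)) (use that insert.hyps in auto)
      have "(\<Sum>j\<in>insert k J. scale (t j ^ Suc e) (u j)) - scale (t k) (\<Sum>j\<in>insert k J. scale (t j ^ e) (u j))
          = (\<Sum>j\<in>J. scale (t j ^ Suc e) (u j) - scale (t k * t j ^ e) (u j))"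
        using insert.hyps by (simp add: scale_right_distrib scale_sum_right sum_subtractf)
      also have "\<dots> = (\<Sum>j\<in>J. scale (t j ^ e) (scale (t j - t k) (u j)))"
      proof (intro sum.cong refl)
        fix j
        have "t j ^ Suc e - t k * t j ^ e = t j ^ e * (t j - t k)"
          by (simp add: right_diff_distrib mult.commute)
        then show "scale (t j ^ Suc e) (u j) - scale (t k * t j ^ e) (u j) = scale (t j ^ e) (scale (t j - t k) (u j))"
          by (metis scale_left_diff_distrib scale_scale)
      qed
      finally show ?thesis using e by simp
    qed
    then show ?thesis using insert.IH[of "\<lambda>j. scale (t j - t k) (u j)"] insert.prems(1) that by auto
  qed
  note tj = this
  have J: "u j \<in> C" if "j \<in> J" for j
  proof -
    have "t j - t k \<noteq> 0" using insert.prems(1) insert.hyps that by (auto simp: inj_on_def)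
    then show ?thesis using subspace_scale[OF C tj[OF that], of "inverse (t j - t k)"]
      by simp
  qed
  have "(\<Sum>j\<in>insert k J. scale (t j ^ 0) (u j)) \<in> C" by (rule insert.prems(2)) (use insert.hyps in simp)
  then have "u k + (\<Sum>j\<in>J. u j) \<in> C" using insert.hyps by simp
  moreover have "(\<Sum>j\<in>J. u j) \<in> C" using J by (intro subspace_sum[OF C])
  ultimately have "u k \<in> C" using subspace_diff[OF C] by fastforce
  then show ?case using J by auto
qed simp

end

section \<open>Regular modules, their socle and multiplication by a generic form\<close>

section \<open>Generic hyperplane sections\<close>

text \<open>A point of the moment curve in the space of linear forms. With one parameter, genericity
  is a matter of polynomials in one variable, and distinct parameters give a Vandermonde matrix. The
  first variable always has coefficient 1, so it can be eliminated in the section.\<close>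

definition gen_form :: "('k::field \<Rightarrow> 'v::ab_group_add \<Rightarrow> 'v) \<Rightarrow> 'k \<Rightarrow> ('v \<Rightarrow> 'v) list \<Rightarrow> 'v \<Rightarrow> 'v" where
  "gen_form s t xs v = (\<Sum>k<length xs. s (t ^ k) ((xs ! k) v))"

text \<open>The relations of the quotient by \<open>l\<close>; in degree 0 there is no lower degree
  to multiply from.\<close>

definition section_rels :: "('v::ab_group_add \<Rightarrow> 'v) \<Rightarrow> (nat \<Rightarrow> 'v set) \<Rightarrow> (nat \<Rightarrow> 'v set) \<Rightarrow> nat \<Rightarrow> 'v set" where
  "section_rels l U B d = (case d of 0 \<Rightarrow> B 0 | Suc d \<Rightarrow> {l u + b |u b. u \<in> U d \<and> b \<in> B (Suc d)})"

lemma section_rels_simps [simp]: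
  "section_rels l U B 0 = B 0" "section_rels l U B (Suc d) = {l u + b |u b. u \<in> U d \<and> b \<in> B (Suc d)}"
  by (simp_all add: section_rels_def)

locale pencil = vector_space scale for scale :: "'k::field \<Rightarrow> 'v::ab_group_add \<Rightarrow> 'v" +
  fixes U :: "nat \<Rightarrow> 'v set"
  assumes fin_U: "finite_dim scale (U d)" and uncountable_field: "uncountable (UNIV :: 'k set)"
begin

sublocale pair: vector_space_pair scale scale by unfold_locales

text \<open>States that the module with pieces \<open>U d / B d\<close> over the polynomial ring with variables acting through
  \<open>xs\<close> has regularity at most 1 (exactness of the Koszul complex in internal degrees at
  least 2), is generated in degree 0, and has no linear relations among its generators.\<close>

definition regular_system :: "('v \<Rightarrow> 'v) list \<Rightarrow> (nat \<Rightarrow> 'v set) \<Rightarrow> bool" where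
  "regular_system xs B \<longleftrightarrow> commuting xs \<and>
    (\<forall>x\<in>set xs. Vector_Spaces.linear scale scale x \<and> (\<forall>d. \<forall>u\<in>U d. x u \<in> U (Suc d)) \<and> (\<forall>d. \<forall>u\<in>B d. x u \<in> B (Suc d))) \<and>
    (\<forall>d. subspace (B d) \<and> B d \<subseteq> U d) \<and>
    (\<forall>i d. \<forall>p\<in>chains (length xs) i (U (Suc (Suc d))). (\<forall>bs. koszul xs p bs \<in> B (Suc (Suc (Suc d)))) \<longrightarrow>
       (\<exists>q\<in>chains (length xs) (Suc i) (U (Suc d)). \<forall>bs. p bs - koszul xs q bs \<in> B (Suc (Suc d)))) \<and>
    (\<forall>v. (\<forall>k<length xs. v k \<in> U 0) \<longrightarrow> (\<Sum>k<length xs. (xs ! k) (v k)) \<in> B (Suc 0) \<longrightarrow> (\<forall>k<length xs. v k \<in> B 0)) \<and>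
    (\<forall>u\<in>U (Suc 0). \<exists>v. (\<forall>k<length xs. v k \<in> U 0) \<and> u - (\<Sum>k<length xs. (xs ! k) (v k)) \<in> B (Suc 0))"

text \<open>Degree 1 is the place where a socle can occur: in higher degrees \<open>no_socle\<close>
  excludes it.\<close>

definition socle :: "('v \<Rightarrow> 'v) list \<Rightarrow> (nat \<Rightarrow> 'v set) \<Rightarrow> 'v set" where
  "socle xs B = {w \<in> U (Suc 0). \<forall>x\<in>set xs. x w \<in> B (Suc (Suc 0))}"

definition hil :: "(nat \<Rightarrow> 'v set) \<Rightarrow> nat \<Rightarrow> int" where
  "hil B d = int (dim (U d)) - int (dim (B d))"

definition socle_dim :: "('v \<Rightarrow> 'v) list \<Rightarrow> (nat \<Rightarrow> 'v set) \<Rightarrow> nat" where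
  "socle_dim xs B = dim (socle xs B) - dim (B (Suc 0))"

lemmas U_subspace = finite_dim_subspace[OF fin_U]
lemmas U_zero = subspace_0[OF U_subspace]
lemmas U_add = subspace_add[OF U_subspace]
lemmas U_diff = subspace_diff[OF U_subspace]
lemmas U_neg = subspace_neg[OF U_subspace]
lemmas U_scale = subspace_scale[OF U_subspace]
lemmas U_sum = subspace_sum[OF U_subspace]

end

locale regular_pencil = pencil scale U for scale :: "'k::field \<Rightarrow> 'v::ab_group_add \<Rightarrow> 'v" and U +
  fixes xs :: "('v \<Rightarrow> 'v) list" and B :: "nat \<Rightarrow> 'v set"
  assumes reg: "regular_system xs B"
begin

lemma com: "commuting xs" using reg by (simp add: regular_system_def)
lemma lin: "x \<in> set xs \<Longrightarrow> Vector_Spaces.linear scale scale x" using reg by (simp add: regular_system_def)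
lemma x_U: "x \<in> set xs \<Longrightarrow> u \<in> U d \<Longrightarrow> x u \<in> U (Suc d)" using reg by (simp add: regular_system_def)
lemma x_B: "x \<in> set xs \<Longrightarrow> u \<in> B d \<Longrightarrow> x u \<in> B (Suc d)" using reg by (simp add: regular_system_def)
lemma B_sub: "subspace (B d)" and B_U: "B d \<subseteq> U d" using reg by (simp_all add: regular_system_def)
lemma exact: "p \<in> chains (length xs) i (U (Suc (Suc d))) \<Longrightarrow> (\<And>bs. koszul xs p bs \<in> B (Suc (Suc (Suc d)))) \<Longrightarrow>
    \<exists>q\<in>chains (length xs) (Suc i) (U (Suc d)). \<forall>bs. p bs - koszul xs q bs \<in> B (Suc (Suc d))"
  using reg unfolding regular_system_def by blast
lemma inj1: "(\<And>k. k < length xs \<Longrightarrow> v k \<in> U 0) \<Longrightarrow> (\<Sum>k<length xs. (xs ! k) (v k)) \<in> B (Suc 0) \<Longrightarrow> k < length xs \<Longrightarrow> v k \<in> B 0"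
  using reg unfolding regular_system_def by blast
lemma gen1: "u \<in> U (Suc 0) \<Longrightarrow> \<exists>v. (\<forall>k<length xs. v k \<in> U 0) \<and> u - (\<Sum>k<length xs. (xs ! k) (v k)) \<in> B (Suc 0)"
  using reg unfolding regular_system_def by blast

lemmas B_zero = subspace_0[OF B_sub]
lemmas B_add = subspace_add[OF B_sub]
lemmas B_diff = subspace_diff[OF B_sub]
lemmas B_neg = subspace_neg[OF B_sub]
lemmas B_scale = subspace_scale[OF B_sub]
lemmas B_sum = subspace_sum[OF B_sub]

lemma fin_B: "finite_dim scale (B d)"
  using finite_dim_subset[OF fin_U B_sub B_U] .

lemma x_add: "x \<in> set xs \<Longrightarrow> x (u + v) = x u + x v"
  and x_scale: "x \<in> set xs \<Longrightarrow> x (scale a u) = scale a (x u)"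
  and x_diff: "x \<in> set xs \<Longrightarrow> x (u - v) = x u - x v"
  and x_sum: "x \<in> set xs \<Longrightarrow> x (sum f I) = (\<Sum>i\<in>I. x (f i))"
  using lin[of x] by (simp_all add: pair.linear_add pair.linear_scale pair.linear_diff pair.linear_sum)

lemma x_zero: "x \<in> set xs \<Longrightarrow> x 0 = 0"
  using lin[of x] by (simp add: pair.linear_0)

lemma x_com: "x \<in> set xs \<Longrightarrow> y \<in> set xs \<Longrightarrow> x (y v) = y (x v)"
  using com by (simp add: commuting_def)

lemma linear_gen_form: "Vector_Spaces.linear scale scale (gen_form scale t xs)"
  by unfold_locales
    (auto simp: gen_form_def x_add x_scale scale_right_distrib sum.distrib scale_sum_right mult.commute)

text \<open>The socle is the top Koszul homology: \<open>w\<close> placed at the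
  all-\<open>True\<close> list is a cycle, and exactness makes it a boundary from one exterior
  degree higher, where every chain is zero.\<close>

lemma no_socle:
  assumes w: "w \<in> U (Suc (Suc d))" "\<And>x. x \<in> set xs \<Longrightarrow> x w \<in> B (Suc (Suc (Suc d)))"
  shows "w \<in> B (Suc (Suc d))"
proof -
  let ?r = "length xs"
  let ?p = "\<lambda>bs. if bs = replicate ?r True then w else 0"
  have top: "count_list bs True = r \<longleftrightarrow> bs = replicate r True" if "length bs = r" for bs and r :: nat
    using that
  proof (induction bs arbitrary: r)
    case (Cons b bs)
    then obtain r' where r: "r = Suc r'" "length bs = r'" by (cases r) auto
    have "count_list bs True \<le> r'" using count_le_length[of bs True] r by simp
    then show ?case using Cons.IH[OF r(2)] r by (cases b) auto
  qed auto
  have p: "?p \<in> chains ?r ?r (U (Suc (Suc d)))"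
    by (rule chainsI) (use w top in auto)
  have "koszul xs ?p bs \<in> B (Suc (Suc (Suc d)))" for bs
    by (rule koszul_mem[where S = "{0, w}"])
      (use w(2) in \<open>auto simp: x_zero B_zero intro: B_add B_neg\<close>)
  from exact[OF p this] obtain q where q: "q \<in> chains ?r (Suc ?r) (U (Suc d))"
    "\<And>bs. ?p bs - koszul xs q bs \<in> B (Suc (Suc d))" by blast
  have "q = (\<lambda>_. 0)"
  proof
    fix bs :: "bool list"
    have "count_list bs True \<noteq> Suc ?r" if "length bs = ?r" using count_le_length[of bs True] that by simp
    then show "q bs = 0" using chainsD0[OF q(1), of bs] by auto
  qed
  then show ?thesis using q(2)[of "replicate ?r True"] koszul_zero[OF com] by simp
qed

lemma socle_subspace: "subspace (socle xs B)"
  unfolding socle_def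
  by (rule subspaceI) (auto simp: x_zero x_add x_scale U_zero U_add U_scale B_zero B_add B_scale)

lemma B_socle: "B (Suc 0) \<subseteq> socle xs B"
  using B_U x_B by (auto simp: socle_def)

lemma fin_socle: "finite_dim scale (socle xs B)"
  by (rule finite_dim_subset[OF fin_U[of "Suc 0"] socle_subspace]) (auto simp: socle_def)

text \<open>Dividing out the socle in degree 1 leaves a module without socle in degrees at least 1.\<close>

definition Bt :: "nat \<Rightarrow> 'v set" where
  "Bt d = (if d = Suc 0 then socle xs B else B d)"

lemma Bt_Suc [simp]: "Bt (Suc (Suc d)) = B (Suc (Suc d))"
  by (simp add: Bt_def)

lemma Bt_sub: "subspace (Bt d)"
  by (simp add: Bt_def socle_subspace B_sub)

lemma Bt_U: "Bt d \<subseteq> U d"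
  using B_U by (auto simp: Bt_def socle_def)

lemma x_Bt: "x \<in> set xs \<Longrightarrow> u \<in> Bt (Suc d) \<Longrightarrow> x u \<in> Bt (Suc (Suc d))"
  by (cases d) (auto simp: Bt_def socle_def x_B)

lemma no_socle_Bt:
  assumes "w \<in> U (Suc d)" "\<And>x. x \<in> set xs \<Longrightarrow> x w \<in> Bt (Suc (Suc d))"
  shows "w \<in> Bt (Suc d)"
  using assms no_socle[of w "d - 1"] by (cases d) (auto simp: Bt_def socle_def)

text \<open>McCoy's argument: a generic linear form annihilates no nonzero polynomial in the parameter
  with coefficients in a module without socle.\<close>

lemma mccoy:
  assumes "\<And>e. f e \<in> U (Suc d)" "\<And>e. e \<ge> E \<Longrightarrow> f e \<in> Bt (Suc d)"
    and "\<And>m. (\<Sum>k | k < length xs \<and> k \<le> m. (xs ! k) (f (m - k))) \<in> Bt (Suc (Suc d))"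
  shows "f e \<in> Bt (Suc d)"
  using assms
proof (induction E arbitrary: f d e)
  case (Suc E)
  let ?C = "Bt (Suc (Suc d))" and ?r = "length xs"
  \<comment> \<open>Strong induction on \<open>j\<close>: in the convolution of index
    \<open>j\<close> all terms other than \<open>x_j f_0\<close> are known to lie in
    \<open>?C\<close>, so this one does. Then \<open>x_j f\<close>, shifted by one, has a smaller
    bound \<open>E\<close> and satisfies the same hypotheses one degree higher.\<close>
  have "\<forall>e. (xs ! j) (f e) \<in> ?C" if "j < ?r" for j
    using that
  proof (induction j rule: less_induct)
    case (less j)
    have xj: "xs ! j \<in> set xs" using less.prems by simp
    have "(\<Sum>k | k < ?r \<and> k \<le> j. (xs ! k) (f (j - k)))
        = (xs ! j) (f 0) + (\<Sum>k | k < j. (xs ! k) (f (j - k)))"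
    proof -
      have "{k. k < ?r \<and> k \<le> j} = insert j {k. k < j}" using less.prems by auto
      then show ?thesis by simp
    qed
    moreover have "(\<Sum>k | k < j. (xs ! k) (f (j - k))) \<in> ?C"
      by (rule subspace_sum[OF Bt_sub]) (use less in auto)
    ultimately have f0: "(xs ! j) (f 0) \<in> ?C"
      using Suc.prems(3)[of j] subspace_diff[OF Bt_sub, of _ "Suc (Suc d)"] by fastforce
    define g where "g e = (xs ! j) (f (Suc e))" for e
    have "g e \<in> ?C" for e
    proof (rule Suc.IH)
      show "g e \<in> U (Suc (Suc d))" for e using x_U[OF xj Suc.prems(1)] by (simp add: g_def)
      show "g e \<in> ?C" if "e \<ge> E" for e using x_Bt[OF xj Suc.prems(2)] that by (simp add: g_def)
      fix m
      let ?A = "{k. k < ?r \<and> k \<le> m}"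
      \<comment> \<open>The convolution of \<open>g\<close> is \<open>x_j\<close> times that of
        \<open>f\<close> without the term in \<open>f 0\<close>; by commutativity the missing term
        is a multiple of \<open>x_j f_0\<close>, which \<open>f0\<close> covers.\<close>
      have "(\<Sum>k\<in>?A. (xs ! k) (g (m - k))) = (xs ! j) (\<Sum>k\<in>?A. (xs ! k) (f (Suc m - k)))"
        unfolding x_sum[OF xj] g_def
        by (intro sum.cong) (use xj in \<open>auto simp: Suc_diff_le intro: x_com\<close>)
      also have "\<dots> \<in> Bt (Suc (Suc (Suc d)))"
      proof (cases "Suc m < ?r")
        case True
        have "{k. k < ?r \<and> k \<le> Suc m} = insert (Suc m) ?A" using True by auto
        then have eq: "(\<Sum>k\<in>?A. (xs ! k) (f (Suc m - k)))
            = (\<Sum>k | k < ?r \<and> k \<le> Suc m. (xs ! k) (f (Suc m - k))) - (xs ! Suc m) (f 0)"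
          by simp
        have xm: "xs ! Suc m \<in> set xs" using True by simp
        have "(xs ! j) ((xs ! Suc m) (f 0)) = (xs ! Suc m) ((xs ! j) (f 0))" using x_com xj xm by blast
        then show ?thesis unfolding eq x_diff[OF xj]
          using x_Bt[OF xj Suc.prems(3)] x_Bt[OF xm f0] subspace_diff[OF Bt_sub] by metis
      next
        case False
        then have "{k. k < ?r \<and> k \<le> Suc m} = ?A" by auto
        then show ?thesis using x_Bt[OF xj Suc.prems(3)[of "Suc m"]] by simp
      qed
      finally show "(\<Sum>k\<in>?A. (xs ! k) (g (m - k))) \<in> Bt (Suc (Suc (Suc d)))" .
    qed
    then have "(xs ! j) (f e) \<in> ?C" for e using f0 by (cases e) (auto simp: g_def)
    then show ?case by blast
  qed
  then have "x (f e) \<in> ?C" if "x \<in> set xs" for x using that by (metis in_set_conv_nth)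
  then show ?case using no_socle_Bt Suc.prems(1) by blast
qed auto

text \<open>The dichotomy of \<open>generic_independence\<close> is applied to the images of a basis
  of \<open>U\<close> modulo \<open>Bt\<close>. A polynomial relation valid for all parameters would
  give a polynomial with coefficients in \<open>U\<close> killed by the generic form; McCoy's
  argument puts these coefficients into \<open>Bt\<close>, against independence of the
  basis.\<close>

lemma finite_bad: "finite {t. \<exists>w\<in>U (Suc d). w \<notin> Bt (Suc d) \<and> gen_form scale t xs w \<in> B (Suc (Suc d))}"
proof -
  let ?r = "length xs"
  obtain E0 E where E: "finite E0" "finite E" "E0 \<inter> E = {}" "independent (E0 \<union> E)"
    "span E0 = Bt (Suc d)" "span (E0 \<union> E) = U (Suc d)"
    using extend_to_basis[OF fin_U Bt_sub Bt_U] by metis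
  let ?v = "\<lambda>w t. gen_form scale t xs w"
  have EU: "E \<subseteq> U (Suc d)" using E(6) span_superset by blast
  have indep: "\<forall>e\<in>E. c e = 0" if c: "(\<Sum>e\<in>E. scale (c e) e) \<in> Bt (Suc d)" for c
  proof -
    obtain u where u: "(\<Sum>e\<in>E. scale (c e) e) = (\<Sum>e\<in>E0. scale (u e) e)"
      using span_finite[OF E(1)] E(5) c by auto
    let ?r = "\<lambda>e. if e \<in> E then c e else - u e"
    have "(\<Sum>e\<in>E0 \<union> E. scale (?r e) e) = (\<Sum>e\<in>E0. scale (?r e) e) + (\<Sum>e\<in>E. scale (?r e) e)"
      using E(1-3) by (rule sum.union_disjoint)
    also have "(\<Sum>e\<in>E0. scale (?r e) e) = - (\<Sum>e\<in>E0. scale (u e) e)"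
      unfolding sum_negf[symmetric] using E(3) by (intro sum.cong) auto
    also have "(\<Sum>e\<in>E. scale (?r e) e) = (\<Sum>e\<in>E. scale (c e) e)" by (intro sum.cong) auto
    finally have "(\<Sum>e\<in>E0 \<union> E. scale (?r e) e) = 0" using u by simp
    then have "\<forall>e\<in>E0 \<union> E. ?r e = 0"
      by (rule independent_iff_sum[THEN iffD1, OF finite_UnI[OF E(1,2)] E(4), THEN spec, THEN mp])
    then show ?thesis by (metis UnI2)
  qed
  have "polyfun scale (?v w)" for w
    unfolding polyfun_def gen_form_def
    by (intro exI[of _ ?r] exI[of _ "\<lambda>k. (xs ! k) w"]) simp
  then have dich: "finite {t. \<exists>c. (\<exists>i\<in>E. c i \<noteq> 0) \<and> (\<Sum>i\<in>E. scale (c i) (?v i t)) \<in> B (Suc (Suc d))} \<or>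
    (\<exists>p. (\<exists>i\<in>E. p i \<noteq> 0) \<and> (\<forall>t. (\<Sum>i\<in>E. scale (poly (p i) t) (?v i t)) \<in> B (Suc (Suc d))))"
    by (intro generic_independence B_sub E(2))
  have "\<not> (\<exists>p. (\<exists>i\<in>E. p i \<noteq> 0) \<and> (\<forall>t. (\<Sum>i\<in>E. scale (poly (p i) t) (?v i t)) \<in> B (Suc (Suc d))))"
  proof
    assume "\<exists>p. (\<exists>i\<in>E. p i \<noteq> 0) \<and> (\<forall>t. (\<Sum>i\<in>E. scale (poly (p i) t) (?v i t)) \<in> B (Suc (Suc d)))"
    then obtain p where p: "\<exists>i\<in>E. p i \<noteq> 0" "\<And>t. (\<Sum>i\<in>E. scale (poly (p i) t) (?v i t)) \<in> B (Suc (Suc d))" by blast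
    define N where "N = Suc (Max (insert 0 ((\<lambda>i. degree (p i)) ` E)))"
    have deg: "degree (p i) < N" if "i \<in> E" for i
      unfolding N_def less_Suc_eq_le using that E(2) by (intro Max_ge) auto
    define f where "f e = (\<Sum>i\<in>E. scale (poly.coeff (p i) e) i)" for e
    have fU: "f e \<in> U (Suc d)" for e unfolding f_def using EU by (intro U_sum U_scale) auto
    have f0: "f e = 0" if "e \<ge> N" for e
      unfolding f_def
      by (intro sum.neutral ballI) (metis deg that coeff_eq_0 less_le_trans scale_zero_left)
    define cv where "cv m = (\<Sum>k | k < ?r \<and> k \<le> m. (xs ! k) (f (m - k)))" for m
    have fpoly: "(\<Sum>i\<in>E. scale (poly (p i) t) i) = (\<Sum>e<N. scale (t ^ e) (f e))" for t
    proof -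
      have "poly (p i) t = (\<Sum>e<N. t ^ e * poly.coeff (p i) e)" if "i \<in> E" for i
        unfolding poly_altdef using deg[OF that]
        by (intro sum.mono_neutral_cong_left) (auto simp: mult.commute coeff_eq_0)
      then have "(\<Sum>i\<in>E. scale (poly (p i) t) i) = (\<Sum>i\<in>E. \<Sum>e<N. scale (t ^ e * poly.coeff (p i) e) i)"
        by (intro sum.cong) (auto simp: scale_sum_left)
      also have "\<dots> = (\<Sum>e<N. \<Sum>i\<in>E. scale (t ^ e * poly.coeff (p i) e) i)" by (rule sum.swap)
      finally show ?thesis by (simp add: f_def scale_sum_right)
    qed
    \<comment> \<open>The Cauchy product of the form and of \<open>f\<close>, both as polynomials in
      \<open>t\<close>; its coefficients are the convolutions \<open>cv m\<close> to which
      \<open>mccoy\<close> refers.\<close>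
    have gf: "gen_form scale t xs (\<Sum>e<N. scale (t ^ e) (f e)) = (\<Sum>m<?r + N. scale (t ^ m) (cv m))" for t
    proof -
      let ?g = "\<lambda>k e. scale (t ^ (k + e)) ((xs ! k) (f e))"
      have "gen_form scale t xs (\<Sum>e<N. scale (t ^ e) (f e)) = (\<Sum>k<?r. \<Sum>e<N. ?g k e)"
        unfolding gen_form_def
        by (intro sum.cong) (auto simp: x_sum x_scale scale_sum_right power_add)
      also have "\<dots> = (\<Sum>(k, e)\<in>{..<?r} \<times> {..<N}. ?g k e)" by (simp add: sum.cartesian_product)
      also have "\<dots> = (\<Sum>(k, m)\<in>{(k, m). k < ?r \<and> k \<le> m \<and> m - k < N}. scale (t ^ m) ((xs ! k) (f (m - k))))"
        by (rule sum.reindex_bij_witness[where j = "\<lambda>(k, e). (k, k + e)" and i = "\<lambda>(k, m). (k, m - k)"]) auto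
      also have "\<dots> = (\<Sum>(k, m)\<in>{(k, m). k < ?r \<and> k \<le> m \<and> m < ?r + N}. scale (t ^ m) ((xs ! k) (f (m - k))))"
      proof (rule sum.mono_neutral_left)
        have "{(k, m). k < ?r \<and> k \<le> m \<and> m < ?r + N} \<subseteq> {..<?r} \<times> {..<?r + N}" by auto
        then show "finite {(k, m). k < ?r \<and> k \<le> m \<and> m < ?r + N}" using finite_subset by blast
        show "\<forall>i\<in>{(k, m). k < ?r \<and> k \<le> m \<and> m < ?r + N} - {(k, m). k < ?r \<and> k \<le> m \<and> m - k < N}.
            (case i of (k, m) \<Rightarrow> scale (t ^ m) ((xs ! k) (f (m - k)))) = 0"
        proof (intro ballI)
          fix i assume "i \<in> {(k, m). k < ?r \<and> k \<le> m \<and> m < ?r + N} - {(k, m). k < ?r \<and> k \<le> m \<and> m - k < N}"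
          then obtain k m where i: "i = (k, m)" "k < ?r" "m - k \<ge> N" by force
          then show "(case i of (k, m) \<Rightarrow> scale (t ^ m) ((xs ! k) (f (m - k)))) = 0"
            using f0[of "m - k"] x_zero[of "xs ! k"] by simp
        qed
      qed auto
      also have "{(k, m). k < ?r \<and> k \<le> m \<and> m < ?r + N} = prod.swap ` (SIGMA m:{..<?r + N}. {k. k < ?r \<and> k \<le> m})"
        by auto
      also have "(\<Sum>(k, m)\<in>prod.swap ` (SIGMA m:{..<?r + N}. {k. k < ?r \<and> k \<le> m}). scale (t ^ m) ((xs ! k) (f (m - k))))
          = (\<Sum>(m, k)\<in>(SIGMA m:{..<?r + N}. {k. k < ?r \<and> k \<le> m}). scale (t ^ m) ((xs ! k) (f (m - k))))"
        by (subst sum.reindex) (auto simp: inj_on_def case_prod_unfold)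
      also have "\<dots> = (\<Sum>m<?r + N. \<Sum>k | k < ?r \<and> k \<le> m. scale (t ^ m) ((xs ! k) (f (m - k))))"
        by (simp add: sum.Sigma)
      finally show ?thesis by (simp add: cv_def scale_sum_right)
    qed
    have cvs: "(\<Sum>m<?r + N. scale (t ^ m) (cv m)) \<in> B (Suc (Suc d))" for t
    proof -
      have "(\<Sum>i\<in>E. scale (poly (p i) t) (?v i t)) = gen_form scale t xs (\<Sum>i\<in>E. scale (poly (p i) t) i)"
        using linear_gen_form by (simp add: pair.linear_sum pair.linear_scale)
      then show ?thesis using p(2)[of t] fpoly gf by simp
    qed
    have inf: "infinite (UNIV :: 'k set)" using uncountable_field countable_finite by blast
    have cvB: "cv m \<in> B (Suc (Suc d))" if "m < ?r + N" for m
      by (rule polynomial_coefficients_mem[OF B_sub inf cvs that])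
    have cvB': "cv m \<in> B (Suc (Suc d))" for m
    proof (cases "m < ?r + N")
      case False
      then have "cv m = 0" unfolding cv_def
        by (intro sum.neutral ballI) (auto simp: f0 x_zero)
      then show ?thesis using B_zero by simp
    qed (rule cvB)
    have "f e \<in> Bt (Suc d)" for e
      by (rule mccoy[where E = N]) (use fU f0 subspace_0[OF Bt_sub] cvB' in \<open>auto simp: cv_def\<close>)
    then have "\<forall>i\<in>E. poly.coeff (p i) e = 0" for e using indep[of "\<lambda>i. poly.coeff (p i) e"] by (simp add: f_def)
    then show False using p(1) by (metis poly_eqI coeff_0)
  qed
  then have fin: "finite {t. \<exists>c. (\<exists>i\<in>E. c i \<noteq> 0) \<and> (\<Sum>i\<in>E. scale (c i) (?v i t)) \<in> B (Suc (Suc d))}"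
    using dich by blast
  show ?thesis
  proof (rule finite_subset[OF subsetI fin])
    fix t assume "t \<in> {t. \<exists>w\<in>U (Suc d). w \<notin> Bt (Suc d) \<and> gen_form scale t xs w \<in> B (Suc (Suc d))}"
    then obtain w where w: "w \<in> U (Suc d)" "w \<notin> Bt (Suc d)" "gen_form scale t xs w \<in> B (Suc (Suc d))" by blast
    have "w \<in> {x + y |x y. x \<in> span E0 \<and> y \<in> span E}" using w(1) E(6) by (metis span_Un)
    then obtain b c where b: "b \<in> Bt (Suc d)" and c: "w = b + (\<Sum>e\<in>E. scale (c e) e)"
      using E(5) span_finite[OF E(2)] by auto
    have "(\<exists>i\<in>E. c i \<noteq> 0)"
    proof (rule ccontr)
      assume "\<not> (\<exists>i\<in>E. c i \<noteq> 0)"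
      then have "(\<Sum>e\<in>E. scale (c e) e) = 0" by (intro sum.neutral) auto
      then show False using b c w(2) by simp
    qed
    moreover have "gen_form scale t xs b \<in> B (Suc (Suc d))"
      unfolding gen_form_def using x_Bt[OF _ b] by (intro B_sum B_scale) auto
    then have "(\<Sum>i\<in>E. scale (c i) (?v i t)) \<in> B (Suc (Suc d))"
    proof -
      assume gb: "gen_form scale t xs b \<in> B (Suc (Suc d))"
      have "(\<Sum>i\<in>E. scale (c i) (?v i t)) = gen_form scale t xs w - gen_form scale t xs b"
        unfolding c using linear_gen_form by (simp add: pair.linear_add pair.linear_sum pair.linear_scale)
      then show ?thesis using B_diff[OF w(3) gb] by simp
    qed
    ultimately show "t \<in> {t. \<exists>c. (\<exists>i\<in>E. c i \<noteq> 0) \<and> (\<Sum>i\<in>E. scale (c i) (?v i t)) \<in> B (Suc (Suc d))}" by blast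
  qed
qed

definition good :: "'k \<Rightarrow> bool" where
  "good t \<longleftrightarrow> (\<forall>d. \<forall>w\<in>U (Suc d). gen_form scale t xs w \<in> B (Suc (Suc d)) \<longrightarrow> w \<in> Bt (Suc d))"

text \<open>Each degree excludes finitely many parameters and all degrees together countably many;
  an uncountable field leaves infinitely many.\<close>

lemma infinite_good: "infinite {t. good t}"
proof
  assume fin: "finite {t. good t}"
  let ?bad = "\<lambda>d. {t. \<exists>w\<in>U (Suc d). w \<notin> Bt (Suc d) \<and> gen_form scale t xs w \<in> B (Suc (Suc d))}"
  have "UNIV = {t. good t} \<union> (\<Union>d. ?bad d)" by (auto simp: good_def)
  moreover have "countable ({t. good t} \<union> (\<Union>d. ?bad d))"
    by (intro countable_Un countable_UN countable_finite[OF fin] countable_finite[OF finite_bad]) simp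
  ultimately show False using uncountable_field by simp
qed

end

section \<open>The section by a good form is regular over one variable fewer\<close>

lemma koszul_off_length:
  assumes "commuting xs" "\<And>bs. length bs \<noteq> length xs \<Longrightarrow> g bs = 0" "length bs \<noteq> length xs"
  shows "koszul xs g bs = 0"
  using assms
proof (induction xs g bs rule: koszul.induct)
  case (1 x xs f bs)
  then show ?case by (simp add: commuting_Cons)
next
  case (2 x xs f bs)
  then show ?case by (simp add: commuting_Cons additive.zero)
qed auto

context regular_pencil
begin

text \<open>\<open>good\<close> speaks of positive degrees. In degree 0 the absence of linear
  relations applies, read off at the variable with coefficient t^0 = 1.\<close>

lemma good_zero:
  assumes "good t" "xs \<noteq> []" "u \<in> U 0" "gen_form scale t xs u \<in> B (Suc 0)"
  shows "u \<in> B 0"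
proof -
  have "(\<Sum>k<length xs. (xs ! k) (scale (t ^ k) u)) \<in> B (Suc 0)"
    using assms(4) by (simp add: gen_form_def x_scale)
  from inj1[OF _ this, of 0] show ?thesis using assms(2,3) U_scale by auto
qed

lemma gen_form_U:
  assumes "u \<in> U d"
  shows "gen_form scale t xs u \<in> U (Suc d)"
proof -
  have "(xs ! k) u \<in> U (Suc d)" if "k \<in> {..<length xs}" for k
    by (rule x_U[OF nth_mem assms]) (use that in simp)
  from U_sum[OF U_scale[OF this]] show ?thesis unfolding gen_form_def .
qed

lemma gen_form_B:
  assumes "u \<in> B d"
  shows "gen_form scale t xs u \<in> B (Suc d)"
proof -
  have "(xs ! k) u \<in> B (Suc d)" if "k \<in> {..<length xs}" for k
    by (rule x_B[OF nth_mem assms]) (use that in simp)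
  from B_sum[OF B_scale[OF this]] show ?thesis unfolding gen_form_def .
qed

lemma gen_form_Bt:
  assumes "u \<in> Bt (Suc d)"
  shows "gen_form scale t xs u \<in> B (Suc (Suc d))"
proof -
  have "(xs ! k) u \<in> B (Suc (Suc d))" if "k \<in> {..<length xs}" for k
    using x_Bt[OF nth_mem assms, of k] that by simp
  from B_sum[OF B_scale[OF this]] show ?thesis unfolding gen_form_def .
qed

text \<open>Modulo the relations, multiplication by a good form is injective in every degree except
  1, where its kernel is the socle.\<close>

lemma dim_section:
  assumes g: "good t" and ne: "xs \<noteq> []"
  shows "hil (section_rels (gen_form scale t xs) U B) (Suc d)
    = hil B (Suc d) - hil B d + (if d = Suc 0 then int (socle_dim xs B) else 0)"
proof -
  have ker: "{u \<in> U d. gen_form scale t xs u \<in> B (Suc d)} = Bt d"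
  proof (cases d)
    case 0
    then show ?thesis using good_zero[OF g ne] gen_form_B[of _ 0] subsetD[OF B_U[of 0]] by (auto simp: Bt_def)
  next
    case (Suc d')
    then show ?thesis using g gen_form_Bt subsetD[OF Bt_U[of "Suc d'"]] by (auto simp: good_def)
  qed
  have "int (dim (Bt d)) + int (dim (section_rels (gen_form scale t xs) U B (Suc d)))
      = int (dim (U d)) + int (dim (B (Suc d)))"
    using pair.rank_nullity_mod[OF linear_gen_form fin_U[of d] fin_B[of "Suc d"], of t]
    unfolding ker section_rels_simps of_nat_add[symmetric] by (rule arg_cong)
  moreover have "int (dim (Bt d)) - int (dim (B d)) = (if d = Suc 0 then int (socle_dim xs B) else 0)"
    using dim_subset_le[OF fin_socle B_socle] unfolding Bt_def socle_dim_def by (cases "d = Suc 0") simp_all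
  ultimately show ?thesis unfolding hil_def by linarith
qed

lemma dim_section_0: "hil (section_rels l U B) 0 = hil B 0"
  by (simp add: hil_def)

lemma section_subspace:
  assumes "Vector_Spaces.linear scale scale l" "\<And>d u. u \<in> U d \<Longrightarrow> l u \<in> U (Suc d)"
  shows "subspace (section_rels l U B d)" "section_rels l U B d \<subseteq> U d" "B d \<subseteq> section_rels l U B d"
proof -
  have l0: "l 0 = 0" using assms(1) by (rule pair.linear_0)
  show "subspace (section_rels l U B d)"
  proof (cases d)
    case (Suc d')
    have "section_rels l U B d = {x + y |x y. x \<in> l ` U d' \<and> y \<in> B (Suc d')}" using Suc by auto
    then show ?thesis using subspace_sums[OF pair.linear_subspace_image[OF assms(1) U_subspace] B_sub] by simp
  qed (simp add: B_sub)
  show "section_rels l U B d \<subseteq> U d"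
    using assms(2) B_U by (cases d) (auto intro!: U_add)
  show "B d \<subseteq> section_rels l U B d"
  proof (cases d)
    case (Suc d')
    have "b \<in> section_rels l U B d" if "b \<in> B d" for b
      using that l0 U_zero unfolding Suc section_rels_simps
      by (intro CollectI exI[of _ 0] exI[of _ b]) simp
    then show ?thesis by blast
  qed simp
qed

end

text \<open>Since \<open>x\<close> has coefficient 1 in the form, modulo the form it is a
  combination of the \<open>ys\<close>. So the section is a module over the remaining variables, and
  \<open>coefs\<close> are the coefficients of the form at these.\<close>

locale regular_pencil_Cons = regular_pencil scale U "x # ys" B
  for scale :: "'k::field \<Rightarrow> 'v::ab_group_add \<Rightarrow> 'v" and U x ys B +
  fixes t :: 'k
  assumes t: "good t"
begin

abbreviation "l \<equiv> gen_form scale t (x # ys)"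
abbreviation "B' \<equiv> section_rels l U B"

definition coefs :: "('v \<Rightarrow> 'v) list" where
  "coefs = map (\<lambda>k. scale (t ^ Suc k)) [0..<length ys]"

lemma length_coefs [simp]: "length coefs = length ys"
  by (simp add: coefs_def)

lemma l_eq: "l v = x v + lincomb coefs ys v"
proof -
  have "lincomb as zs v = (\<Sum>k<length zs. (as ! k) ((zs ! k) v))" if "length as = length zs" for as zs :: "('v \<Rightarrow> 'v) list"
    using that by (induction as zs rule: list_induct2) (auto simp: sum.lessThan_Suc_shift simp del: sum.lessThan_Suc)
  then have "lincomb coefs ys v = (\<Sum>k<length ys. scale (t ^ Suc k) ((ys ! k) v))"
    by (simp add: coefs_def)
  then show ?thesis
    by (simp add: gen_form_def sum.lessThan_Suc_shift del: sum.lessThan_Suc)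
qed

lemma coefs_additive: "\<forall>a\<in>set coefs. additive a"
  by (auto simp: coefs_def additive_def scale_right_distrib)

lemma coefs_commute: "\<forall>a\<in>set coefs. \<forall>y\<in>set ys. \<forall>v. a (y v) = y (a v)"
  by (simp add: coefs_def x_scale)

lemma coefs_U: "\<forall>a\<in>set coefs. \<forall>u\<in>U d. a u \<in> U d"
  by (simp add: coefs_def U_scale)

lemma com_ys: "commuting ys"
  using com unfolding commuting_Cons by blast

lemma additive_x: "additive x"
  using com unfolding commuting_Cons by blast

lemma l_add: "l (u + v) = l u + l v" by (rule pair.linear_add[OF linear_gen_form])
lemma l_0: "l 0 = 0" by (rule pair.linear_0[OF linear_gen_form])

lemma y_l: "y \<in> set ys \<Longrightarrow> y (l u) = l (y u)"
proof -
  assume "y \<in> set ys"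
  then have y: "y \<in> set (x # ys)" by simp
  show ?thesis
    unfolding gen_form_def x_sum[OF y] x_scale[OF y]
    by (intro sum.cong refl) (simp only: lessThan_iff x_com[OF y nth_mem])
qed

lemma koszul_l: "l (koszul ys f bs) = koszul ys (\<lambda>bs. l (f bs)) bs"
  by (rule koszul_hom[where S = UNIV]) (auto simp: list_all2_same y_l l_add)

lemma koszul_ys_B: "(\<And>bs. f bs \<in> B d) \<Longrightarrow> koszul ys f bs \<in> B (Suc d)"
  by (rule koszul_mem[where S = "B d"]) (auto intro: x_B B_zero B_add B_neg)

lemma koszul_ys_U: "(\<And>bs. f bs \<in> U d) \<Longrightarrow> koszul ys f bs \<in> U (Suc d)"
  by (rule koszul_mem[where S = "U d"]) (auto intro: x_U U_zero U_add U_neg)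

lemma wedge_mem:
  assumes "\<And>bs. f bs \<in> S" "subspace S"
  shows "wedge coefs f bs \<in> S"
proof -
  have "wedge as f bs \<in> S" if "\<forall>a\<in>set as. \<forall>u\<in>S. a u \<in> S" "\<And>bs. f bs \<in> S" for as f and bs
    using that
  proof (induction as f bs rule: wedge.induct)
    case (1 a as f bs)
    then show ?case using subspace_diff[OF assms(2)] by simp
  qed (use subspace_0[OF assms(2)] in auto)
  then show ?thesis using assms subspace_scale[OF assms(2)] by (auto simp: coefs_def)
qed

text \<open>With K the differential over \<open>ys\<close>, write K p = l y modulo \<open>B\<close>.
  Cartan's formula for the vector \<open>coefs\<close> shows that p - coefs wedge y and - y form a
  chain over \<open>x # ys\<close> that is closed modulo \<open>B\<close>. If (w, w') has this chain
  as boundary, then w - coefs wedge w' has boundary p up to multiples of \<open>l\<close>.\<close>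

lemma section_exact:
  assumes p: "p \<in> chains (length ys) i (U (Suc (Suc d)))"
    and k: "\<And>bs. koszul ys p bs \<in> B' (Suc (Suc (Suc d)))"
  shows "\<exists>q\<in>chains (length ys) (Suc i) (U (Suc d)). \<forall>bs. p bs - koszul ys q bs \<in> B' (Suc (Suc d))"
proof -
  let ?r = "length ys" and ?d2 = "Suc (Suc d)" and ?d3 = "Suc (Suc (Suc d))"
  have x0: "x 0 = 0" using additive_x by (rule additive.zero)
  \<comment> \<open>\<open>y\<close> has exterior degree \<open>i - 1\<close>, which does not exist
    for \<open>i = 0\<close>, where \<open>y\<close> is 0. The properties used later are therefore
    collected here for both cases.\<close>
  have "\<exists>y. (\<forall>bs. y bs \<in> U ?d2) \<and> (\<forall>bs. koszul ys p bs - l (y bs) \<in> B ?d3)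
      \<and> (\<forall>z\<in>chains ?r i (U ?d2). cone z (- y) \<in> chains (Suc ?r) i (U ?d2))
      \<and> wedge coefs y \<in> chains ?r i (U ?d2) \<and> (\<forall>bs. length bs \<noteq> ?r \<longrightarrow> y bs = 0)"
  proof (cases i)
    case 0
    have z: "koszul ys p = (\<lambda>_. 0)" using koszul_chains_0[OF com_ys] p 0 by blast
    have w0: "wedge coefs (\<lambda>_. 0) = (\<lambda>_. 0)" using wedge_zero[OF coefs_additive] by (simp add: fun_eq_iff)
    have c: "cone z (- (\<lambda>_. 0)) \<in> chains (Suc ?r) 0 (U ?d2)" if "z \<in> chains ?r 0 (U ?d2)" for z
      using cone_chains_0[OF that] by (simp add: fun_Compl_def)
    show ?thesis
      using z w0 c 0 U_zero B_zero l_0 by (intro exI[of _ "\<lambda>_. 0"]) (auto intro: chains_zero)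
  next
    case (Suc i')
    have kU: "koszul ys p \<in> chains ?r i' (U ?d3)"
      by (rule koszul_chains) (use p Suc com_ys in \<open>auto intro: x_U U_zero U_add U_neg\<close>)
    have "\<exists>y\<in>chains ?r i' (U ?d2). \<forall>bs. (\<lambda>w u. u - l w \<in> B ?d3) (y bs) (koszul ys p bs)"
    proof (rule chains_lift[OF kU])
      fix u assume "u \<in> range (koszul ys p)"
      then have "u \<in> B' ?d3" using k by blast
      then obtain w b where "w \<in> U ?d2" "b \<in> B ?d3" "u = l w + b" by auto
      then show "\<exists>w\<in>U ?d2. u - l w \<in> B ?d3" by (intro bexI[of _ w]) auto
    qed (simp add: l_0 B_zero)
    then obtain y where y: "y \<in> chains ?r i' (U ?d2)" "\<And>bs. koszul ys p bs - l (y bs) \<in> B ?d3" by blast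
    have "- y \<in> chains ?r i' (U ?d2)"
      unfolding fun_Compl_def by (rule chains_map[OF y(1)]) (auto intro: U_neg)
    then have c: "cone z (- y) \<in> chains (Suc ?r) i (U ?d2)" if "z \<in> chains ?r i (U ?d2)" for z
      using cone_chains that Suc by blast
    have "wedge coefs y \<in> chains (length coefs) (Suc i') (U ?d2)"
      by (rule wedge_chains) (use y(1) coefs_U coefs_additive U_zero U_diff in \<open>auto intro: additive.zero\<close>)
    then show ?thesis
      using y c Suc chainsD'[OF y(1) U_zero] chainsD0[OF y(1)] by (intro exI[of _ y]) auto
  qed
  then obtain y where yU: "\<And>bs. y bs \<in> U ?d2" and ky: "\<And>bs. koszul ys p bs - l (y bs) \<in> B ?d3"
    and cone_y: "\<And>z. z \<in> chains ?r i (U ?d2) \<Longrightarrow> cone z (- y) \<in> chains (Suc ?r) i (U ?d2)"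
    and wy: "wedge coefs y \<in> chains ?r i (U ?d2)" and y0: "\<And>bs. length bs \<noteq> ?r \<Longrightarrow> y bs = 0" by blast
  \<comment> \<open>From K K p = 0 it follows that \<open>l\<close> kills K y modulo
    \<open>B\<close>; in degree 3 and above a good form kills only elements of
    \<open>B\<close>.\<close>
  have kyB: "koszul ys y bs \<in> B ?d3" for bs
  proof -
    have "koszul ys (\<lambda>bs. koszul ys p bs - l (y bs)) bs \<in> B (Suc ?d3)"
      by (rule koszul_ys_B) (rule ky)
    moreover have "koszul ys (\<lambda>bs. koszul ys p bs - l (y bs)) bs = - l (koszul ys y bs)"
      using koszul_diff[OF com_ys, of "koszul ys p" "\<lambda>bs. l (y bs)" bs] koszul_koszul[OF com_ys, of p bs]
      by (simp add: koszul_l fun_diff_def)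
    ultimately have "l (koszul ys y bs) \<in> B (Suc ?d3)" using B_neg by fastforce
    then show ?thesis using t koszul_ys_U[where f = y and bs = bs, OF yU] unfolding good_def by (metis Bt_Suc)
  qed
  define z where "z = p - wedge coefs y"
  have zc: "z \<in> chains ?r i (U ?d2)" unfolding z_def by (rule chains_diff[OF U_diff p wy])
  let ?f = "cone z (- y)"
  have wk: "koszul ys (wedge coefs y) bs = l (y bs) - x (y bs) - wedge coefs (koszul ys y) bs" if "length bs = ?r" for bs
    using koszul_wedge[OF com_ys length_coefs that coefs_additive coefs_commute, of y] l_eq[of "y bs"]
    by (simp add: algebra_simps)
  have wB: "wedge coefs (koszul ys y) bs \<in> B ?d3" for bs
    by (rule wedge_mem[OF kyB B_sub])
  have fF: "koszul ys z bs + x (- y bs) \<in> B ?d3" for bs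
  proof (cases "length bs = ?r")
    case True
    have "koszul ys z bs + x (- y bs) = (koszul ys p bs - l (y bs)) + wedge coefs (koszul ys y) bs"
      unfolding z_def koszul_diff[OF com_ys] wk[OF True] additive.minus[OF additive_x] by (simp add: algebra_simps)
    then show ?thesis using B_add[OF ky wB] by simp
  next
    case False
    then have "koszul ys z bs = 0" "y bs = 0"
      using koszul_off_length[OF com_ys, where g = z and bs = bs] chainsD0[OF zc] y0 by blast+
    then show ?thesis using x0 B_zero by simp
  qed
  have kf: "koszul (x # ys) ?f bs \<in> B ?d3" for bs
  proof (cases bs)
    case (Cons b bs')
    then show ?thesis
      using fF[of bs'] kyB[of bs'] koszul_neg[OF com_ys, of y bs'] by (cases b) (simp_all add: fun_Compl_def)
  qed (simp add: B_zero)
  have "?f \<in> chains (length (x # ys)) i (U ?d2)" using cone_y[OF zc] by simp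
  from exact[OF this kf] obtain q where q: "q \<in> chains (Suc ?r) (Suc i) (U (Suc d))"
    "\<And>bs. ?f bs - koszul (x # ys) q bs \<in> B ?d2" by auto
  let ?w = "\<lambda>bs. q (False # bs)" and ?w' = "\<lambda>bs. q (True # bs)"
  have w: "?w \<in> chains ?r (Suc i) (U (Suc d))" and w': "?w' \<in> chains ?r i (U (Suc d))"
    using chains_False[OF q(1)] chains_True[OF q(1)] by auto
  have q1: "z bs - (koszul ys ?w bs + x (?w' bs)) \<in> B ?d2" for bs using q(2)[of "False # bs"] by simp
  have q2: "- y bs + koszul ys ?w' bs \<in> B ?d2" for bs using q(2)[of "True # bs"] by simp
  have ww: "wedge coefs ?w' \<in> chains (length coefs) (Suc i) (U (Suc d))"
    by (rule wedge_chains) (use w' coefs_U coefs_additive U_zero U_diff in \<open>auto intro: additive.zero\<close>)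
  define q' where "q' = ?w - wedge coefs ?w'"
  have q'c: "q' \<in> chains ?r (Suc i) (U (Suc d))"
    unfolding q'_def using chains_diff[OF U_diff w, of "wedge coefs ?w'"] ww by simp
  have "p bs - koszul ys q' bs \<in> B' ?d2" for bs
  proof (cases "length bs = ?r")
    case True
    have e1: "koszul ys (wedge coefs ?w') bs = l (?w' bs) - x (?w' bs) - wedge coefs (koszul ys ?w') bs"
      using koszul_wedge[OF com_ys length_coefs True coefs_additive coefs_commute, of ?w'] l_eq[of "?w' bs"]
      by (simp add: algebra_simps)
    have e2: "wedge coefs (- y + koszul ys ?w') bs = - wedge coefs y bs + wedge coefs (koszul ys ?w') bs"
      by (simp only: wedge_add[OF coefs_additive] wedge_neg[OF coefs_additive])
    have e3: "wedge coefs (- y + koszul ys ?w') bs \<in> B ?d2"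
      by (rule wedge_mem[OF _ B_sub]) (use q2 in simp)
    have "p bs - koszul ys q' bs - l (?w' bs)
        = (z bs - (koszul ys ?w bs + x (?w' bs))) - wedge coefs (- y + koszul ys ?w') bs"
      unfolding q'_def koszul_diff[OF com_ys] e1 e2 z_def by (simp add: algebra_simps)
    then have "p bs - koszul ys q' bs - l (?w' bs) \<in> B ?d2" using B_diff[OF q1 e3] by simp
    moreover have "p bs - koszul ys q' bs = l (?w' bs) + (p bs - koszul ys q' bs - l (?w' bs))" by simp
    moreover have "?w' bs \<in> U (Suc d)" using chainsD'[OF w' U_zero] .
    ultimately show ?thesis unfolding section_rels_simps by blast
  next
    case False
    then have "koszul ys q' bs = 0" "p bs = 0"
      using koszul_off_length[OF com_ys, where g = q' and bs = bs] chainsD0[OF q'c] chainsD0[OF p] by blast+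
    then have z: "p bs - koszul ys q' bs = l 0 + 0" using l_0 by simp
    show ?thesis unfolding section_rels_simps z using U_zero B_zero by blast
  qed
  then show ?thesis using q'c by blast
qed

end

text \<open>The last hypothesis says that the quotients \<open>Q j / B\<close> have a direct sum
  inside \<open>W / B\<close>; they are added one at a time, each meeting the previous sum exactly
  in \<open>B\<close>.\<close>

lemma (in vector_space) sum_dims_independent_mod:
  assumes "finite J" "finite_dim scale W" "subspace B" "B \<subseteq> W"
    and "\<And>j. j \<in> J \<Longrightarrow> subspace (Q j)" "\<And>j. j \<in> J \<Longrightarrow> B \<subseteq> Q j" "\<And>j. j \<in> J \<Longrightarrow> Q j \<subseteq> W"
    and "\<And>q. (\<And>j. j \<in> J \<Longrightarrow> q j \<in> Q j) \<Longrightarrow> (\<Sum>j\<in>J. q j) \<in> B \<Longrightarrow> \<forall>j\<in>J. q j \<in> B"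
  shows "(\<Sum>j\<in>J. dim (Q j) - dim B) + dim B \<le> dim W"
proof -
  define S where "S J = {v. \<exists>q. (\<forall>j\<in>J. q j \<in> Q j) \<and> v - (\<Sum>j\<in>J. q j) \<in> B}" for J
  have "subspace (S J) \<and> S J \<subseteq> W \<and> B \<subseteq> S J \<and> (\<Sum>j\<in>J. dim (Q j) - dim B) + dim B = dim (S J)"
    using assms(1,5-8)
  proof (induction J rule: finite_induct)
    case empty
    have "S {} = B" by (simp add: S_def)
    then show ?case using assms(3,4) by simp
  next
    case (insert k J)
    have ind: "\<forall>j\<in>J. q j \<in> B" if q: "\<And>j. j \<in> J \<Longrightarrow> q j \<in> Q j" "(\<Sum>j\<in>J. q j) \<in> B" for q
    proof -
      have "(\<Sum>j\<in>insert k J. (q(k := 0)) j) = (\<Sum>j\<in>J. q j)"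
        unfolding sum.insert[OF insert.hyps] using insert.hyps(2) by (auto intro!: sum.cong)
      moreover have "(q(k := 0)) j \<in> Q j" if "j \<in> insert k J" for j
        using that q(1) subspace_0[OF insert.prems(1)] by auto
      ultimately have "\<forall>j\<in>insert k J. (q(k := 0)) j \<in> B" using insert.prems(4)[of "q(k := 0)"] q(2) by simp
      then show ?thesis using insert.hyps(2) by (metis fun_upd_other insertCI)
    qed
    have IH: "subspace (S J)" "S J \<subseteq> W" "B \<subseteq> S J" "(\<Sum>j\<in>J. dim (Q j) - dim B) + dim B = dim (S J)"
      using insert.IH[OF _ _ _ ind] insert.prems(1-3) by blast+
    have Qk: "subspace (Q k)" "B \<subseteq> Q k" "Q k \<subseteq> W" using insert.prems(1-3) by blast+
    have Sk: "S (insert k J) = {a + b |a b. a \<in> S J \<and> b \<in> Q k}"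
    proof (intro equalityI subsetI)
      fix v assume "v \<in> S (insert k J)"
      then obtain q where q: "\<forall>j\<in>insert k J. q j \<in> Q j" "v - (\<Sum>j\<in>insert k J. q j) \<in> B" unfolding S_def by blast
      have "v - q k - (\<Sum>j\<in>J. q j) \<in> B" using q(2) insert.hyps by (simp add: algebra_simps)
      then have "v - q k \<in> S J" unfolding S_def using q(1) by blast
      moreover have "v = (v - q k) + q k" by simp
      ultimately show "v \<in> {a + b |a b. a \<in> S J \<and> b \<in> Q k}" using q(1) by blast
    next
      fix v assume "v \<in> {a + b |a b. a \<in> S J \<and> b \<in> Q k}"
      then obtain a b q where v: "v = a + b" "b \<in> Q k" "\<forall>j\<in>J. q j \<in> Q j" "a - (\<Sum>j\<in>J. q j) \<in> B" unfolding S_def by blast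
      have "(\<Sum>j\<in>J. (q(k := b)) j) = (\<Sum>j\<in>J. q j)" using insert.hyps by (intro sum.cong) auto
      then have "v - (\<Sum>j\<in>insert k J. (q(k := b)) j) \<in> B" using v(1,4) insert.hyps by (simp add: algebra_simps)
      moreover have "\<forall>j\<in>insert k J. (q(k := b)) j \<in> Q j" using v(2,3) by simp
      ultimately show "v \<in> S (insert k J)" unfolding S_def by blast
    qed
    have int: "S J \<inter> Q k = B"
    proof (intro equalityI subsetI)
      fix v assume v: "v \<in> S J \<inter> Q k"
      then obtain q where q: "\<forall>j\<in>J. q j \<in> Q j" "v - (\<Sum>j\<in>J. q j) \<in> B" unfolding S_def by blast
      have "(\<Sum>j\<in>J. (q(k := - v)) j) = (\<Sum>j\<in>J. q j)" using insert.hyps by (intro sum.cong) auto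
      then have "(\<Sum>j\<in>insert k J. (q(k := - v)) j) = - (v - (\<Sum>j\<in>J. q j))" using insert.hyps by simp
      then have "(\<Sum>j\<in>insert k J. (q(k := - v)) j) \<in> B" using subspace_neg[OF assms(3) q(2)] by simp
      moreover have "(q(k := - v)) j \<in> Q j" if "j \<in> insert k J" for j
        using that q(1) v subspace_neg[OF Qk(1)] by auto
      ultimately have "\<forall>j\<in>insert k J. (q(k := - v)) j \<in> B" using insert.prems(4)[of "q(k := - v)"] by blast
      then have "- v \<in> B" by simp
      then show "v \<in> B" using subspace_neg[OF assms(3)] by fastforce
    qed (use IH(3) Qk(2) in auto)
    have fin: "finite_dim scale (S J)" "finite_dim scale (Q k)"
      using finite_dim_subset[OF assms(2)] IH(1,2) Qk by blast+
    have "dim (S (insert k J)) + dim B = dim (S J) + dim (Q k)"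
      using dim_sums_Int[OF fin] int unfolding Sk by simp
    moreover have "dim B \<le> dim (Q k)" by (rule dim_subset_le[OF fin(2) Qk(2)])
    ultimately have d: "(\<Sum>j\<in>insert k J. dim (Q j) - dim B) + dim B = dim (S (insert k J))"
      using IH(4) insert.hyps by simp
    have "subspace (S (insert k J))" unfolding Sk by (rule subspace_sums[OF IH(1) Qk(1)])
    moreover have "S (insert k J) \<subseteq> W"
      unfolding Sk using IH(2) Qk(3) subspace_add[OF finite_dim_subspace[OF assms(2)]] by blast
    moreover have "B \<subseteq> S (insert k J)"
    proof
      fix b assume "b \<in> B"
      then have "b \<in> S J" "b = b + 0" using IH(3) by auto
      then show "b \<in> S (insert k J)" unfolding Sk using subspace_0[OF Qk(1)] by blast
    qed
    ultimately show ?case using d by blast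
  qed
  then show ?thesis using dim_subset_le[OF assms(2), of "S J"] by metis
qed

section \<open>How much of the socle a section loses\<close>

context regular_pencil
begin

text \<open>The part of the socle that becomes zero in the section with parameter
  \<open>t\<close>.\<close>

definition socle_part :: "'k \<Rightarrow> 'v set" where
  "socle_part t = socle xs B \<inter> section_rels (gen_form scale t xs) U B (Suc 0)"

lemma section_gen_form:
  "subspace (section_rels (gen_form scale t xs) U B d)" "section_rels (gen_form scale t xs) U B d \<subseteq> U d"
  "B d \<subseteq> section_rels (gen_form scale t xs) U B d"
  using section_subspace[OF linear_gen_form gen_form_U] by blast+

lemma socle_part:
  "subspace (socle_part t)" "B (Suc 0) \<subseteq> socle_part t" "socle_part t \<subseteq> socle xs B"
  unfolding socle_part_def
  using subspace_inter[OF socle_subspace section_gen_form(1)] B_socle section_gen_form(3) by blast+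

text \<open>With q_t = l_t u_t modulo \<open>B\<close>, the sum of the q_t is the sum over k of x_k
  applied to the sum over t of t^k u_t. As there are no linear relations, each inner sum lies in
  \<open>B 0\<close>. There are as many exponents k as parameters, so the Vandermonde system puts
  every u_t into \<open>B 0\<close>.\<close>

lemma socle_parts_independent:
  assumes J: "finite J" "card J = length xs"
    and q: "\<And>j. j \<in> J \<Longrightarrow> q j \<in> socle_part j" "(\<Sum>j\<in>J. q j) \<in> B (Suc 0)"
  shows "\<forall>j\<in>J. q j \<in> B (Suc 0)"
proof -
  have "\<exists>u b. u \<in> U 0 \<and> b \<in> B (Suc 0) \<and> q j = gen_form scale j xs u + b" if "j \<in> J" for j
    using q(1)[OF that] by (auto simp: socle_part_def)
  then obtain u b where u: "\<And>j. j \<in> J \<Longrightarrow> u j \<in> U 0" "\<And>j. j \<in> J \<Longrightarrow> b j \<in> B (Suc 0)"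
    "\<And>j. j \<in> J \<Longrightarrow> q j = gen_form scale j xs (u j) + b j" by metis
  have "(\<Sum>j\<in>J. gen_form scale j xs (u j)) = (\<Sum>j\<in>J. q j) - (\<Sum>j\<in>J. b j)"
    using u(3) by (simp add: sum.distrib)
  then have "(\<Sum>j\<in>J. gen_form scale j xs (u j)) \<in> B (Suc 0)"
    using B_diff[OF q(2) B_sum[OF u(2)]] by simp
  moreover have "(\<Sum>j\<in>J. gen_form scale j xs (u j)) = (\<Sum>k<length xs. (xs ! k) (\<Sum>j\<in>J. scale (j ^ k) (u j)))"
    unfolding gen_form_def sum.swap[of _ "{..<length xs}" J]
    by (simp add: x_sum x_scale)
  ultimately have lin0: "(\<Sum>k<length xs. (xs ! k) (\<Sum>j\<in>J. scale (j ^ k) (u j))) \<in> B (Suc 0)" by simp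
  have "(\<Sum>j\<in>J. scale (j ^ k) (u j)) \<in> B 0" if "k < length xs" for k
  proof -
    have "(\<Sum>j\<in>J. scale (j ^ k) (u j)) \<in> U 0" for k by (rule U_sum, rule U_scale, rule u(1))
    then show ?thesis using inj1[of "\<lambda>k. \<Sum>j\<in>J. scale (j ^ k) (u j)", OF _ lin0 that] by blast
  qed
  then have "\<forall>j\<in>J. u j \<in> B 0"
    using vandermonde_mem[OF B_sub J(1), of "\<lambda>j. j"] J(2) by simp
  then have "gen_form scale j xs (u j) + b j \<in> B (Suc 0)" if "j \<in> J" for j
    using B_add[OF gen_form_B u(2)] that by blast
  then show ?thesis using u(3) by simp
qed

text \<open>An average over as many good parameters as there are variables, whose socle parts are
  independent.\<close>

lemma small_socle_part:
  assumes "xs \<noteq> []"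
  shows "\<exists>t. good t \<and> length xs * (dim (socle_part t) - dim (B (Suc 0))) \<le> socle_dim xs B"
proof -
  obtain J where J: "finite J" "card J = length xs" "J \<subseteq> {t. good t}"
    using infinite_arbitrarily_large[OF infinite_good] by blast
  let ?c = "\<lambda>t. dim (socle_part t) - dim (B (Suc 0))"
  have "(\<Sum>j\<in>J. ?c j) + dim (B (Suc 0)) \<le> dim (socle xs B)"
    by (rule sum_dims_independent_mod[OF J(1) fin_socle B_sub B_socle])
      (use socle_part socle_parts_independent[OF J(1,2)] in auto)
  then have le: "(\<Sum>j\<in>J. ?c j) \<le> socle_dim xs B" by (simp add: socle_dim_def)
  have "\<exists>j\<in>J. length xs * ?c j \<le> socle_dim xs B"
  proof (rule ccontr)
    assume "\<not> ?thesis"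
    then have "\<And>j. j \<in> J \<Longrightarrow> Suc (socle_dim xs B) \<le> length xs * ?c j" by fastforce
    then have "(\<Sum>j\<in>J. Suc (socle_dim xs B)) \<le> (\<Sum>j\<in>J. length xs * ?c j)" by (rule sum_mono)
    also have "\<dots> = length xs * (\<Sum>j\<in>J. ?c j)" by (simp add: sum_distrib_left)
    also have "\<dots> \<le> length xs * socle_dim xs B" using le by simp
    finally show False using J(2) assms by simp
  qed
  then show ?thesis using J(3) by blast
qed

end

context regular_pencil_Cons
begin

lemma l_sum: "l u = x u + (\<Sum>k<length ys. scale (t ^ Suc k) ((ys ! k) u))"
  by (simp add: gen_form_def sum.lessThan_Suc_shift del: sum.lessThan_Suc)

lemma sum_Cons: "(\<Sum>k<length (x # ys). ((x # ys) ! k) (v k)) = x (v 0) + (\<Sum>k<length ys. (ys ! k) (v (Suc k)))"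
  by (simp add: sum.lessThan_Suc_shift del: sum.lessThan_Suc)

lemma section_regular: "regular_system ys B'"
  unfolding regular_system_def
proof (intro conjI allI ballI impI)
  show "commuting ys" by (rule com_ys)
  show "subspace (B' d)" "B' d \<subseteq> U d" for d by (rule section_gen_form)+
next
  fix y assume y: "y \<in> set ys"
  then have yx: "y \<in> set (x # ys)" by simp
  show "Vector_Spaces.linear scale scale y" by (rule lin[OF yx])
  show "y u \<in> U (Suc d)" if "u \<in> U d" for u d by (rule x_U[OF yx that])
  fix d u assume u: "u \<in> B' d"
  show "y u \<in> B' (Suc d)"
  proof (cases d)
    case 0
    then show ?thesis using u x_B[OF yx, of u 0] section_gen_form(3)[of "Suc 0" t] by auto
  next
    case (Suc e)
    then obtain w b where w: "w \<in> U e" "b \<in> B (Suc e)" "u = l w + b" using u by auto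
    then have "y u = l (y w) + y b" "y w \<in> U (Suc e)" "y b \<in> B (Suc (Suc e))"
      using y_l[OF y] x_add[OF yx] x_U[OF yx] x_B[OF yx] by auto
    then show ?thesis unfolding Suc section_rels_simps by blast
  qed
next
  fix i d p assume p: "p \<in> chains (length ys) i (U (Suc (Suc d)))" "\<forall>bs. koszul ys p bs \<in> B' (Suc (Suc (Suc d)))"
  show "\<exists>q\<in>chains (length ys) (Suc i) (U (Suc d)). \<forall>bs. p bs - koszul ys q bs \<in> B' (Suc (Suc d))"
    by (rule section_exact[OF p(1)]) (use p(2) in blast)
next
  fix v k assume v: "\<forall>k<length ys. v k \<in> U 0" "(\<Sum>k<length ys. (ys ! k) (v k)) \<in> B' (Suc 0)" and k: "k < length ys"
  obtain u b where u: "u \<in> U 0" "b \<in> B (Suc 0)" "(\<Sum>k<length ys. (ys ! k) (v k)) = l u + b" using v(2) by auto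
  \<comment> \<open>The relation that represents \<open>l u\<close> in terms of the
    \<open>ys\<close> becomes a linear relation over \<open>x # ys\<close>, in which
    \<open>x\<close> receives \<open>- u\<close>.\<close>
  define v' where "v' k = (case k of 0 \<Rightarrow> - u | Suc k \<Rightarrow> v k - scale (t ^ Suc k) u)" for k
  have v'U: "v' k \<in> U 0" if "k < length (x # ys)" for k
    using that v(1) u(1) by (auto simp: v'_def intro!: U_neg U_diff U_scale split: nat.split simp del: power_Suc)
  have ys: "ys ! k \<in> set (x # ys)" if "k < length ys" for k using that by simp
  have "(\<Sum>k<length ys. (ys ! k) (v' (Suc k))) = (\<Sum>k<length ys. (ys ! k) (v k) - scale (t ^ Suc k) ((ys ! k) u))"
    by (intro sum.cong) (auto simp: v'_def x_diff[OF ys] x_scale[OF ys] simp del: power_Suc)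
  then have "(\<Sum>k<length (x # ys). ((x # ys) ! k) (v' k)) = (\<Sum>k<length ys. (ys ! k) (v k)) - l u"
    unfolding sum_Cons l_sum sum_subtractf using x_diff[of x 0 u] x_zero[of x] by (simp add: v'_def del: power_Suc)
  then have "(\<Sum>k<length (x # ys). ((x # ys) ! k) (v' k)) \<in> B (Suc 0)" using u by simp
  from inj1[OF v'U this] have v'B: "v' k \<in> B 0" if "k < length (x # ys)" for k using that by blast
  have "- u \<in> B 0" using v'B[of 0] by (simp add: v'_def)
  then have "u \<in> B 0" using B_neg by fastforce
  moreover have "v k = v' (Suc k) + scale (t ^ Suc k) u" by (simp add: v'_def)
  ultimately show "v k \<in> B' 0" using v'B[of "Suc k"] k B_add B_scale by simp
next
  fix u assume "u \<in> U (Suc 0)"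
  from gen1[OF this] obtain v where v: "\<forall>k<length (x # ys). v k \<in> U 0"
    "u - (\<Sum>k<length (x # ys). ((x # ys) ! k) (v k)) \<in> B (Suc 0)" by blast
  \<comment> \<open>\<open>x\<close> is replaced by \<open>l\<close> minus the remaining terms of
    the form, which moves \<open>v 0\<close> to the other variables.\<close>
  define w where "w k = v (Suc k) - scale (t ^ Suc k) (v 0)" for k
  have wU: "\<forall>k<length ys. w k \<in> U 0" using v(1) U_diff U_scale by (auto simp: w_def simp del: power_Suc)
  have ys: "ys ! k \<in> set (x # ys)" if "k < length ys" for k using that by simp
  have "(\<Sum>k<length ys. (ys ! k) (w k)) = (\<Sum>k<length ys. (ys ! k) (v (Suc k)) - scale (t ^ Suc k) ((ys ! k) (v 0)))"
    by (intro sum.cong) (auto simp: w_def x_diff[OF ys] x_scale[OF ys] simp del: power_Suc)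
  then have "u - (\<Sum>k<length ys. (ys ! k) (w k)) = l (v 0) + (u - (\<Sum>k<length (x # ys). ((x # ys) ! k) (v k)))"
    unfolding sum_Cons l_sum sum_subtractf by simp
  then have "u - (\<Sum>k<length ys. (ys ! k) (w k)) \<in> B' (Suc 0)"
    unfolding section_rels_simps using v by blast
  then show "\<exists>v. (\<forall>k<length ys. v k \<in> U 0) \<and> u - (\<Sum>k<length ys. (ys ! k) (v k)) \<in> B' (Suc 0)" using wU by blast
qed

text \<open>The socle maps into the socle of the section, and what is lost is
  \<open>socle_part t\<close>.\<close>

lemma socle_dim_section:
  "dim (socle (x # ys) B) \<le> socle_dim ys B' + dim (socle_part t)"
proof -
  interpret S: regular_pencil scale U ys B'
    by (rule regular_pencil.intro[OF pencil_axioms]) (simp add: regular_pencil_axioms_def section_regular)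
  let ?S = "{a + b |a b. a \<in> socle (x # ys) B \<and> b \<in> B' (Suc 0)}"
  have fin: "finite_dim scale (B' (Suc 0))" by (rule S.fin_B)
  have "dim ?S + dim (socle_part t) = dim (socle (x # ys) B) + dim (B' (Suc 0))"
    using dim_sums_Int[OF fin_socle fin] unfolding socle_part_def .
  moreover have "?S \<subseteq> socle ys B'"
  proof
    fix v assume "v \<in> ?S"
    then obtain a b where v: "v = a + b" "a \<in> socle (x # ys) B" "b \<in> B' (Suc 0)" by blast
    have "a \<in> socle ys B'"
      using v(2) section_gen_form(3)[of "Suc (Suc 0)" t] unfolding socle_def by auto
    then show "v \<in> socle ys B'"
      unfolding v(1) using subspace_add[OF S.socle_subspace] v(3) S.B_socle by blast
  qed
  then have "dim ?S \<le> dim (socle ys B')" by (rule dim_subset_le[OF S.fin_socle])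
  ultimately show ?thesis unfolding socle_dim_def by linarith
qed

end

text \<open>The numerator of the Hilbert series, expanded in powers of \<open>1 - X\<close>. Its last coefficient is
  the dimension of the socle, and the others are those of a generic hyperplane section.\<close>

definition numerator_coeffs :: "nat \<Rightarrow> int fps \<Rightarrow> (nat \<Rightarrow> nat) \<Rightarrow> bool" where
  "numerator_coeffs r H a \<longleftrightarrow>
    (1 - fps_X) ^ r * H = fps_const (fps_nth H 0) - fps_X\<^sup>2 * (\<Sum>i<r. of_nat (a i) * (1 - fps_X) ^ i) \<and>
    (r > 0 \<longrightarrow> int (a 0) \<le> fps_nth H 0) \<and> (\<forall>i. Suc i < r \<longrightarrow> Suc i * a (Suc i) \<le> Suc (Suc i) * a i)"

section \<open>The numerator by repeated sections\<close>

context pencil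
begin

text \<open>The parameter of the section is the one from \<open>small_socle_part\<close>; together
  with \<open>socle_dim_section\<close> it gives the inequality between the last two coefficients.
  The earlier inequalities are those of the section.\<close>

lemma hilbert_series_numerator:
  assumes "regular_system xs B"
  shows "\<exists>a. numerator_coeffs (length xs) (Abs_fps (hil B)) a \<and>
    (xs \<noteq> [] \<longrightarrow> a (length xs - 1) = socle_dim xs B)"
  using assms
proof (induction xs arbitrary: B)
  case Nil
  interpret regular_pencil scale U "[]" B
    by (rule regular_pencil.intro[OF pencil_axioms]) (simp add: regular_pencil_axioms_def Nil)
  \<comment> \<open>Without variables, generation in degree 0 and the absence of a socle above
    degree 1 leave nothing in positive degrees.\<close>
  have "U (Suc d) \<subseteq> B (Suc d)" for d
    using gen1 no_socle by (cases d) auto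
  then have "B (Suc d) = U (Suc d)" for d using B_U by blast
  then have "hil B (Suc d) = 0" for d by (simp add: hil_def)
  then have "Abs_fps (hil B) = fps_const (hil B 0)"
    by (intro fps_ext) (metis fps_nth_fps_const fps_nth_Abs_fps not0_implies_Suc)
  then show ?case by (simp add: numerator_coeffs_def)
next
  case (Cons x ys)
  interpret regular_pencil scale U "x # ys" B
    by (rule regular_pencil.intro[OF pencil_axioms]) (simp add: regular_pencil_axioms_def Cons.prems)
  let ?r = "length ys" and ?s = "socle_dim (x # ys) B"
  obtain t where t: "good t" "Suc ?r * (dim (socle_part t) - dim (B (Suc 0))) \<le> ?s"
    using small_socle_part by auto
  interpret C: regular_pencil_Cons scale U x ys B t
    by (rule regular_pencil_Cons.intro[OF regular_pencil_axioms]) (simp add: regular_pencil_Cons_axioms_def t(1))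
  let ?B = "section_rels (gen_form scale t (x # ys)) U B"
  obtain a where a: "numerator_coeffs ?r (Abs_fps (hil ?B)) a"
    and last: "ys \<noteq> [] \<longrightarrow> a (?r - 1) = socle_dim ys ?B"
    using Cons.IH[OF C.section_regular] by blast
  have hs: "hil ?B (Suc d) = hil B (Suc d) - hil B d + (if d = Suc 0 then int ?s else 0)" for d
    by (rule dim_section[OF t(1)]) simp
  have h0: "hil ?B 0 = hil B 0" by (rule dim_section_0)
  \<comment> \<open>The extra term sits in degree 2: there the image of multiplication from degree 1
    is smaller by the dimension of the socle.\<close>
  have "Abs_fps (hil ?B) = (1 - fps_X) * Abs_fps (hil B) + fps_X\<^sup>2 * of_nat ?s"
  proof (rule fps_ext)
    fix d
    have "fps_nth (of_nat ?s :: int fps) e = (if e = 0 then int ?s else 0)" for e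
      by (metis fps_nth_fps_const fps_of_nat)
    then have "fps_nth (fps_X\<^sup>2 * of_nat ?s :: int fps) d = (if d = 2 then int ?s else 0)"
      by (simp add: fps_X_power_mult_nth)
    moreover have "fps_nth ((1 - fps_X) * Abs_fps (hil B)) d = hil B d - (if d = 0 then 0 else hil B (d - 1))"
      by (simp add: left_diff_distrib)
    ultimately show "fps_nth (Abs_fps (hil ?B)) d = fps_nth ((1 - fps_X) * Abs_fps (hil B) + fps_X\<^sup>2 * of_nat ?s) d"
      using h0 hs by (cases d) auto
  qed
  then have e: "(1 - fps_X) * Abs_fps (hil B) = Abs_fps (hil ?B) - fps_X\<^sup>2 * of_nat ?s" by simp
  let ?a = "a(?r := ?s)"
  have "(1 - fps_X) ^ Suc ?r * Abs_fps (hil B) = (1 - fps_X) ^ ?r * ((1 - fps_X) * Abs_fps (hil B))"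
    by (simp add: mult.assoc mult.left_commute)
  also have "\<dots> = (1 - fps_X) ^ ?r * Abs_fps (hil ?B) - fps_X\<^sup>2 * (of_nat ?s * (1 - fps_X) ^ ?r)"
    unfolding e by (simp add: algebra_simps)
  also have "(1 - fps_X) ^ ?r * Abs_fps (hil ?B) = fps_const (hil B 0) - fps_X\<^sup>2 * (\<Sum>i<?r. of_nat (?a i) * (1 - fps_X) ^ i)"
    using a h0 by (simp add: numerator_coeffs_def)
  finally have eq: "(1 - fps_X) ^ Suc ?r * Abs_fps (hil B)
      = fps_const (hil B 0) - fps_X\<^sup>2 * (\<Sum>i<Suc ?r. of_nat (?a i) * (1 - fps_X) ^ i)"
    by (simp add: algebra_simps)
  have "int (?a 0) \<le> hil B 0"
  proof (cases "ys = []")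
    case True
    \<comment> \<open>With a single variable the section lives in degree 0, so the Hilbert function
      agrees in degrees 0 and 1, and the socle dimension is its drop from degree 1 to 2.\<close>
    have "hil ?B (Suc d) = 0" for d
    proof -
      have "fps_nth (Abs_fps (hil ?B)) (Suc d) = 0"
        using a True by (simp add: numerator_coeffs_def)
      then show ?thesis by simp
    qed
    then have "hil B 1 = hil B 0" "int ?s = hil B 1 - hil B 2"
      using hs[of 0] hs[of "Suc 0"] by (simp_all add: numeral_2_eq_2)
    moreover have "hil B 2 \<ge> 0" using dim_subset_le[OF fin_U B_U] by (simp add: hil_def)
    ultimately show ?thesis using True by simp
  next
    case False
    then show ?thesis using a h0 by (simp add: numerator_coeffs_def)
  qed
  moreover have "Suc i * ?a (Suc i) \<le> Suc (Suc i) * ?a i" if "Suc i < Suc ?r" for i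
  proof (cases "Suc i = ?r")
    case True
    have "dim (B (Suc 0)) \<le> dim (socle_part t)"
      by (rule dim_subset_le[OF finite_dim_subset[OF fin_socle socle_part(1) socle_part(3)] socle_part(2)])
    moreover have "dim (socle (x # ys) B) \<le> socle_dim ys ?B + dim (socle_part t)" by (rule C.socle_dim_section)
    ultimately have "?s \<le> socle_dim ys ?B + (dim (socle_part t) - dim (B (Suc 0)))"
      unfolding socle_dim_def[of "x # ys"] by linarith
    \<comment> \<open>With r + 1 variables, socle dimensions s and s' of module and section, and
      loss c: s <= s' + c and (r + 1) c <= s give r s <= (r + 1) s'.\<close>
    then have "Suc ?r * ?s \<le> Suc ?r * socle_dim ys ?B + Suc ?r * (dim (socle_part t) - dim (B (Suc 0)))"
      by (metis add_mult_distrib2 mult_le_mono2)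
    then have "?r * ?s \<le> Suc ?r * socle_dim ys ?B" using t(2) by simp
    moreover have "a i = socle_dim ys ?B" using last True by (cases ys) auto
    ultimately show ?thesis using True by (metis fun_upd_apply n_not_Suc_n)
  next
    case False
    then show ?thesis using a that by (simp add: numerator_coeffs_def)
  qed
  ultimately have "numerator_coeffs (length (x # ys)) (Abs_fps (hil B)) ?a"
    using eq by (simp add: numerator_coeffs_def del: sum.lessThan_Suc power_Suc)
  moreover have "?a (length (x # ys) - 1) = ?s" by simp
  ultimately show ?case by blast
qed

end

section \<open>Transfer to Laurent series over the ground field\<close>

section \<open>Extension of the ground field\<close>

text \<open>Generic linear forms need an uncountable field. Relations over \<open>k\<close> are extended to the
  field of Laurent series over \<open>k\<close>, where all conditions can be checked on coefficients.\<close>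

lemma uncountable_fls: "uncountable (UNIV :: 'k::field fls set)"
proof
  assume c: "countable (UNIV :: 'k fls set)"
  \<comment> \<open>Series with coefficients 0 and 1 encode the sets of natural numbers, so a
    diagonal argument applies.\<close>
  define g where "g A = fps_to_fls (Abs_fps (\<lambda>n. if n \<in> A then 1 else 0 :: 'k))" for A :: "nat set"
  have "inj g"
  proof (rule injI)
    fix A A' assume "g A = g A'"
    then have "Abs_fps (\<lambda>n. if n \<in> A then 1 else 0 :: 'k) = Abs_fps (\<lambda>n. if n \<in> A' then 1 else 0)"
      by (simp add: g_def)
    then have e: "fps_nth (Abs_fps (\<lambda>n. if n \<in> A then 1 else 0 :: 'k)) n = fps_nth (Abs_fps (\<lambda>n. if n \<in> A' then 1 else 0)) n" for n
      by simp
    have "n \<in> A \<longleftrightarrow> n \<in> A'" for n using e[of n] by (cases "n \<in> A"; cases "n \<in> A'") auto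
    then show "A = A'" by blast
  qed
  have "countable (range g)" by (rule countable_subset[OF subset_UNIV c])
  then have "countable (UNIV :: nat set set)" by (rule countable_image_inj_on[OF _ \<open>inj g\<close>])
  then obtain f :: "nat \<Rightarrow> nat set" where "range f = UNIV" using uncountable_def[of "UNIV :: nat set set"] by blast
  then obtain k where "f k = {n. n \<notin> f n}" by (metis rangeE UNIV_I)
  then show False by blast
qed

lemma fls_common_bound:
  assumes "finite A"
  shows "\<exists>N. \<forall>a\<in>A. \<forall>e<N. fls_nth (g a) e = 0"
  using assms
proof (induction A rule: finite_induct)
  case (insert a A)
  then obtain N where "\<forall>a\<in>A. \<forall>e<N. fls_nth (g a) e = 0" by blast
  then show ?case by (intro exI[of _ "min N (fls_subdegree (g a))"]) auto
qed simp

definition coeff_fun :: "int \<Rightarrow> ('i \<Rightarrow> 'k::zero fls) \<Rightarrow> 'i \<Rightarrow> 'k" where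
  "coeff_fun e f = (\<lambda>i. fls_nth (f i) e)"

lemma coeff_fun_add: "coeff_fun e (f + g) = coeff_fun e f + coeff_fun e (g :: 'i \<Rightarrow> 'k::monoid_add fls)"
  and coeff_fun_zero: "coeff_fun e (0 :: 'i \<Rightarrow> 'k::monoid_add fls) = 0"
  by (auto simp: coeff_fun_def fun_eq_iff)

lemma coeff_fun_diff: "coeff_fun e (f - g) = coeff_fun e f - coeff_fun e (g :: 'i \<Rightarrow> 'k::ab_group_add fls)"
  by (auto simp: coeff_fun_def fun_eq_iff)

lemma coeff_fun_shift: "coeff_fun e (shift i f) = shift i (coeff_fun e f)"
  by (auto simp: coeff_fun_def shift_def fun_eq_iff)

lemma coeff_fun_coords: "f \<in> coords n G dg d \<longleftrightarrow> (\<forall>e. coeff_fun e f \<in> coords n G dg d)"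
  for f :: "idx \<Rightarrow> 'k::zero fls"
proof -
  have "f i \<noteq> 0 \<longleftrightarrow> (\<exists>e. coeff_fun e f i \<noteq> 0)" for i
    unfolding coeff_fun_def using fls_eq_iff[of "f i" 0] by simp
  then show ?thesis unfolding coords_def by blast
qed

lemma coeff_fun_koszul:
  fixes f :: "bool list \<Rightarrow> idx \<Rightarrow> 'k::field fls"
  shows "coeff_fun e (koszul (shifts n) f bs) = koszul (shifts n) (\<lambda>bs. coeff_fun e (f bs)) bs"
proof (rule koszul_hom[where S = UNIV and h = "coeff_fun e :: (idx \<Rightarrow> 'k fls) \<Rightarrow> idx \<Rightarrow> 'k"])
  have "list_all2 (\<lambda>x y. \<forall>u. coeff_fun e (x u) = y (coeff_fun e u))
      (shifts n :: ((idx \<Rightarrow> 'k fls) \<Rightarrow> _) list) (shifts n :: ((idx \<Rightarrow> 'k) \<Rightarrow> _) list)"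
    by (induction n) (simp_all add: coeff_fun_shift)
  then show "list_all2 (\<lambda>x y. \<forall>u. u \<in> UNIV \<longrightarrow> x u \<in> UNIV \<and> coeff_fun e (x u) = y (coeff_fun e u))
      (shifts n :: ((idx \<Rightarrow> 'k fls) \<Rightarrow> _) list) (shifts n :: ((idx \<Rightarrow> 'k) \<Rightarrow> _) list)"
    by simp
qed (simp_all add: coeff_fun_add)

lemma coeff_fun_realize:
  fixes c :: "int \<Rightarrow> 'i \<Rightarrow> 'k::zero"
  assumes "\<And>e. e < N \<Longrightarrow> c e = (\<lambda>_. 0)"
  shows "coeff_fun e (\<lambda>i. Abs_fls (\<lambda>e. c e i)) = c e"
proof
  fix i
  have "\<forall>e<N. c e i = 0" using assms by simp
  then show "coeff_fun e (\<lambda>i. Abs_fls (\<lambda>e. c e i)) i = c e i"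
    unfolding coeff_fun_def by (rule nth_Abs_fls_lower_bound)
qed

definition ext_scale :: "'k::field fls \<Rightarrow> (idx \<Rightarrow> 'k fls) \<Rightarrow> idx \<Rightarrow> 'k fls" where
  "ext_scale = (\<lambda>c f i. c * f i)"

lemma vector_space_ext_scale: "vector_space ext_scale"
  unfolding ext_scale_def by (rule vector_space_vscale)

text \<open>The index of the k-th basis vector in exterior degree 1.\<close>

definition unit_list :: "nat \<Rightarrow> nat \<Rightarrow> bool list" where
  "unit_list r k = replicate k False @ True # replicate (r - Suc k) False"

text \<open>A tuple as a chain of exterior degree 1; the position of the single \<open>True\<close>
  is the number of \<open>False\<close> bits before it.\<close>

definition one_chain :: "nat \<Rightarrow> (nat \<Rightarrow> 'v::zero) \<Rightarrow> bool list \<Rightarrow> 'v" where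
  "one_chain r v bs = (if length bs = r \<and> count_list bs True = 1 then v (length (takeWhile Not bs)) else 0)"

lemma count_list_replicate: "count_list (replicate k False) True = 0"
  by (induction k) auto

lemma length_unit_list: "k < r \<Longrightarrow> length (unit_list r k) = r"
  and count_unit_list: "count_list (unit_list r k) True = 1"
  by (simp_all add: unit_list_def count_list_replicate)

lemma takeWhile_unit_list: "length (takeWhile Not (unit_list r k)) = k"
proof -
  have "takeWhile Not (replicate k False @ True # xs) = replicate k False" for xs
    by (induction k) auto
  then show ?thesis by (simp add: unit_list_def)
qed

lemma one_chain_unit_list: "k < r \<Longrightarrow> one_chain r v (unit_list r k) = v k"
  by (simp add: one_chain_def length_unit_list count_unit_list takeWhile_unit_list)

lemma one_chain_chains:
  assumes "\<And>k. k < r \<Longrightarrow> v k \<in> S"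
  shows "one_chain r v \<in> chains r 1 S"
proof (rule chainsI)
  fix bs :: "bool list" assume bs: "length bs = r" "count_list bs True = 1"
  have "length (takeWhile Not bs) \<noteq> length bs"
  proof
    assume "length (takeWhile Not bs) = length bs"
    then have "takeWhile Not bs = bs" by (metis order_refl take_all takeWhile_eq_take)
    then have "True \<notin> set bs" by (metis takeWhile_eq_all_conv)
    then show False using bs(2) by (simp add: count_list_0_iff)
  qed
  then have "length (takeWhile Not bs) < r" using length_takeWhile_le[of Not bs] bs(1) by simp
  then show "one_chain r v bs \<in> S" using bs assms by (simp add: one_chain_def)
qed (auto simp: one_chain_def)

lemma koszul_low:
  "koszul xs f (low (length xs)) = (\<Sum>k<length xs. (xs ! k) (f (unit_list (length xs) k)))"
proof (induction xs arbitrary: f)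
  case (Cons x xs)
  have u0: "unit_list (Suc r) 0 = True # low r" for r by (simp add: unit_list_def)
  have uS: "unit_list (Suc r) (Suc k) = False # unit_list r k" for r k by (simp add: unit_list_def)
  have "koszul (x # xs) f (low (length (x # xs)))
      = (\<Sum>k<length xs. (xs ! k) (f (False # unit_list (length xs) k))) + x (f (True # low (length xs)))"
    using Cons.IH by simp
  then show ?case by (simp add: sum.lessThan_Suc_shift u0 uS add.commute del: sum.lessThan_Suc)
qed simp

context relations
begin

abbreviation ext_U :: "int \<Rightarrow> (idx \<Rightarrow> 'k fls) set" where "ext_U \<equiv> coords n G dg"

text \<open>Extension of scalars, described by coefficients instead of tensor products;
  \<open>ext_B_dim\<close> shows that it is the span of a k-basis of \<open>B d\<close>.\<close>

definition ext_B :: "int \<Rightarrow> (idx \<Rightarrow> 'k fls) set" where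
  "ext_B d = {f. \<forall>e. coeff_fun e f \<in> B d} \<inter> ext_U d"

lemma ext_B_iff: "f \<in> ext_B d \<longleftrightarrow> (\<forall>e. coeff_fun e f \<in> B d)"
proof -
  have "f \<in> ext_U d" if "\<forall>e. coeff_fun e f \<in> B d"
    unfolding coeff_fun_coords[of f] using subsetD[OF B_coords] that by simp
  then show ?thesis unfolding ext_B_def by blast
qed

text \<open>A common lower bound for the exponents is what allows coefficientwise constructions to
  be reassembled into Laurent series.\<close>

lemma coords_bound:
  assumes "finite A" "\<And>a. a \<in> A \<Longrightarrow> f a \<in> ext_U d"
  shows "\<exists>N. \<forall>a\<in>A. \<forall>e<N. coeff_fun e (f a) = (\<lambda>_. 0)"
proof -
  have "finite (A \<times> index_set n G dg d)" using assms(1) finite_index_set'[OF finite_G] by simp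
  from fls_common_bound[OF this, of "\<lambda>(a, i). f a i"]
  obtain N where N: "\<And>a i e. a \<in> A \<Longrightarrow> i \<in> index_set n G dg d \<Longrightarrow> e < N \<Longrightarrow> fls_nth (f a i) e = 0"
    by force
  have "coeff_fun e (f a) i = 0" if "a \<in> A" "e < N" for a e i
  proof (cases "f a i = 0")
    case False
    then have "i \<in> index_set n G dg d" using assms(2)[OF that(1)] unfolding coords_def by blast
    then show ?thesis unfolding coeff_fun_def using N that by blast
  qed (simp add: coeff_fun_def)
  then show ?thesis by (intro exI[of _ N]) (simp add: fun_eq_iff)
qed

text \<open>A k-basis of \<open>B d\<close>, read as constant vectors, is a basis over the Laurent
  series: the coordinates of a vector are the series formed from the coordinates of its coefficient
  vectors.\<close>

lemma ext_B_dim: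
  "module.subspace ext_scale (ext_B d)" "vector_space.dim ext_scale (ext_B d) = v.dim (B d)"
proof -
  interpret w: vector_space "ext_scale :: 'k fls \<Rightarrow> _"
    by (rule vector_space_ext_scale)
  obtain E where E: "finite E" "v.independent E" "v.span E = B d" "card E = v.dim (B d)"
    using v.finite_dim_basis[OF finite_dim_B] .
  define ct :: "(idx \<Rightarrow> 'k) \<Rightarrow> idx \<Rightarrow> 'k fls" where "ct u = (\<lambda>i. fls_const (u i))" for u
  have sum_app: "(\<Sum>b\<in>F. g b) i = (\<Sum>b\<in>F. g b i)" for g :: "'b \<Rightarrow> idx \<Rightarrow> 'c::comm_monoid_add" and F i
    by (induction F rule: infinite_finite_induct) auto
  have inj: "inj_on ct E"
  proof (rule inj_onI)
    fix u u' assume "ct u = ct u'"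
    then have "fls_nth (fls_const (u i)) 0 = fls_nth (fls_const (u' i)) 0" for i by (metis ct_def)
    then show "u = u'" by (auto simp: fun_eq_iff)
  qed
  have nth: "coeff_fun e (\<Sum>b\<in>E. ext_scale (c b) (ct b)) = (\<Sum>b\<in>E. (\<lambda>i. fls_nth (c b) e * b i))" for c e
    by (rule ext) (simp add: coeff_fun_def sum_app fls_nth_sum ct_def ext_scale_def fls_mult_const_nth)
  have span: "w.span (ct ` E) = ext_B d"
  proof (intro equalityI subsetI)
    fix f assume "f \<in> w.span (ct ` E)"
    then obtain c where f: "f = (\<Sum>b\<in>ct ` E. ext_scale (c b) b)" using w.span_finite[of "ct ` E"] E(1) by auto
    have f: "f = (\<Sum>b\<in>E. ext_scale (c (ct b)) (ct b))" unfolding f by (simp add: sum.reindex[OF inj])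
    have "coeff_fun e f \<in> v.span E" for e
      unfolding f nth[of _ "\<lambda>b. c (ct b)"] by (intro v.span_sum v.span_scale v.span_base)
    then show "f \<in> ext_B d" using E(3) by (simp add: ext_B_iff)
  next
    fix f assume f: "f \<in> ext_B d"
    then have "f \<in> ext_U d" by (simp add: ext_B_def)
    then obtain N where N: "\<And>e. e < N \<Longrightarrow> coeff_fun e f = (\<lambda>_. 0)"
      using coords_bound[of "{()}" "\<lambda>_. f" d] by auto
    have ex: "\<exists>u. coeff_fun e f = (\<Sum>b\<in>E. (\<lambda>i. u b * b i)) \<and> (e < N \<longrightarrow> u = (\<lambda>_. 0))" for e
    proof (cases "e < N")
      case True
      have "(\<Sum>b\<in>E. (\<lambda>i. 0 * b i)) = (\<lambda>_. 0 :: 'k)" by (rule ext) (simp add: sum_app)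
      then show ?thesis using N[OF True] by (intro exI[of _ "\<lambda>_. 0"]) simp
    next
      case False
      have "coeff_fun e f \<in> v.span E" using f E(3) by (simp add: ext_B_iff)
      then show ?thesis using v.span_finite[OF E(1)] False by auto
    qed
    have "\<forall>e. \<exists>u. coeff_fun e f = (\<Sum>b\<in>E. (\<lambda>i. u b * b i)) \<and> (e < N \<longrightarrow> u = (\<lambda>_. 0))"
      by (rule allI, rule ex)
    from choice[OF this] obtain u
      where u: "\<And>e. coeff_fun e f = (\<Sum>b\<in>E. (\<lambda>i. u e b * b i))" "\<And>e. e < N \<Longrightarrow> u e = (\<lambda>_. 0)" by blast
    define c where "c b = Abs_fls (\<lambda>e. u e b)" for b
    have c: "fls_nth (c b) e = u e b" for b e
      using fun_cong[OF coeff_fun_realize[of N u e, OF u(2)], of b] by (simp add: coeff_fun_def c_def)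
    have ce: "coeff_fun e f = coeff_fun e (\<Sum>b\<in>E. ext_scale (c b) (ct b))" for e
      unfolding nth c by (rule u(1))
    have "f i = (\<Sum>b\<in>E. ext_scale (c b) (ct b)) i" for i
    proof (rule fls_eqI)
      fix e show "fls_nth (f i) e = fls_nth ((\<Sum>b\<in>E. ext_scale (c b) (ct b)) i) e"
        using fun_cong[OF ce[of e], of i] unfolding coeff_fun_def .
    qed
    then have "f = (\<Sum>b\<in>E. ext_scale (c b) (ct b))" by (rule ext)
    then show "f \<in> w.span (ct ` E)"
      by (simp only:) (intro w.span_sum w.span_scale w.span_base imageI)
  qed
  have "w.independent (ct ` E)"
  proof (rule w.independent_iff_sum[THEN iffD2])
    show "finite (ct ` E)" using E(1) by simp
    show "\<forall>c. (\<Sum>b\<in>ct ` E. ext_scale (c b) b) = 0 \<longrightarrow> (\<forall>b\<in>ct ` E. c b = 0)"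
    proof (intro allI impI ballI)
      fix c b assume c: "(\<Sum>b\<in>ct ` E. ext_scale (c b) b) = 0" and "b \<in> ct ` E"
      then obtain b' where b': "b' \<in> E" "b = ct b'" by blast
      have "(\<Sum>b\<in>E. ext_scale (c (ct b)) (ct b)) = 0" using c by (simp add: sum.reindex[OF inj])
      then have z: "coeff_fun e (\<Sum>b\<in>E. ext_scale (c (ct b)) (ct b)) = 0" for e
        by (simp only: coeff_fun_zero)
      have "(\<Sum>b\<in>E. (\<lambda>i. fls_nth (c (ct b)) e * b i)) = 0" for e
        using z[of e] unfolding nth[of e "\<lambda>b. c (ct b)"] .
      then have "fls_nth (c (ct b')) e = 0" for e
        using v.independent_iff_sum[THEN iffD1, OF E(1,2), THEN spec, THEN mp, of "\<lambda>b. fls_nth (c (ct b)) e"] b'(1) by blast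
      then show "c b = 0" using b'(2) by (simp add: fls_zero_eqI)
    qed
  qed
  then have "w.dim (ext_B d) = card (ct ` E)"
    unfolding span[symmetric] w.dim_span by (rule w.dim_eq_card_independent)
  then show "w.dim (ext_B d) = v.dim (B d)" using card_image[OF inj] E(4) by simp
  show "w.subspace (ext_B d)" unfolding span[symmetric] by (rule w.subspace_span)
qed

text \<open>The equation is solved over k for each coefficient of \<open>p\<close>. Below the common
  bound \<open>N\<close> the solution 0 is taken, so that the solutions are the coefficients of
  Laurent series.\<close>

lemma ext_exact:
  assumes "koszul_betti i d = 0" and p: "p \<in> chains n i (ext_U d)"
    and k: "\<And>bs. koszul (shifts n) p bs \<in> ext_B (d + 1)"
  shows "\<exists>q\<in>chains n (Suc i) (ext_U (d - 1)). \<forall>bs. p bs - koszul (shifts n) q bs \<in> ext_B d"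
proof -
  let ?c = "\<lambda>e bs. coeff_fun e (p bs)"
  have fin: "finite {bs :: bool list. length bs = n}" using finite_lists_length_eq[of "UNIV :: bool set" n] by simp
  obtain N where N: "\<And>bs e. length bs = n \<Longrightarrow> e < N \<Longrightarrow> ?c e bs = (\<lambda>_. 0)"
    using coords_bound[OF fin, of p d] chainsD'[OF p coords_zero(1)] by blast
  have N: "?c e = (\<lambda>_ _. 0)" if "e < N" for e
  proof
    fix bs show "?c e bs = (\<lambda>_. 0)"
    proof (cases "length bs = n")
      case False
      then have "p bs = 0" using chainsD0[OF p] by blast
      then show ?thesis by (simp add: coeff_fun_def)
    qed (use N that in blast)
  qed
  have "\<exists>q\<in>chains n (Suc i) (U (d - 1)). (\<forall>bs. ?c e bs - koszul (shifts n) q bs \<in> B d) \<and> (e < N \<longrightarrow> q = (\<lambda>_ _. 0))" for e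
  proof (cases "e < N")
    case True
    have "koszul (shifts n) (\<lambda>_ _. 0 :: 'k) bs = 0" for bs
      using koszul_zero[OF commuting_shifts, of n bs] by (simp add: zero_fun_def)
    moreover have "(0 :: idx \<Rightarrow> 'k) - 0 \<in> B d" using B_zero by simp
    moreover have "(\<lambda>_ _. 0) \<in> chains n (Suc i) (U (d - 1))"
      using chains_zero[OF coords_zero(1), of n "Suc i" n G dg "d - 1"] by (simp add: zero_fun_def)
    moreover have "?c e bs = 0" for bs using fun_cong[OF N[OF True], of bs] by (simp add: zero_fun_def)
    ultimately show ?thesis by (intro bexI[of _ "\<lambda>_ _. 0"]) (simp_all add: zero_fun_def)
  next
    case False
    have "coeff_fun e u \<in> U d" if "u \<in> ext_U d" for u
      using coeff_fun_coords[of u n G dg d] that by blast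
    then have "?c e \<in> chains n i (U d)"
      by (intro chains_map[OF p]) (auto simp: coeff_fun_def fun_eq_iff)
    moreover have "koszul (shifts n) (?c e) bs \<in> B (d + 1)" for bs
      using k[of bs] unfolding ext_B_iff coeff_fun_koszul by blast
    ultimately have "?c e \<in> boundaries i d"
      using assms(1) koszul_betti_0_exact unfolding cycles_def by blast
    then obtain q b where q: "?c e = koszul (shifts n) q + b" "q \<in> chains n (Suc i) (U (d - 1))" "b \<in> chains n i (B d)"
      unfolding boundaries_def by blast
    have "?c e bs - koszul (shifts n) q bs = b bs" for bs using fun_cong[OF q(1), of bs] by simp
    then show ?thesis using q(2) chainsD'[OF q(3) B_zero] False by (intro bexI[of _ q]) simp_all
  qed
  then obtain q where q: "\<And>e. q e \<in> chains n (Suc i) (U (d - 1))" "\<And>e bs. ?c e bs - koszul (shifts n) (q e) bs \<in> B d"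
    "\<And>e. e < N \<Longrightarrow> q e = (\<lambda>_ _. 0)" by metis
  define Q where "Q bs = (\<lambda>i. Abs_fls (\<lambda>e. q e bs i))" for bs
  have cQ: "coeff_fun e (Q bs) = q e bs" for e bs
    unfolding Q_def by (rule coeff_fun_realize[where N = N]) (simp add: q(3))
  have "Q \<in> chains n (Suc i) (ext_U (d - 1))"
  proof (rule chainsI)
    fix bs :: "bool list" assume "length bs = n" "count_list bs True = Suc i"
    then show "Q bs \<in> ext_U (d - 1)" unfolding coeff_fun_coords[of "Q bs"] cQ using chainsD[OF q(1)] by blast
  next
    fix bs :: "bool list" assume "\<not> (length bs = n \<and> count_list bs True = Suc i)"
    then have "coeff_fun e (Q bs) = 0" for e unfolding cQ using chainsD0[OF q(1)] by blast
    then show "Q bs = 0" by (intro ext fls_eqI) (metis coeff_fun_def coeff_fun_zero)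
  qed
  moreover have "p bs - koszul (shifts n) Q bs \<in> ext_B d" for bs
    unfolding ext_B_iff coeff_fun_diff coeff_fun_koszul cQ using q(2) by blast
  ultimately show ?thesis by blast
qed

lemma ext_B_sums: "0 \<in> ext_B d" "x \<in> ext_B d \<Longrightarrow> y \<in> ext_B d \<Longrightarrow> x + y \<in> ext_B d"
    "x \<in> ext_B d \<Longrightarrow> - x \<in> ext_B d"
proof -
  interpret w: vector_space "ext_scale :: 'k fls \<Rightarrow> _"
    by (rule vector_space_ext_scale)
  show "0 \<in> ext_B d" "x \<in> ext_B d \<Longrightarrow> y \<in> ext_B d \<Longrightarrow> x + y \<in> ext_B d" "x \<in> ext_B d \<Longrightarrow> - x \<in> ext_B d"
    using w.subspace_0[OF ext_B_dim(1)] w.subspace_add[OF ext_B_dim(1)] w.subspace_neg[OF ext_B_dim(1)] by blast+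
qed

lemma ext_B_shift: "i \<in> {1..n} \<Longrightarrow> u \<in> ext_B d \<Longrightarrow> shift i u \<in> ext_B (d + 1)"
  using B_shift by (simp add: ext_B_iff coeff_fun_shift)

lemma koszul_ext_B: "(\<And>bs. p bs \<in> ext_B d) \<Longrightarrow> koszul (shifts n) p bs \<in> ext_B (d + 1)"
  by (rule koszul_mem[where S = "ext_B d"]) (auto simp: set_shifts ext_B_shift ext_B_sums)

lemma two_linear_negative:
  assumes two_linear "d < 0"
  shows "U d = B d"
proof -
  define L where "L = Min (insert 0 (dg ` G)) - 1"
  have L: "dg b > L" if "b \<in> G" for b
  proof -
    have "Min (insert 0 (dg ` G)) \<le> dg b" by (rule Min_le) (use finite_G that in auto)
    then show ?thesis by (simp add: L_def)
  qed
  have low: "U e = B e" if "e \<le> L" for e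
  proof -
    have "index_set n G dg e = {}" using L that by (force simp: index_set_def)
    then have "U e = {0}" by (auto simp: coords_def fun_eq_iff)
    then show ?thesis using B_coords[of e] B_zero[of e] by auto
  qed
  show ?thesis
  proof (cases "d \<le> L")
    case False
    then have "L \<le> d" by simp
    then show ?thesis using assms(2)
    proof (induction d rule: int_ge_induct)
      case (step e)
      then have IH: "U e = B e" by simp
      have "U (e + 1) \<subseteq> B (e + 1)"
      proof
        fix u assume u: "u \<in> U (e + 1)"
        have "koszul_betti 0 (e + 1) = 0" using assms(1) step.prems by (simp add: two_linear_def)
        then have "at_low n u \<in> boundaries 0 (e + 1)"
          using koszul_betti_0_exact cycles_0 at_low_chains[OF u] by blast
        then obtain q b where q: "at_low n u = koszul (shifts n) q + b" "q \<in> chains n (Suc 0) (U e)" "b \<in> chains n 0 (B (e + 1))"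
          unfolding boundaries_def by auto
        have "u = koszul (shifts n) q (low n) + b (low n)" using fun_cong[OF q(1), of "low n"] by (simp add: at_low_def)
        moreover have "q bs \<in> B e" for bs using chainsD'[OF q(2) coords_zero(1)] IH by blast
        ultimately show "u \<in> B (e + 1)" using B_add[OF koszul_B chainsD'[OF q(3) B_zero]] by simp
      qed
      then show ?case using B_coords by blast
    qed (use low in simp)
  qed (rule low)
qed

lemma hilbert_negative: "two_linear \<Longrightarrow> d < 0 \<Longrightarrow> hilbert d = 0"
  by (simp add: hilbert_def two_linear_negative)

text \<open>The last three clauses of \<open>regular_system\<close> are vanishing statements for
  Koszul homology: coefficient degree at least 2 in every exterior degree, coefficient degree 0 in
  exterior degree 1, and coefficient degree 1 in exterior degree 0.\<close>

theorem two_linear_numerator: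
  assumes two_linear
  shows "\<exists>a. numerator_coeffs n (Abs_fps (\<lambda>d. hilbert (int d))) a"
proof -
  interpret w: vector_space "ext_scale :: 'k fls \<Rightarrow> _"
    by (rule vector_space_ext_scale)
  have fin: "finite_dim ext_scale (ext_U d)" for d
    unfolding ext_scale_def by (rule finite_dim_coords(1)[OF finite_index_set'[OF finite_G]])
  interpret pencil "ext_scale :: 'k fls \<Rightarrow> _" "\<lambda>d. ext_U (int d)"
    by (rule pencil.intro[OF vector_space_ext_scale]) (simp add: pencil_axioms_def fin uncountable_fls)
  let ?xs = "shifts n :: ((idx \<Rightarrow> 'k fls) \<Rightarrow> _) list" and ?B = "\<lambda>d. ext_B (int d)"
  have nonneg: "ext_U (- 1) = ext_B (- 1)"
  proof -
    have "U (- 1) = B (- 1)" by (rule two_linear_negative[OF assms]) simp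
    then have "f \<in> ext_U (- 1) \<longleftrightarrow> f \<in> ext_B (- 1)" for f
      unfolding ext_B_iff using coeff_fun_coords[of f n G dg "- 1"] by simp
    then show ?thesis by blast
  qed
  have "regular_system ?xs ?B"
    unfolding regular_system_def length_shifts
  proof (intro conjI allI ballI impI)
    show "commuting ?xs" by (rule commuting_shifts)
    show "w.subspace (ext_B (int d))" "ext_B (int d) \<subseteq> ext_U (int d)" for d
      using ext_B_dim(1) by (auto simp: ext_B_def)
  next
    fix x assume "x \<in> set ?xs"
    then obtain i where x: "x = shift i" "i \<in> {1..n}" by (auto simp: set_shifts)
    show "Vector_Spaces.linear ext_scale ext_scale x"
      unfolding x(1) by unfold_locales (simp_all add: shift_add shift_scale ext_scale_def)
    show "x u \<in> ext_U (int (Suc d))" if "u \<in> ext_U (int d)" for u d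
      using coords_shift[OF x(2) that] by (simp add: x(1) add.commute)
    show "x u \<in> ext_B (int (Suc d))" if "u \<in> ext_B (int d)" for u d
      using ext_B_shift[OF x(2) that] by (simp add: x(1) add.commute)
  next
    fix i d p assume p: "p \<in> chains n i (ext_U (int (Suc (Suc d))))" "\<forall>bs. koszul ?xs p bs \<in> ext_B (int (Suc (Suc (Suc d))))"
    have "koszul_betti i (int (Suc (Suc d))) = 0" using assms by (cases i) (auto simp: two_linear_def)
    then show "\<exists>q\<in>chains n (Suc i) (ext_U (int (Suc d))). \<forall>bs. p bs - koszul ?xs q bs \<in> ext_B (int (Suc (Suc d)))"
      using ext_exact[OF _ p(1)] p(2) by (simp add: add.commute)
  next
    fix v k assume v: "\<forall>k<n. v k \<in> ext_U (int 0)" "(\<Sum>k<n. (?xs ! k) (v k)) \<in> ext_B (int (Suc 0))" and k: "k < n"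
    have p: "one_chain n v \<in> chains n 1 (ext_U 0)" by (rule one_chain_chains) (use v(1) in simp)
    have sh: "shift i u \<in> ext_U 1" if "i \<in> {1..n}" "u \<in> ext_U 0" for i u
      using coords_shift[OF that] by simp
    have kc: "koszul ?xs (one_chain n v) \<in> chains (length ?xs) 0 (ext_U 1)"
      by (rule koszul_chains[where S = "ext_U 0"])
        (use p sh in \<open>auto simp: set_shifts commuting_shifts intro: coords_zero coords_add coords_neg\<close>)
    have "koszul ?xs (one_chain n v) (low n) = (\<Sum>k<n. (?xs ! k) (v k))"
      using koszul_low[of ?xs "one_chain n v"] by (simp add: one_chain_unit_list)
    then have "koszul ?xs (one_chain n v) bs \<in> ext_B (0 + 1)" for bs
      using chainsD0[OF kc, of bs] count_list_True_eq_0[of bs n] v(2) ext_B_sums(1) by (cases "bs = low n") auto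
    from ext_exact[OF _ p this] obtain q where q: "q \<in> chains n 2 (ext_U (- 1))"
      "\<And>bs. one_chain n v bs - koszul ?xs q bs \<in> ext_B 0"
      using assms by (auto simp: two_linear_def numeral_2_eq_2)
    \<comment> \<open>The chain \<open>q\<close> has coefficients of degree -1, where every element
      is a relation, so it does not affect membership of \<open>v k\<close>.\<close>
    have "q bs \<in> ext_B (- 1)" for bs using chainsD'[OF q(1) coords_zero(1)] nonneg by blast
    from koszul_ext_B[OF this] have "koszul ?xs q bs \<in> ext_B 0" for bs by simp
    from ext_B_sums(2)[OF q(2)[of "unit_list n k"] this[of "unit_list n k"]] have "one_chain n v (unit_list n k) \<in> ext_B 0" by simp
    then show "v k \<in> ext_B (int 0)" using one_chain_unit_list[OF k, of v] by simp
  next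
    fix u assume "u \<in> ext_U (int (Suc 0))"
    then have p: "at_low n u \<in> chains n 0 (ext_U 1)" by (intro at_low_chains) simp
    have "koszul ?xs (at_low n u) bs \<in> ext_B (1 + 1)" for bs
      using koszul_chains_0[OF commuting_shifts, of "at_low n u" n "ext_U 1"] p ext_B_sums(1) by simp
    from ext_exact[OF _ p this] obtain q where q: "q \<in> chains n 1 (ext_U 0)"
      "\<And>bs. at_low n u bs - koszul ?xs q bs \<in> ext_B 1"
      using assms by (auto simp: two_linear_def)
    have "koszul ?xs q (low n) = (\<Sum>k<n. (?xs ! k) (q (unit_list n k)))"
      using koszul_low[of ?xs q] by simp
    then have "u - (\<Sum>k<n. (?xs ! k) (q (unit_list n k))) \<in> ext_B (int (Suc 0))"
      using q(2)[of "low n"] by (simp add: at_low_def)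
    then show "\<exists>v. (\<forall>k<n. v k \<in> ext_U (int 0)) \<and> u - (\<Sum>k<n. (?xs ! k) (v k)) \<in> ext_B (int (Suc 0))"
      using chainsD'[OF q(1) coords_zero(1)] by (intro exI[of _ "\<lambda>k. q (unit_list n k)"]) simp
  qed
  from hilbert_series_numerator[OF this]
  obtain a where "numerator_coeffs n (Abs_fps (hil ?B)) a" unfolding length_shifts by blast
  moreover have "hil ?B = (\<lambda>d. hilbert (int d))"
    unfolding hil_def hilbert_def ext_B_dim(2)
    by (simp add: ext_scale_def finite_dim_coords(2)[OF finite_index_set'[OF finite_G]])
  ultimately show ?thesis by auto
qed

end

section \<open>Integer combinatorics of the coefficient sequences\<close>

section \<open>Decomposition of the numerator\<close>

text \<open>The numerator of the Hilbert series of the edge ring of the threshold graph on \<open>{1..N}\<close> in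
  which the vertices of \<open>D\<close> are added as dominating vertices and the others as isolated ones, the
  vertices being added in increasing order.\<close>

fun threshold_numerator :: "nat set \<Rightarrow> nat \<Rightarrow> int fps" where
  "threshold_numerator D 0 = 1"
| "threshold_numerator D (Suc N) = (if Suc N \<in> D then threshold_numerator D N
     else (1 - fps_X) * threshold_numerator D N + fps_X * (1 - fps_X) ^ N)"

text \<open>The graph is read off from its last vertex: \<open>\<alpha> n = 0\<close> makes it
  dominating. Otherwise all entries are positive and it is isolated; the remaining graph has the
  sequence without its first entry and with 1 subtracted from the others, which satisfies the same
  conditions.\<close>

lemma threshold_numerator_cong:
  "(\<And>b. b \<le> N \<Longrightarrow> b \<in> D \<longleftrightarrow> b \<in> D') \<Longrightarrow> threshold_numerator D N = threshold_numerator D' N"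
  by (induction N) auto

lemma threshold_numerator_realizes:
  assumes "\<And>i. i < n \<Longrightarrow> \<alpha> i \<le> Suc i" "\<And>i. Suc i < n \<Longrightarrow> \<alpha> i = Suc i \<or> \<alpha> (Suc i) \<le> \<alpha> i"
  shows "\<exists>D. threshold_numerator D (Suc n) = 1 - fps_X\<^sup>2 * (\<Sum>i<n. of_nat (\<alpha> i) * (1 - fps_X) ^ i)"
  using assms
proof (induction n arbitrary: \<alpha>)
  case 0
  show ?case by (rule exI[of _ UNIV]) simp
next
  case (Suc n)
  show ?case
  proof (cases "\<alpha> n = 0")
    case True
    obtain D where D: "threshold_numerator D (Suc n) = 1 - fps_X\<^sup>2 * (\<Sum>i<n. of_nat (\<alpha> i) * (1 - fps_X) ^ i)"
      using Suc.IH[of \<alpha>] Suc.prems by force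
    have "threshold_numerator (insert (Suc (Suc n)) D) (Suc n) = threshold_numerator D (Suc n)"
      by (rule threshold_numerator_cong) auto
    then have "threshold_numerator (insert (Suc (Suc n)) D) (Suc (Suc n)) = threshold_numerator D (Suc n)"
      by (simp del: threshold_numerator.simps add: threshold_numerator.simps(2)[of _ "Suc n"])
    then show ?thesis using D True by (intro exI[of _ "insert (Suc (Suc n)) D"]) simp
  next
    case False
    \<comment> \<open>Downwards from \<open>n\<close>: an entry is either i + 1 or at least its
      successor, so positivity propagates.\<close>
    have pos: "\<alpha> i > 0" if "i \<le> n" for i
      using that
    proof (induction rule: inc_induct)
      case (step j)
      then show ?case using Suc.prems(2)[of j] by auto
    qed (use False in simp)
    have \<alpha>0: "\<alpha> 0 = 1" using pos[of 0] Suc.prems(1)[of 0] by simp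
    let ?\<beta> = "\<lambda>i. \<alpha> (Suc i) - 1"
    have "?\<beta> i \<le> Suc i" if "i < n" for i using Suc.prems(1)[of "Suc i"] that by simp
    moreover have "?\<beta> i = Suc i \<or> ?\<beta> (Suc i) \<le> ?\<beta> i" if "Suc i < n" for i
      using Suc.prems(2)[of "Suc i"] that by auto
    ultimately obtain D where D: "threshold_numerator D (Suc n) = 1 - fps_X\<^sup>2 * (\<Sum>i<n. of_nat (?\<beta> i) * (1 - fps_X) ^ i)"
      using Suc.IH[of ?\<beta>] by blast
    let ?D = "D - {Suc (Suc n)}" and ?Y = "1 - fps_X :: int fps"
    have "threshold_numerator ?D (Suc n) = threshold_numerator D (Suc n)"
      by (rule threshold_numerator_cong) auto
    then have K: "threshold_numerator ?D (Suc (Suc n)) = ?Y * threshold_numerator D (Suc n) + fps_X * ?Y ^ Suc n"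
      by (simp del: threshold_numerator.simps add: threshold_numerator.simps(2)[of _ "Suc n"])
    have cancel: "1 + (x + (g - 1)) = x + g" for x g :: "int fps" by simp
    \<comment> \<open>A geometric sum turns the ones added to the sequence into the summand
      contributed by an isolated vertex.\<close>
    have geo: "fps_X * (\<Sum>i<k. ?Y ^ i) = 1 - ?Y ^ k" for k
      by (induction k) (simp_all add: algebra_simps)
    have "(of_nat (\<alpha> (Suc i)) :: int fps) = of_nat (?\<beta> i) + 1" if "i < n" for i
      using pos[of "Suc i"] that by (simp add: of_nat_diff)
    then have "(\<Sum>i<n. of_nat (\<alpha> (Suc i)) * ?Y ^ Suc i) = (\<Sum>i<n. of_nat (?\<beta> i) * ?Y ^ Suc i + ?Y ^ Suc i)"
      by (intro sum.cong) (auto simp: distrib_right simp del: of_nat_diff)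
    then have "(\<Sum>i<Suc n. of_nat (\<alpha> i) * ?Y ^ i)
        = 1 + ((\<Sum>i<n. of_nat (?\<beta> i) * ?Y ^ Suc i) + (\<Sum>i<n. ?Y ^ Suc i))"
      using \<alpha>0 by (simp add: sum.lessThan_Suc_shift sum.distrib del: sum.lessThan_Suc power_Suc of_nat_diff)
    also have "(\<Sum>i<n. ?Y ^ Suc i) = (\<Sum>i<Suc n. ?Y ^ i) - 1"
      by (simp add: sum.lessThan_Suc_shift del: sum.lessThan_Suc)
    also have "(\<Sum>i<n. of_nat (?\<beta> i) * ?Y ^ Suc i) = ?Y * (\<Sum>i<n. of_nat (?\<beta> i) * ?Y ^ i)"
      by (simp add: sum_distrib_left mult.left_commute del: of_nat_diff)
    also have "1 + (?Y * (\<Sum>i<n. of_nat (?\<beta> i) * ?Y ^ i) + ((\<Sum>i<Suc n. ?Y ^ i) - 1))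
        = ?Y * (\<Sum>i<n. of_nat (?\<beta> i) * ?Y ^ i) + (\<Sum>i<Suc n. ?Y ^ i)"
      by (rule cancel)
    finally have S: "(\<Sum>i<Suc n. of_nat (\<alpha> i) * ?Y ^ i)
        = ?Y * (\<Sum>i<n. of_nat (?\<beta> i) * ?Y ^ i) + (\<Sum>i<Suc n. ?Y ^ i)" .
    have "fps_X\<^sup>2 * (\<Sum>i<Suc n. of_nat (\<alpha> i) * ?Y ^ i)
        = fps_X\<^sup>2 * (?Y * (\<Sum>i<n. of_nat (?\<beta> i) * ?Y ^ i)) + fps_X * (fps_X * (\<Sum>i<Suc n. ?Y ^ i))"
      unfolding S by (simp only: power2_eq_square distrib_left mult.assoc)
    also have "\<dots> = ?Y * (fps_X\<^sup>2 * (\<Sum>i<n. of_nat (?\<beta> i) * ?Y ^ i)) + fps_X * (1 - ?Y ^ Suc n)"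
      unfolding geo by (simp add: mult.left_commute)
    finally have S': "fps_X\<^sup>2 * (\<Sum>i<Suc n. of_nat (\<alpha> i) * ?Y ^ i) = \<dots>" .
    have rearrange: "1 - (?Y * t + fps_X * (1 - p)) = ?Y * (1 - t) + fps_X * p" for t p :: "int fps"
      by (simp add: algebra_simps)
    have "1 - fps_X\<^sup>2 * (\<Sum>i<Suc n. of_nat (\<alpha> i) * ?Y ^ i) = threshold_numerator ?D (Suc (Suc n))"
      unfolding K D S' by (rule rearrange)
    from this[symmetric] show ?thesis by (rule exI)
  qed
qed

lemma sum_truncated: "(\<Sum>l<m. min r (A - r * l)) = min A (r * m)" for A r m :: nat
proof (induction m)
  case (Suc m)
  have "min A (r * m) + min r (A - r * m) = min A (r * m + r)" by linarith
  then show ?case using Suc by simp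
qed simp

text \<open>The coefficient \<open>a i\<close> is cut into blocks of size \<open>i + 1\<close>, the last one incomplete.\<close>

theorem numerator_decomposition:
  assumes "numerator_coeffs n H a" "fps_nth H 0 = int m"
  shows "\<exists>D. (1 - fps_X) ^ n * H = (\<Sum>l\<in>{1..m}. threshold_numerator (D l) (Suc n))"
proof -
  let ?Y = "1 - fps_X :: int fps"
  have a0: "a 0 \<le> m" if "n > 0" using assms that by (simp add: numerator_coeffs_def)
  have step: "Suc i * a (Suc i) \<le> Suc (Suc i) * a i" if "Suc i < n" for i
    using assms(1) that by (simp add: numerator_coeffs_def)
  \<comment> \<open>Guarantees that \<open>m\<close> blocks of size i + 1 use up all of
    \<open>a i\<close>.\<close>
  have bound: "a i \<le> Suc i * m" if "i < n" for i
    using that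
  proof (induction i)
    case (Suc i)
    have "Suc i * a (Suc i) \<le> Suc (Suc i) * (Suc i * m)"
      using step[OF Suc.prems] mult_le_mono2[OF Suc.IH, of "Suc (Suc i)"] Suc.prems by linarith
    then have "Suc i * a (Suc i) \<le> Suc i * (Suc (Suc i) * m)" by (simp only: mult.left_commute)
    then show ?case using mult_le_cancel1[of "Suc i"] by blast
  qed (use a0 in simp)
  define \<alpha> where "\<alpha> l i = min (Suc i) (a i - Suc i * l)" for l i
  have "\<exists>D. threshold_numerator D (Suc n) = 1 - fps_X\<^sup>2 * (\<Sum>i<n. of_nat (\<alpha> l i) * ?Y ^ i)" for l
  proof (rule threshold_numerator_realizes)
    show "\<alpha> l i \<le> Suc i" for i by (simp add: \<alpha>_def)
    fix i assume i: "Suc i < n"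
    show "\<alpha> l i = Suc i \<or> \<alpha> l (Suc i) \<le> \<alpha> l i"
    proof (rule disjCI)
      assume not: "\<not> \<alpha> l (Suc i) \<le> \<alpha> l i"
      show "\<alpha> l i = Suc i"
      proof (rule ccontr)
        assume "\<alpha> l i \<noteq> Suc i"
        then have c: "\<alpha> l i = a i - Suc i * l" "a i - Suc i * l < Suc i" by (auto simp: \<alpha>_def min_def split: if_splits)
        \<comment> \<open>\<open>c\<close> is what remains of \<open>a i\<close> for the incomplete
          block \<open>l\<close>, so c < i + 1. In the inequality for the next index the surplus
          over a multiple of i + 1 is at most \<open>c\<close>, and this strict bound absorbs it on
          division by i + 1; so at most \<open>c\<close> remains there as well.\<close>
        define c where "c = a i - Suc i * l"
        have "a i \<le> Suc i * l + c" by (simp add: c_def)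
        then have "Suc (Suc i) * a i \<le> Suc (Suc i) * (Suc i * l + c)" by (rule mult_le_mono2)
        then have "Suc i * a (Suc i) \<le> Suc i * (Suc (Suc i) * l) + Suc i * c + c"
          using step[OF i] by (simp add: algebra_simps)
        also have "\<dots> < Suc i * (Suc (Suc i) * l) + Suc i * c + Suc i" using c by (simp add: c_def)
        also have "\<dots> = Suc i * (Suc (Suc i) * l + c + 1)" by (simp add: algebra_simps)
        finally have "a (Suc i) < Suc (Suc i) * l + c + 1" using mult_less_cancel1 by blast
        then have "\<alpha> l (Suc i) \<le> c" by (simp add: \<alpha>_def)
        then show False using not c by (simp add: c_def)
      qed
    qed
  qed
  then obtain D where D: "\<And>l. threshold_numerator (D l) (Suc n) = 1 - fps_X\<^sup>2 * (\<Sum>i<n. of_nat (\<alpha> l i) * ?Y ^ i)" by metis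
  have "(\<Sum>l<m. \<Sum>i<n. of_nat (\<alpha> l i) * ?Y ^ i) = (\<Sum>i<n. of_nat (\<Sum>l<m. \<alpha> l i) * ?Y ^ i)"
    unfolding sum.swap[of _ "{..<n}"] by (simp add: sum_distrib_right)
  also have "\<dots> = (\<Sum>i<n. of_nat (a i) * ?Y ^ i)"
    using bound unfolding \<alpha>_def sum_truncated by (intro sum.cong) (auto simp: min_def)
  finally have "(\<Sum>l<m. threshold_numerator (D l) (Suc n)) = of_nat m - fps_X\<^sup>2 * (\<Sum>i<n. of_nat (a i) * ?Y ^ i)"
    unfolding D by (simp add: sum_subtractf sum_distrib_left[symmetric])
  also have "\<dots> = ?Y ^ n * H"
    using assms by (simp add: numerator_coeffs_def fps_of_nat)
  also have "(\<Sum>l<m. threshold_numerator (D l) (Suc n)) = (\<Sum>l\<in>{1..m}. threshold_numerator (D (l - 1)) (Suc n))"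
    by (rule sum.reindex_bij_witness[where i = "\<lambda>l. l - 1" and j = Suc]) auto
  finally show ?thesis by (intro exI[of _ "\<lambda>l. D (l - 1)"]) simp
qed

section \<open>Monomial bases and linearity of the threshold ideals\<close>

section \<open>Koszul homology of threshold graph rings\<close>

text \<open>The monomials outside the nonedge ideal of the threshold graph on \<open>{1..N}\<close> in which the
  vertices of \<open>D\<close> are dominating: \<open>a < b\<close> are adjacent if and only if \<open>b \<in> D\<close>.\<close>

definition standard :: "nat set \<Rightarrow> (nat \<Rightarrow>\<^sub>0 nat) \<Rightarrow> bool" where
  "standard D t \<longleftrightarrow> (\<forall>a\<in>Poly_Mapping.keys t. \<forall>b\<in>Poly_Mapping.keys t. a < b \<longrightarrow> b \<in> D)"

text \<open>Multiplication by a variable in the edge ring, written in its basis of standard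
  monomials: a product that is not standard is zero.\<close>

definition std_shift :: "nat set \<Rightarrow> nat \<Rightarrow> ((nat \<Rightarrow>\<^sub>0 nat) \<Rightarrow> 'k::zero) \<Rightarrow> (nat \<Rightarrow>\<^sub>0 nat) \<Rightarrow> 'k" where
  "std_shift D i u = (\<lambda>t. if standard D t \<and> 0 < Poly_Mapping.lookup t i then u (t - unit_exp i) else 0)"

fun std_shifts :: "nat set \<Rightarrow> nat \<Rightarrow> (((nat \<Rightarrow>\<^sub>0 nat) \<Rightarrow> 'k::zero) \<Rightarrow> (nat \<Rightarrow>\<^sub>0 nat) \<Rightarrow> 'k) list" where
  "std_shifts D 0 = []"
| "std_shifts D (Suc r) = std_shift D (Suc r) # std_shifts D r"

definition std_funs :: "nat set \<Rightarrow> nat \<Rightarrow> int \<Rightarrow> ((nat \<Rightarrow>\<^sub>0 nat) \<Rightarrow> 'k::zero) set" where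
  "std_funs D r d = {u. \<forall>t. u t \<noteq> 0 \<longrightarrow> standard D t \<and> Poly_Mapping.keys t \<subseteq> {1..r} \<and> int (monomial_degree t) = d}"

lemma standard_subset: "standard D t \<Longrightarrow> Poly_Mapping.keys s \<subseteq> Poly_Mapping.keys t \<Longrightarrow> standard D s"
  unfolding standard_def by blast

lemma standard_minus: "standard D t \<Longrightarrow> standard D (t - unit_exp i)"
  by (erule standard_subset) (auto simp: in_keys_iff lookup_minus)

lemma length_std_shifts [simp]: "length (std_shifts D r) = r"
  by (induction r) auto

lemma set_std_shifts: "set (std_shifts D r) = std_shift D ` {1..r}"
proof (induction r)
  case (Suc r)
  have "{1..Suc r} = insert (Suc r) {1..r}" by auto
  then show ?case using Suc by simp
qed simp

lemma additive_std_shift: "additive (std_shift D i :: ((nat \<Rightarrow>\<^sub>0 nat) \<Rightarrow> 'k::ab_group_add) \<Rightarrow> _)"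
  by unfold_locales (auto simp: std_shift_def fun_eq_iff)

lemma std_shift_commute: "std_shift D i (std_shift D j u) = std_shift D j (std_shift D i u)"
proof
  fix t
  have "t - unit_exp i - unit_exp j = t - unit_exp j - unit_exp i"
    by (rule poly_mapping_eqI) (simp add: lookup_minus)
  then show "std_shift D i (std_shift D j u) t = std_shift D j (std_shift D i u) t"
    by (auto simp: std_shift_def standard_minus lookup_minus lookup_single when_def)
qed

lemma commuting_std_shifts: "commuting (std_shifts D r :: (((nat \<Rightarrow>\<^sub>0 nat) \<Rightarrow> 'k::ab_group_add) \<Rightarrow> _) list)"
  unfolding commuting_def set_std_shifts using additive_std_shift std_shift_commute by blast

lemma std_funs_zero: "0 \<in> std_funs D r d"
  by (simp add: std_funs_def)

lemma std_funs_add: "u \<in> std_funs D r d \<Longrightarrow> v \<in> std_funs D r d \<Longrightarrow> u + v \<in> std_funs D r d"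
  for u :: "_ \<Rightarrow> 'k::monoid_add"
  unfolding std_funs_def by force

lemma std_funs_neg: "u \<in> std_funs D r d \<Longrightarrow> - u \<in> std_funs D r d" for u :: "_ \<Rightarrow> 'k::group_add"
  unfolding std_funs_def by simp

lemma std_funs_diff: "u \<in> std_funs D r d \<Longrightarrow> v \<in> std_funs D r d \<Longrightarrow> u - v \<in> std_funs D r d"
  for u :: "_ \<Rightarrow> 'k::ab_group_add"
  using std_funs_add[of u D r d "- v"] std_funs_neg[of v D r d] by simp

lemma std_funs_mono: "r \<le> r' \<Longrightarrow> std_funs D r d \<subseteq> std_funs D r' d"
  unfolding std_funs_def by fastforce

lemma std_funs_shift:
  assumes "i \<in> {1..r}" "u \<in> std_funs D r (d - 1)"
  shows "std_shift D i u \<in> std_funs D r d"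
  unfolding std_funs_def
proof (intro CollectI allI impI)
  fix t assume "std_shift D i u t \<noteq> 0"
  then have t: "standard D t" "0 < Poly_Mapping.lookup t i" "u (t - unit_exp i) \<noteq> 0"
    by (auto simp: std_shift_def split: if_splits)
  then have "Poly_Mapping.keys (t - unit_exp i) \<subseteq> {1..r} \<and> int (monomial_degree (t - unit_exp i)) = d - 1"
    using assms(2) unfolding std_funs_def by blast
  then show "standard D t \<and> Poly_Mapping.keys t \<subseteq> {1..r} \<and> int (monomial_degree t) = d"
    using t(1) keys_minus_unit_exp[OF t(2)] monomial_degree_minus[OF t(2)] assms(1) by simp
qed

text \<open>Induction on the last vertex through the mapping cone. For an isolated last vertex, d >=
  2 ensures that the lift from the induction hypothesis has positive degree, so that its product
  with the last variable is zero. The case \<open>D = UNIV\<close> is the polynomial ring, exact in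
  all positive exterior degrees; it serves for coefficients of degree 0.\<close>

lemma std_koszul_exact:
  fixes p :: "bool list \<Rightarrow> (nat \<Rightarrow>\<^sub>0 nat) \<Rightarrow> 'k::ab_group_add"
  assumes "p \<in> chains r i (std_funs D r d)" "\<And>bs. koszul (std_shifts D r) p bs = 0"
    and "d \<ge> 2 \<or> i = 0 \<and> d \<ge> 1 \<or> D = UNIV \<and> i > 0"
  shows "\<exists>q\<in>chains r (Suc i) (std_funs D r (d - 1)). \<forall>bs. koszul (std_shifts D r) q bs = p bs"
  using assms
proof (induction r arbitrary: p i d)
  case 0
  have "p bs = 0" for bs
  proof (cases "bs = [] \<and> i = 0")
    case True
    then have "p bs \<in> std_funs D 0 d" using chainsD[OF 0(1), of bs] by simp
    moreover have "d \<ge> 1" using 0(3) True by auto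
    ultimately have "p bs t = 0" for t
      using keys_eq_empty[of t] unfolding std_funs_def by fastforce
    then show ?thesis by (simp add: fun_eq_iff)
  next
    case False
    then show ?thesis using chainsD0[OF 0(1), of bs] by auto
  qed
  then show ?case using chains_zero[OF std_funs_zero] by (intro bexI[of _ "\<lambda>_. 0"]) auto
next
  case (Suc r)
  let ?R = "Suc r" and ?xs = "std_shifts D r :: (((nat \<Rightarrow>\<^sub>0 nat) \<Rightarrow> 'k) \<Rightarrow> _) list"
  let ?x = "std_shift D ?R :: ((nat \<Rightarrow>\<^sub>0 nat) \<Rightarrow> 'k) \<Rightarrow> _"
  let ?W = "\<lambda>r d. std_funs D r d :: ((nat \<Rightarrow>\<^sub>0 nat) \<Rightarrow> 'k) set"
  note com = commuting_std_shifts[of D r, where 'k = 'k]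
  have xadd: "?x (u + v) = ?x u + ?x v" for u v by (rule additive.add[OF additive_std_shift])
  have xdiff: "?x (u - v) = ?x u - ?x v" for u v by (rule additive.diff[OF additive_std_shift])
  have x0: "?x 0 = 0" by (rule additive.zero[OF additive_std_shift])
  define z where "z bs = p (False # bs)" for bs
  define y where "y bs = p (True # bs)" for bs
  have z: "z \<in> chains r i (?W ?R d)" unfolding z_def by (rule chains_False[OF Suc.prems(1)])
  have yW: "y bs \<in> ?W ?R d" for bs unfolding y_def by (rule chainsD'[OF Suc.prems(1) std_funs_zero])
  have zW: "z bs \<in> ?W ?R d" for bs unfolding z_def by (rule chainsD'[OF Suc.prems(1) std_funs_zero])
  have kz: "koszul ?xs z bs + ?x (y bs) = 0" for bs
    using Suc.prems(2)[of "False # bs"] unfolding z_def[abs_def] y_def by (simp only: std_shifts.simps koszul.simps)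
  have ky: "koszul ?xs y bs = 0" for bs
    using Suc.prems(2)[of "True # bs"] unfolding y_def[abs_def] by (simp only: std_shifts.simps koszul.simps neg_equal_0_iff_equal)
  \<comment> \<open>\<open>down\<close> and \<open>bot\<close> are quotient and remainder on
    division by the last variable.\<close>
  define down where "down u t = u (t + unit_exp ?R)" for u :: "(nat \<Rightarrow>\<^sub>0 nat) \<Rightarrow> 'k" and t
  define bot where "bot u t = (if 0 < Poly_Mapping.lookup t ?R then 0 else u t)" for u :: "(nat \<Rightarrow>\<^sub>0 nat) \<Rightarrow> 'k" and t
  have keys_le: "Poly_Mapping.keys t \<subseteq> {1..r}" if "Poly_Mapping.keys t \<subseteq> {1..?R}" "Poly_Mapping.lookup t ?R = 0" for t :: "nat \<Rightarrow>\<^sub>0 nat"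
    using that atLeastAtMostSuc_conv[of 1 r] by (auto simp: in_keys_iff)
  have down: "down u \<in> ?W ?R (d - 1)" if u: "u \<in> ?W ?R d" for u
    unfolding std_funs_def
  proof (intro CollectI allI impI)
    fix t assume "down u t \<noteq> 0"
    then have t: "standard D (t + unit_exp ?R)" "Poly_Mapping.keys (t + unit_exp ?R) \<subseteq> {1..?R}"
      "int (monomial_degree (t + unit_exp ?R)) = d"
      using u unfolding down_def std_funs_def by blast+
    have "standard D t" by (rule standard_subset[OF t(1)]) (auto simp: keys_plus_unit_exp)
    then show "standard D t \<and> Poly_Mapping.keys t \<subseteq> {1..?R} \<and> int (monomial_degree t) = d - 1"
      using t(2,3) by (simp add: keys_plus_unit_exp monomial_degree_add)
  qed
  have bot: "bot u \<in> ?W r d" if u: "u \<in> ?W ?R d" for u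
    unfolding std_funs_def
  proof (intro CollectI allI impI)
    fix t assume "bot u t \<noteq> 0"
    then have "u t \<noteq> 0" "Poly_Mapping.lookup t ?R = 0" by (auto simp: bot_def split: if_splits)
    then show "standard D t \<and> Poly_Mapping.keys t \<subseteq> {1..r} \<and> int (monomial_degree t) = d"
      using u keys_le[of t] unfolding std_funs_def by blast
  qed
  have split: "u = bot u + ?x (down u)" if u: "u \<in> ?W ?R d" for u
  proof
    fix t
    show "u t = (bot u + ?x (down u)) t"
    proof (cases "0 < Poly_Mapping.lookup t ?R")
      case True
      then have "t - unit_exp ?R + unit_exp ?R = t" using minus_unit_exp[OF True] by (simp add: add.commute)
      moreover have "u t = 0" if "\<not> standard D t" using u that unfolding std_funs_def by blast
      ultimately show ?thesis using True by (auto simp: bot_def std_shift_def down_def)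
    qed (simp add: bot_def std_shift_def)
  qed
  define z' where "z' bs = down (z bs)" for bs
  define z0 where "z0 bs = bot (z bs)" for bs
  have z'c: "z' \<in> chains r i (?W ?R (d - 1))"
    unfolding z'_def by (rule chains_map[OF z down]) (auto simp: down_def fun_eq_iff)
  have z0c: "z0 \<in> chains r i (?W r d)"
    unfolding z0_def by (rule chains_map[OF z bot]) (auto simp: bot_def fun_eq_iff)
  have kz'W: "koszul ?xs z' bs \<in> ?W ?R d" for bs
    by (rule koszul_mem[where S = "?W ?R (d - 1)"])
      (auto simp: set_std_shifts intro: std_funs_shift std_funs_zero std_funs_add std_funs_neg chainsD'[OF z'c])
  \<comment> \<open>Subtracting the boundary of the cone chain (0, z') from (z, y) leaves (z0, y'),
    where z0 is free of the last variable.\<close>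
  define y' where "y' bs = y bs + koszul ?xs z' bs" for bs
  have y'W: "y' bs \<in> ?W ?R d" for bs unfolding y'_def by (rule std_funs_add[OF yW kz'W])
  have y'_eq: "y' = y + koszul ?xs z'" by (simp add: fun_eq_iff y'_def)
  have ky': "koszul ?xs y' bs = 0" for bs
    unfolding y'_eq koszul_add[OF com] ky koszul_koszul[OF com] by simp
  have "commuting (?x # ?xs)" using commuting_std_shifts[of D ?R, where 'k = 'k] by simp
  note kx = koszul_commute[OF this]
  have kz0: "koszul ?xs z0 bs + ?x (y' bs) = 0" for bs
  proof -
    have "z = z0 + (\<lambda>bs. ?x (z' bs))"
    proof
      fix bs show "z bs = (z0 + (\<lambda>bs. ?x (z' bs))) bs" using split[OF zW[of bs]] by (simp add: z0_def z'_def)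
    qed
    then have "koszul ?xs z bs = koszul ?xs z0 bs + ?x (koszul ?xs z' bs)"
      using koszul_add[OF com, of z0 "\<lambda>bs. ?x (z' bs)" bs] kx[of z' bs] by simp
    then show ?thesis using kz[of bs] unfolding y'_def xadd by (simp add: algebra_simps)
  qed
  have no_R: "koszul ?xs z0 bs t = 0" if "0 < Poly_Mapping.lookup t ?R" for bs t
  proof -
    let ?S = "{u :: (nat \<Rightarrow>\<^sub>0 nat) \<Rightarrow> 'k. \<forall>t. 0 < Poly_Mapping.lookup t ?R \<longrightarrow> u t = 0}"
    have "koszul ?xs z0 bs \<in> ?S"
    proof (rule koszul_mem[where S = ?S])
      fix x and u :: "(nat \<Rightarrow>\<^sub>0 nat) \<Rightarrow> 'k" assume "x \<in> set ?xs" "u \<in> ?S"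
      then show "x u \<in> ?S" by (auto simp: set_std_shifts std_shift_def lookup_minus lookup_single)
    qed (auto simp: z0_def bot_def)
    then show ?thesis using that by blast
  qed
  \<comment> \<open>The first summand has no monomial containing the last variable and the second
    has only such monomials, so they vanish separately.\<close>
  have both: "koszul ?xs z0 bs = 0" "?x (y' bs) = 0" for bs
  proof -
    have "koszul ?xs z0 bs t = 0 \<and> ?x (y' bs) t = 0" for t
    proof (cases "0 < Poly_Mapping.lookup t ?R")
      case True
      then show ?thesis using no_R[OF True, of bs] fun_cong[OF kz0[of bs], of t] by simp
    next
      case False
      then show ?thesis using fun_cong[OF kz0[of bs], of t] by (simp add: std_shift_def)
    qed
    then show "koszul ?xs z0 bs = 0" "?x (y' bs) = 0" by (auto simp: fun_eq_iff)
  qed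
  \<comment> \<open>A standard monomial can be killed by the last variable only if that vertex is
    isolated and does not occur in the monomial; a nonadjacent pair among the other vertices would
    have made the monomial nonstandard before.\<close>
  have supp: "?R \<notin> D \<and> Poly_Mapping.lookup s ?R = 0" if s: "y' bs s \<noteq> 0" for bs s
  proof -
    have sW: "standard D s" "Poly_Mapping.keys s \<subseteq> {1..?R}" using y'W[of bs] s unfolding std_funs_def by blast+
    have "s + unit_exp ?R - unit_exp ?R = s"
      by (rule poly_mapping_eqI) (simp add: lookup_add lookup_minus)
    have "?x (y' bs) (s + unit_exp ?R) = 0" using both(2)[of bs] by simp
    then have "\<not> standard D (s + unit_exp ?R)"
      using s \<open>s + unit_exp ?R - unit_exp ?R = s\<close> by (simp add: std_shift_def lookup_add split: if_splits)
    then obtain a b where ab: "a \<in> insert ?R (Poly_Mapping.keys s)" "b \<in> insert ?R (Poly_Mapping.keys s)" "a < b" "b \<notin> D"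
      unfolding standard_def keys_plus_unit_exp by blast
    have "b \<le> ?R" using ab(2) sW(2) by auto
    then have a: "a \<in> Poly_Mapping.keys s" using ab(1,3) by auto
    then have b: "b = ?R" using ab sW(1) unfolding standard_def by blast
    then have "?R \<notin> Poly_Mapping.keys s" using a ab(3,4) sW(1) unfolding standard_def by blast
    then show ?thesis using b ab(4) by (simp add: in_keys_iff)
  qed
  have y'r: "y' bs \<in> ?W r d" for bs
    using y'W[of bs] supp[of bs] keys_le unfolding std_funs_def by blast
  have "\<exists>v\<in>chains r i (?W r (d - 1)). \<forall>bs. koszul ?xs v bs = y' bs \<and> ?x (v bs) = 0"
  proof (cases "(\<forall>bs. y' bs = 0)")
    case True
    then show ?thesis
      by (intro bexI[of _ "\<lambda>_. 0"]) (simp_all add: koszul_zero[OF com] x0 chains_zero[OF std_funs_zero])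
  next
    case False
    have "?R \<notin> D"
    proof
      assume "?R \<in> D"
      then have "y' bs s = 0" for bs s using supp[of bs s] by blast
      then have "\<forall>bs. y' bs = 0" by (simp add: fun_eq_iff)
      then show False using False by blast
    qed
    then have nD: "D \<noteq> UNIV" by blast
    have "i \<noteq> 0"
    proof
      assume i: "i = 0"
      have "y bs = 0" for bs unfolding y_def using chains_True_0 Suc.prems(1) i by blast
      moreover have "koszul ?xs z' = (\<lambda>_. 0)" using koszul_chains_0[OF com, of z'] z'c i by simp
      ultimately show False using False by (simp add: y'_def)
    qed
    then obtain i' where i': "i = Suc i'" by (cases i) auto
    then have d: "d \<ge> 2" using Suc.prems(3) nD by auto
    have yc: "y \<in> chains r i' (?W ?R d)" unfolding y_def using chains_True Suc.prems(1) i' by blast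
    have "koszul ?xs z' \<in> chains (length ?xs) i' (?W ?R d)"
      by (rule koszul_chains[where S = "?W ?R (d - 1)"])
        (use z'c i' com in \<open>auto simp: set_std_shifts intro: std_funs_shift std_funs_zero std_funs_add std_funs_neg\<close>)
    then have "y' \<in> chains r i' (?W ?R d)"
      unfolding y'_eq by (intro chains_add[OF std_funs_add yc]) simp_all
    then have "y' \<in> chains r i' (?W r d)" by (rule chains_change[OF _ y'r])
    from Suc.IH[OF this ky'] d obtain v where v: "v \<in> chains r (Suc i') (?W r (d - 1))" "\<And>bs. koszul ?xs v bs = y' bs" by blast
    \<comment> \<open>The monomials of \<open>v\<close> have degree d - 1 >= 1, so each contains an
      earlier vertex, which is not adjacent to the isolated last one.\<close>
    have "?x (v bs) t = 0" for bs t
    proof (rule ccontr)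
      assume "?x (v bs) t \<noteq> 0"
      then have t: "standard D t" "0 < Poly_Mapping.lookup t ?R" "v bs (t - unit_exp ?R) \<noteq> 0"
        by (auto simp: std_shift_def split: if_splits)
      then have k: "Poly_Mapping.keys (t - unit_exp ?R) \<subseteq> {1..r}" "int (monomial_degree (t - unit_exp ?R)) = d - 1"
        using chainsD'[OF v(1) std_funs_zero, of bs] unfolding std_funs_def by blast+
      then have "t - unit_exp ?R \<noteq> 0" using d monomial_degree_eq_0_iff[of "t - unit_exp ?R"] by linarith
      then obtain a where a: "a \<in> Poly_Mapping.keys (t - unit_exp ?R)" using keys_eq_empty by blast
      then have "a < ?R" "a \<in> Poly_Mapping.keys t" "?R \<in> Poly_Mapping.keys t"
        using k(1) keys_minus_unit_exp[OF t(2)] by auto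
      then show False using t(1) \<open>?R \<notin> D\<close> unfolding standard_def by blast
    qed
    then have "?x (v bs) = 0" for bs by (simp add: fun_eq_iff)
    then show ?thesis using v i' by blast
  qed
  then obtain v where v: "v \<in> chains r i (?W r (d - 1))" "\<And>bs. koszul ?xs v bs = y' bs" "\<And>bs. ?x (v bs) = 0" by blast
  obtain w where w: "w \<in> chains r (Suc i) (?W r (d - 1))" "\<And>bs. koszul ?xs w bs = z0 bs"
    using Suc.IH[OF z0c both(1) Suc.prems(3)] by blast
  have mono: "?W r (d - 1) \<subseteq> ?W ?R (d - 1)" by (rule std_funs_mono) simp
  let ?q = "cone w (z' - v)"
  have "z' - v \<in> chains r i (?W ?R (d - 1))"
    by (rule chains_diff[OF std_funs_diff z'c subsetD[OF chains_mono[OF mono] v(1)]])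
  then have "?q \<in> chains ?R (Suc i) (?W ?R (d - 1))"
    by (rule cone_chains[OF subsetD[OF chains_mono[OF mono] w(1)]])
  moreover have "koszul (std_shifts D ?R) ?q bs = p bs" for bs
  proof (cases bs)
    case Nil
    then show ?thesis using chainsD0[OF Suc.prems(1), of "[]"] by simp
  next
    case (Cons b bs')
    show ?thesis
    proof (cases b)
      case True
      have "koszul ?xs (z' - v) bs' = koszul ?xs z' bs' - y' bs'"
        using koszul_diff[OF com, of z' v bs'] v(2) by simp
      moreover have "(\<lambda>bs. ?q (True # bs)) = z' - v" by (rule ext) simp
      moreover have "bs = True # bs'" using Cons True by simp
      ultimately show ?thesis by (simp only: std_shifts.simps koszul.simps y'_def y_def) simp
    next
      case False
      have "koszul ?xs w bs' + ?x (z' bs' - v bs') = z bs'"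
        using split[OF zW[of bs']] unfolding xdiff v(3) w(2) by (simp add: z0_def z'_def)
      then show ?thesis using Cons False by (simp add: z_def)
    qed
  qed
  ultimately show ?case by blast
qed

text \<open>The relations of a direct sum of edge rings with one generator of degree 0 for each
  summand: in the l-th summand they are spanned by the monomials that are not standard for
  \<open>D l\<close>.\<close>

definition std_rels :: "nat \<Rightarrow> nat \<Rightarrow> (nat \<Rightarrow> nat set) \<Rightarrow> int \<Rightarrow> (idx \<Rightarrow> 'k::zero) set" where
  "std_rels n m D d = {u \<in> coords n {1..m} (\<lambda>_. 0) d. \<forall>l t. standard (D l) t \<longrightarrow> u (l, t) = 0}"

lemma relations_std_rels: "relations n {1..m} (\<lambda>_. 0) (std_rels n m D :: int \<Rightarrow> (idx \<Rightarrow> 'k::field) set)"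
proof (rule relations.intro)
  interpret v: vector_space "vscale :: 'k \<Rightarrow> _" by (rule vector_space_vscale)
  show "v.subspace (std_rels n m D d)" for d
    by (rule v.subspaceI) (auto simp: std_rels_def coords_zero coords_add coords_scale)
  show "shift i u \<in> std_rels n m D (j + 1)" if "i \<in> {1..n}" "u \<in> std_rels n m D j" for i j and u :: "idx \<Rightarrow> 'k"
    using that coords_shift[of i n u "{1..m}" "\<lambda>_. 0" j] by (auto simp: std_rels_def shift_def standard_minus)
qed (auto simp: std_rels_def)

text \<open>The class of the l-th coordinate in its edge ring, in the basis of standard
  monomials.\<close>

definition truncate :: "nat set \<Rightarrow> nat \<Rightarrow> (idx \<Rightarrow> 'k::zero) \<Rightarrow> (nat \<Rightarrow>\<^sub>0 nat) \<Rightarrow> 'k" where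
  "truncate D l u t = (if standard D t then u (l, t) else 0)"

lemma truncate_koszul:
  fixes p :: "bool list \<Rightarrow> idx \<Rightarrow> 'k::ab_group_add"
  shows "truncate D l (koszul (shifts n) p bs) = koszul (std_shifts D n) (\<lambda>bs. truncate D l (p bs)) bs"
proof (rule koszul_hom[where S = UNIV and h = "truncate D l :: (idx \<Rightarrow> 'k) \<Rightarrow> (nat \<Rightarrow>\<^sub>0 nat) \<Rightarrow> 'k"])
  have sh: "truncate D l (shift i u) = std_shift D i (truncate D l u)" for i and u :: "idx \<Rightarrow> 'k"
    by (auto simp: truncate_def std_shift_def shift_def fun_eq_iff standard_minus)
  have "list_all2 (\<lambda>x y. \<forall>u. truncate D l (x u) = y (truncate D l u))
    (shifts n :: ((idx \<Rightarrow> 'k) \<Rightarrow> _) list) (std_shifts D n)"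
    by (induction n) (simp_all add: sh)
  then show "list_all2 (\<lambda>x y. \<forall>u. u \<in> UNIV \<longrightarrow> x u \<in> UNIV \<and> truncate D l (x u) = y (truncate D l u))
    (shifts n :: ((idx \<Rightarrow> 'k) \<Rightarrow> _) list) (std_shifts D n)" by simp
qed (auto simp: truncate_def fun_eq_iff)

lemma truncate_std_funs: "u \<in> coords n {1..m} (\<lambda>_. 0) d \<Longrightarrow> truncate D l u \<in> std_funs D n d"
  unfolding coords_def std_funs_def truncate_def index_set_def by (auto split: if_splits)

lemma std_rels_iff:
  "u \<in> std_rels n m D d \<longleftrightarrow> u \<in> coords n {1..m} (\<lambda>_. 0) d \<and> (\<forall>l\<in>{1..m}. truncate (D l) l u = 0)"
proof -
  have "u (l, t) = 0" if "u \<in> coords n {1..m} (\<lambda>_. 0) d" "l \<notin> {1..m}" for l t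
    using that unfolding coords_def index_set_def by blast
  then show ?thesis
    unfolding std_rels_def truncate_def fun_eq_iff zero_fun_def by (auto split: if_splits)
qed

lemma monomial_degree_1_standard: "monomial_degree t = 1 \<Longrightarrow> standard D t"
  unfolding standard_def
proof (intro ballI impI)
  fix a b assume t: "monomial_degree t = 1" "a \<in> Poly_Mapping.keys t" "b \<in> Poly_Mapping.keys t" "a < b"
  have a: "0 < Poly_Mapping.lookup t a" using t(2) by (simp add: in_keys_iff)
  then have "t - unit_exp a = 0" using monomial_degree_minus[OF a] t(1) monomial_degree_eq_0_iff by simp
  then have "Poly_Mapping.keys t = {a}" using keys_minus_unit_exp[OF a] by simp
  then show "b \<in> D" using t(3,4) by simp
qed

text \<open>Coefficient degrees at least 2 are handled summand by summand. In coefficient degree 0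
  and positive exterior degree, a cycle closes exactly and not just modulo relations, since all
  monomials of degree 1 are standard; the Koszul complex of the polynomial ring then makes it a
  boundary of coefficients of degree -1, hence zero.\<close>

theorem two_linear_std_rels: "relations.two_linear n {1..m} (\<lambda>_. 0) (std_rels n m D :: int \<Rightarrow> (idx \<Rightarrow> 'k::field) set)"
proof -
  interpret relations n "{1..m}" "\<lambda>_. 0" "std_rels n m D :: int \<Rightarrow> (idx \<Rightarrow> 'k) set"
    by (rule relations_std_rels)
  have z: "koszul_betti i d = 0" if "cycles i d \<subseteq> chains n i (std_rels n m D d)" for i d
    unfolding koszul_betti_0_exact
  proof
    fix p assume "p \<in> cycles i d"
    then have p: "p \<in> chains n i (std_rels n m D d)" using that by blast
    have "(\<lambda>_. 0) \<in> chains n (Suc i) (U (d - 1))" by (rule chains_zero[OF coords_zero(1)])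
    moreover have "p = koszul (shifts n) (\<lambda>_. 0) + p" by (rule ext) (simp add: koszul_zero[OF commuting_shifts])
    ultimately show "p \<in> boundaries i d" unfolding boundaries_def using p by blast
  qed
  have neg: "koszul_betti i d = 0" if "d < 0" for i d
  proof (rule z)
    have "index_set n {1..m} (\<lambda>_. 0) d = {}" using that by (auto simp: index_set_def)
    then have "U d \<subseteq> {0}" by (auto simp: coords_def fun_eq_iff)
    then have "U d \<subseteq> std_rels n m D d" using B_zero by blast
    then have "chains n i (U d) \<subseteq> chains n i (std_rels n m D d)" by (rule chains_mono)
    then show "cycles i d \<subseteq> chains n i (std_rels n m D d)" unfolding cycles_def by blast
  qed
  have zero: "koszul_betti i 0 = 0" if "i > 0" for i
  proof (rule z, rule subsetI)
    fix p assume p: "p \<in> cycles i 0"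
    then have pc: "p \<in> chains n i (U 0)" and k: "\<And>bs. koszul (shifts n) p bs \<in> std_rels n m D (0 + 1)"
      unfolding cycles_def by blast+
    have "u = 0" if u: "u \<in> std_rels n m D (0 + 1)" for u :: "idx \<Rightarrow> 'k"
    proof -
      have "u (l, t) = 0" for l t
      proof (rule ccontr)
        assume ne: "u (l, t) \<noteq> 0"
        then have "monomial_degree t = 1" using u unfolding std_rels_def coords_def index_set_def by auto
        then show False using monomial_degree_1_standard[of t "D l"] u ne unfolding std_rels_def by blast
      qed
      then show ?thesis by (auto simp: fun_eq_iff)
    qed
    then have k0: "koszul (shifts n) p bs = 0" for bs using k by blast
    have "truncate UNIV l (p bs) = 0" for l bs
    proof -
      have c: "(\<lambda>bs. truncate UNIV l (p bs)) \<in> chains n i (std_funs UNIV n 0)"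
        by (rule chains_map[OF pc truncate_std_funs]) (auto simp: truncate_def fun_eq_iff)
      have "koszul (std_shifts UNIV n) (\<lambda>bs. truncate UNIV l (p bs)) bs = 0" for bs
        unfolding truncate_koszul[symmetric] k0 by (simp add: truncate_def fun_eq_iff)
      from std_koszul_exact[OF c this] that obtain q where q: "q \<in> chains n (Suc i) (std_funs UNIV n (0 - 1))"
        "\<And>bs. koszul (std_shifts UNIV n) q bs = truncate UNIV l (p bs)" by blast
      have "q bs = 0" for bs using chainsD'[OF q(1) std_funs_zero, of bs] unfolding std_funs_def by (auto simp: fun_eq_iff)
      then have "q = (\<lambda>_. 0)" by blast
      then show ?thesis using q(2)[of bs] koszul_zero[OF commuting_std_shifts] by metis
    qed
    then have "p bs (l, t) = 0" for bs l t
      by (metis (full_types) UNIV_I standard_def truncate_def zero_fun_apply)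
    then have "p bs = 0" for bs by (auto simp: fun_eq_iff)
    then show "p \<in> chains n i (std_rels n m D 0)" by (intro chainsI) (simp_all add: B_zero)
  qed
  have pos: "koszul_betti i d = 0" if d: "d \<ge> 2 \<or> i = 0 \<and> d \<ge> 1" for i d
    unfolding koszul_betti_0_exact
  proof
    fix p assume p: "p \<in> cycles i d"
    then have pc: "p \<in> chains n i (U d)" and k: "\<And>bs. koszul (shifts n) p bs \<in> std_rels n m D (d + 1)"
      unfolding cycles_def by blast+
    have "\<exists>q\<in>chains n (Suc i) (std_funs (D l) n (d - 1)).
        \<forall>bs. koszul (std_shifts (D l) n) q bs = truncate (D l) l (p bs)" if l: "l \<in> {1..m}" for l
    proof (rule std_koszul_exact)
      show "(\<lambda>bs. truncate (D l) l (p bs)) \<in> chains n i (std_funs (D l) n d)"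
        by (rule chains_map[OF pc truncate_std_funs]) (auto simp: truncate_def fun_eq_iff)
      show "koszul (std_shifts (D l) n) (\<lambda>bs. truncate (D l) l (p bs)) bs = 0" for bs
        unfolding truncate_koszul[symmetric] using k[of bs] l unfolding std_rels_iff by blast
    qed (use d in auto)
    then obtain q where q: "\<And>l. l \<in> {1..m} \<Longrightarrow> q l \<in> chains n (Suc i) (std_funs (D l) n (d - 1))"
      "\<And>l bs. l \<in> {1..m} \<Longrightarrow> koszul (std_shifts (D l) n) (q l) bs = truncate (D l) l (p bs)" by metis
    define Q where "Q bs = (\<lambda>(l, t). if l \<in> {1..m} then q l bs t else 0)" for bs
    have Qc: "Q \<in> chains n (Suc i) (U (d - 1))"
    proof (rule chainsI)
      fix bs :: "bool list" assume bs: "length bs = n" "count_list bs True = Suc i"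
      show "Q bs \<in> U (d - 1)"
        unfolding coords_def
      proof (intro CollectI allI impI)
        fix j assume j: "Q bs j \<noteq> 0"
        obtain l t where lt: "j = (l, t)" by fastforce
        then have l: "l \<in> {1..m}" "q l bs t \<noteq> 0" using j by (auto simp: Q_def split: if_splits)
        then have "Poly_Mapping.keys t \<subseteq> {1..n}" "int (monomial_degree t) = d - 1"
          using chainsD[OF q(1)[OF l(1)] bs] unfolding std_funs_def by blast+
        then show "j \<in> index_set n {1..m} (\<lambda>_. 0) (d - 1)" using l(1) lt by (simp add: index_set_def)
      qed
    next
      fix bs :: "bool list" assume bs: "\<not> (length bs = n \<and> count_list bs True = Suc i)"
      have "q l bs = 0" if "l \<in> {1..m}" for l using chainsD0[OF q(1)[OF that] bs] .
      then show "Q bs = 0" by (auto simp: Q_def fun_eq_iff)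
    qed
    have tQ: "truncate (D l) l (Q bs) = q l bs" if l: "l \<in> {1..m}" for l bs
      using chainsD'[OF q(1)[OF l] std_funs_zero, of bs] l unfolding std_funs_def
      by (auto simp: truncate_def Q_def fun_eq_iff)
    let ?b = "p - koszul (shifts n) Q"
    have bU: "?b \<in> chains n i (U d)" by (rule chains_diff[OF coords_diff pc koszul_U[OF Qc]])
    have "?b bs \<in> std_rels n m D d" for bs
      unfolding std_rels_iff
    proof (intro conjI ballI)
      show "?b bs \<in> U d" by (rule chainsD'[OF bU coords_zero(1)])
      fix l assume l: "l \<in> {1..m}"
      have "(\<lambda>bs. truncate (D l) l (Q bs)) = q l" using tQ[OF l] by blast
      then have "truncate (D l) l (koszul (shifts n) Q bs) = truncate (D l) l (p bs)"
        unfolding truncate_koszul using q(2)[OF l] by simp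
      then show "truncate (D l) l (?b bs) = 0"
        by (auto simp: truncate_def fun_eq_iff split: if_splits)
    qed
    then have "?b \<in> chains n i (std_rels n m D d)" by (rule chains_change[OF bU])
    moreover have "p = koszul (shifts n) Q + ?b" by simp
    ultimately show "p \<in> boundaries i d" unfolding boundaries_def using Qc by blast
  qed
  show ?thesis
    unfolding two_linear_def
  proof (intro conjI allI impI)
    fix d :: int assume "d \<noteq> 0"
    then show "koszul_betti 0 d = 0" using neg[of d 0] pos[of d 0] by linarith
  next
    fix i and d :: int assume "d \<noteq> 1"
    then show "koszul_betti (Suc i) d = 0" using neg[of d "Suc i"] pos[of d "Suc i"] zero[of "Suc i"] by (cases "d = 0") force+
  qed
qed

section \<open>Counting standard monomials\<close>

definition std_monomials :: "nat set \<Rightarrow> nat \<Rightarrow> nat \<Rightarrow> (nat \<Rightarrow>\<^sub>0 nat) set" where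
  "std_monomials D N d = {t. standard D t \<and> Poly_Mapping.keys t \<subseteq> {1..N} \<and> monomial_degree t = d}"

lemma finite_std_monomials: "finite (std_monomials D N d)"
  by (rule finite_subset[OF _ finite_monomials[of N d]]) (auto simp: std_monomials_def)

lemma hilbert_std_rels:
  "relations.hilbert n {1..m} (\<lambda>_. 0) (std_rels n m D :: int \<Rightarrow> (idx \<Rightarrow> 'k::field) set) (int d)
    = (\<Sum>l\<in>{1..m}. int (card (std_monomials (D l) n d)))"
proof -
  interpret relations n "{1..m}" "\<lambda>_. 0" "std_rels n m D :: int \<Rightarrow> (idx \<Rightarrow> 'k) set"
    by (rule relations_std_rels)
  let ?I = "index_set n {1..m} (\<lambda>_. 0) (int d)"
  let ?S = "Sigma {1..m} (\<lambda>l. std_monomials (D l) n d)"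
  have fin: "finite ?I" by (rule finite_index_set'[OF finite_G])
  have key: "i \<in> ?S \<longleftrightarrow> standard (D (fst i)) (snd i)" if "i \<in> ?I" for i
    using that by (cases i) (simp add: index_set_def std_monomials_def)
  have eq: "std_rels n m D (int d) = {f :: idx \<Rightarrow> 'k. \<forall>i. f i \<noteq> 0 \<longrightarrow> i \<in> ?I - ?S}"
  proof (intro equalityI subsetI CollectI allI impI)
    fix u :: "idx \<Rightarrow> 'k" and i assume u: "u \<in> std_rels n m D (int d)" "u i \<noteq> 0"
    then have i: "i \<in> ?I" unfolding std_rels_def coords_def by blast
    have "\<not> standard (D (fst i)) (snd i)" using u unfolding std_rels_def by (cases i) auto
    then show "i \<in> ?I - ?S" using i key[OF i] by blast
  next
    fix u :: "idx \<Rightarrow> 'k" assume u: "u \<in> {f. \<forall>i. f i \<noteq> 0 \<longrightarrow> i \<in> ?I - ?S}"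
    have "u (l, t) = 0" if "standard (D l) t" for l t
    proof (rule ccontr)
      assume "u (l, t) \<noteq> 0"
      then have "(l, t) \<in> ?I" "(l, t) \<notin> ?S" using u by blast+
      then show False using key[of "(l, t)"] that by simp
    qed
    moreover have "u \<in> coords n {1..m} (\<lambda>_. 0) (int d)" using u unfolding coords_def by blast
    ultimately show "u \<in> std_rels n m D (int d)" unfolding std_rels_def by blast
  qed
  have "v.dim (std_rels n m D (int d) :: (idx \<Rightarrow> 'k) set) = card (?I - ?S)"
    unfolding eq by (rule finite_dim_supported(2)[OF finite_Diff[OF fin]])
  moreover have "v.dim (U (int d) :: (idx \<Rightarrow> 'k) set) = card ?I" by (rule finite_dim_coords(2)[OF fin])
  moreover have "?S \<subseteq> ?I" by (auto simp: index_set_def std_monomials_def)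
  then have "card (?I - ?S) = card ?I - card ?S" "card ?S \<le> card ?I"
    using card_Diff_subset[of ?S ?I] finite_subset[OF _ fin] card_mono[OF fin] by auto
  ultimately have "hilbert (int d) = int (card ?S)" unfolding hilbert_def by simp
  then show ?thesis using finite_std_monomials by simp
qed

lemma std_monomials_0: "std_monomials D N 0 = {0}"
  by (auto simp: std_monomials_def monomial_degree_eq_0_iff standard_def)

text \<open>Multiplication by a dominating last vertex preserves standardness, so the monomials that
  contain it are the multiples of arbitrary standard ones.\<close>

lemma std_monomials_dominating:
  assumes "Suc r \<in> D"
  shows "card (std_monomials D (Suc r) (Suc d)) = card (std_monomials D r (Suc d)) + card (std_monomials D (Suc r) d)"
proof -
  let ?e = "unit_exp (Suc r)"
  have "std_monomials D (Suc r) (Suc d) = std_monomials D r (Suc d) \<union> (\<lambda>s. s + ?e) ` std_monomials D (Suc r) d"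
  proof (intro equalityI subsetI)
    fix t assume t: "t \<in> std_monomials D (Suc r) (Suc d)"
    show "t \<in> std_monomials D r (Suc d) \<union> (\<lambda>s. s + ?e) ` std_monomials D (Suc r) d"
    proof (cases "0 < Poly_Mapping.lookup t (Suc r)")
      case True
      then have "t - ?e \<in> std_monomials D (Suc r) d"
        using t standard_minus keys_minus_unit_exp[OF True] monomial_degree_minus[OF True] by (auto simp: std_monomials_def)
      moreover have "t = t - ?e + ?e" using minus_unit_exp[OF True] by (simp add: add.commute)
      ultimately show ?thesis by blast
    next
      case False
      then have "Suc r \<notin> Poly_Mapping.keys t" by (simp add: in_keys_iff)
      then have "t \<in> std_monomials D r (Suc d)" using t atLeastAtMostSuc_conv[of 1 r] by (auto simp: std_monomials_def)
      then show ?thesis by blast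
    qed
  next
    fix t assume "t \<in> std_monomials D r (Suc d) \<union> (\<lambda>s. s + ?e) ` std_monomials D (Suc r) d"
    then show "t \<in> std_monomials D (Suc r) (Suc d)"
    proof
      assume "t \<in> std_monomials D r (Suc d)"
      then show ?thesis by (force simp: std_monomials_def)
    next
      assume "t \<in> (\<lambda>s. s + ?e) ` std_monomials D (Suc r) d"
      then obtain s where s: "t = s + ?e" "standard D s" "Poly_Mapping.keys s \<subseteq> {1..Suc r}" "monomial_degree s = d"
        by (auto simp: std_monomials_def)
      have "standard D t"
        unfolding standard_def s(1) keys_plus_unit_exp
      proof (intro ballI impI)
        fix a b assume ab: "a \<in> insert (Suc r) (Poly_Mapping.keys s)" "b \<in> insert (Suc r) (Poly_Mapping.keys s)" "a < b"
        show "b \<in> D"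
        proof (cases "b = Suc r")
          case False
          then have "b \<in> Poly_Mapping.keys s" "b \<le> Suc r" using ab(2) s(3) by auto
          then show ?thesis using ab(1,3) s(2) unfolding standard_def by auto
        qed (use assms in simp)
      qed
      then show ?thesis using s by (simp add: std_monomials_def keys_plus_unit_exp monomial_degree_add)
    qed
  qed
  moreover have "std_monomials D r (Suc d) \<inter> (\<lambda>s. s + ?e) ` std_monomials D (Suc r) d = {}"
    by (auto simp: std_monomials_def keys_plus_unit_exp)
  moreover have "card ((\<lambda>s. s + ?e) ` std_monomials D (Suc r) d) = card (std_monomials D (Suc r) d)"
    by (rule card_image) (simp add: inj_on_def)
  ultimately show ?thesis using finite_std_monomials by (simp add: card_Un_disjoint)
qed

text \<open>An isolated last vertex contributes its pure power and nothing else.\<close>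

lemma std_monomials_isolated:
  assumes "Suc r \<notin> D"
  shows "card (std_monomials D (Suc r) (Suc d)) = card (std_monomials D r (Suc d)) + 1"
proof -
  let ?t = "Poly_Mapping.single (Suc r) (Suc d)"
  have "std_monomials D (Suc r) (Suc d) = insert ?t (std_monomials D r (Suc d))"
  proof (intro equalityI subsetI)
    fix t assume t: "t \<in> std_monomials D (Suc r) (Suc d)"
    show "t \<in> insert ?t (std_monomials D r (Suc d))"
    proof (cases "Suc r \<in> Poly_Mapping.keys t")
      case True
      have "a = Suc r" if a: "a \<in> Poly_Mapping.keys t" for a
      proof (rule ccontr)
        assume "a \<noteq> Suc r"
        moreover have "a \<le> Suc r" using a t by (auto simp: std_monomials_def)
        ultimately show False using a True t assms unfolding std_monomials_def standard_def by force
      qed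
      then have k: "Poly_Mapping.keys t = {Suc r}" using True by blast
      then have "Poly_Mapping.lookup t (Suc r) = Suc d" using t by (simp add: std_monomials_def monomial_degree_def)
      then have "t = ?t"
        by (intro poly_mapping_eqI) (metis k lookup_single_eq lookup_single_not_eq not_in_keys_iff_lookup_eq_zero singletonD)
      then show ?thesis by blast
    next
      case False
      then have "t \<in> std_monomials D r (Suc d)" using t atLeastAtMostSuc_conv[of 1 r] by (auto simp: std_monomials_def)
      then show ?thesis by blast
    qed
  next
    fix t assume "t \<in> insert ?t (std_monomials D r (Suc d))"
    then show "t \<in> std_monomials D (Suc r) (Suc d)"
    proof
      assume "t = ?t"
      then show ?thesis by (simp add: std_monomials_def standard_def monomial_degree_def)
    next
      assume "t \<in> std_monomials D r (Suc d)"
      then show ?thesis by (force simp: std_monomials_def)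
    qed
  qed
  moreover have "?t \<notin> std_monomials D r (Suc d)" by (simp add: std_monomials_def)
  ultimately show ?thesis using finite_std_monomials by simp
qed

section \<open>Edge rings of threshold graphs\<close>

definition numbered_threshold_graph :: "nat set \<Rightarrow> nat \<Rightarrow> nat graph" where
  "numbered_threshold_graph D N = ({1..N}, {{a, b} |a b. a \<in> {1..N} \<and> b \<in> {1..N} \<and> a < b \<and> b \<in> D})"

lemma threshold_numbered: "threshold_graph (numbered_threshold_graph D (Suc N))"
proof (induction N)
  case 0
  have "numbered_threshold_graph D (Suc 0) = ({1}, {})" by (auto simp: numbered_threshold_graph_def)
  then show ?case using threshold_graph.single[of "Suc 0"] by simp
next
  case (Suc N)
  let ?v = "Suc (Suc N)" and ?G = "numbered_threshold_graph D (Suc N)"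
  have v: "{1..?v} = insert ?v {1..Suc N}" by auto
  have new: "?v \<notin> fst ?G" by (simp add: numbered_threshold_graph_def)
  have edges: "snd (numbered_threshold_graph D ?v) = snd ?G \<union> (if ?v \<in> D then {{u, ?v} |u. u \<in> {1..Suc N}} else {})"
  proof (intro equalityI subsetI)
    fix e assume "e \<in> snd (numbered_threshold_graph D ?v)"
    then obtain a b where ab: "e = {a, b}" "a \<in> {1..?v}" "b \<in> {1..?v}" "a < b" "b \<in> D"
      by (auto simp: numbered_threshold_graph_def)
    have a: "a \<in> {1..Suc N}" using ab by auto
    show "e \<in> snd ?G \<union> (if ?v \<in> D then {{u, ?v} |u. u \<in> {1..Suc N}} else {})"
    proof (cases "b = ?v")
      case True
      then show ?thesis using ab(1,5) a by auto
    next
      case False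
      then have "b \<in> {1..Suc N}" using ab(3) by auto
      then have "e \<in> snd ?G" using ab a unfolding numbered_threshold_graph_def snd_conv by blast
      then show ?thesis by blast
    qed
  next
    fix e assume "e \<in> snd ?G \<union> (if ?v \<in> D then {{u, ?v} |u. u \<in> {1..Suc N}} else {})"
    then consider "e \<in> snd ?G" | u where "e = {u, ?v}" "u \<in> {1..Suc N}" "?v \<in> D"
      by (auto split: if_splits)
    then show "e \<in> snd (numbered_threshold_graph D ?v)"
    proof cases
      case 1
      then obtain a b where ab: "e = {a, b}" "a \<in> {1..Suc N}" "b \<in> {1..Suc N}" "a < b" "b \<in> D"
        by (auto simp: numbered_threshold_graph_def)
      then have "a \<in> {1..?v}" "b \<in> {1..?v}" by auto
      then show ?thesis using ab unfolding numbered_threshold_graph_def snd_conv by blast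
    next
      case 2
      then have "u \<in> {1..?v}" "?v \<in> {1..?v}" "u < ?v" by auto
      then show ?thesis using 2 unfolding numbered_threshold_graph_def snd_conv by blast
    qed
  qed
  have fst: "fst (numbered_threshold_graph D ?v) = insert ?v (fst ?G)"
    using v by (simp add: numbered_threshold_graph_def)
  show ?case
  proof (cases "?v \<in> D")
    case True
    have "{{u, ?v} |u. u \<in> {1..Suc N}} = {{u, ?v} |u. u \<in> fst ?G}" by (simp add: numbered_threshold_graph_def)
    then have "numbered_threshold_graph D ?v = add_dominating ?v ?G"
      using fst edges True by (cases ?G, cases "numbered_threshold_graph D ?v") simp
    then show ?thesis using threshold_graph.dominating[OF Suc new] by simp
  next
    case False
    then have "numbered_threshold_graph D ?v = add_isolated ?v ?G"
      using fst edges by (cases ?G, cases "numbered_threshold_graph D ?v") simp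
    then show ?thesis using threshold_graph.isolated[OF Suc new] by simp
  qed
qed

section \<open>The polynomial ring and the nonedge ideal as a span of monomials\<close>

lemma mem_mpoly_ring: "p \<in> carrier (mpoly_ring n) \<longleftrightarrow> (\<forall>t. Poly_Mapping.lookup p t \<noteq> 0 \<longrightarrow> Poly_Mapping.keys t \<subseteq> {1..n})"
  by (auto simp: mpoly_ring_def in_keys_iff)

lemma mpoly_ring_add: "p \<in> carrier (mpoly_ring n) \<Longrightarrow> q \<in> carrier (mpoly_ring n) \<Longrightarrow> p + q \<in> carrier (mpoly_ring n)"
proof -
  assume pq: "p \<in> carrier (mpoly_ring n)" "q \<in> carrier (mpoly_ring n)"
  show ?thesis
    unfolding mem_mpoly_ring lookup_add
  proof (intro allI impI)
    fix t assume "Poly_Mapping.lookup p t + Poly_Mapping.lookup q t \<noteq> 0"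
    then have "Poly_Mapping.lookup p t \<noteq> 0 \<or> Poly_Mapping.lookup q t \<noteq> 0" by auto
    then show "Poly_Mapping.keys t \<subseteq> {1..n}" using pq unfolding mem_mpoly_ring by blast
  qed
qed

lemma mpoly_ring_neg: "p \<in> carrier (mpoly_ring n) \<Longrightarrow> - p \<in> carrier (mpoly_ring n)"
  unfolding mem_mpoly_ring by simp

lemma mpoly_ring_mult:
  assumes "p \<in> carrier (mpoly_ring n)" "q \<in> carrier (mpoly_ring n)"
  shows "p * q \<in> carrier (mpoly_ring n)"
  unfolding mpoly_ring_def partial_object.simps mem_Collect_eq
proof (intro ballI)
  fix t assume "t \<in> Poly_Mapping.keys (p * q)"
  then obtain a b where "t = a + b" "a \<in> Poly_Mapping.keys p" "b \<in> Poly_Mapping.keys q"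
    using Poly_Mapping.keys_mult[of p q] by blast
  then have "Poly_Mapping.keys a \<subseteq> {1..n}" "Poly_Mapping.keys b \<subseteq> {1..n}" "t = a + b"
    using assms unfolding mpoly_ring_def by simp_all
  then show "Poly_Mapping.keys t \<subseteq> {1..n}" using Poly_Mapping.keys_add[of a b] by blast
qed

lemma cring_mpoly_ring: "cring (mpoly_ring n :: 'k::field mpoly ring)"
proof (rule cringI)
  have c0: "(0 :: 'k mpoly) \<in> carrier (mpoly_ring n)" and c1: "(1 :: 'k mpoly) \<in> carrier (mpoly_ring n)"
    by (auto simp: mpoly_ring_def)
  show "abelian_group (mpoly_ring n :: 'k mpoly ring)"
    by (rule abelian_groupI) (auto simp: mpoly_ring_add c0 algebra_simps intro!: bexI[of _ "- _"] mpoly_ring_neg)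
  show "Group.comm_monoid (mpoly_ring n :: 'k mpoly ring)"
    by (rule comm_monoidI) (auto simp: mpoly_ring_mult c1 algebra_simps)
qed (simp add: algebra_simps)

definition std_ideal :: "nat set \<Rightarrow> nat \<Rightarrow> 'k::field mpoly set" where
  "std_ideal D N = {p \<in> carrier (mpoly_ring N). \<forall>t. standard D t \<longrightarrow> Poly_Mapping.lookup p t = 0}"

lemma standard_add: "standard D (s + t) \<Longrightarrow> standard D t"
  by (erule standard_subset) (auto simp: in_keys_iff lookup_add)

lemma ideal_std_ideal: "ideal (std_ideal D N) (mpoly_ring N :: 'k::field mpoly ring)"
proof -
  interpret R: cring "mpoly_ring N :: 'k mpoly ring" by (rule cring_mpoly_ring)
  have mult: "p * q \<in> std_ideal D N" if p: "p \<in> carrier (mpoly_ring N)" and q: "q \<in> std_ideal D N" for p q :: "'k mpoly"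
  proof -
    have "Poly_Mapping.lookup (p * q) t = 0" if t: "standard D t" for t
    proof (rule ccontr)
      assume "Poly_Mapping.lookup (p * q) t \<noteq> 0"
      then obtain a b where ab: "t = a + b" "b \<in> Poly_Mapping.keys q"
        using Poly_Mapping.keys_mult[of p q] by (auto simp: in_keys_iff)
      then have "standard D b" using t standard_add[of D a b] by simp
      then show False using ab(2) q by (simp add: std_ideal_def in_keys_iff)
    qed
    then show ?thesis using p q mpoly_ring_mult[of p N q] by (simp add: std_ideal_def)
  qed
  show ?thesis
  proof (rule idealI[OF R.ring_axioms])
    show "subgroup (std_ideal D N) (add_monoid (mpoly_ring N :: 'k mpoly ring))"
    proof (rule R.add.subgroupI)
      have "(0 :: 'k mpoly) \<in> std_ideal D N" using R.zero_closed by (simp add: std_ideal_def)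
      then show "std_ideal D N \<noteq> ({} :: 'k mpoly set)" by blast
      fix a :: "'k mpoly" assume a: "a \<in> std_ideal D N"
      have "\<ominus>\<^bsub>mpoly_ring N\<^esub> a = - a"
        using a by (intro R.minus_equality) (auto simp: std_ideal_def mpoly_ring_neg)
      then show "\<ominus>\<^bsub>mpoly_ring N\<^esub> a \<in> std_ideal D N"
        using a by (simp add: std_ideal_def mpoly_ring_neg)
    qed (auto simp: std_ideal_def mpoly_ring_add lookup_add)
    show "x \<otimes>\<^bsub>mpoly_ring N\<^esub> a \<in> std_ideal D N" "a \<otimes>\<^bsub>mpoly_ring N\<^esub> x \<in> std_ideal D N"
      if "a \<in> std_ideal D N" "x \<in> carrier (mpoly_ring N)" for a x :: "'k mpoly"
      using mult[OF that(2,1)] by (simp_all add: mult.commute[of a x])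
  qed
qed

lemma var_times_var: "var a * var b = (Poly_Mapping.single (unit_exp a + unit_exp b) 1 :: 'k::field mpoly)"
  by (simp add: var_def mult_single)

text \<open>A monomial fails to be standard exactly if it is divisible by x_a x_b for some nonedge
  ab, and an ideal generated by monomials is spanned by the monomials in it.\<close>

lemma nonedge_ideal_numbered:
  "nonedge_ideal N (numbered_threshold_graph D N) = (std_ideal D N :: 'k::field mpoly set)"
proof -
  interpret R: cring "mpoly_ring N :: 'k mpoly ring" by (rule cring_mpoly_ring)
  let ?S = "{var a * var b | a b. a \<in> {1..N} \<and> b \<in> {1..N} \<and> a \<noteq> b \<and> {a, b} \<notin> snd (numbered_threshold_graph D N)} :: 'k mpoly set"
  have keys2: "Poly_Mapping.keys (unit_exp a + unit_exp b) = {a, b}" for a b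
    by (auto simp: in_keys_iff lookup_add lookup_single when_def split: if_splits)
  have S_carrier: "?S \<subseteq> carrier (mpoly_ring N)"
    by (auto simp: var_times_var mpoly_ring_def keys2)
  have S_std: "?S \<subseteq> std_ideal D N"
  proof
    fix p assume pS: "p \<in> ?S"
    then obtain a b where p: "p = var a * var b" "a \<in> {1..N}" "b \<in> {1..N}" "a \<noteq> b" "{a, b} \<notin> snd (numbered_threshold_graph D N)" by blast
    have "\<not> standard D (unit_exp a + unit_exp b)"
    proof
      assume "standard D (unit_exp a + unit_exp b)"
      then have d: "a < b \<Longrightarrow> b \<in> D" "b < a \<Longrightarrow> a \<in> D" unfolding standard_def keys2 by blast+
      have "{a, b} \<in> snd (numbered_threshold_graph D N)"
      proof (cases "a < b")
        case True
        then show ?thesis using d(1) p(2,3) unfolding numbered_threshold_graph_def snd_conv by blast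
      next
        case False
        then have "b < a" using p(4) by simp
        then have "{b, a} \<in> snd (numbered_threshold_graph D N)"
          using d(2) p(2,3) unfolding numbered_threshold_graph_def snd_conv by blast
        then show ?thesis by (simp add: insert_commute)
      qed
      then show False using p(5) by blast
    qed
    then have "Poly_Mapping.lookup p t = 0" if "standard D t" for t
      using that unfolding p(1) var_times_var by (auto simp: lookup_single when_def)
    then show "p \<in> std_ideal D N" using pS S_carrier by (auto simp: std_ideal_def)
  qed
  have idl: "ideal (Idl\<^bsub>mpoly_ring N\<^esub> ?S) (mpoly_ring N)" by (rule R.genideal_ideal[OF S_carrier])
  have mono: "Poly_Mapping.single t c \<in> Idl\<^bsub>mpoly_ring N\<^esub> ?S"
    if t: "\<not> standard D t" "Poly_Mapping.keys t \<subseteq> {1..N}" for t and c :: 'k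
  proof -
    obtain a b where ab: "a \<in> Poly_Mapping.keys t" "b \<in> Poly_Mapping.keys t" "a < b" "b \<notin> D"
      using t(1) unfolding standard_def by blast
    have "{a, b} \<notin> snd (numbered_threshold_graph D N)"
    proof
      assume "{a, b} \<in> snd (numbered_threshold_graph D N)"
      then obtain a' b' where "{a, b} = {a', b'}" "a' < b'" "b' \<in> D" by (auto simp: numbered_threshold_graph_def)
      then show False using ab(3,4) by (auto simp: doubleton_eq_iff)
    qed
    moreover have "a \<in> {1..N}" "b \<in> {1..N}" "a \<noteq> b" using ab t(2) by auto
    ultimately have "(var a * var b :: 'k mpoly) \<in> ?S" by blast
    then have v: "(var a * var b :: 'k mpoly) \<in> Idl\<^bsub>mpoly_ring N\<^esub> ?S" using R.genideal_self[OF S_carrier] by blast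
    have c: "(Poly_Mapping.single (t - unit_exp a - unit_exp b) c :: 'k mpoly) \<in> carrier (mpoly_ring N)"
      using t(2) by (auto simp: mem_mpoly_ring lookup_single when_def in_keys_iff lookup_minus split: if_splits)
    have "(Poly_Mapping.single (t - unit_exp a - unit_exp b) c :: 'k mpoly) * (var a * var b) \<in> Idl\<^bsub>mpoly_ring N\<^esub> ?S"
      using ideal.I_l_closed[OF idl v c] by simp
    moreover have "t - unit_exp a - unit_exp b + (unit_exp a + unit_exp b) = t"
      using ab by (intro poly_mapping_eqI) (auto simp: lookup_add lookup_minus lookup_single when_def in_keys_iff)
    ultimately show ?thesis by (simp add: var_times_var mult_single)
  qed
  have "p \<in> Idl\<^bsub>mpoly_ring N\<^esub> ?S" if p: "p \<in> std_ideal D N" for p :: "'k mpoly"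
  proof -
    have sum: "(\<Sum>t\<in>A. Poly_Mapping.single t (Poly_Mapping.lookup p t)) \<in> Idl\<^bsub>mpoly_ring N\<^esub> ?S"
      if "finite A" "A \<subseteq> Poly_Mapping.keys p" for A
      using that
    proof (induction A rule: finite_induct)
      case empty
      then show ?case using additive_subgroup.zero_closed[OF ideal.axioms(1)[OF idl]] by simp
    next
      case (insert t A)
      have "Poly_Mapping.lookup p t \<noteq> 0" using insert.prems by (simp add: in_keys_iff)
      then have "\<not> standard D t" "Poly_Mapping.keys t \<subseteq> {1..N}"
        using p by (auto simp: std_ideal_def mem_mpoly_ring)
      from mono[OF this] insert show ?case
        using additive_subgroup.a_closed[OF ideal.axioms(1)[OF idl]] by simp
    qed
    have eq: "(\<Sum>t\<in>Poly_Mapping.keys p. Poly_Mapping.single t (Poly_Mapping.lookup p t)) = p"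
      by (rule poly_mapping_eqI) (simp add: lookup_sum lookup_single when_def in_keys_iff)
    show ?thesis using sum[OF finite_keys order_refl] unfolding eq .
  qed
  moreover have "Idl\<^bsub>mpoly_ring N\<^esub> ?S \<subseteq> std_ideal D N"
    by (rule R.genideal_minimal[OF ideal_std_ideal S_std])
  ultimately show ?thesis unfolding nonedge_ideal_def by blast
qed

section \<open>Direct sums of edge rings in standard coefficients\<close>

definition std_coset :: "nat set \<Rightarrow> nat \<Rightarrow> 'k::field mpoly \<Rightarrow> 'k mpoly set" where
  "std_coset D N p = std_ideal D N +>\<^bsub>mpoly_ring N\<^esub> p"

lemma std_coset_eq_iff:
  assumes "p \<in> carrier (mpoly_ring N)" "q \<in> carrier (mpoly_ring N)"
  shows "std_coset D N p = std_coset D N q \<longleftrightarrow> (\<forall>t. standard D t \<longrightarrow> Poly_Mapping.lookup p t = Poly_Mapping.lookup q t)"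
proof -
  have eq: "std_coset D N p = {r \<in> carrier (mpoly_ring N). \<forall>t. standard D t \<longrightarrow> Poly_Mapping.lookup r t = Poly_Mapping.lookup p t}"
    if p: "p \<in> carrier (mpoly_ring N)" for p :: "'a mpoly"
  proof (intro equalityI subsetI)
    fix r assume "r \<in> std_coset D N p"
    then obtain h where "h \<in> std_ideal D N" "r = h + p" unfolding std_coset_def a_r_coset_def' by auto
    then show "r \<in> {r \<in> carrier (mpoly_ring N). \<forall>t. standard D t \<longrightarrow> Poly_Mapping.lookup r t = Poly_Mapping.lookup p t}"
      using p by (simp add: std_ideal_def mpoly_ring_add lookup_add)
  next
    fix r assume r: "r \<in> {r \<in> carrier (mpoly_ring N). \<forall>t. standard D t \<longrightarrow> Poly_Mapping.lookup r t = Poly_Mapping.lookup p t}"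
    then have "r - p \<in> std_ideal D N"
      using mpoly_ring_add[of r N "- p"] mpoly_ring_neg[OF p] by (simp add: std_ideal_def lookup_minus)
    moreover have "r = (r - p) + p" by simp
    ultimately show "r \<in> std_coset D N p" unfolding std_coset_def a_r_coset_def' mpoly_ring_simps by blast
  qed
  show ?thesis unfolding eq[OF assms(1)] eq[OF assms(2)] using assms by auto
qed

lemma graph_module_numbered:
  fixes p q :: "'k::field mpoly" and N :: nat and D :: "nat set"
  defines "M \<equiv> graph_module N (numbered_threshold_graph D N) :: ('k mpoly, 'k mpoly set) graded_module"
  shows "carrier M = std_coset D N ` carrier (mpoly_ring N)" "zero M = std_coset D N 0"
    and "grade M j = std_coset D N ` homogeneous N j"
    and "p \<in> carrier (mpoly_ring N) \<Longrightarrow> q \<in> carrier (mpoly_ring N) \<Longrightarrow>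
      add M (std_coset D N p) (std_coset D N q) = std_coset D N (p + q)"
    and "p \<in> carrier (mpoly_ring N) \<Longrightarrow> q \<in> carrier (mpoly_ring N) \<Longrightarrow>
      p \<odot>\<^bsub>M\<^esub> std_coset D N q = std_coset D N (p * q)"
proof -
  let ?R = "mpoly_ring N :: 'k mpoly ring" and ?I = "std_ideal D N :: 'k mpoly set"
  note hom = ideal.rcos_ring_hom[OF ideal_std_ideal[of D N, where 'k = 'k]]
  show "carrier M = std_coset D N ` carrier (mpoly_ring N)"
    by (auto simp: M_def graph_module_def Let_def nonedge_ideal_numbered FactRing_def A_RCOSETS_def' std_coset_def)
  have "std_coset D N 0 = ?I"
    unfolding std_coset_def a_r_coset_def' by auto
  then show "zero M = std_coset D N 0"
    by (simp add: M_def graph_module_def Let_def nonedge_ideal_numbered FactRing_def)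
  show "grade M j = std_coset D N ` homogeneous N j"
    by (auto simp: M_def graph_module_def Let_def nonedge_ideal_numbered std_coset_def)
  show "add M (std_coset D N p) (std_coset D N q) = std_coset D N (p + q)"
    if "p \<in> carrier (mpoly_ring N)" "q \<in> carrier (mpoly_ring N)"
    using ring_hom_add[OF hom that] by (simp add: M_def graph_module_def Let_def nonedge_ideal_numbered std_coset_def)
  show "p \<odot>\<^bsub>M\<^esub> std_coset D N q = std_coset D N (p * q)"
    if "p \<in> carrier (mpoly_ring N)" "q \<in> carrier (mpoly_ring N)"
    using ring_hom_mult[OF hom that] by (simp add: M_def graph_module_def Let_def nonedge_ideal_numbered std_coset_def)
qed

text \<open>\<open>field_type\<close> fixes the field, which \<open>N\<close>, \<open>m\<close> and
  \<open>D\<close> do not mention.\<close>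

locale threshold_sum =
  fixes N m :: nat and D :: "nat \<Rightarrow> nat set" and field_type :: "'k::field itself"
begin

definition M :: "('k mpoly, nat \<Rightarrow> 'k mpoly set) graded_module" where
  "M = direct_sum {1..m} (\<lambda>l. graph_module N (numbered_threshold_graph (D l) N))"

abbreviation F :: "('k mpoly, nat \<Rightarrow>\<^sub>0 'k mpoly) graded_module" where
  "F \<equiv> free_module N {1..m} (\<lambda>_. 0)"

definition proj :: "(nat \<Rightarrow>\<^sub>0 'k mpoly) \<Rightarrow> nat \<Rightarrow> 'k mpoly set" where
  "proj f = (\<lambda>l\<in>{1..m}. std_coset (D l) N (Poly_Mapping.lookup f l))"

lemma lookup_carrier: "f \<in> carrier F \<Longrightarrow> Poly_Mapping.lookup f l \<in> carrier (mpoly_ring N)"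
  by (simp add: free_module_def)

lemma proj_eq_iff:
  assumes "f \<in> carrier F" "g \<in> carrier F"
  shows "proj f = proj g \<longleftrightarrow> (\<forall>l\<in>{1..m}. \<forall>t. standard (D l) t \<longrightarrow> coeff f (l, t) = coeff g (l, t))"
proof -
  have "proj f = proj g \<longleftrightarrow> (\<forall>l\<in>{1..m}. std_coset (D l) N (Poly_Mapping.lookup f l) = std_coset (D l) N (Poly_Mapping.lookup g l))"
    unfolding proj_def by (auto simp: fun_eq_iff restrict_def)
  then show ?thesis using std_coset_eq_iff[OF lookup_carrier[OF assms(1)] lookup_carrier[OF assms(2)]] by (simp add: coeff_def)
qed

lemma choose_family:
  assumes "x \<in> (\<Pi>\<^sub>E l\<in>{1..m}. std_coset (D l) N ` P l)"
  shows "\<exists>f. (\<forall>l. Poly_Mapping.lookup f l = 0 \<or> l \<in> {1..m}) \<and> (\<forall>l\<in>{1..m}. Poly_Mapping.lookup f l \<in> P l) \<and> proj f = x"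
proof -
  have "\<forall>l\<in>{1..m}. \<exists>p\<in>P l. x l = std_coset (D l) N p" using PiE_mem[OF assms] by blast
  then obtain p where p: "\<And>l. l \<in> {1..m} \<Longrightarrow> p l \<in> P l" "\<And>l. l \<in> {1..m} \<Longrightarrow> x l = std_coset (D l) N (p l)" by metis
  define f where "f = Abs_poly_mapping (\<lambda>l. if l \<in> {1..m} then p l else 0)"
  have "finite {l. (if l \<in> {1..m} then p l else 0) \<noteq> 0}" by (rule finite_subset[of _ "{1..m}"]) auto
  then have f: "Poly_Mapping.lookup f l = (if l \<in> {1..m} then p l else 0)" for l
    unfolding f_def by (subst Abs_poly_mapping_inverse) auto
  have "proj f = x"
  proof
    fix l show "proj f l = x l"
      using p(2)[of l] PiE_arb[OF assms, of l] by (auto simp: proj_def f)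
  qed
  then show ?thesis using f p(1) by (intro exI[of _ f]) auto
qed

lemma proj_carrier: "carrier M = proj ` carrier F"
proof (intro equalityI subsetI)
  fix x assume "x \<in> carrier M"
  then have "x \<in> (\<Pi>\<^sub>E l\<in>{1..m}. std_coset (D l) N ` carrier (mpoly_ring N))"
    by (simp add: M_def direct_sum_def graph_module_numbered)
  from choose_family[OF this] obtain f where f: "\<And>l. Poly_Mapping.lookup f l = 0 \<or> l \<in> {1..m}"
    "\<And>l. l \<in> {1..m} \<Longrightarrow> Poly_Mapping.lookup f l \<in> carrier (mpoly_ring N)" "proj f = x" by blast
  have "(0 :: 'k mpoly) \<in> carrier (mpoly_ring N)" by (simp add: mem_mpoly_ring)
  then have "Poly_Mapping.lookup f l \<in> carrier (mpoly_ring N)" for l using f(1)[of l] f(2)[of l] by metis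
  moreover have "Poly_Mapping.keys f \<subseteq> {1..m}" using f(1) by (meson in_keys_iff subsetI)
  ultimately have "f \<in> carrier F" by (simp add: free_module_def)
  then show "x \<in> proj ` carrier F" using f(3) by blast
next
  fix x assume "x \<in> proj ` carrier F"
  then show "x \<in> carrier M"
    by (auto simp: M_def direct_sum_def graph_module_numbered proj_def intro!: imageI lookup_carrier)
qed

lemma proj_grade: "grade M j = proj ` grade F j"
proof (intro equalityI subsetI)
  fix x assume "x \<in> grade M j"
  then have "x \<in> (\<Pi>\<^sub>E l\<in>{1..m}. std_coset (D l) N ` homogeneous N j)"
    by (simp add: M_def direct_sum_def graph_module_numbered)
  from choose_family[OF this] obtain f where f: "\<And>l. Poly_Mapping.lookup f l = 0 \<or> l \<in> {1..m}"
    "\<And>l. l \<in> {1..m} \<Longrightarrow> Poly_Mapping.lookup f l \<in> homogeneous N j" "proj f = x" by blast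
  then have "f \<in> grade F j" by (force simp: free_module_def in_keys_iff)
  then show "x \<in> proj ` grade F j" using f(3) by blast
next
  fix x assume "x \<in> proj ` grade F j"
  then show "x \<in> grade M j"
    by (auto simp: M_def direct_sum_def graph_module_numbered proj_def free_module_def)
qed

lemma proj_zero: "zero M = proj 0"
  by (simp add: M_def direct_sum_def graph_module_numbered proj_def)

lemma proj_add: "f \<in> carrier F \<Longrightarrow> g \<in> carrier F \<Longrightarrow> add M (proj f) (proj g) = proj (f + g)"
  using lookup_carrier
  by (auto simp: M_def direct_sum_def graph_module_numbered proj_def lookup_add fun_eq_iff restrict_def)

lemma proj_smult: "p \<in> carrier (mpoly_ring N) \<Longrightarrow> f \<in> carrier F \<Longrightarrow> p \<odot>\<^bsub>M\<^esub> proj f = proj (scale_poly p f)"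
  using lookup_carrier
  by (auto simp: M_def direct_sum_def graph_module_numbered proj_def lookup_scale_poly fun_eq_iff restrict_def)

lemma abelian_M: "abelian_group M"
proof (rule abelian_groupI)
  fix x y z assume "x \<in> carrier M" "y \<in> carrier M" "z \<in> carrier M"
  then obtain f g h where f: "x = proj f" "y = proj g" "z = proj h" "f \<in> carrier F" "g \<in> carrier F" "h \<in> carrier F"
    unfolding proj_carrier by blast
  show "x \<oplus>\<^bsub>M\<^esub> y \<oplus>\<^bsub>M\<^esub> z = x \<oplus>\<^bsub>M\<^esub> (y \<oplus>\<^bsub>M\<^esub> z)"
    using f by (simp add: proj_add free_carrier_add add.assoc)
next
  fix x y assume "x \<in> carrier M" "y \<in> carrier M"
  then obtain f g where f: "x = proj f" "y = proj g" "f \<in> carrier F" "g \<in> carrier F" unfolding proj_carrier by blast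
  then show "x \<oplus>\<^bsub>M\<^esub> y \<in> carrier M" using free_carrier_add[OF f(3,4)] by (simp add: proj_add proj_carrier)
  show "x \<oplus>\<^bsub>M\<^esub> y = y \<oplus>\<^bsub>M\<^esub> x" using f by (simp add: proj_add add.commute)
next
  show "\<zero>\<^bsub>M\<^esub> \<in> carrier M" unfolding proj_zero proj_carrier using free_carrier_zero by blast
next
  fix x assume "x \<in> carrier M"
  then obtain f where f: "x = proj f" "f \<in> carrier F" unfolding proj_carrier by blast
  show "\<zero>\<^bsub>M\<^esub> \<oplus>\<^bsub>M\<^esub> x = x" using f proj_add[OF free_carrier_zero f(2)] by (simp add: proj_zero)
  have "proj (- f) \<in> carrier M" unfolding proj_carrier using free_carrier_neg[OF f(2)] by blast
  moreover have "proj (- f) \<oplus>\<^bsub>M\<^esub> x = \<zero>\<^bsub>M\<^esub>"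
    using proj_add[OF free_carrier_neg[OF f(2)] f(2)] f(1) by (simp add: proj_zero)
  ultimately show "\<exists>y\<in>carrier M. y \<oplus>\<^bsub>M\<^esub> x = \<zero>\<^bsub>M\<^esub>" by blast
qed

text \<open>A choice of polynomial representatives; their coefficients at standard monomials do not
  depend on it.\<close>

definition rep :: "(nat \<Rightarrow> 'k mpoly set) \<Rightarrow> nat \<Rightarrow>\<^sub>0 'k mpoly" where
  "rep x = (SOME f. f \<in> carrier F \<and> proj f = x)"

lemma rep:
  assumes "x \<in> carrier M"
  shows "rep x \<in> carrier F" "proj (rep x) = x"
proof -
  have "\<exists>f. f \<in> carrier F \<and> proj f = x" using assms unfolding proj_carrier by blast
  from someI_ex[OF this] show "rep x \<in> carrier F" "proj (rep x) = x" unfolding rep_def by blast+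
qed

lemma coeff_rep:
  assumes "f \<in> carrier F" "l \<in> {1..m}" "standard (D l) t"
  shows "coeff (rep (proj f)) (l, t) = coeff f (l, t)"
proof -
  have "proj f \<in> carrier M" unfolding proj_carrier using assms(1) by blast
  then show ?thesis using rep[of "proj f"] proj_eq_iff[of "rep (proj f)" f] assms by blast
qed

lemma coeff_rep_grade:
  assumes "x \<in> grade M j" "l \<in> {1..m}" "standard (D l) t" "int (monomial_degree t) \<noteq> j"
  shows "coeff (rep x) (l, t) = 0"
proof -
  obtain f where f: "f \<in> grade F j" "x = proj f" using assms(1) unfolding proj_grade by blast
  have "coeff f (l, t) = 0" using f(1) assms(4) unfolding mem_free_grade by (auto simp: index_set_def)
  then show ?thesis using coeff_rep[OF free_grade_carrier[OF f(1)] assms(2,3)] f(2) by simp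
qed

text \<open>An element of \<open>M\<close> is determined by its coefficients at standard monomials.
  Such a coefficient in degree \<open>j\<close> is additive and vanishes on the images of all
  components of other degrees; in other degrees both sides have coefficient 0.\<close>

lemma graded_hom_component:
  assumes h: "h \<in> graded_hom N (free_module N B d) M" and x: "x \<in> carrier (free_module N B d)" and g: "h x \<in> grade M j"
  shows "h (component d j x) = h x"
proof -
  let ?C = "carrier (free_module N B d)"
  have h_carrier: "h y \<in> carrier M" if "y \<in> ?C" for y using h that by (auto simp: graded_hom_def)
  have h_grade: "h y \<in> grade M i" if "y \<in> free_grade N B d i" for y i using h that unfolding graded_hom_def by blast
  have h_add: "h (y + z) = add M (h y) (h z)" if "y \<in> ?C" "z \<in> ?C" for y z
    using h that by (simp add: graded_hom_def)
  have comp: "component d i x \<in> ?C" for i by (rule free_grade_carrier[OF component_grade[OF x]])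
  have "coeff (rep (h (component d j x))) (l, t) = coeff (rep (h x)) (l, t)" if l: "l \<in> {1..m}" and t: "standard (D l) t" for l t
  proof (cases "int (monomial_degree t) = j")
    case False
    then show ?thesis
      using coeff_rep_grade[OF g l t] coeff_rep_grade[OF h_grade[OF component_grade[OF x]] l t] by simp
  next
    case True
    define \<phi> where "\<phi> y = coeff (rep (h y)) (l, t)" for y
    have add: "\<phi> (y + z) = \<phi> y + \<phi> z" if yz: "y \<in> ?C" "z \<in> ?C" for y z
    proof -
      have y: "h y \<in> carrier M" and z: "h z \<in> carrier M" using h_carrier yz by blast+
      have "h (y + z) = add M (proj (rep (h y))) (proj (rep (h z)))"
        using h_add[OF yz] unfolding rep(2)[OF y] rep(2)[OF z] .
      also have "\<dots> = proj (rep (h y) + rep (h z))" by (rule proj_add[OF rep(1)[OF y] rep(1)[OF z]])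
      finally show ?thesis
        unfolding \<phi>_def using coeff_rep[OF free_carrier_add[OF rep(1)[OF y] rep(1)[OF z]] l t] by (simp add: coeff_add)
    qed
    have zero: "\<phi> 0 = 0" using add[OF free_carrier_zero free_carrier_zero] by (metis add.right_neutral add_left_cancel)
    obtain J where J: "finite J" "x = (\<Sum>i\<in>J. component d i x)" "\<And>i. i \<notin> J \<Longrightarrow> component d i x = 0"
      using sum_components[of x d] by blast
    have "\<phi> (\<Sum>i\<in>I. component d i x) = (\<Sum>i\<in>I. \<phi> (component d i x))" if "finite I" for I
      using that
    proof (induction I rule: finite_induct)
      case (insert i I)
      have "(\<Sum>i\<in>I. component d i x) \<in> ?C" using comp by (intro free_carrier_sum)
      then show ?case using insert add[OF comp] by simp
    qed (simp add: zero)
    then have "\<phi> x = (\<Sum>i\<in>J. \<phi> (component d i x))" using J(1,2) by metis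
    also have "\<dots> = (\<Sum>i\<in>J. if i = j then \<phi> (component d j x) else 0)"
    proof (rule sum.cong[OF refl])
      fix i show "\<phi> (component d i x) = (if i = j then \<phi> (component d j x) else 0)"
        using coeff_rep_grade[OF h_grade[OF component_grade[OF x]] l t, of i] True by (auto simp: \<phi>_def)
    qed
    also have "\<dots> = \<phi> (component d j x)" using J(1) J(3)[of j] zero by simp
    finally show ?thesis by (simp add: \<phi>_def)
  qed
  moreover have hx: "h x \<in> carrier M" and hc: "h (component d j x) \<in> carrier M" using h_carrier comp x by blast+
  ultimately have "proj (rep (h (component d j x))) = proj (rep (h x))"
    unfolding proj_eq_iff[OF rep(1)[OF hc] rep(1)[OF hx]] by blast
  then show ?thesis unfolding rep(2)[OF hx] rep(2)[OF hc] .
qed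

lemma presented: "presented_by N M {1..m} (\<lambda>_. 0) proj"
proof (rule presented_by.intro)
  show "abelian_group M" by (rule abelian_M)
  show "grade M j \<subseteq> carrier M" for j unfolding proj_grade proj_carrier using free_grade_carrier by blast
  show "\<zero>\<^bsub>M\<^esub> \<in> grade M j" for j unfolding proj_grade proj_zero using free_grade_zero by blast
  show "proj \<in> graded_hom N F M"
    unfolding graded_hom_def using proj_carrier proj_grade by (auto simp: proj_add proj_smult)
  show "proj ` carrier F = carrier M" by (simp add: proj_carrier)
qed (use graded_hom_component in auto)

sublocale P: presented_by N M "{1..m}" "\<lambda>_. 0" proj by (rule presented)

lemma ker_eq: "P.ker = std_rels N m D"
proof
  fix j
  have "proj (of_coeff u) = \<zero>\<^bsub>M\<^esub> \<longleftrightarrow> (\<forall>l t. standard (D l) t \<longrightarrow> u (l, t) = 0)" if u: "u \<in> coords N {1..m} (\<lambda>_. 0) j" for u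
  proof -
    have c: "of_coeff u \<in> carrier F" by (rule free_grade_carrier[OF P.of_coeff_grade[OF u]])
    have "u (l, t) = 0" if "l \<notin> {1..m}" for l t using u that unfolding coords_def index_set_def by blast
    then show ?thesis
      unfolding proj_zero proj_eq_iff[OF c free_carrier_zero] P.coeff_of_coeff_coords[OF u] coeff_zero by blast
  qed
  then show "P.ker j = std_rels N m D j" unfolding P.ker_def std_rels_def by blast
qed

end

text \<open>The counts give (1 - X) H_(N+1) = H_N for a dominating vertex and (1 - X) H_(N+1) = (1 -
  X) H_N + X for an isolated one, which is the recursion of
  \<open>threshold_numerator\<close>.\<close>

lemma threshold_hilbert_series:
  "(1 - fps_X) ^ N * Abs_fps (\<lambda>d. int (card (std_monomials D N d))) = threshold_numerator D N"
proof (induction N)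
  case 0
  have "std_monomials D 0 (Suc d) = {}" for d by (auto simp: std_monomials_def)
  then have "Abs_fps (\<lambda>d. int (card (std_monomials D 0 d))) = 1"
    by (intro fps_ext) (metis card.empty card_1_singleton_iff fps_nth_Abs_fps fps_one_nth not0_implies_Suc of_nat_0 of_nat_1 One_nat_def std_monomials_0)
  then show ?case by simp
next
  case (Suc N)
  define H where "H r = Abs_fps (\<lambda>d. int (card (std_monomials D r d)))" for r
  have H0: "fps_nth (H r) 0 = 1" for r by (simp add: H_def std_monomials_0)
  have nth_0: "fps_nth ((1 - fps_X) * H r) 0 = 1" for r by (simp add: left_diff_distrib H0)
  have nth_Suc: "fps_nth ((1 - fps_X) * H r) (Suc d) = fps_nth (H r) (Suc d) - fps_nth (H r) d" for r d
    by (simp add: left_diff_distrib)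
  have IH: "(1 - fps_X) ^ N * H N = threshold_numerator D N" using Suc.IH by (simp add: H_def)
  have "(1 - fps_X) ^ Suc N * H (Suc N) = (1 - fps_X) ^ N * ((1 - fps_X) * H (Suc N))"
    by (simp add: mult.assoc mult.left_commute)
  also have "\<dots> = threshold_numerator D (Suc N)"
  proof (cases "Suc N \<in> D")
    case True
    have "(1 - fps_X) * H (Suc N) = H N"
    proof (rule fps_ext)
      fix d show "fps_nth ((1 - fps_X) * H (Suc N)) d = fps_nth (H N) d"
      proof (cases d)
        case (Suc e)
        show ?thesis unfolding Suc nth_Suc by (simp add: H_def std_monomials_dominating[OF True])
      qed (simp only: nth_0 H0)
    qed
    then show ?thesis using IH True by simp
  next
    case False
    have S: "fps_nth (H (Suc N)) (Suc d) = fps_nth (H N) (Suc d) + 1" for d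
      by (simp add: H_def std_monomials_isolated[OF False])
    have "(1 - fps_X) * H (Suc N) = (1 - fps_X) * H N + fps_X"
    proof (rule fps_ext)
      fix d show "fps_nth ((1 - fps_X) * H (Suc N)) d = fps_nth ((1 - fps_X) * H N + fps_X) d"
      proof (cases d)
        case (Suc e)
        then show ?thesis by (cases e) (simp_all only: fps_add_nth nth_Suc S H0 fps_X_nth, simp_all)
      qed (simp add: H0)
    qed
    then have "(1 - fps_X) ^ N * ((1 - fps_X) * H (Suc N)) = (1 - fps_X) * ((1 - fps_X) ^ N * H N) + fps_X * (1 - fps_X) ^ N"
      by (simp only: distrib_left mult.left_commute mult.commute)
    then show ?thesis using IH False by simp
  qed
  finally show ?case unfolding H_def .
qed

context threshold_sum
begin

lemma two_linear_M: "P.two_linear"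
  using two_linear_std_rels[of N m D, where 'k = 'k] unfolding ker_eq .

lemma hilbert_numerator_M: "hilbert_numerator N P.hilbert = (\<Sum>l\<in>{1..m}. threshold_numerator (D l) N)"
proof -
  have "P.hilbert (int d) = (\<Sum>l\<in>{1..m}. int (card (std_monomials (D l) N d)))" for d
    unfolding ker_eq by (rule hilbert_std_rels)
  then have "Abs_fps (\<lambda>d. P.hilbert (int d)) = (\<Sum>l\<in>{1..m}. Abs_fps (\<lambda>d. int (card (std_monomials (D l) N d))))"
    by (intro fps_ext) (simp add: fps_sum_nth)
  then show ?thesis
    by (simp add: hilbert_numerator_def sum_distrib_left threshold_hilbert_series)
qed

end

section \<open>Comparison of the two modules through their numerators\<close>

theorem mainTheorem2:
  fixes n m :: nat and M :: "('k::field mpoly, 'm) graded_module"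
  assumes "graded_module n M"
    and "finitely_generated n M"
    and "two_linear_resolution n M"
    and "betti n M 0 0 = m"
  shows "\<exists>T :: nat \<Rightarrow> nat graph.
    (\<forall>l \<in> {1..m}. threshold_graph (T l) \<and> fst (T l) = {1..n + 1}) \<and>
    (\<forall>i j. betti n M i j =
      betti (n + 1)
        (direct_sum {1..m} (\<lambda>l. graph_module (n + 1) (T l) :: ('k mpoly, 'k mpoly set) graded_module))
        i j)"
proof -
  obtain G dg h where pres: "presented_by n M G dg h"
    using graded_module.presented_by_exists[OF assms(1,2)] by blast
  interpret A: presented_by n M G dg h by (rule pres)
  have two_linear: A.two_linear
    unfolding A.two_linear_def
  proof (intro conjI allI impI)
    show "A.koszul_betti 0 d = 0" if "d \<noteq> 0" for d
      using A.betti_eq_koszul[of 0 d] assms(3) that by (simp add: two_linear_resolution_def)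
    show "A.koszul_betti (Suc i) d = 0" if "d \<noteq> 1" for i d
    proof -
      have "betti n M (Suc i) (d + int (Suc i)) = 0"
        using assms(3) that by (simp add: two_linear_resolution_def)
      then show ?thesis using A.betti_eq_koszul[of "Suc i" "d + int (Suc i)"] by simp
    qed
  qed
  note neg = A.hilbert_negative[OF two_linear]
  obtain a where a: "numerator_coeffs n (Abs_fps (\<lambda>d. A.hilbert (int d))) a"
    using A.two_linear_numerator[OF two_linear] by blast
  have "fps_nth (hilbert_numerator n A.hilbert) 0 = int m"
    using A.two_linear_betti(2)[OF two_linear neg] A.betti_eq_koszul[of 0 0] assms(4) by simp
  then have "fps_nth (Abs_fps (\<lambda>d. A.hilbert (int d))) 0 = int m"
    by (simp add: hilbert_numerator_def fps_nth_power_0)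
  from numerator_decomposition[OF a this]
  obtain D where D: "hilbert_numerator n A.hilbert = (\<Sum>l\<in>{1..m}. threshold_numerator (D l) (Suc n))"
    unfolding hilbert_numerator_def by blast
  interpret C: threshold_sum "Suc n" m D "TYPE('k)" .
  have negC: "C.P.hilbert d = 0" if "d < 0" for d by (rule C.P.hilbert_negative[OF C.two_linear_M that])
  \<comment> \<open>The left numerator is formed with n variables and the right one with n + 1, in
    accordance with the two polynomial rings.\<close>
  have num: "hilbert_numerator n A.hilbert = hilbert_numerator (Suc n) C.P.hilbert"
    unfolding D C.hilbert_numerator_M ..
  \<comment> \<open>Both modules are two-linear, so a Betti number is either read off from the
    common numerator or zero on both sides.\<close>
  have same: "A.koszul_betti i d = C.P.koszul_betti i d" for i d
  proof (cases i)
    case 0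
    then show ?thesis
      using A.two_linear_betti(2)[OF two_linear neg] C.P.two_linear_betti(2)[OF C.two_linear_M negC] num
        two_linear C.two_linear_M
      unfolding A.two_linear_def C.P.two_linear_def by (cases "d = 0") simp_all
  next
    case (Suc i')
    then show ?thesis
      using A.two_linear_betti(1)[OF two_linear neg, of i'] C.P.two_linear_betti(1)[OF C.two_linear_M negC, of i'] num
        two_linear C.two_linear_M
      unfolding A.two_linear_def C.P.two_linear_def by (cases "d = 1") simp_all
  qed
  let ?T = "\<lambda>l. numbered_threshold_graph (D l) (Suc n)"
  have "betti n M i j = betti (n + 1)
      (direct_sum {1..m} (\<lambda>l. graph_module (n + 1) (?T l) :: ('k mpoly, 'k mpoly set) graded_module)) i j" for i j
  proof -
    have "betti n M i j = betti (Suc n) C.M i j"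
      unfolding A.betti_eq_koszul C.P.betti_eq_koszul by (rule same)
    then show ?thesis unfolding C.M_def by simp
  qed
  moreover have "fst (?T l) = {1..n + 1}" for l by (simp add: numbered_threshold_graph_def)
  ultimately show ?thesis using threshold_numbered by (intro exI[of _ ?T]) blast
qed

end
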